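(* Let $\beta\in(0,1)$ and let $U:\mathbb{R}_+\to\mathbb{R}$ be concave (in addition to being continuous and strictly increasing). Then the following statements hold. a) $V_\infty$ is the unique solution of $v=Tv$ in $\mathcal{C}(E)$ with $\underline{b}(\mu,z)\le v(x,\mu,z)\le\bar{b}(\mu,z)$ for all $(x,\mu,z)\in E$. Moreover, $T^nV_0\uparrow V_\infty$, $T^n\underline{b}\uparrow V_\infty$ and $T^n\bar{b}\downarrow V_\infty$ for $n\to\infty$. The value function is given by $J_\infty(x)=V_\infty(x,Q_0\otimes\delta_0,1)$, $x\in E_X$. b) There exists a minimizer $f^*\in F$ of $V_\infty$, and $(g_0^*,g_1^*,\ldots)$ with $$g_n^*(h_n):=f^*\big(x_n,\mu_n(\cdot|h_n),\beta^n\big)$$ is an optimal policy for the problem $J_\infty(x)=\inf_{\sigma\in\Pi}\int_{E_Y}\mathbb{E}^\sigma_{xy}\big[U\big(\sum_{k=0}^\infty\beta^kc(X_k,Y_k,A_k)\big)\big]Q_0(dy)$.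
   Context: Notation: $\mathbb{R}_+=[0,\infty)$, $\delta_s$ is the Dirac measure at $s$. Model. $E_X,E_Y,A$ are Borel spaces (Borel subsets of Polish spaces). $D\subset E_X\times A$ is Borel, $D(x):=\{a\in A:(x,a)\in D\}$, and $D$ contains the graph of a measurable map $E_X\to A$. $Q$ is a stochastic kernel from $D\times E_Y$ to $E_X\times E_Y$ having a measurable density $q$ with respect to $\sigma$-finite measures $\lambda$ on $E_X$ and $\nu$ on $E_Y$: $Q(B|x,y,a)=\int_Bq(x',y'|x,y,a)\,\lambda(dx')\nu(dy')$. Put $q^X(x'|x,y,a):=\int_{E_Y}q(x',y'|x,y,a)\,\nu(dy')$. $Q_0$ is a probability measure on $E_Y$ (distribution of $Y_0$), $c:D\times E_Y\to\mathbb{R}_+$ is a measurable one-stage cost, written $c(x,y,a)$. The component $x$ is observable, $y$ is hidden. Policies. $H_0:=E_X$, $H_n:=H_{n-1}\times A\times E_X$. A decision rule at stage $n$ is a measurable $g_n:H_n\to A$ with $g_n(h_n)\in D(x_n)$ for $h_n=(x_0,a_0,\ldots,x_n)$. A policy is a sequence $\pi=(g_0,g_1,\ldots)$ of such rules; $\Pi$ is the set of all policies. For $\pi\in\Pi$, $\mathbb{E}^\pi_{xy}$ is expectation under the law of the process $(X_n,Y_n)_{n\in\mathbb{N}_0}$ with $X_0=x$, $Y_0=y$, actions $A_n:=g_n(X_0,A_0,\ldots,X_n)$ and transition kernel $Q$. Standing assumptions: $U:[0,\infty)\to\mathbb{R}$ is continuous and strictly increasing; $D(x)$ is compact for all $x$;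 $x\mapsto D(x)$ is upper semicontinuous (if $x_n\to x$ and $a_n\in D(x_n)$ then $(a_n)$ has an accumulation point in $D(x)$); $(x,y,a)\mapsto c(x,y,a)$ is continuous; $(x,y,x',y',a)\mapsto q(x',y'|x,y,a)$ is continuous and bounded; there are constants $0<\underline{c}<\bar{c}$ with $\underline{c}\le c\le\bar{c}$. Updating operator. $\mathbb{P}_b(E_Y\times\mathbb{R}_+)$ is the set of probability measures $\mu$ on $\mathcal{B}(E_Y\times\mathbb{R}_+)$ for which there is $K>0$ with $\mu(E_Y\times[0,K])=1$, with the topology of weak convergence. $\mu^Y(dy):=\mu(dy,\mathbb{R}_+)$, $\mu^S(ds):=\mu(E_Y,ds)$. For $a\in D(x)$, $$\Psi(x,a,x',\mu,z)(B):=\frac{\int_{E_Y}\int_{\mathbb{R}_+}\Big(\int_{B}q(x',y'|x,y,a)\,\nu(dy')\,\delta_{s+zc(x,y,a)}(ds')\Big)\mu(dy,ds)}{\int_{E_Y}q^X(x'|x,y,a)\,\mu^Y(dy)},\quad B\in\mathcal{B}(E_Y\times\mathbb{R}_+),$$ where $(y',s')$ are the integration variables over $B$; $\Psi$ is defined only when the denominator is positive (the other points $x'$ form a null set for $Q^X(\cdot|x,\mu^Y,a)$ below and may be ignored). The filter is $\mu_0(\cdot|h_0):=Q_0\otimes\delta_0$, $\mu_{n+1}(\cdot|h_n,a,x'):=\Psi(x_n,a,x',\mu_n(\cdot|h_n),\beta^n)$. Operators and value functions. $E:=E_X\times\mathbb{P}_b(E_Y\times\mathbb{R}_+)\times(0,1]$.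 For a probability measure $m$ on $E_Y$, $Q^X(B|x,m,a):=\int_B\int_{E_Y}q^X(x'|x,y,a)\,m(dy)\lambda(dx')$. $V_0(x,\mu,z):=\int\int U(s)\,\mu(dy,ds)$; $\mathcal{C}(E):=\{v:E\to\mathbb{R}:v\text{ lower semicontinuous},\ v\ge V_0\}$; $$(Tv)(x,\mu,z):=\inf_{a\in D(x)}\int_{E_X}v\big(x',\Psi(x,a,x',\mu,z),\beta z\big)\,Q^X(dx'|x,\mu^Y,a).$$ $F$ is the set of measurable $f:E\to A$ with $f(x,\mu,z)\in D(x)$; $f\in F$ is a minimizer of $v$ if $a=f(x,\mu,z)$ attains the infimum in $(Tv)(x,\mu,z)$ for all $(x,\mu,z)\in E$. Further, $$V_\infty(x,\mu,z):=\inf_{\sigma\in\Pi}\int_{E_Y}\int_{\mathbb{R}_+}\mathbb{E}^\sigma_{xy}\Big[U\Big(s+z\sum_{k=0}^\infty\beta^kc(X_k,Y_k,A_k)\Big)\Big]\mu(dy,ds),$$ $$\bar{b}(\mu,z):=\int_{\mathbb{R}_+}U\Big(s+\frac{z\bar{c}}{1-\beta}\Big)\mu^S(ds),\qquad\underline{b}(\mu,z):=\int_{\mathbb{R}_+}U\Big(s+\frac{z\underline{c}}{1-\beta}\Big)\mu^S(ds),$$ the last two regarded as functions on $E$ not depending on $x$. Arrows $\uparrow,\downarrow$ denote monotone pointwise convergence. A policy is optimal if it attains the infimum defining $J_\infty(x)$ for every $x\in E_X$. *)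

theory Defs
  imports "HOL-Probability.Probability"
begin

section \<open>The partially observable model\<close>

record ('x, 'y, 'a) pomdp =
  obs_states :: "'x set"                                          \<comment> \<open>\<open>E\<^sub>X\<close>\<close>
  hid_states :: "'y set"                                          \<comment> \<open>\<open>E\<^sub>Y\<close>\<close>
  act_space  :: "'a set"                                          \<comment> \<open>\<open>A\<close>\<close>
  adm        :: "('x \<times> 'a) set"                                   \<comment> \<open>\<open>D\<close>\<close>
  kernel     :: "'x \<Rightarrow> 'y \<Rightarrow> 'a \<Rightarrow> ('x \<times> 'y) measure"              \<comment> \<open>\<open>Q(\<sqdot>|x,y,a)\<close>\<close>
  dens       :: "'x \<Rightarrow> 'y \<Rightarrow> 'x \<Rightarrow> 'y \<Rightarrow> 'a \<Rightarrow> real"                \<comment> \<open>\<open>dens M x' y' x y a = q(x',y'|x,y,a)\<close>\<close>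
  ref_obs    :: "'x measure"                                      \<comment> \<open>\<open>\<lambda>\<close>\<close>
  ref_hid    :: "'y measure"                                      \<comment> \<open>\<open>\<nu>\<close>\<close>
  init_hid   :: "'y measure"                                      \<comment> \<open>\<open>Q\<^sub>0\<close>\<close>
  cost       :: "'x \<Rightarrow> 'y \<Rightarrow> 'a \<Rightarrow> real"                            \<comment> \<open>\<open>c\<close>\<close>

text \<open>A Borel space is a Borel subset of a type of class \<^class>\<open>polish_space\<close>, with the trace
  \<open>\<sigma>\<close>-algebra and the trace topology.\<close>

definition obs_borel :: "('x::polish_space, 'y, 'a) pomdp \<Rightarrow> 'x measure" where
  "obs_borel M = restrict_space borel (obs_states M)"

definition hid_borel :: "('x, 'y::polish_space, 'a) pomdp \<Rightarrow> 'y measure" where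
  "hid_borel M = restrict_space borel (hid_states M)"

definition act_borel :: "('x, 'y, 'a::polish_space) pomdp \<Rightarrow> 'a measure" where
  "act_borel M = restrict_space borel (act_space M)"

definition Rplus :: "real measure" where
  "Rplus = restrict_space borel {0..}"

definition acts :: "('x, 'y, 'a) pomdp \<Rightarrow> 'x \<Rightarrow> 'a set" where
  "acts M x = {a. (x, a) \<in> adm M}"

definition cost_dom :: "('x, 'y, 'a) pomdp \<Rightarrow> ('x \<times> 'y \<times> 'a) set" where
  "cost_dom M = {(x, y, a). (x, a) \<in> adm M \<and> y \<in> hid_states M}"

definition dens_dom :: "('x, 'y, 'a) pomdp \<Rightarrow> ('x \<times> 'y \<times> 'x \<times> 'y \<times> 'a) set" where
  "dens_dom M = {(x, y, x', y', a). (x, a) \<in> adm M \<and> y \<in> hid_states M \<and>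
                                     x' \<in> obs_states M \<and> y' \<in> hid_states M}"

locale pomdp_model =
  fixes M :: "('x::polish_space, 'y::polish_space, 'a::polish_space) pomdp"
  assumes obs_states_borel: "obs_states M \<in> sets borel"
    and hid_states_borel: "hid_states M \<in> sets borel"
    and act_space_borel: "act_space M \<in> sets borel"
    and adm_borel: "adm M \<in> sets (obs_borel M \<Otimes>\<^sub>M act_borel M)"
    and adm_graph: "\<exists>\<phi>\<in>obs_borel M \<rightarrow>\<^sub>M act_borel M. \<forall>x\<in>obs_states M. (x, \<phi> x) \<in> adm M"
    and ref_obs: "sigma_finite_measure (ref_obs M)" "sets (ref_obs M) = sets (obs_borel M)"
    and ref_hid: "sigma_finite_measure (ref_hid M)" "sets (ref_hid M) = sets (hid_borel M)"
    and dens_nonneg: "\<And>x y x' y' a. (x, y, x', y', a) \<in> dens_dom M \<Longrightarrow> 0 \<le> dens M x' y' x y a"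
    and dens_measurable:
      "(\<lambda>(x, y, x', y', a). dens M x' y' x y a) \<in> borel_measurable (restrict_space borel (dens_dom M))"
    and kernel: "(\<lambda>(x, y, a). kernel M x y a)
      \<in> restrict_space borel (cost_dom M) \<rightarrow>\<^sub>M prob_algebra (obs_borel M \<Otimes>\<^sub>M hid_borel M)"
    and kernel_dens: "\<And>x y a. (x, y, a) \<in> cost_dom M \<Longrightarrow> kernel M x y a =
      density (ref_obs M \<Otimes>\<^sub>M ref_hid M) (\<lambda>(x', y'). ennreal (dens M x' y' x y a))"
    and init_hid: "init_hid M \<in> space (prob_algebra (hid_borel M))"
    and cost_nonneg: "\<And>x y a. (x, y, a) \<in> cost_dom M \<Longrightarrow> 0 \<le> cost M x y a"
    and cost_measurable:
      "(\<lambda>(x, y, a). cost M x y a) \<in> borel_measurable (restrict_space borel (cost_dom M))"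

text \<open>\<open>U\<close> matters on \<open>[0,\<infinity>)\<close> only; \<open>cl\<close> and \<open>cu\<close> are the bounds of the one-stage cost.\<close>

locale pomdp_standing = pomdp_model M
  for M :: "('x::polish_space, 'y::polish_space, 'a::polish_space) pomdp" +
  fixes U :: "real \<Rightarrow> real" and cl cu :: real
  assumes U_continuous: "continuous_on {0..} U"
    and U_strict_mono: "strict_mono_on {0..} U"
    and acts_compact: "\<And>x. x \<in> obs_states M \<Longrightarrow> compact (acts M x)"
    and acts_usc: "\<And>x xs as. \<lbrakk>x \<in> obs_states M; \<And>n. xs n \<in> obs_states M; xs \<longlonglongrightarrow> x;
        \<And>n. as n \<in> acts M (xs n)\<rbrakk> \<Longrightarrow>
        \<exists>a\<in>acts M x. \<exists>r::nat \<Rightarrow> nat. strict_mono r \<and> (as \<circ> r) \<longlonglongrightarrow> a"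
    and cost_continuous: "continuous_on (cost_dom M) (\<lambda>(x, y, a). cost M x y a)"
    and dens_continuous: "continuous_on (dens_dom M) (\<lambda>(x, y, x', y', a). dens M x' y' x y a)"
    and dens_bounded: "bounded ((\<lambda>(x, y, x', y', a). dens M x' y' x y a) ` dens_dom M)"
    and cost_bounds: "0 < cl" "cl < cu"
      "\<And>x y a. (x, y, a) \<in> cost_dom M \<Longrightarrow> cl \<le> cost M x y a \<and> cost M x y a \<le> cu"

section \<open>Policies and the controlled process\<close>

text \<open>A history \<open>(x\<^sub>0,a\<^sub>0,\<dots>,a\<^sub>n\<^sub>-\<^sub>1,x\<^sub>n)\<close> is stored as the pair of the families
  \<open>(x\<^sub>i)\<^sub>i\<^sub>\<le>\<^sub>n\<close> and \<open>(a\<^sub>i)\<^sub>i\<^sub><\<^sub>n\<close>.\<close>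

type_synonym ('x, 'a) hist = "(nat \<Rightarrow> 'x) \<times> (nat \<Rightarrow> 'a)"

definition hist_space ::
  "('x::polish_space, 'y, 'a::polish_space) pomdp \<Rightarrow> nat \<Rightarrow> ('x, 'a) hist measure" where
  "hist_space M n = (\<Pi>\<^sub>M i\<in>{..n}. obs_borel M) \<Otimes>\<^sub>M (\<Pi>\<^sub>M i\<in>{..<n}. act_borel M)"

definition policies ::
  "('x::polish_space, 'y, 'a::polish_space) pomdp \<Rightarrow> (nat \<Rightarrow> ('x, 'a) hist \<Rightarrow> 'a) set" where
  "policies M = {g. \<forall>n. g n \<in> hist_space M n \<rightarrow>\<^sub>M act_borel M \<and>
                        (\<forall>(xs, as)\<in>space (hist_space M n). g n (xs, as) \<in> acts M (xs n))}"

text \<open>Actions along the observed path \<open>xs\<close>: \<open>past_actions g xs n\<close> is the family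
  \<open>(A\<^sub>i)\<^sub>i\<^sub><\<^sub>n\<close>, and \<open>action g xs n\<close> is \<open>A\<^sub>n = g\<^sub>n(x\<^sub>0,A\<^sub>0,\<dots>,x\<^sub>n)\<close>.\<close>

primrec past_actions :: "(nat \<Rightarrow> ('x, 'a) hist \<Rightarrow> 'a) \<Rightarrow> (nat \<Rightarrow> 'x) \<Rightarrow> nat \<Rightarrow> nat \<Rightarrow> 'a" where
  "past_actions g xs 0 = (\<lambda>_. undefined)"
| "past_actions g xs (Suc n) =
     (past_actions g xs n)(n := g n (restrict xs {..n}, past_actions g xs n))"

definition action :: "(nat \<Rightarrow> ('x, 'a) hist \<Rightarrow> 'a) \<Rightarrow> (nat \<Rightarrow> 'x) \<Rightarrow> nat \<Rightarrow> 'a" where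
  "action g xs n = g n (restrict xs {..n}, past_actions g xs n)"

text \<open>Law of \<open>(X\<^sub>n,Y\<^sub>n)\<^sub>n\<close> under \<open>g\<close> with \<open>X\<^sub>0=x\<close>, \<open>Y\<^sub>0=y\<close>, by the
  Ionescu-Tulcea theorem: \<open>step_kernel M g x y n \<omega>\<close> is the conditional distribution of
  \<open>(X\<^sub>n,Y\<^sub>n)\<close> given the path \<open>\<omega>\<close> before time \<open>n\<close>.\<close>

definition step_kernel :: "('x::polish_space, 'y::polish_space, 'a) pomdp \<Rightarrow>
    (nat \<Rightarrow> ('x, 'a) hist \<Rightarrow> 'a) \<Rightarrow> 'x \<Rightarrow> 'y \<Rightarrow> nat \<Rightarrow> (nat \<Rightarrow> 'x \<times> 'y) \<Rightarrow> ('x \<times> 'y) measure" where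
  "step_kernel M g x y n \<omega> = (case n of
      0 \<Rightarrow> return (obs_borel M \<Otimes>\<^sub>M hid_borel M) (x, y)
    | Suc k \<Rightarrow> kernel M (fst (\<omega> k)) (snd (\<omega> k)) (action g (fst \<circ> \<omega>) k))"

definition law :: "('x::polish_space, 'y::polish_space, 'a) pomdp \<Rightarrow>
    (nat \<Rightarrow> ('x, 'a) hist \<Rightarrow> 'a) \<Rightarrow> 'x \<Rightarrow> 'y \<Rightarrow> (nat \<Rightarrow> 'x \<times> 'y) measure" where
  "law M g x y =
     (let S = (\<lambda>_. obs_borel M \<Otimes>\<^sub>M hid_borel M)
      in projective_family.lim UNIV (Ionescu_Tulcea.CI (step_kernel M g x y) S) S)"

definition disc_cost :: "('x, 'y, 'a) pomdp \<Rightarrow> real \<Rightarrow> (nat \<Rightarrow> ('x, 'a) hist \<Rightarrow> 'a) \<Rightarrow>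
    (nat \<Rightarrow> 'x \<times> 'y) \<Rightarrow> real" where
  "disc_cost M \<beta> g \<omega> =
     (\<Sum>k. \<beta> ^ k * cost M (fst (\<omega> k)) (snd (\<omega> k)) (action g (fst \<circ> \<omega>) k))"

definition policy_cost :: "('x::polish_space, 'y::polish_space, 'a::polish_space) pomdp \<Rightarrow>
    (real \<Rightarrow> real) \<Rightarrow> real \<Rightarrow> (nat \<Rightarrow> ('x, 'a) hist \<Rightarrow> 'a) \<Rightarrow> 'x \<Rightarrow> real" where
  "policy_cost M U \<beta> g x =
     (\<integral>y. (\<integral>\<omega>. U (disc_cost M \<beta> g \<omega>) \<partial>law M g x y) \<partial>init_hid M)"

definition J_inf :: "('x::polish_space, 'y::polish_space, 'a::polish_space) pomdp \<Rightarrow>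
    (real \<Rightarrow> real) \<Rightarrow> real \<Rightarrow> 'x \<Rightarrow> real" where
  "J_inf M U \<beta> x = (INF g\<in>policies M. policy_cost M U \<beta> g x)"

definition optimal :: "('x::polish_space, 'y::polish_space, 'a::polish_space) pomdp \<Rightarrow>
    (real \<Rightarrow> real) \<Rightarrow> real \<Rightarrow> (nat \<Rightarrow> ('x, 'a) hist \<Rightarrow> 'a) \<Rightarrow> bool" where
  "optimal M U \<beta> g \<longleftrightarrow>
     g \<in> policies M \<and> (\<forall>x\<in>obs_states M. policy_cost M U \<beta> g x = J_inf M U \<beta> x)"

section \<open>The extended state space\<close>

definition hs_borel :: "('x, 'y::polish_space, 'a) pomdp \<Rightarrow> ('y \<times> real) measure" where
  "hs_borel M = hid_borel M \<Otimes>\<^sub>M Rplus"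

definition Pb :: "('x, 'y::polish_space, 'a) pomdp \<Rightarrow> ('y \<times> real) measure set" where
  "Pb M = {\<mu>. prob_space \<mu> \<and> sets \<mu> = sets (hs_borel M) \<and>
              (\<exists>K>0. measure \<mu> (hid_states M \<times> {0..K}) = 1)}"

definition margY :: "('x, 'y::polish_space, 'a) pomdp \<Rightarrow> ('y \<times> real) measure \<Rightarrow> 'y measure" where
  "margY M \<mu> = distr \<mu> (hid_borel M) fst"

definition margS :: "('y \<times> real) measure \<Rightarrow> real measure" where
  "margS \<mu> = distr \<mu> Rplus snd"

text \<open>The topology of weak convergence: the coarsest one making \<open>\<mu> \<mapsto> \<integral>f d\<mu>\<close> continuous for
  every bounded continuous \<open>f : E\<^sub>Y \<times> [0,\<infinity>) \<rightarrow> \<real>\<close>.\<close>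

definition Pb_top :: "('x, 'y::polish_space, 'a) pomdp \<Rightarrow> ('y \<times> real) measure topology" where
  "Pb_top M = topology_generated_by
     {{\<mu>\<in>Pb M. (\<integral>p. f p \<partial>\<mu>) \<in> W} | (f :: 'y \<times> real \<Rightarrow> real) W.
        continuous_on (hid_states M \<times> {0..}) f \<and> bounded (f ` (hid_states M \<times> {0..})) \<and> open W}"

definition E_top :: "('x::polish_space, 'y::polish_space, 'a) pomdp \<Rightarrow>
    ('x \<times> ('y \<times> real) measure \<times> real) topology" where
  "E_top M = prod_topology (top_of_set (obs_states M))
               (prod_topology (Pb_top M) (top_of_set {0<..1}))"

definition E_set :: "('x::polish_space, 'y::polish_space, 'a) pomdp \<Rightarrow>
    ('x \<times> ('y \<times> real) measure \<times> real) set" where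
  "E_set M = obs_states M \<times> Pb M \<times> {0<..1}"

definition E_borel :: "('x::polish_space, 'y::polish_space, 'a) pomdp \<Rightarrow>
    ('x \<times> ('y \<times> real) measure \<times> real) measure" where
  "E_borel M = sigma (E_set M) {G. openin (E_top M) G}"

definition lower_semicont :: "'b topology \<Rightarrow> ('b \<Rightarrow> real) \<Rightarrow> bool" where
  "lower_semicont X v \<longleftrightarrow> (\<forall>r. openin X {e\<in>topspace X. r < v e})"

section \<open>Updating operator and filter\<close>

text \<open>The marginal density \<open>q\<^sup>X\<close> is extended-real valued: its integral over \<open>x'\<close> is 1, but
  it may be infinite on a \<open>\<lambda>\<close>-null set.\<close>

definition densX :: "('x, 'y, 'a) pomdp \<Rightarrow> 'x \<Rightarrow> 'x \<Rightarrow> 'y \<Rightarrow> 'a \<Rightarrow> ennreal" where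
  "densX M x' x y a = (\<integral>\<^sup>+y'. ennreal (dens M x' y' x y a) \<partial>ref_hid M)"

definition mixX :: "('x, 'y, 'a) pomdp \<Rightarrow> 'x \<Rightarrow> 'x \<Rightarrow> 'y measure \<Rightarrow> 'a \<Rightarrow> ennreal" where
  "mixX M x' x m a = (\<integral>\<^sup>+y. densX M x' x y a \<partial>m)"

definition kernelX :: "('x, 'y, 'a) pomdp \<Rightarrow> 'x \<Rightarrow> 'y measure \<Rightarrow> 'a \<Rightarrow> 'x measure" where
  "kernelX M x m a = density (ref_obs M) (\<lambda>x'. mixX M x' x m a)"

text \<open>The quotient defining \<open>\<Psi>\<close> makes sense iff its denominator is neither 0 nor \<open>\<infinity>\<close>; the
  remaining \<open>x'\<close> form a null set of \<open>kernelX M x (margY M \<mu>) a\<close>.\<close>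

definition Psi_ok :: "('x, 'y::polish_space, 'a) pomdp \<Rightarrow> 'x \<Rightarrow> 'a \<Rightarrow> 'x \<Rightarrow>
    ('y \<times> real) measure \<Rightarrow> bool" where
  "Psi_ok M x a x' \<mu> \<longleftrightarrow>
     a \<in> acts M x \<and> 0 < mixX M x' x (margY M \<mu>) a \<and> mixX M x' x (margY M \<mu>) a < \<infinity>"

definition Psi :: "('x, 'y::polish_space, 'a) pomdp \<Rightarrow> 'x \<Rightarrow> 'a \<Rightarrow> 'x \<Rightarrow>
    ('y \<times> real) measure \<Rightarrow> real \<Rightarrow> ('y \<times> real) measure" where
  "Psi M x a x' \<mu> z = measure_of (space (hs_borel M)) (sets (hs_borel M))
     (\<lambda>B. (\<integral>\<^sup>+(y, s). (\<integral>\<^sup>+(y', s'). ennreal (dens M x' y' x y a) * indicator B (y', s')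
                            \<partial>(ref_hid M \<Otimes>\<^sub>M return Rplus (s + z * cost M x y a))) \<partial>\<mu>)
          / mixX M x' x (margY M \<mu>) a)"

definition init_belief :: "('x, 'y::polish_space, 'a) pomdp \<Rightarrow> ('y \<times> real) measure" where
  "init_belief M = init_hid M \<Otimes>\<^sub>M return Rplus 0"

text \<open>\<open>belief M \<beta> n h\<close> is \<open>\<mu>\<^sub>n(\<sqdot>|h\<^sub>n)\<close>; it depends only on the first \<open>n\<close> steps of \<open>h\<close>, and is
  meaningful only if every update on the way is defined (\<open>belief_ok\<close>).\<close>

primrec belief :: "('x, 'y::polish_space, 'a) pomdp \<Rightarrow> real \<Rightarrow> nat \<Rightarrow> ('x, 'a) hist \<Rightarrow>
    ('y \<times> real) measure" where
  "belief M \<beta> 0 h = init_belief M"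
| "belief M \<beta> (Suc n) h =
     Psi M (fst h n) (snd h n) (fst h (Suc n)) (belief M \<beta> n h) (\<beta> ^ n)"

definition belief_ok :: "('x, 'y::polish_space, 'a) pomdp \<Rightarrow> real \<Rightarrow> nat \<Rightarrow> ('x, 'a) hist \<Rightarrow> bool" where
  "belief_ok M \<beta> n h \<longleftrightarrow>
     (\<forall>k<n. Psi_ok M (fst h k) (snd h k) (fst h (Suc k)) (belief M \<beta> k h))"

section \<open>Value functions and the Bellman operator\<close>

definition V_zero :: "(real \<Rightarrow> real) \<Rightarrow> 'x \<times> ('y \<times> real) measure \<times> real \<Rightarrow> real" where
  "V_zero U = (\<lambda>(x, \<mu>, z). \<integral>(y, s). U s \<partial>\<mu>)"

definition C_E :: "('x::polish_space, 'y::polish_space, 'a) pomdp \<Rightarrow> (real \<Rightarrow> real) \<Rightarrow>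
    ('x \<times> ('y \<times> real) measure \<times> real \<Rightarrow> real) set" where
  "C_E M U = {v. lower_semicont (E_top M) v \<and> (\<forall>e\<in>E_set M. V_zero U e \<le> v e)}"

text \<open>The integral under the infimum of \<open>T\<close>. The null set where \<open>\<Psi>\<close> is undefined is cut out
  explicitly, so that the integrand is measurable for measurable \<open>v\<close>. For the functions between
  \<open>b_lower\<close> and \<open>b_upper\<close>, and for the iterates of \<open>V_zero\<close>, the integrand is bounded.\<close>

definition L_op :: "('x, 'y::polish_space, 'a) pomdp \<Rightarrow> real \<Rightarrow>
    ('x \<times> ('y \<times> real) measure \<times> real \<Rightarrow> real) \<Rightarrow> 'x \<times> ('y \<times> real) measure \<times> real \<Rightarrow> 'a \<Rightarrow> real" where
  "L_op M \<beta> v = (\<lambda>(x, \<mu>, z) a.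
     \<integral>x'. (if Psi_ok M x a x' \<mu> then v (x', Psi M x a x' \<mu> z, \<beta> * z) else 0)
       \<partial>kernelX M x (margY M \<mu>) a)"

definition T_op :: "('x, 'y::polish_space, 'a) pomdp \<Rightarrow> real \<Rightarrow>
    ('x \<times> ('y \<times> real) measure \<times> real \<Rightarrow> real) \<Rightarrow> 'x \<times> ('y \<times> real) measure \<times> real \<Rightarrow> real" where
  "T_op M \<beta> v e = (INF a\<in>acts M (fst e). L_op M \<beta> v e a)"

definition F_rules :: "('x::polish_space, 'y::polish_space, 'a::polish_space) pomdp \<Rightarrow>
    ('x \<times> ('y \<times> real) measure \<times> real \<Rightarrow> 'a) set" where
  "F_rules M = {f\<in>E_borel M \<rightarrow>\<^sub>M act_borel M. \<forall>e\<in>E_set M. f e \<in> acts M (fst e)}"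

definition minimizer :: "('x::polish_space, 'y::polish_space, 'a::polish_space) pomdp \<Rightarrow> real \<Rightarrow>
    ('x \<times> ('y \<times> real) measure \<times> real \<Rightarrow> real) \<Rightarrow> ('x \<times> ('y \<times> real) measure \<times> real \<Rightarrow> 'a) \<Rightarrow> bool" where
  "minimizer M \<beta> v f \<longleftrightarrow>
     f \<in> F_rules M \<and> (\<forall>e\<in>E_set M. L_op M \<beta> v e (f e) = T_op M \<beta> v e)"

definition V_inf :: "('x::polish_space, 'y::polish_space, 'a::polish_space) pomdp \<Rightarrow>
    (real \<Rightarrow> real) \<Rightarrow> real \<Rightarrow> 'x \<times> ('y \<times> real) measure \<times> real \<Rightarrow> real" where
  "V_inf M U \<beta> = (\<lambda>(x, \<mu>, z). INF g\<in>policies M.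
     \<integral>(y, s). (\<integral>\<omega>. U (s + z * disc_cost M \<beta> g \<omega>) \<partial>law M g x y) \<partial>\<mu>)"

definition b_upper :: "(real \<Rightarrow> real) \<Rightarrow> real \<Rightarrow> real \<Rightarrow> 'x \<times> ('y \<times> real) measure \<times> real \<Rightarrow> real" where
  "b_upper U \<beta> cu = (\<lambda>(x, \<mu>, z). \<integral>s. U (s + z * cu / (1 - \<beta>)) \<partial>margS \<mu>)"

definition b_lower :: "(real \<Rightarrow> real) \<Rightarrow> real \<Rightarrow> real \<Rightarrow> 'x \<times> ('y \<times> real) measure \<times> real \<Rightarrow> real" where
  "b_lower U \<beta> cl = (\<lambda>(x, \<mu>, z). \<integral>s. U (s + z * cl / (1 - \<beta>)) \<partial>margS \<mu>)"

text \<open>\<open>g\<close> is the policy \<open>g\<^sub>n(h\<^sub>n) = f(x\<^sub>n,\<mu>\<^sub>n(\<sqdot>|h\<^sub>n),\<beta>\<^sup>n)\<close>. Nothing is required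
  at histories for which \<open>\<mu>\<^sub>n\<close> is undefined.\<close>

definition generated_by :: "('x::polish_space, 'y::polish_space, 'a::polish_space) pomdp \<Rightarrow> real \<Rightarrow>
    ('x \<times> ('y \<times> real) measure \<times> real \<Rightarrow> 'a) \<Rightarrow> (nat \<Rightarrow> ('x, 'a) hist \<Rightarrow> 'a) \<Rightarrow> bool" where
  "generated_by M \<beta> f g \<longleftrightarrow>
     (\<forall>n. \<forall>h\<in>space (hist_space M n). belief_ok M \<beta> n h \<longrightarrow>
        g n h = f (fst h n, belief M \<beta> n h, \<beta> ^ n))"

end

theory Submission
  imports Defs
begin

text \<open>Since the densities \<open>q(\<sqdot>|x,y,a)\<close> integrate to one, Fatou-type lower bounds under weak convergence
  of the beliefs are automatically limits, and \<open>\<Psi>\<close> and the kernel are continuous enough for \<open>T\<close> to preserve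
  lower semicontinuity. The beliefs carry a second countable topology, so lower semicontinuity can be tested on
  sequences and measurability on countably many sets. Concavity gives \<open>U(s+t) - U(s) \<le> U(t) - U(0)\<close>, whence
  \<open>T\<^sup>n b\<close> for the upper bound \<open>b\<close> exceeds \<open>T\<^sup>n V\<^sub>0\<close> by at most \<open>U(\<beta>\<^sup>n z c / (1-\<beta>)) - U(0)\<close>;
  all iterates therefore squeeze one fixed point. The filter equation turns the cost of any policy into an
  expectation along the belief process, which the iterates bound from below, and the policy built from a minimizer
  attains the fixed point.\<close>

section \<open>Weak convergence and measurable selection\<close>

text \<open>Two devices shape the development. \<open>U\<close> may be negative, whereas Fatou,
  Tonelli and measurability of kernels work best for nonnegative integrands; so values are measured
  from \<open>U 0\<close>, a lower bound of every function in the class considered, and real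
  integrals are reached only through \<open>util0\<close> and \<open>excess\<close>. Moreover the
  update is made total: a denominator equal to 0 or \<infinity> produces the null measure. Beliefs
  along a history are therefore sub-probabilities that are either null or members of
  \<open>Pb M\<close>, and the filter equation can be stated without exceptional sets. The obstacle
  to semicontinuity is the denominator of the update, for which convergence holds only for almost
  every next observation and only along a subsequence. This suffices because semicontinuity is a
  statement about arbitrary sequences. The limit of the decreasing iterates of
  \<open>b_upper\<close> would not inherit lower semicontinuity; the increasing iterates of
  \<open>b_lower\<close> have the same limit and provide it. They also carry the comparison with an
  arbitrary policy.\<close>

lemma emeasure_lborel_less_ennreal:
  "emeasure lborel {t. 0 \<le> t \<and> ennreal t < c} = c"
proof (cases c)
  case (real r)
  have "{t. 0 \<le> t \<and> ennreal t < c} = {0..<r}"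
    using real by (auto simp: ennreal_less_iff)
  then show ?thesis using real by simp
next
  case top
  have "(\<Union>n::nat. {0..<real n}) = {0..}"
    by (auto intro: reals_Archimedean2)
  moreover have "(SUP n. emeasure lborel {0..<real n}) = emeasure lborel (\<Union>n::nat. {0..<real n})"
    by (rule SUP_emeasure_incseq) (auto simp: incseq_def)
  moreover have "(SUP n. emeasure lborel {0..<real n}) = top"
    by (simp add: ennreal_SUP_of_nat_eq_top ennreal_of_nat_eq_real_of_nat[symmetric])
  ultimately show ?thesis using top by (simp add: atLeast_def)
qed

text \<open>The outer integral runs over Lebesgue measure whatever \<mu> is. Integrals against a
  varying sequence of measures thus become integrals of varying functions against one fixed measure,
  where the ordinary Fatou lemma applies.\<close>

lemma nn_integral_layer_cake:
  assumes "sigma_finite_measure \<mu>" and [measurable]: "g \<in> borel_measurable \<mu>"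
  shows "(\<integral>\<^sup>+p. g p \<partial>\<mu>) =
    (\<integral>\<^sup>+t. indicator {0..} t * emeasure \<mu> {p\<in>space \<mu>. ennreal t < g p} \<partial>lborel)"
proof -
  interpret sigma_finite_measure \<mu> by fact
  interpret P: pair_sigma_finite \<mu> lborel ..
  have "(\<integral>\<^sup>+p. g p \<partial>\<mu>) = (\<integral>\<^sup>+p. (\<integral>\<^sup>+t. indicator {t. 0 \<le> t \<and> ennreal t < g p} t \<partial>lborel) \<partial>\<mu>)"
    by (simp add: emeasure_lborel_less_ennreal)
  also have "\<dots> = (\<integral>\<^sup>+t. (\<integral>\<^sup>+p. indicator {t. 0 \<le> t \<and> ennreal t < g p} t \<partial>\<mu>) \<partial>lborel)"
    by (rule P.Fubini'[symmetric]) measurable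
  also have "\<dots> = (\<integral>\<^sup>+t. indicator {0..} t * emeasure \<mu> {p\<in>space \<mu>. ennreal t < g p} \<partial>lborel)"
  proof (rule nn_integral_cong)
    fix t :: real
    have "(\<integral>\<^sup>+p. indicator {t. 0 \<le> t \<and> ennreal t < g p} t \<partial>\<mu>) =
        (\<integral>\<^sup>+p. indicator {0..} t * indicator {p\<in>space \<mu>. ennreal t < g p} p \<partial>\<mu>)"
      by (intro nn_integral_cong) (auto split: split_indicator)
    also have "\<dots> = indicator {0..} t * emeasure \<mu> {p\<in>space \<mu>. ennreal t < g p}"
      by (subst nn_integral_cmult) auto
    finally show "(\<integral>\<^sup>+p. indicator {t. 0 \<le> t \<and> ennreal t < g p} t \<partial>\<mu>) =
        indicator {0..} t * emeasure \<mu> {p\<in>space \<mu>. ennreal t < g p}" .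
  qed
  finally show ?thesis .
qed

text \<open>Both sides are written as integrals of tail masses, which reduces the claim to the ordinary
  Fatou lemma and the portmanteau inequality for the interiors of the tail sets.\<close>

lemma weak_Fatou:
  fixes S :: "'b::metric_space set"
  assumes S: "space \<mu> = S" "\<And>n. space (\<mu>s n) = S"
      "\<And>G. open G \<Longrightarrow> G \<inter> S \<in> sets \<mu>" "\<And>n G. open G \<Longrightarrow> G \<inter> S \<in> sets (\<mu>s n)"
    and fin: "sigma_finite_measure \<mu>" "\<And>n. sigma_finite_measure (\<mu>s n)"
    and weak: "\<And>G. open G \<Longrightarrow> emeasure \<mu> (G \<inter> S) \<le> liminf (\<lambda>n. emeasure (\<mu>s n) (G \<inter> S))"
    and [measurable]: "g \<in> borel_measurable \<mu>" "\<And>n. gs n \<in> borel_measurable (\<mu>s n)"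
    and lim: "\<And>p ps. p \<in> S \<Longrightarrow> (\<And>n. ps n \<in> S) \<Longrightarrow> ps \<longlonglongrightarrow> p \<Longrightarrow>
        (g p :: ennreal) \<le> liminf (\<lambda>n. gs n (ps n))"
  shows "(\<integral>\<^sup>+p. g p \<partial>\<mu>) \<le> liminf (\<lambda>n. \<integral>\<^sup>+p. gs n p \<partial>\<mu>s n)"
proof -
  let ?T = "\<lambda>t. emeasure \<mu> {p\<in>space \<mu>. t < g p}"
  let ?Ts = "\<lambda>n t. emeasure (\<mu>s n) {p\<in>space (\<mu>s n). t < gs n p}"
  have tail: "?T t \<le> liminf (\<lambda>n. ?Ts n t)" for t
  proof -
    \<comment> \<open>\<open>Gk k\<close> is the largest open set on whose trace all
      \<open>gs n\<close> with \<open>n \<ge> k\<close> exceed \<open>t\<close>. Openness lets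
      \<open>weak\<close> act on it, and from index \<open>k\<close> on its trace lies in every tail
      event.\<close>
    define Gk where "Gk k = \<Union>{G. open G \<and> (\<forall>n\<ge>k. \<forall>p\<in>G \<inter> S. t < gs n p)}" for k
    have Gk: "open (Gk k)" for k unfolding Gk_def by auto
    have inc: "incseq (\<lambda>k. Gk k \<inter> S)"
      unfolding incseq_def Gk_def by (blast intro: order_trans)
    have Gk_tail: "t < gs n p" if "p \<in> Gk k \<inter> S" "k \<le> n" for p k n
      using that unfolding Gk_def by auto
    have cover: "\<exists>k. p \<in> Gk k" if p: "p \<in> S" "t < g p" for p
    proof (rule ccontr)
      assume "\<nexists>k. p \<in> Gk k"
      then have *: "\<not> (open G \<and> (\<forall>n\<ge>k. \<forall>p\<in>G \<inter> S. t < gs n p)) \<or> p \<notin> G" for k G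
        unfolding Gk_def by blast
      have "\<exists>np. fst np \<ge> k \<and> snd np \<in> ball p (1 / real (Suc k)) \<and> snd np \<in> S \<and> gs (fst np) (snd np) \<le> t" for k
        using *[of "ball p (1 / real (Suc k))" k] by (simp add: not_less Bex_def)
      then obtain np where np': "\<And>k. fst (np k) \<ge> k \<and> snd (np k) \<in> ball p (1 / real (Suc k)) \<and>
          snd (np k) \<in> S \<and> gs (fst (np k)) (snd (np k)) \<le> t"
        by metis
      define n where "n k = fst (np k)" for k
      define p' where "p' k = snd (np k)" for k
      have np: "n k \<ge> k" "p' k \<in> ball p (1 / real (Suc k))" "p' k \<in> S" "gs (n k) (p' k) \<le> t" for k
        using np'[of k] by (simp_all add: n_def p'_def)
      \<comment> \<open>The indices \<open>n k\<close> may repeat and may leave gaps, but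
        \<open>lim\<close> asks for a point at every index: one representative is chosen for each
        attained index, and \<open>p\<close> itself fills the gaps.\<close>
      define ps where "ps m = (if \<exists>k. n k = m then p' (SOME k. n k = m) else p)" for m
      have psS: "ps m \<in> S" for m using np p by (auto simp: ps_def)
      have ps_n: "\<exists>j. n j = n k \<and> ps (n k) = p' j" for k
      proof -
        have "n (SOME j. n j = n k) = n k" by (rule someI[of "\<lambda>j. n j = n k"]) simp
        then show ?thesis by (auto simp: ps_def)
      qed
      have "ps \<longlonglongrightarrow> p"
      proof (rule metric_LIMSEQ_I)
        fix e :: real assume "0 < e"
        then obtain K where K: "1 / real (Suc K) < e" using nat_approx_posE by blast
        \<comment> \<open>From \<open>N\<close> on, an index attained by \<open>n\<close> is
          attained only at arguments \<open>j > K\<close>, so its representative \<open>p' j\<close>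
          is closer to \<open>p\<close> than \<open>1 / real (Suc K)\<close>.\<close>
        define N where "N = Suc (Max (n ` {..K}))"
        have "dist (ps m) p < e" if "m \<ge> N" for m
        proof (cases "\<exists>k. n k = m")
          case True
          then obtain j where j: "n j = m" "ps m = p' j" using ps_n by metis
          have "j > K"
          proof (rule ccontr)
            assume "\<not> j > K"
            then have "n j \<le> Max (n ` {..K})" by (intro Max_ge) auto
            then show False using j that by (simp add: N_def)
          qed
          then have "1 / real (Suc j) \<le> 1 / real (Suc K)" by (simp add: frac_le)
          moreover have "dist p (p' j) < 1 / real (Suc j)" using np(2)[of j] by simp
          ultimately show ?thesis using K j by (simp add: dist_commute)
        qed (use \<open>0 < e\<close> in \<open>simp add: ps_def\<close>)
        then show "\<exists>N. \<forall>m\<ge>N. dist (ps m) p < e" by blast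
      qed
      from lim[OF p(1) psS this] p(2) have "t < liminf (\<lambda>n. gs n (ps n))" by (rule less_le_trans[rotated])
      then obtain N where N: "\<And>m. m \<ge> N \<Longrightarrow> t < gs m (ps m)"
        using less_LiminfD[of t sequentially] unfolding eventually_sequentially by blast
      have "n N \<ge> N" by (rule np)
      obtain j where "n j = n N" "ps (n N) = p' j" using ps_n by metis
      then show False using N[OF \<open>n N \<ge> N\<close>] np(4)[of j] by auto
    qed
    have [measurable]: "Gk k \<inter> S \<in> sets \<mu>" "Gk k \<inter> S \<in> sets (\<mu>s n)" for k n using S Gk by auto
    have "?T t \<le> emeasure \<mu> (\<Union>k. Gk k \<inter> S)"
      using cover S(1) by (intro emeasure_mono) (blast, measurable)
    also have "\<dots> = (SUP k. emeasure \<mu> (Gk k \<inter> S))"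
      using inc by (intro SUP_emeasure_incseq[symmetric]) auto
    also have "\<dots> \<le> liminf (\<lambda>n. ?Ts n t)"
    proof (rule SUP_least)
      fix k
      have "emeasure \<mu> (Gk k \<inter> S) \<le> liminf (\<lambda>n. emeasure (\<mu>s n) (Gk k \<inter> S))" by (rule weak[OF Gk])
      also have "\<dots> \<le> liminf (\<lambda>n. ?Ts n t)"
      proof (rule Liminf_mono, rule eventually_sequentiallyI[of k], rule emeasure_mono)
        fix n assume "k \<le> n"
        then show "Gk k \<inter> S \<subseteq> {p \<in> space (\<mu>s n). t < gs n p}" using Gk_tail S(2) by auto
        show "{p \<in> space (\<mu>s n). t < gs n p} \<in> sets (\<mu>s n)" by measurable
      qed
      finally show "emeasure \<mu> (Gk k \<inter> S) \<le> liminf (\<lambda>n. ?Ts n t)" .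
    qed
    finally show ?thesis .
  qed
  have meas: "(\<lambda>t. indicator {0..} t * ?Ts n (ennreal t)) \<in> borel_measurable lborel" for n
  proof -
    interpret sigma_finite_measure "\<mu>s n" by fact
    show ?thesis by measurable
  qed
  have "(\<integral>\<^sup>+p. g p \<partial>\<mu>) = (\<integral>\<^sup>+t. indicator {0..} t * ?T (ennreal t) \<partial>lborel)"
    by (rule nn_integral_layer_cake) (use fin in auto)
  also have "\<dots> \<le> (\<integral>\<^sup>+t. liminf (\<lambda>n. indicator {0..} t * ?Ts n (ennreal t)) \<partial>lborel)"
    by (intro nn_integral_mono) (auto split: split_indicator intro: tail)
  also have "\<dots> \<le> liminf (\<lambda>n. \<integral>\<^sup>+t. indicator {0..} t * ?Ts n (ennreal t) \<partial>lborel)"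
    by (rule nn_integral_liminf) (rule meas)
  also have "\<dots> = liminf (\<lambda>n. \<integral>\<^sup>+p. gs n p \<partial>\<mu>s n)"
    by (subst nn_integral_layer_cake) (use fin in auto)
  finally show ?thesis .
qed

text \<open>The selection is obtained by minimising the distances to the points of a dense sequence
  one after the other; the surviving sets shrink to a single point.\<close>

lemma compact_valued_measurable_selection:
  fixes G :: "'e \<Rightarrow> 'a::polish_space set"
  assumes comp: "\<And>e. e \<in> space N \<Longrightarrow> compact (G e)"
    and ne: "\<And>e. e \<in> space N \<Longrightarrow> G e \<noteq> {}"
    and hit: "\<And>C. closed C \<Longrightarrow> {e\<in>space N. G e \<inter> C \<noteq> {}} \<in> sets N"
  shows "\<exists>f\<in>N \<rightarrow>\<^sub>M borel. \<forall>e\<in>space N. f e \<in> G e"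
proof -
  obtain Dn :: "'a set" where Dn: "countable Dn" "\<And>X::'a set. open X \<Longrightarrow> X \<noteq> {} \<Longrightarrow> \<exists>d\<in>Dn. d \<in> X"
    using countable_dense_setE by blast
  define d where "d = from_nat_into Dn"
  have "Dn \<noteq> {}" using Dn(2)[of UNIV] by auto
  then have d: "range d = Dn" using Dn(1) by (simp add: d_def range_from_nat_into)
  define H where "H = rec_nat G (\<lambda>k K e. {a\<in>K e. \<forall>b\<in>K e. dist a (d k) \<le> dist b (d k)})"
  have H0: "H 0 = G" and HS: "H (Suc k) e = {a\<in>H k e. \<forall>b\<in>H k e. dist a (d k) \<le> dist b (d k)}" for k e
    by (simp_all add: H_def)
  have HH: "e \<in> space N \<Longrightarrow> compact (H k e) \<and> H k e \<noteq> {}" for k e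
  proof (induction k)
    case 0 then show ?case by (simp add: H0 comp ne)
  next
    case (Suc k)
    then have c: "compact (H k e)" "H k e \<noteq> {}" by auto
    have cont: "continuous_on (H k e) (\<lambda>a. dist a (d k))" by (intro continuous_intros)
    obtain a where a: "a \<in> H k e" "\<And>b. b \<in> H k e \<Longrightarrow> dist a (d k) \<le> dist b (d k)"
      using continuous_attains_inf[OF c cont] by auto
    have "H (Suc k) e = H k e \<inter> cball (d k) (dist a (d k))"
      using a by (auto simp: HS dist_commute intro: order_trans)
    then have "compact (H (Suc k) e)" using c by (auto intro: compact_Int_closed)
    moreover have "a \<in> H (Suc k) e" using a by (auto simp: HS)
    ultimately show ?case by auto
  qed
  have dec: "H (Suc k) e \<subseteq> H k e" for k e by (auto simp: HS)
  have dec': "k \<le> l \<Longrightarrow> H l e \<subseteq> H k e" for k l e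
    by (rule lift_Suc_antimono_le[of "\<lambda>k. H k e"]) (use dec in auto)
  have hitH: "closed C \<Longrightarrow> {e\<in>space N. H k e \<inter> C \<noteq> {}} \<in> sets N" for k C
  proof (induction k arbitrary: C)
    case 0 then show ?case by (simp add: H0 hit)
  next
    case (Suc k)
    have [measurable]: "{e\<in>space N. H k e \<inter> C \<inter> cball (d k) q \<noteq> {}} \<in> sets N"
      "{e\<in>space N. H k e \<inter> cball (d k) q \<noteq> {}} \<in> sets N" for q
      using Suc.IH[of "C \<inter> cball (d k) q"] Suc.IH[of "cball (d k) q"] Suc.prems by (auto simp: Int_assoc)
    \<comment> \<open>Some point of \<open>H k e\<close> nearest to \<open>d k\<close> lies in
      \<open>C\<close> iff every ball around \<open>d k\<close> that meets \<open>H k e\<close> also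
      meets \<open>H k e \<inter> C\<close>. Rational radii turn this into countably many conditions
      covered by the induction hypothesis.\<close>
    have "{e\<in>space N. H (Suc k) e \<inter> C \<noteq> {}} = {e\<in>space N. \<forall>r::rat. e \<in> {e\<in>space N. H k e \<inter> cball (d k) (of_rat r) \<noteq> {}} \<longrightarrow>
        e \<in> {e\<in>space N. H k e \<inter> C \<inter> cball (d k) (of_rat r) \<noteq> {}}}" (is "?L = ?R")
    proof (intro set_eqI iffI)
      fix e assume "e \<in> ?L"
      then obtain a where a: "e \<in> space N" "a \<in> H k e" "a \<in> C" "\<And>b. b \<in> H k e \<Longrightarrow> dist a (d k) \<le> dist b (d k)"
        by (auto simp: HS)
      show "e \<in> ?R"
      proof safe
        fix r b assume "b \<in> H k e" "b \<in> cball (d k) (of_rat r)"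
        then have "a \<in> H k e \<inter> C \<inter> cball (d k) (of_rat r)" using a(2,3) a(4)[of b] by (auto simp: dist_commute)
        then show "H k e \<inter> C \<inter> cball (d k) (of_rat r) = {} \<Longrightarrow> False" by auto
      qed (use a in auto)
    next
      fix e assume e: "e \<in> ?R"
      then have eN: "e \<in> space N" by auto
      note c = HH[OF eN, of k]
      have cont: "continuous_on A (\<lambda>a. dist a (d k))" for A by (intro continuous_intros)
      obtain a where a: "a \<in> H k e" "\<And>b. b \<in> H k e \<Longrightarrow> dist a (d k) \<le> dist b (d k)"
        using continuous_attains_inf[OF _ _ cont] c by metis
      have hit_q: "\<exists>b\<in>H k e \<inter> C. dist b (d k) \<le> q" if "q \<in> \<rat>" "dist a (d k) \<le> q" for q
      proof -
        obtain r where r: "q = of_rat r" using \<open>q \<in> \<rat>\<close> Rats_cases by blast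
        have "a \<in> H k e \<inter> cball (d k) q" using a(1) that by (simp add: dist_commute)
        then have "H k e \<inter> C \<inter> cball (d k) q \<noteq> {}" using e unfolding r by blast
        then show ?thesis by (auto simp: dist_commute)
      qed
      have c': "compact (H k e \<inter> C)" using c Suc.prems by (auto intro: compact_Int_closed)
      have "\<exists>q\<in>\<rat>. dist a (d k) < q" using Rats_dense_in_real[of "dist a (d k)" "dist a (d k) + 1"] by auto
      then have "H k e \<inter> C \<noteq> {}" using hit_q by fastforce
      then obtain b where b: "b \<in> H k e \<inter> C" "\<And>b'. b' \<in> H k e \<inter> C \<Longrightarrow> dist b (d k) \<le> dist b' (d k)"
        using continuous_attains_inf[OF c' _ cont] by metis
      have "dist b (d k) \<le> dist a (d k)"
      proof (rule ccontr)
        assume "\<not> ?thesis"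
        then obtain q where q: "q \<in> \<rat>" "dist a (d k) < q" "q < dist b (d k)"
          using Rats_dense_in_real by (meson not_le)
        then obtain b' where "b' \<in> H k e \<inter> C" "dist b' (d k) \<le> q" using hit_q[of q] by auto
        with b(2)[of b'] q show False by auto
      qed
      with a b have "b \<in> H (Suc k) e \<inter> C" by (auto simp: HS intro: order_trans)
      then show "e \<in> ?L" using eN by auto
    qed
    also have "\<dots> \<in> sets N"
    proof (rule sets.sets_Collect_countable_All)
      fix r :: rat
      have "{e\<in>space N. e \<in> {e\<in>space N. H k e \<inter> cball (d k) (of_rat r) \<noteq> {}} \<longrightarrow>
          e \<in> {e\<in>space N. H k e \<inter> C \<inter> cball (d k) (of_rat r) \<noteq> {}}} =
        (space N - {e\<in>space N. H k e \<inter> cball (d k) (of_rat r) \<noteq> {}}) \<union> {e\<in>space N. H k e \<inter> C \<inter> cball (d k) (of_rat r) \<noteq> {}}"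
        by blast
      also have "\<dots> \<in> sets N" by measurable
      finally show "{e\<in>space N. e \<in> {e\<in>space N. H k e \<inter> cball (d k) (of_rat r) \<noteq> {}} \<longrightarrow>
          e \<in> {e\<in>space N. H k e \<inter> C \<inter> cball (d k) (of_rat r) \<noteq> {}}} \<in> sets N" .
    qed
    finally show ?case .
  qed
  \<comment> \<open>Finite intersection property for a decreasing sequence of compact sets. With
    \<open>C = UNIV\<close> it yields the selected point; with a general closed \<open>C\<close> it
    decides whether that point lies in \<open>C\<close>.\<close>
  have inter: "(\<Inter>k. H k e \<inter> C) \<noteq> {}" if e: "e \<in> space N" and C: "closed C" and ne': "\<And>k. H k e \<inter> C \<noteq> {}" for e C
  proof -
    have c: "compact (H n e \<inter> C)" for n using HH[OF e] C by (auto intro: compact_Int_closed)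
    have "(H 0 e \<inter> C) \<inter> (\<Inter>k\<in>UNIV. H k e \<inter> C) \<noteq> {}"
    proof (rule compact_imp_fip_image[OF c])
      show "closed (H k e \<inter> C)" for k using c by (rule compact_imp_closed)
      fix K :: "nat set" assume "finite K"
      then have "H (Max (insert 0 K)) e \<subseteq> H k e" if "k \<in> insert 0 K" for k
        using that by (intro dec' Max_ge) auto
      then have "H (Max (insert 0 K)) e \<inter> C \<subseteq> H 0 e \<inter> C \<inter> (\<Inter>k\<in>K. H k e \<inter> C)" by blast
      then show "H 0 e \<inter> C \<inter> (\<Inter>k\<in>K. H k e \<inter> C) \<noteq> {}" using ne'[of "Max (insert 0 K)"] by blast
    qed
    then show ?thesis by auto
  qed
  \<comment> \<open>Two points surviving all stages have the same distance to every
    \<open>d k\<close>, and the \<open>d k\<close> are dense.\<close>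
  have uniq: "a = b" if ab: "\<And>k. a \<in> H k e" "\<And>k. b \<in> H k e" for a b e
  proof (rule ccontr)
    assume "a \<noteq> b"
    then obtain x where "x \<in> Dn" "x \<in> ball a (dist a b / 2)" using Dn(2)[of "ball a (dist a b / 2)"] by auto
    then obtain k where k: "dist a (d k) < dist a b / 2" using d by (metis mem_ball rangeE)
    have "dist a (d k) = dist b (d k)" using ab(1)[of "Suc k"] ab(2)[of "Suc k"] ab(1)[of k] ab(2)[of k]
      by (auto simp: HS intro: antisym)
    then show False using k dist_triangle2[of a b "d k"] by linarith
  qed
  define f where "f e = (SOME a. \<forall>k. a \<in> H k e)" for e
  have f: "f e \<in> H k e" if "e \<in> space N" for e k
  proof -
    have "\<exists>a. \<forall>k. a \<in> H k e" using inter[OF that, of UNIV] HH[OF that] by auto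
    then have "\<forall>k. f e \<in> H k e" unfolding f_def by (rule someI_ex)
    then show ?thesis by simp
  qed
  have "f \<in> N \<rightarrow>\<^sub>M borel"
  proof (rule borel_measurableI)
    fix B :: "'a set" assume "open B"
    define C where "C = - B"
    have C: "closed C" using \<open>open B\<close> by (simp add: C_def closed_def)
    have "f -` C \<inter> space N = {e\<in>space N. \<forall>k. e \<in> {e\<in>space N. H k e \<inter> C \<noteq> {}}}"
    proof (intro set_eqI iffI)
      fix e assume "e \<in> {e\<in>space N. \<forall>k. e \<in> {e\<in>space N. H k e \<inter> C \<noteq> {}}}"
      then have e: "e \<in> space N" "\<And>k. H k e \<inter> C \<noteq> {}" by auto
      then obtain a where "a \<in> C" "\<And>k. a \<in> H k e" using inter[OF e(1) C e(2)] by auto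
      then show "e \<in> f -` C \<inter> space N" using uniq[of "f e" e a] f[OF e(1)] e(1) by auto
    qed (use f in fastforce)
    also have "\<dots> \<in> sets N" using hitH[OF C] by measurable
    finally have "space N - (f -` C \<inter> space N) \<in> sets N" by measurable
    also have "space N - (f -` C \<inter> space N) = f -` B \<inter> space N" by (auto simp: C_def)
    finally show "f -` B \<inter> space N \<in> sets N" .
  qed
  then show ?thesis using f[of _ 0] H0 by auto
qed

section \<open>Density, cost and the Bayes update\<close>

lemma measurable_restrict_borelI:
  assumes "f \<in> N \<rightarrow>\<^sub>M restrict_space borel S"
  shows "f \<in> N \<rightarrow>\<^sub>M borel"
  by (rule measurable_compose[OF assms, of id borel, simplified]) (simp add: measurable_restrict_space1)

lemma id_measurable_restrict_pair:
  "(\<lambda>p. p) \<in> restrict_space borel (S \<times> T) \<rightarrow>\<^sub>M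
     restrict_space (borel :: 'a::second_countable_topology measure) S \<Otimes>\<^sub>M
     restrict_space (borel :: 'b::second_countable_topology measure) T"
proof -
  have "fst \<in> restrict_space borel (S \<times> T) \<rightarrow>\<^sub>M restrict_space (borel :: 'a measure) S"
       "snd \<in> restrict_space borel (S \<times> T) \<rightarrow>\<^sub>M restrict_space (borel :: 'b measure) T"
    by (intro measurable_restrict_space2 measurable_restrict_space1 borel_measurable_continuous_onI
        continuous_intros; auto simp: space_restrict_space)+
  from measurable_Pair[OF this] show ?thesis by simp
qed

lemma id_measurable_pair_restrict:
  "(\<lambda>p. p) \<in> restrict_space (borel :: 'a::second_countable_topology measure) S \<Otimes>\<^sub>M
     restrict_space (borel :: 'b::second_countable_topology measure) T \<rightarrow>\<^sub>M restrict_space borel (S \<times> T)"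
proof (rule measurable_restrict_space2)
  show "(\<lambda>p. p) \<in> restrict_space (borel :: 'a measure) S \<Otimes>\<^sub>M restrict_space (borel :: 'b measure) T \<rightarrow>\<^sub>M borel"
    using borel_measurable_Pair[OF measurable_restrict_borelI[OF measurable_fst]
        measurable_restrict_borelI[OF measurable_snd]]
    by simp
qed (auto simp: space_pair_measure space_restrict_space)

text \<open>The identity is measurable in both directions. Second countability enters by making the
  Borel sets of a product the product of the Borel sigma-algebras.\<close>

lemma sets_restrict_borel_pair:
  "sets (restrict_space (borel :: 'a::second_countable_topology measure) S \<Otimes>\<^sub>M
     restrict_space (borel :: 'b::second_countable_topology measure) T) = sets (restrict_space borel (S \<times> T))"
    (is "sets ?L = sets ?R")
proof (intro set_eqI iffI)
  have sp: "space ?L = space ?R" by (auto simp: space_pair_measure space_restrict_space)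
  fix A
  { assume A: "A \<in> sets ?L"
    from measurable_sets[OF id_measurable_restrict_pair A] sets.sets_into_space[OF A]
    show "A \<in> sets ?R" by (simp add: sp Int_absorb2) }
  { assume A: "A \<in> sets ?R"
    from measurable_sets[OF id_measurable_pair_restrict A] sets.sets_into_space[OF A]
    show "A \<in> sets ?L" by (simp add: sp[symmetric] Int_absorb2) }
qed

context pomdp_standing
begin

section \<open>Density and cost with default values\<close>

abbreviation "XX \<equiv> obs_states M"
abbreviation "YY \<equiv> hid_states M"
abbreviation "lam \<equiv> ref_obs M"
abbreviation "nu \<equiv> ref_hid M"
abbreviation "HS \<equiv> hs_borel M"

text \<open>Inadmissible triples get density 0, so every update along an inadmissible step is the null
  measure.\<close>

definition qe where
  "qe x' y' x y a = (if (x, y, x', y', a) \<in> dens_dom M then dens M x' y' x y a else 0)"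

text \<open>The default \<open>cl\<close> keeps the bounds of \<open>ce_bounds\<close> valid at all
  arguments, so accumulated costs stay nonnegative without side conditions on admissibility.\<close>

definition ce where
  "ce x y a = (if (x, y, a) \<in> cost_dom M then cost M x y a else cl)"

sublocale lam: sigma_finite_measure lam by (rule ref_obs)
sublocale nu: sigma_finite_measure nu by (rule ref_hid)
sublocale lamnu: pair_sigma_finite lam nu ..

lemma space_obs_borel[simp]: "space (obs_borel M) = XX"
  and space_hid_borel[simp]: "space (hid_borel M) = YY"
  and space_act_borel[simp]: "space (act_borel M) = act_space M"
  and space_Rplus[simp]: "space Rplus = {0..}"
  by (auto simp: obs_borel_def hid_borel_def act_borel_def Rplus_def space_restrict_space)

lemma space_lam[simp]: "space lam = XX" and space_nu[simp]: "space nu = YY"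
  using sets_eq_imp_space_eq[OF ref_obs(2)] sets_eq_imp_space_eq[OF ref_hid(2)] by simp_all

lemmas sets_lam[measurable_cong] = ref_obs(2)
lemmas sets_nu[measurable_cong] = ref_hid(2)

lemma space_HS[simp]: "space HS = YY \<times> {0..}"
  by (simp add: hs_borel_def space_pair_measure)

lemma sets_HS: "sets HS = sets (restrict_space borel (YY \<times> {0..}))"
  unfolding hs_borel_def hid_borel_def Rplus_def by (rule sets_restrict_borel_pair)

lemma obs_borelD: "f \<in> N \<rightarrow>\<^sub>M obs_borel M \<Longrightarrow> f \<in> N \<rightarrow>\<^sub>M borel"
  and hid_borelD: "g \<in> N \<rightarrow>\<^sub>M hid_borel M \<Longrightarrow> g \<in> N \<rightarrow>\<^sub>M borel"
  and act_borelD: "h \<in> N \<rightarrow>\<^sub>M act_borel M \<Longrightarrow> h \<in> N \<rightarrow>\<^sub>M borel"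
  and Rplus_borelD: "r \<in> N \<rightarrow>\<^sub>M Rplus \<Longrightarrow> r \<in> N \<rightarrow>\<^sub>M borel"
  unfolding obs_borel_def hid_borel_def act_borel_def Rplus_def by (auto intro: measurable_restrict_borelI)

lemma Rplus_fst_snd:
  "fst \<in> HS \<rightarrow>\<^sub>M borel" "snd \<in> HS \<rightarrow>\<^sub>M borel" "fst \<in> HS \<rightarrow>\<^sub>M hid_borel M" "snd \<in> HS \<rightarrow>\<^sub>M Rplus"
  unfolding hs_borel_def by (auto intro: hid_borelD Rplus_borelD measurable_fst measurable_snd)

lemma hid_proj:
  assumes "f \<in> N \<rightarrow>\<^sub>M nu" shows "f \<in> N \<rightarrow>\<^sub>M borel"
  using assms hid_borelD measurable_cong_sets[OF refl sets_nu] by blast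

lemma obs_proj:
  assumes "f \<in> N \<rightarrow>\<^sub>M lam" shows "f \<in> N \<rightarrow>\<^sub>M borel"
  using assms obs_borelD measurable_cong_sets[OF refl sets_lam] by blast

lemma proj_borel[measurable]:
  "fst \<in> lam \<Otimes>\<^sub>M N \<rightarrow>\<^sub>M borel" "fst \<in> obs_borel M \<Otimes>\<^sub>M N \<rightarrow>\<^sub>M borel"
  "snd \<in> N \<Otimes>\<^sub>M nu \<rightarrow>\<^sub>M borel" "snd \<in> N \<Otimes>\<^sub>M hid_borel M \<rightarrow>\<^sub>M borel"
  "fst \<in> hid_borel M \<Otimes>\<^sub>M N \<rightarrow>\<^sub>M borel" "snd \<in> N \<Otimes>\<^sub>M Rplus \<rightarrow>\<^sub>M borel"
  by (auto intro: hid_proj obs_proj hid_borelD obs_borelD Rplus_borelD measurable_fst measurable_snd)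

lemma sets_HS_pair[measurable_cong]: "sets HS = sets (hid_borel M \<Otimes>\<^sub>M Rplus)"
  by (simp add: hs_borel_def)

lemma HS_open: "open G \<Longrightarrow> G \<inter> (YY \<times> {0..}) \<in> sets HS"
  unfolding sets_HS sets_restrict_space by (rule image_eqI[where x=G]) (auto simp: Int_commute)

lemma adm_sets[measurable]: "adm M \<in> sets borel"
proof -
  have "adm M \<in> sets (restrict_space borel (XX \<times> act_space M))"
    using adm_borel unfolding obs_borel_def act_borel_def sets_restrict_borel_pair .
  then show ?thesis
    using obs_states_borel act_space_borel
    by (subst (asm) sets_restrict_space_iff) (auto simp: borel_prod[symmetric])
qed

lemma adm_subset: "adm M \<subseteq> XX \<times> act_space M"
  using sets.sets_into_space[OF adm_borel] by (simp add: space_pair_measure)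

lemmas [measurable] = obs_states_borel hid_states_borel act_space_borel

lemma dens_dom_sets: "dens_dom M \<in> sets borel"
proof -
  have "Measurable.pred (borel \<Otimes>\<^sub>M borel \<Otimes>\<^sub>M borel \<Otimes>\<^sub>M borel \<Otimes>\<^sub>M borel) (\<lambda>w :: 'x \<times> 'y \<times> 'x \<times> 'y \<times> 'a. (fst w, snd (snd (snd (snd w)))) \<in> adm M \<and>
    fst (snd w) \<in> YY \<and> fst (snd (snd w)) \<in> XX \<and> fst (snd (snd (snd w))) \<in> YY)"
    by measurable
  moreover have "dens_dom M = {w. (fst w, snd (snd (snd (snd w)))) \<in> adm M \<and>
    fst (snd w) \<in> YY \<and> fst (snd (snd w)) \<in> XX \<and> fst (snd (snd (snd w))) \<in> YY}"
    by (auto simp: dens_dom_def)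
  ultimately show ?thesis
    by (simp add: pred_def borel_prod)
qed

lemma cost_dom_sets: "cost_dom M \<in> sets borel"
proof -
  have "Measurable.pred (borel \<Otimes>\<^sub>M borel \<Otimes>\<^sub>M borel) (\<lambda>w :: 'x \<times> 'y \<times> 'a. (fst w, snd (snd w)) \<in> adm M \<and> fst (snd w) \<in> YY)"
    by measurable
  moreover have "cost_dom M = {w. (fst w, snd (snd w)) \<in> adm M \<and> fst (snd w) \<in> YY}"
    by (auto simp: cost_dom_def)
  ultimately show ?thesis
    by (simp add: pred_def borel_prod)
qed

lemma qe_measurable': "(\<lambda>(x, y, x', y', a). qe x' y' x y a) \<in> borel_measurable borel"
proof -
  have "(\<lambda>w. if w \<in> dens_dom M then (\<lambda>(x, y, x', y', a). dens M x' y' x y a) w else 0) \<in> borel_measurable borel"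
    using dens_dom_sets dens_measurable
    by (subst measurable_If_restrict_space_iff) auto
  also have "(\<lambda>w. if w \<in> dens_dom M then (\<lambda>(x, y, x', y', a). dens M x' y' x y a) w else 0)
      = (\<lambda>(x, y, x', y', a). qe x' y' x y a)"
    by (auto simp: qe_def fun_eq_iff)
  finally show ?thesis .
qed

lemma ce_measurable': "(\<lambda>(x, y, a). ce x y a) \<in> borel_measurable borel"
proof -
  have "(\<lambda>w. if w \<in> cost_dom M then (\<lambda>(x, y, a). cost M x y a) w else cl) \<in> borel_measurable borel"
    using cost_dom_sets cost_measurable
    by (subst measurable_If_restrict_space_iff) auto
  also have "(\<lambda>w. if w \<in> cost_dom M then (\<lambda>(x, y, a). cost M x y a) w else cl)
      = (\<lambda>(x, y, a). ce x y a)"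
    by (auto simp: ce_def fun_eq_iff)
  finally show ?thesis .
qed

lemma qe_measurable[measurable (raw)]:
  assumes [measurable]: "f1 \<in> N \<rightarrow>\<^sub>M borel" "f2 \<in> N \<rightarrow>\<^sub>M borel" "f3 \<in> N \<rightarrow>\<^sub>M borel" "f4 \<in> N \<rightarrow>\<^sub>M borel" "f5 \<in> N \<rightarrow>\<^sub>M borel"
  shows "(\<lambda>w. qe (f1 w) (f2 w) (f3 w) (f4 w) (f5 w)) \<in> borel_measurable N"
proof -
  have "(\<lambda>w. (f3 w, f4 w, f1 w, f2 w, f5 w)) \<in> N \<rightarrow>\<^sub>M borel" by measurable
  from measurable_compose[OF this qe_measurable'] show ?thesis by simp
qed

lemma ce_measurable[measurable (raw)]:
  assumes [measurable]: "f1 \<in> N \<rightarrow>\<^sub>M borel" "f2 \<in> N \<rightarrow>\<^sub>M borel" "f3 \<in> N \<rightarrow>\<^sub>M borel"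
  shows "(\<lambda>w. ce (f1 w) (f2 w) (f3 w)) \<in> borel_measurable N"
proof -
  have "(\<lambda>w. (f1 w, f2 w, f3 w)) \<in> N \<rightarrow>\<^sub>M borel" by measurable
  from measurable_compose[OF this ce_measurable'] show ?thesis by simp
qed

lemma ce_bounds: "cl \<le> ce x y a" "ce x y a \<le> cu" "0 < ce x y a"
  using cost_bounds by (auto simp: ce_def intro: less_le_trans)

lemma qe_inadm: "(x, a) \<notin> adm M \<Longrightarrow> qe x' y' x y a = 0"
  by (auto simp: qe_def dens_dom_def)

lemma qe_dens: "(x, a) \<in> adm M \<Longrightarrow> y \<in> YY \<Longrightarrow> x' \<in> XX \<Longrightarrow> y' \<in> YY \<Longrightarrow> qe x' y' x y a = dens M x' y' x y a"
  by (auto simp: qe_def dens_dom_def)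

section \<open>The transition kernel as a density\<close>

lemma kernel_qe:
  assumes "(x, a) \<in> adm M" "y \<in> YY"
  shows "kernel M x y a = density (lam \<Otimes>\<^sub>M nu) (\<lambda>(x', y'). ennreal (qe x' y' x y a))"
proof -
  have "(x, y, a) \<in> cost_dom M" using assms by (auto simp: cost_dom_def)
  from kernel_dens[OF this] show ?thesis
  proof (simp only:, intro density_cong)
    have eq: "w \<in> space (lam \<Otimes>\<^sub>M nu) \<Longrightarrow> (\<lambda>(x', y'). ennreal (dens M x' y' x y a)) w = (\<lambda>(x', y'). ennreal (qe x' y' x y a)) w" for w
      using assms by (auto simp: qe_dens space_pair_measure)
    show m: "(\<lambda>(x', y'). ennreal (qe x' y' x y a)) \<in> borel_measurable (lam \<Otimes>\<^sub>M nu)"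
      by measurable
    show "(\<lambda>(x', y'). ennreal (dens M x' y' x y a)) \<in> borel_measurable (lam \<Otimes>\<^sub>M nu)"
      using m by (rule measurable_cong[THEN iffD1, rotated]) (rule eq[symmetric])
    show "AE w in lam \<Otimes>\<^sub>M nu. (case w of (x', y') \<Rightarrow> ennreal (dens M x' y' x y a)) = (case w of (x', y') \<Rightarrow> ennreal (qe x' y' x y a))"
      using eq by (intro AE_I2)
  qed
qed

lemma kernel_prob:
  assumes "(x, a) \<in> adm M" "y \<in> YY"
  shows "kernel M x y a \<in> space (prob_algebra (obs_borel M \<Otimes>\<^sub>M hid_borel M))"
proof -
  have "(x, y, a) \<in> space (restrict_space borel (cost_dom M))"
    using assms by (auto simp: cost_dom_def space_restrict_space)
  from measurable_space[OF kernel this] show ?thesis by simp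
qed

lemma nn_integral_kernel:
  assumes "(x, a) \<in> adm M" "y \<in> YY" and [measurable]: "f \<in> borel_measurable (obs_borel M \<Otimes>\<^sub>M hid_borel M)"
  shows "(\<integral>\<^sup>+w. f w \<partial>kernel M x y a) = (\<integral>\<^sup>+x'. (\<integral>\<^sup>+y'. ennreal (qe x' y' x y a) * f (x', y') \<partial>nu) \<partial>lam)"
proof -
  have m: "(\<lambda>(x', y'). ennreal (qe x' y' x y a)) \<in> borel_measurable (lam \<Otimes>\<^sub>M nu)"
    and f: "f \<in> borel_measurable (lam \<Otimes>\<^sub>M nu)"
    by measurable
  have "(\<integral>\<^sup>+w. f w \<partial>kernel M x y a) = (\<integral>\<^sup>+w. (\<lambda>(x', y'). ennreal (qe x' y' x y a)) w * f w \<partial>(lam \<Otimes>\<^sub>M nu))"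
    unfolding kernel_qe[OF assms(1,2)] by (rule nn_integral_density[OF m f])
  also have "\<dots> = (\<integral>\<^sup>+x'. (\<integral>\<^sup>+y'. (\<lambda>(x', y'). ennreal (qe x' y' x y a)) (x', y') * f (x', y') \<partial>nu) \<partial>lam)"
    by (rule nu.nn_integral_fst[symmetric]) (intro borel_measurable_times_ennreal m f)
  finally show ?thesis by simp
qed

lemma qe_total:
  assumes "(x, a) \<in> adm M" "y \<in> YY"
  shows "(\<integral>\<^sup>+x'. (\<integral>\<^sup>+y'. ennreal (qe x' y' x y a) \<partial>nu) \<partial>lam) = 1"
proof -
  interpret prob_space "kernel M x y a"
    using kernel_prob[OF assms] by (simp add: space_prob_algebra)
  have "(\<integral>\<^sup>+w. 1 \<partial>kernel M x y a) = (\<integral>\<^sup>+x'. (\<integral>\<^sup>+y'. ennreal (qe x' y' x y a) * 1 \<partial>nu) \<partial>lam)"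
    by (rule nn_integral_kernel[OF assms]) simp
  then show ?thesis by (simp add: emeasure_space_1)
qed

section \<open>Predictive density and Bayes update\<close>

definition mx where
  "mx x a x' \<mu> = (\<integral>\<^sup>+p. (\<integral>\<^sup>+y'. ennreal (qe x' y' x (fst p) a) \<partial>nu) \<partial>\<mu>)"

definition shift where
  "shift x a z w = (snd w, snd (fst w) + z * ce x (fst (fst w)) a)"

text \<open>An image measure in place of the set function in \<open>Psi\<close>, so that countable
  additivity is automatic. The denominator \<open>mx\<close> is the predictive density of the next
  observation. In \<open>ennreal\<close> both \<open>0 / 0\<close> and
  \<open>c / \<infinity>\<close> with finite \<open>c\<close> are 0, and the density vanishes almost
  everywhere when \<open>mx\<close> does; degenerate denominators thus give the null
  measure.\<close>

definition upd where
  "upd x a x' \<mu> z = distr (density (\<mu> \<Otimes>\<^sub>M nu) (\<lambda>w. ennreal (qe x' (snd w) x (fst (fst w)) a) / mx x a x' \<mu>))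
     HS (shift x a z)"

lemma shift_measurable[measurable]:
  assumes "0 \<le> z" shows "shift x a z \<in> HS \<Otimes>\<^sub>M nu \<rightarrow>\<^sub>M HS"
proof -
  have "(\<lambda>w. snd (fst w) + z * ce x (fst (fst w)) a) \<in> HS \<Otimes>\<^sub>M nu \<rightarrow>\<^sub>M Rplus"
    unfolding Rplus_def
  proof (rule measurable_restrict_space2)
    show "(\<lambda>w. snd (fst w) + z * ce x (fst (fst w)) a) \<in> HS \<Otimes>\<^sub>M nu \<rightarrow>\<^sub>M borel" by measurable
    show "(\<lambda>w. snd (fst w) + z * ce x (fst (fst w)) a) \<in> space (HS \<Otimes>\<^sub>M nu) \<rightarrow> {0..}"
      using ce_bounds(3)[THEN less_imp_le] assms by (auto simp: space_pair_measure)
  qed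
  moreover have "snd \<in> HS \<Otimes>\<^sub>M nu \<rightarrow>\<^sub>M hid_borel M" by measurable
  ultimately show ?thesis unfolding shift_def[abs_def] hs_borel_def by measurable
qed

lemma sets_upd[simp, measurable_cong]: "sets (upd x a x' \<mu> z) = sets HS"
  and space_upd[simp]: "space (upd x a x' \<mu> z) = YY \<times> {0..}"
  by (simp_all add: upd_def)

text \<open>Sub-probabilities, because \<open>upd\<close> may return the null measure. With the
  sigma-algebra generated by evaluation on sets, a belief depending on a history is a kernel and can
  be integrated measurably.\<close>

definition SP where "SP = subprob_algebra HS"

lemma SP_D: "\<mu> \<in> space SP \<Longrightarrow> subprob_space \<mu>" "\<mu> \<in> space SP \<Longrightarrow> sets \<mu> = sets HS" "\<mu> \<in> space SP \<Longrightarrow> space \<mu> = YY \<times> {0..}"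
  using sets_eq_imp_space_eq[of \<mu> HS] by (simp_all add: SP_def space_subprob_algebra)

lemma qe_nu_measurable[measurable]: "(\<lambda>y'. ennreal (qe x' y' x y a)) \<in> borel_measurable nu"
proof -
  have [measurable]: "(\<lambda>y'. y') \<in> nu \<rightarrow>\<^sub>M borel" by (rule hid_proj) simp
  show ?thesis by measurable
qed

lemma inner_qe_measurable[measurable]:
  "(\<lambda>p. \<integral>\<^sup>+y'. ennreal (qe x' y' x (fst p) a) \<partial>nu) \<in> borel_measurable HS"
  by measurable

lemma nn_integral_upd:
  assumes \<mu>: "\<mu> \<in> space SP" and z: "0 \<le> z" and f[measurable]: "f \<in> borel_measurable HS"
  shows "(\<integral>\<^sup>+p. f p \<partial>upd x a x' \<mu> z) =
    (\<integral>\<^sup>+p. (\<integral>\<^sup>+y'. ennreal (qe x' y' x (fst p) a) * f (y', snd p + z * ce x (fst p) a) \<partial>nu) \<partial>\<mu>) / mx x a x' \<mu>"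
proof -
  have [measurable_cong]: "sets \<mu> = sets HS" using SP_D(2)[OF \<mu>] .
  interpret m: subprob_space \<mu> using SP_D(1)[OF \<mu>] .
  note shift_measurable[OF z, measurable]
  let ?q = "\<lambda>w. ennreal (qe x' (snd w) x (fst (fst w)) a)"
  have [measurable]: "shift x a z \<in> \<mu> \<Otimes>\<^sub>M nu \<rightarrow>\<^sub>M HS" "(\<lambda>w. f (shift x a z w)) \<in> borel_measurable (\<mu> \<Otimes>\<^sub>M nu)"
    "?q \<in> borel_measurable (\<mu> \<Otimes>\<^sub>M nu)"
    by measurable
  have "(\<integral>\<^sup>+p. f p \<partial>upd x a x' \<mu> z) = (\<integral>\<^sup>+w. f (shift x a z w) \<partial>density (\<mu> \<Otimes>\<^sub>M nu) (\<lambda>w. ?q w / mx x a x' \<mu>))"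
    unfolding upd_def by (rule nn_integral_distr) auto
  also have "\<dots> = (\<integral>\<^sup>+w. ?q w / mx x a x' \<mu> * f (shift x a z w) \<partial>(\<mu> \<Otimes>\<^sub>M nu))"
    by (rule nn_integral_density) auto
  also have "\<dots> = (\<integral>\<^sup>+w. ?q w * f (shift x a z w) / mx x a x' \<mu> \<partial>(\<mu> \<Otimes>\<^sub>M nu))"
    by (simp add: ennreal_times_divide mult.commute)
  also have "\<dots> = (\<integral>\<^sup>+w. ?q w * f (shift x a z w) \<partial>(\<mu> \<Otimes>\<^sub>M nu)) / mx x a x' \<mu>"
    by (rule nn_integral_divide) auto
  also have "(\<integral>\<^sup>+w. ?q w * f (shift x a z w) \<partial>(\<mu> \<Otimes>\<^sub>M nu)) =
    (\<integral>\<^sup>+p. (\<integral>\<^sup>+y'. ?q (p, y') * f (shift x a z (p, y')) \<partial>nu) \<partial>\<mu>)"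
    by (rule nu.nn_integral_fst[symmetric]) auto
  finally show ?thesis by (simp add: shift_def)
qed

text \<open>For a constant integrand the numerator is \<open>mx\<close> itself, and
  \<open>mx / mx\<close> in \<open>ennreal\<close> equals 1 strictly between 0 and \<infinity> and 0
  at both ends.\<close>

lemma emeasure_upd_space:
  assumes "\<mu> \<in> space SP" "0 \<le> z"
  shows "emeasure (upd x a x' \<mu> z) (YY \<times> {0..}) = (if 0 < mx x a x' \<mu> \<and> mx x a x' \<mu> < \<infinity> then 1 else 0)"
proof -
  have "emeasure (upd x a x' \<mu> z) (YY \<times> {0..}) = (\<integral>\<^sup>+p. 1 \<partial>upd x a x' \<mu> z)" by simp
  also have "\<dots> = mx x a x' \<mu> / mx x a x' \<mu>"
    by (subst nn_integral_upd[OF assms]) (simp_all add: mx_def)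
  also have "\<dots> = (if 0 < mx x a x' \<mu> \<and> mx x a x' \<mu> < \<infinity> then 1 else 0)"
    by (auto simp: less_top[symmetric] zero_less_iff_neq_zero)
  finally show ?thesis .
qed

lemma upd_SP: 
  assumes *: "\<mu> \<in> space SP" "0 \<le> z" shows "upd x a x' \<mu> z \<in> space SP"
proof -
  have "space \<mu> \<noteq> {}" using SP_D(1)[OF *(1)] by (simp add: subprob_space.subprob_not_empty)
  then have "subprob_space (upd x a x' \<mu> z)"
    using emeasure_upd_space[OF *, of x a x'] SP_D(3)[OF *(1)] by (intro subprob_spaceI) auto
  then show ?thesis by (simp add: SP_def space_subprob_algebra)
qed

lemma mx_measurable[measurable (raw)]:
  assumes [measurable]: "f \<in> N \<rightarrow>\<^sub>M borel" "g \<in> N \<rightarrow>\<^sub>M borel" "h \<in> N \<rightarrow>\<^sub>M borel" and m: "m \<in> N \<rightarrow>\<^sub>M SP"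
  shows "(\<lambda>w. mx (f w) (g w) (h w) (m w)) \<in> borel_measurable N"
  unfolding mx_def
  by (rule nn_integral_measurable_subprob_algebra2[where N=HS, OF _ m[unfolded SP_def]]) measurable

text \<open>State, action, observation and belief all vary measurably here, which is what allows the
  update to be iterated along a path.\<close>

lemma upd_measurable[measurable (raw)]:
  assumes [measurable]: "f \<in> N \<rightarrow>\<^sub>M borel" "g \<in> N \<rightarrow>\<^sub>M borel" "h \<in> N \<rightarrow>\<^sub>M borel"
    and m[measurable]: "m \<in> N \<rightarrow>\<^sub>M SP" and z: "0 \<le> z"
  shows "(\<lambda>w. upd (f w) (g w) (h w) (m w) z) \<in> N \<rightarrow>\<^sub>M SP"
  unfolding SP_def
proof (rule measurable_subprob_algebra)
  fix w assume w: "w \<in> space N"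
  show "subprob_space (upd (f w) (g w) (h w) (m w) z)"
    using upd_SP[OF measurable_space[OF m w] z] SP_D by auto
next
  fix A assume A[measurable]: "A \<in> sets HS"
  have "(\<lambda>w. (\<integral>\<^sup>+p. (\<integral>\<^sup>+y'. ennreal (qe (h w) y' (f w) (fst p) (g w)) *
      indicator A (y', snd p + z * ce (f w) (fst p) (g w)) \<partial>nu) \<partial>m w) / mx (f w) (g w) (h w) (m w)) \<in> borel_measurable N"
  proof (rule borel_measurable_divide_ennreal)
    have *: "(\<lambda>u. snd (snd (fst u)) + z * ce (f (fst (fst u))) (fst (snd (fst u))) (g (fst (fst u)))) \<in> (N \<Otimes>\<^sub>M HS) \<Otimes>\<^sub>M nu \<rightarrow>\<^sub>M Rplus"
      unfolding Rplus_def
    proof (rule measurable_restrict_space2)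
      show "(\<lambda>u. snd (snd (fst u)) + z * ce (f (fst (fst u))) (fst (snd (fst u))) (g (fst (fst u)))) \<in> (N \<Otimes>\<^sub>M HS) \<Otimes>\<^sub>M nu \<rightarrow>\<^sub>M borel"
        by measurable
      show "(\<lambda>u. snd (snd (fst u)) + z * ce (f (fst (fst u))) (fst (snd (fst u))) (g (fst (fst u)))) \<in> space ((N \<Otimes>\<^sub>M HS) \<Otimes>\<^sub>M nu) \<rightarrow> {0..}"
        using ce_bounds(3)[THEN less_imp_le] z by (auto simp: space_pair_measure)
    qed
    have [measurable]: "(\<lambda>u. (snd u, snd (snd (fst u)) + z * ce (f (fst (fst u))) (fst (snd (fst u))) (g (fst (fst u))))) \<in> (N \<Otimes>\<^sub>M HS) \<Otimes>\<^sub>M nu \<rightarrow>\<^sub>M HS"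
      unfolding hs_borel_def using *[unfolded hs_borel_def] by measurable
    have "(\<lambda>(w, p). \<integral>\<^sup>+y'. ennreal (qe (h w) y' (f w) (fst p) (g w)) *
      indicator A (y', snd p + z * ce (f w) (fst p) (g w)) \<partial>nu) \<in> borel_measurable (N \<Otimes>\<^sub>M HS)"
      by measurable
    then show "(\<lambda>w. \<integral>\<^sup>+p. (\<integral>\<^sup>+y'. ennreal (qe (h w) y' (f w) (fst p) (g w)) *
      indicator A (y', snd p + z * ce (f w) (fst p) (g w)) \<partial>nu) \<partial>m w) \<in> borel_measurable N"
      by (rule nn_integral_measurable_subprob_algebra2[OF _ m[unfolded SP_def]])
  qed measurable
  then show "(\<lambda>w. emeasure (upd (f w) (g w) (h w) (m w) z) A) \<in> borel_measurable N"
  proof (rule measurable_cong[THEN iffD1, rotated])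
    fix w assume w: "w \<in> space N"
    show "(\<integral>\<^sup>+p. (\<integral>\<^sup>+y'. ennreal (qe (h w) y' (f w) (fst p) (g w)) *
      indicator A (y', snd p + z * ce (f w) (fst p) (g w)) \<partial>nu) \<partial>m w) / mx (f w) (g w) (h w) (m w) = emeasure (upd (f w) (g w) (h w) (m w) z) A"
      using nn_integral_upd[OF measurable_space[OF m w] z, of "indicator A"] by (simp add: case_prod_beta)
  qed
qed simp

text \<open>Tonelli and the unit mass of the kernel. This conservation of mass later combines with a
  Fatou bound to give convergence of the predictive densities.\<close>

lemma mx_total:
  assumes \<mu>: "\<mu> \<in> space SP" and adm: "(x, a) \<in> adm M"
  shows "(\<integral>\<^sup>+x'. mx x a x' \<mu> \<partial>lam) = emeasure \<mu> (space \<mu>)"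
proof -
  have [measurable_cong]: "sets \<mu> = sets HS" using SP_D(2)[OF \<mu>] .
  interpret m: subprob_space \<mu> using SP_D(1)[OF \<mu>] .
  interpret pair_sigma_finite lam \<mu> ..
  have "(\<integral>\<^sup>+x'. mx x a x' \<mu> \<partial>lam) = (\<integral>\<^sup>+p. (\<integral>\<^sup>+x'. (\<integral>\<^sup>+y'. ennreal (qe x' y' x (fst p) a) \<partial>nu) \<partial>lam) \<partial>\<mu>)"
    unfolding mx_def by (rule Fubini'[symmetric]) measurable
  also have "\<dots> = (\<integral>\<^sup>+p. 1 \<partial>\<mu>)"
    using SP_D(3)[OF \<mu>] adm by (intro nn_integral_cong qe_total) auto
  finally show ?thesis by simp
qed

lemma mx_finite_AE:
  assumes \<mu>: "\<mu> \<in> space SP" and adm: "(x, a) \<in> adm M"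
  shows "AE x' in lam. mx x a x' \<mu> < \<infinity>"
proof -
  interpret m: subprob_space \<mu> using SP_D(1)[OF \<mu>] .
  have [measurable]: "(\<lambda>_. \<mu>) \<in> lam \<rightarrow>\<^sub>M SP" using \<mu> by simp
  have "AE x' in lam. mx x a x' \<mu> \<noteq> \<infinity>"
  proof (rule nn_integral_PInf_AE)
    show "(\<lambda>x'. mx x a x' \<mu>) \<in> borel_measurable lam"
      by (rule mx_measurable) (auto intro: obs_proj)
    show "(\<integral>\<^sup>+x'. mx x a x' \<mu> \<partial>lam) \<noteq> \<infinity>"
      using mx_total[OF assms] m.emeasure_space_le_1 by (auto simp: top_unique)
  qed
  then show ?thesis by (simp add: less_top)
qed

text \<open>Bayes' rule in integrated form: predictive density times updated belief is the joint law
  of next observation, next hidden state and accumulated cost. The denominator cancels where it is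
  positive and finite; infinite values occur on a null set only, and its zeros are treated
  separately.\<close>

lemma one_step_disintegration:
  assumes \<mu>: "\<mu> \<in> space SP" and adm: "(x, a) \<in> adm M" and z: "0 \<le> z"
    and \<psi>[measurable]: "(\<lambda>(x', p). \<psi> x' p) \<in> borel_measurable (obs_borel M \<Otimes>\<^sub>M HS)"
  shows "(\<integral>\<^sup>+x'. mx x a x' \<mu> * (\<integral>\<^sup>+p. \<psi> x' p \<partial>upd x a x' \<mu> z) \<partial>lam) =
    (\<integral>\<^sup>+p. (\<integral>\<^sup>+x'. (\<integral>\<^sup>+y'. ennreal (qe x' y' x (fst p) a) * \<psi> x' (y', snd p + z * ce x (fst p) a) \<partial>nu) \<partial>lam) \<partial>\<mu>)"
proof -
  have [measurable_cong]: "sets \<mu> = sets HS" using SP_D(2)[OF \<mu>] .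
  interpret m: subprob_space \<mu> using SP_D(1)[OF \<mu>] .
  interpret pair_sigma_finite lam \<mu> ..
  let ?I = "\<lambda>x' p. \<integral>\<^sup>+y'. ennreal (qe x' y' x (fst p) a) * \<psi> x' (y', snd p + z * ce x (fst p) a) \<partial>nu"
  have *: "(\<lambda>w. snd (snd (fst w)) + z * ce x (fst (snd (fst w))) a) \<in> (lam \<Otimes>\<^sub>M HS) \<Otimes>\<^sub>M nu \<rightarrow>\<^sub>M Rplus"
    unfolding Rplus_def
  proof (rule measurable_restrict_space2)
    show "(\<lambda>w. snd (snd (fst w)) + z * ce x (fst (snd (fst w))) a) \<in> (lam \<Otimes>\<^sub>M HS) \<Otimes>\<^sub>M nu \<rightarrow>\<^sub>M borel" by measurable
    show "(\<lambda>w. snd (snd (fst w)) + z * ce x (fst (snd (fst w))) a) \<in> space ((lam \<Otimes>\<^sub>M HS) \<Otimes>\<^sub>M nu) \<rightarrow> {0..}"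
      using ce_bounds(3)[THEN less_imp_le] z by (auto simp: space_pair_measure)
  qed
  have P: "(\<lambda>w. (fst (fst w), snd w, snd (snd (fst w)) + z * ce x (fst (snd (fst w))) a)) \<in> (lam \<Otimes>\<^sub>M HS) \<Otimes>\<^sub>M nu \<rightarrow>\<^sub>M obs_borel M \<Otimes>\<^sub>M HS"
    unfolding hs_borel_def using *[unfolded hs_borel_def] by measurable
  have [measurable]: "(\<lambda>w. \<psi> (fst (fst w)) (snd w, snd (snd (fst w)) + z * ce x (fst (snd (fst w))) a)) \<in> borel_measurable ((lam \<Otimes>\<^sub>M HS) \<Otimes>\<^sub>M nu)"
    using measurable_compose[OF P \<psi>] by simp
  have "(\<lambda>(x', p). ?I x' p) \<in> borel_measurable (lam \<Otimes>\<^sub>M HS)"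
    unfolding case_prod_beta by (rule nu.borel_measurable_nn_integral) (simp add: case_prod_beta)
  then have mI: "(\<lambda>(x', p). ?I x' p) \<in> borel_measurable (lam \<Otimes>\<^sub>M \<mu>)"
    using measurable_cong_sets[OF sets_pair_measure_cong[OF refl SP_D(2)[OF \<mu>]] refl] by blast
  have "(\<integral>\<^sup>+x'. mx x a x' \<mu> * (\<integral>\<^sup>+p. \<psi> x' p \<partial>upd x a x' \<mu> z) \<partial>lam) = (\<integral>\<^sup>+x'. (\<integral>\<^sup>+p. ?I x' p \<partial>\<mu>) \<partial>lam)"
  proof (rule nn_integral_cong_AE)
    show "AE x' in lam. mx x a x' \<mu> * (\<integral>\<^sup>+p. \<psi> x' p \<partial>upd x a x' \<mu> z) = (\<integral>\<^sup>+p. ?I x' p \<partial>\<mu>)"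
      using mx_finite_AE[OF \<mu> adm] AE_space
    proof eventually_elim
      case (elim x')
      then have "x' \<in> XX" by simp
      then have m: "\<psi> x' \<in> borel_measurable HS"
        using measurable_Pair2[OF \<psi>, of x'] by simp
      show ?case
      proof (cases "mx x a x' \<mu> = 0")
        case False
        with elim show ?thesis
          unfolding nn_integral_upd[OF \<mu> z m] ennreal_times_divide
          by (subst mult.commute, intro mult_divide_eq_ennreal) auto
      next
        \<comment> \<open>A vanishing denominator forces the density to vanish for almost all hidden
          pairs and almost all next hidden states, so both sides are 0.\<close>
        case True
        then have "AE p in \<mu>. (\<integral>\<^sup>+y'. ennreal (qe x' y' x (fst p) a) \<partial>nu) = 0"
          unfolding mx_def by (subst (asm) nn_integral_0_iff_AE) auto
        then have "AE p in \<mu>. ?I x' p = 0"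
          using AE_space
        proof eventually_elim
          case (elim p)
          then have "AE y' in nu. ennreal (qe x' y' x (fst p) a) = 0"
            by (subst (asm) nn_integral_0_iff_AE) auto
          then have "?I x' p = (\<integral>\<^sup>+y'. 0 \<partial>nu)"
            by (intro nn_integral_cong_AE) auto
          then show ?case by simp
        qed
        then have "(\<integral>\<^sup>+p. ?I x' p \<partial>\<mu>) = (\<integral>\<^sup>+p. 0 \<partial>\<mu>)" by (rule nn_integral_cong_AE)
        with True show ?thesis by simp
      qed
    qed
  qed
  also have "\<dots> = (\<integral>\<^sup>+p. (\<integral>\<^sup>+x'. ?I x' p \<partial>lam) \<partial>\<mu>)"
    by (rule Fubini'[OF mI, symmetric])
  finally show ?thesis .
qed

section \<open>The topology of the extended state space\<close>

abbreviation "HSp \<equiv> YY \<times> {0::real..}"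

lemma Pb_D:
  assumes "\<mu> \<in> Pb M"
  shows "prob_space \<mu>" "sets \<mu> = sets HS" "space \<mu> = HSp" "\<mu> \<in> space SP"
  using assms sets_eq_imp_space_eq[of \<mu> HS]
  by (auto simp: Pb_def SP_def space_subprob_algebra prob_space_imp_subprob_space)

lemma Pb_iff:
  "\<mu> \<in> Pb M \<longleftrightarrow> prob_space \<mu> \<and> sets \<mu> = sets HS \<and> (\<exists>K>0. AE p in \<mu>. snd p \<le> K)"
proof -
  have "measure \<mu> (YY \<times> {0..K}) = 1 \<longleftrightarrow> (AE p in \<mu>. snd p \<le> K)"
    if \<mu>: "prob_space \<mu>" "sets \<mu> = sets HS" and K: "K > 0" for K
  proof -
    interpret prob_space \<mu> by fact
    have sp: "space \<mu> = HSp" using sets_eq_imp_space_eq[OF \<mu>(2)] by simp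
    have "YY \<times> {0..K} = {p\<in>space HS. snd p \<le> K}" by auto
    also have "\<dots> \<in> sets HS" using Rplus_fst_snd by measurable
    finally have "YY \<times> {0..K} \<in> sets \<mu>" using \<mu> by simp
    then have "prob (YY \<times> {0..K}) = 1 \<longleftrightarrow> (AE p in \<mu>. p \<in> YY \<times> {0..K})"
      by (rule prob_eq_1)
    also have "\<dots> \<longleftrightarrow> (AE p in \<mu>. snd p \<le> K)"
      by (rule AE_cong) (auto simp: sp)
    finally show ?thesis .
  qed
  then show ?thesis unfolding Pb_def by auto
qed

text \<open>The portmanteau condition on open sets, chosen over test functions because Fatou
  arguments deliver lower bounds only. Between members of \<open>Pb M\<close>,
  \<open>wconv_integral\<close> recovers convergence of integrals of bounded continuous
  functions.\<close>

definition wconv where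
  "wconv \<mu>s \<mu> \<longleftrightarrow> (\<forall>G. open G \<longrightarrow> emeasure \<mu> (G \<inter> HSp) \<le> liminf (\<lambda>n::nat. emeasure (\<mu>s n) (G \<inter> HSp)))"

lemma weak_Fatou_HS:
  assumes \<mu>s: "\<And>n. \<mu>s n \<in> space SP" "\<mu> \<in> space SP" and w: "wconv \<mu>s \<mu>"
    and [measurable]: "g \<in> borel_measurable HS" "\<And>n. gs n \<in> borel_measurable HS"
    and lim: "\<And>p ps. p \<in> HSp \<Longrightarrow> (\<And>n. ps n \<in> HSp) \<Longrightarrow> ps \<longlonglongrightarrow> p \<Longrightarrow>
        (g p :: ennreal) \<le> liminf (\<lambda>n. gs n (ps n))"
  shows "(\<integral>\<^sup>+p. g p \<partial>\<mu>) \<le> liminf (\<lambda>n. \<integral>\<^sup>+p. gs n p \<partial>\<mu>s n)"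
proof (rule weak_Fatou[where S=HSp])
  show "space \<mu> = HSp" "space (\<mu>s n) = HSp" for n using \<mu>s SP_D by auto
  show "open G \<Longrightarrow> G \<inter> HSp \<in> sets \<mu>" "open G \<Longrightarrow> G \<inter> HSp \<in> sets (\<mu>s n)" for n G
    using HS_open[of G] SP_D(2)[OF \<mu>s(1)] SP_D(2)[OF \<mu>s(2)] by auto
  have *: "subprob_space \<mu>" "subprob_space (\<mu>s n)" for n
    using SP_D(1)[OF \<mu>s(1)] SP_D(1)[OF \<mu>s(2)] by auto
  show "sigma_finite_measure \<mu>" "sigma_finite_measure (\<mu>s n)" for n
    using * by (auto simp: subprob_space_def finite_measure_def)
  show "open G \<Longrightarrow> emeasure \<mu> (G \<inter> HSp) \<le> liminf (\<lambda>n. emeasure (\<mu>s n) (G \<inter> HSp))" for G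
    using w by (auto simp: wconv_def)
  show "g \<in> borel_measurable \<mu>" "gs n \<in> borel_measurable (\<mu>s n)" for n
    using assms(4,5) measurable_cong_sets[OF SP_D(2)[OF \<mu>s(1)] refl]
      measurable_cong_sets[OF SP_D(2)[OF \<mu>s(2)] refl] by blast+
qed (use lim in auto)

lemma continuous_HS_measurable: "continuous_on HSp f \<Longrightarrow> f \<in> borel_measurable HS"
  using borel_measurable_continuous_on_restrict[of HSp f] measurable_cong_sets[OF sets_HS refl] by blast

lemma integrable_bounded_continuous:
  assumes "\<mu> \<in> Pb M" "continuous_on HSp f" "\<And>p. p \<in> HSp \<Longrightarrow> \<bar>f p\<bar> \<le> (B::real)"
  shows "integrable \<mu> f"
proof -
  note \<mu> = Pb_D[OF assms(1)]
  interpret prob_space \<mu> by (rule \<mu>)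
  show ?thesis
  proof (rule integrable_const_bound)
    show "AE p in \<mu>. norm (f p) \<le> B" using assms(3) \<mu>(3) by (intro AE_I2) auto
    show "f \<in> borel_measurable \<mu>"
      using continuous_HS_measurable[OF assms(2)] measurable_cong_sets[OF \<mu>(2) refl] by blast
  qed
qed

lemma wconv_integral_lower:
  assumes \<mu>s: "\<And>n. \<mu>s n \<in> Pb M" "\<mu> \<in> Pb M" and w: "wconv \<mu>s \<mu>"
    and f: "continuous_on HSp f" "\<And>p. p \<in> HSp \<Longrightarrow> \<bar>f p\<bar> \<le> (B::real)"
    and r: "r < (\<integral>p. f p \<partial>\<mu>)"
  shows "eventually (\<lambda>n. r < (\<integral>p. f p \<partial>\<mu>s n)) sequentially"
proof -
  \<comment> \<open>Adding \<open>B\<close> makes the integrand nonnegative; the extra 1 makes its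
    mean strictly positive, which is what the comparison uses when \<open>r + C\<close> is negative
    and \<open>ennreal\<close> truncates it to 0.\<close>
  define C where "C = B + 1"
  have conv: "(\<integral>\<^sup>+p. ennreal (f p + C) \<partial>\<nu>) = ennreal ((\<integral>p. f p \<partial>\<nu>) + C) \<and> 0 < (\<integral>p. f p \<partial>\<nu>) + C" if "\<nu> \<in> Pb M" for \<nu>
  proof -
    note \<nu> = Pb_D[OF that]
    interpret prob_space \<nu> by (rule \<nu>)
    have i: "integrable \<nu> f" by (rule integrable_bounded_continuous[OF that f])
    have nn1: "AE p in \<nu>. 1 \<le> f p + C"
    proof (rule AE_I2)
      fix p assume "p \<in> space \<nu>"
      then have "\<bar>f p\<bar> \<le> B" using f(2) \<nu>(3) by auto
      then show "1 \<le> f p + C" by (simp add: C_def)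
    qed
    then have nn: "AE p in \<nu>. 0 \<le> f p + C" by eventually_elim simp
    have "(\<integral>\<^sup>+p. ennreal (f p + C) \<partial>\<nu>) = ennreal (\<integral>p. f p + C \<partial>\<nu>)"
      using i nn by (intro nn_integral_eq_integral) auto
    moreover have "(\<integral>p. f p + C \<partial>\<nu>) = (\<integral>p. f p \<partial>\<nu>) + C" using i by (simp add: prob_space)
    moreover have "1 \<le> (\<integral>p. f p + C \<partial>\<nu>)" using nn1 i by (intro integral_ge_const) auto
    ultimately show ?thesis by simp
  qed
  note [measurable] = continuous_HS_measurable[OF f(1)]
  have "(\<integral>\<^sup>+p. ennreal (f p + C) \<partial>\<mu>) \<le> liminf (\<lambda>n. \<integral>\<^sup>+p. ennreal (f p + C) \<partial>\<mu>s n)"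
  proof (rule weak_Fatou_HS[OF _ _ w])
    fix p and ps :: "nat \<Rightarrow> 'y \<times> real" assume p: "p \<in> HSp" "\<And>n. ps n \<in> HSp" "ps \<longlonglongrightarrow> p"
    have "(\<lambda>n. f (ps n)) \<longlonglongrightarrow> f p"
      by (rule continuous_on_tendsto_compose[OF f(1) p(3,1)]) (use p in auto)
    then have "(\<lambda>n. ennreal (f (ps n) + C)) \<longlonglongrightarrow> ennreal (f p + C)" by (intro tendsto_intros)
    then show "ennreal (f p + C) \<le> liminf (\<lambda>n. ennreal (f (ps n) + C))"
      by (simp add: lim_imp_Liminf)
  qed (use \<mu>s Pb_D in auto)
  then have "ennreal ((\<integral>p. f p \<partial>\<mu>) + C) \<le> liminf (\<lambda>n. ennreal ((\<integral>p. f p \<partial>\<mu>s n) + C))"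
    using conv \<mu>s by simp
  moreover have "ennreal (r + C) < ennreal ((\<integral>p. f p \<partial>\<mu>) + C)"
    using r conv[OF \<mu>s(2)] by (cases "0 \<le> r + C") (auto simp: ennreal_less_iff ennreal_neg not_le)
  ultimately have "eventually (\<lambda>n. ennreal (r + C) < ennreal ((\<integral>p. f p \<partial>\<mu>s n) + C)) sequentially"
    by (intro less_LiminfD) (rule less_le_trans)
  then show ?thesis
  proof eventually_elim
    case (elim n)
    then show ?case using conv[OF \<mu>s(1)[of n]]
      by (cases "0 \<le> r + C") (auto simp: ennreal_less_iff)
  qed
qed

text \<open>A bounded \<open>f\<close> and its negative both fall under the one-sided bound.\<close>

lemma wconv_integral:
  assumes \<mu>s: "\<And>n. \<mu>s n \<in> Pb M" "\<mu> \<in> Pb M" and w: "wconv \<mu>s \<mu>"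
    and f: "continuous_on HSp f" "bounded (f ` HSp)"
  shows "(\<lambda>n. \<integral>p. f p \<partial>\<mu>s n) \<longlonglongrightarrow> (\<integral>p. f p \<partial>\<mu> :: real)"
proof -
  obtain B where B: "\<And>p. p \<in> HSp \<Longrightarrow> \<bar>f p\<bar> \<le> B"
    using f(2) by (auto simp: bounded_iff)
  have B': "\<And>p. p \<in> HSp \<Longrightarrow> \<bar>- f p\<bar> \<le> B" using B by simp
  have f': "continuous_on HSp (\<lambda>p. - f p)" using f(1) by (intro continuous_intros)
  show ?thesis
  proof (rule order_tendstoI)
    fix r assume "r < (\<integral>p. f p \<partial>\<mu>)"
    from wconv_integral_lower[OF \<mu>s w f(1) B this]
    show "eventually (\<lambda>n. r < (\<integral>p. f p \<partial>\<mu>s n)) sequentially" by simp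
  next
    fix r assume "(\<integral>p. f p \<partial>\<mu>) < r"
    then have "- r < (\<integral>p. - f p \<partial>\<mu>)" by simp
    from wconv_integral_lower[OF \<mu>s w f' B' this]
    show "eventually (\<lambda>n. (\<integral>p. f p \<partial>\<mu>s n) < r) sequentially" by simp
  qed
qed

lemma topspace_Pb_top[simp]: "topspace (Pb_top M) = Pb M"
proof -
  have "Pb M \<in> {{\<mu>\<in>Pb M. (\<integral>p. f p \<partial>\<mu>) \<in> W} | (f :: 'y \<times> real \<Rightarrow> real) W.
        continuous_on (hid_states M \<times> {0..}) f \<and> bounded (f ` (hid_states M \<times> {0..})) \<and> open W}"
    by (rule CollectI, rule exI[of _ "\<lambda>_. 0"], rule exI[of _ UNIV]) (auto simp: bounded_iff)
  then show ?thesis unfolding Pb_top_def topology_generated_by_topspace by blast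
qed

lemma topspace_E_top[simp]: "topspace (E_top M) = E_set M"
  by (simp add: E_top_def E_set_def)

lemma Pb_top_openD:
  assumes "openin (Pb_top M) W" "\<mu> \<in> W" "\<And>n. \<mu>s n \<in> Pb M" "wconv \<mu>s \<mu>"
  shows "eventually (\<lambda>n. \<mu>s n \<in> W) sequentially"
  using assms(1)[unfolded Pb_top_def openin_topology_generated_by_iff] assms(2)
proof (induction W rule: generate_topology_on.induct)
  case (Int a b)
  then show ?case by (auto intro: eventually_conj)
next
  case (UN K)
  then obtain k where "k \<in> K" "\<mu> \<in> k" by auto
  with UN(2) have "eventually (\<lambda>n. \<mu>s n \<in> k) sequentially" by auto
  then show ?case by eventually_elim (use \<open>k \<in> K\<close> in auto)
next
  case (Basis s)
  then obtain f :: "'y \<times> real \<Rightarrow> real" and W where s: "s = {\<mu>\<in>Pb M. (\<integral>p. f p \<partial>\<mu>) \<in> W}"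
    "continuous_on HSp f" "bounded (f ` HSp)" "open W" by auto
  then have "(\<lambda>n. \<integral>p. f p \<partial>\<mu>s n) \<longlonglongrightarrow> (\<integral>p. f p \<partial>\<mu>)"
    using Basis assms by (intro wconv_integral) auto
  then have "eventually (\<lambda>n. (\<integral>p. f p \<partial>\<mu>s n) \<in> W) sequentially"
    using s Basis by (auto dest: topological_tendstoD)
  then show ?case by eventually_elim (use s assms in auto)
qed auto

text \<open>The indicator of an open set is the pointwise limit from below of the continuous
  functions \<open>min 1 (j * infdist p (- G))\<close>, so the set is a union of generating open
  sets of the weak topology.\<close>

lemma openin_Pb_top_gt:
  assumes G: "open G"
  shows "openin (Pb_top M) {\<mu>\<in>Pb M. q < measure \<mu> (G \<inter> HSp)}"
proof (cases "G = UNIV")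
  \<comment> \<open>The distance to an empty complement is 0 by convention, so the approximating
    functions would vanish; here the mass is simply 1.\<close>
  case True
  have "measure \<mu> HSp = 1" if "\<mu> \<in> Pb M" for \<mu>
    using prob_space.prob_space[OF Pb_D(1)[OF that]] Pb_D(3)[OF that] by simp
  with True have "{\<mu>\<in>Pb M. q < measure \<mu> (G \<inter> HSp)} = (if q < 1 then topspace (Pb_top M) else {})"
    by auto
  then show ?thesis by (simp del: topspace_Pb_top)
next
  case False
  define f where "f j p = min 1 (real j * infdist p (- G))" for j p
  have ne: "- G \<noteq> {}" using False by auto
  have f01: "0 \<le> f j p" "f j p \<le> 1" for j p by (auto simp: f_def infdist_nonneg)
  have f_out: "f j p = 0" if "p \<notin> G" for j p using that by (simp add: f_def)
  have cont: "continuous_on HSp (f j)" for j unfolding f_def by (intro continuous_intros)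
  have lim: "(\<lambda>j. f j p) \<longlonglongrightarrow> indicat_real G p" for p
  proof (cases "p \<in> G")
    case True
    then have pos: "0 < infdist p (- G)"
      using infdist_pos_not_in_closed[of "- G" p] G ne by (auto simp: closed_def)
    obtain N where N: "1 / infdist p (- G) < real N" using reals_Archimedean2 by blast
    have "f j p = 1" if "j \<ge> N" for j
    proof -
      have "1 / infdist p (- G) \<le> real j" using N that by linarith
      then have "1 \<le> real j * infdist p (- G)" using pos by (simp add: field_simps)
      then show ?thesis by (simp add: f_def)
    qed
    then have "eventually (\<lambda>j. f j p = 1) sequentially" by (auto simp: eventually_sequentially)
    then show ?thesis using True by (simp add: tendsto_eventually)
  qed (simp add: f_out)
  have "{\<mu>\<in>Pb M. q < measure \<mu> (G \<inter> HSp)} = (\<Union>j. {\<mu>\<in>Pb M. (\<integral>p. f j p \<partial>\<mu>) \<in> {q<..}})"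
  proof (intro set_eqI)
    fix \<mu>
    show "\<mu> \<in> {\<mu>\<in>Pb M. q < measure \<mu> (G \<inter> HSp)} \<longleftrightarrow> \<mu> \<in> (\<Union>j. {\<mu>\<in>Pb M. (\<integral>p. f j p \<partial>\<mu>) \<in> {q<..}})"
    proof (cases "\<mu> \<in> Pb M")
      case True
      note \<mu> = Pb_D[OF True]
      interpret prob_space \<mu> by (rule \<mu>)
      have [measurable]: "G \<inter> HSp \<in> sets \<mu>" "f j \<in> borel_measurable \<mu>" for j
        using HS_open[OF G] \<mu>(2) continuous_HS_measurable[OF cont] measurable_cong_sets[OF \<mu>(2) refl] by blast+
      have int: "integrable \<mu> (f j)" for j
        by (rule integrable_const_bound[where B=1]) (use f01 in auto)
      have meas: "measure \<mu> (G \<inter> HSp) = (\<integral>p. indicat_real (G \<inter> HSp) p \<partial>\<mu>)" by simp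
      have up: "(\<integral>p. f j p \<partial>\<mu>) \<le> measure \<mu> (G \<inter> HSp)" for j
      proof -
        have "integrable \<mu> (indicat_real (G \<inter> HSp))"
          by (rule integrable_const_bound[where B=1]) auto
        then show ?thesis unfolding meas
          by (intro integral_mono[OF int]) (auto simp: f01 f_out \<mu>(3) indicator_def)
      qed
      have "(\<lambda>j. \<integral>p. f j p \<partial>\<mu>) \<longlonglongrightarrow> (\<integral>p. indicat_real (G \<inter> HSp) p \<partial>\<mu>)"
      proof (rule integral_dominated_convergence[where w="\<lambda>_. 1"])
        show "AE p in \<mu>. (\<lambda>j. f j p) \<longlonglongrightarrow> indicat_real (G \<inter> HSp) p"
        proof (rule AE_I2)
          fix p assume "p \<in> space \<mu>"
          then show "(\<lambda>j. f j p) \<longlonglongrightarrow> indicat_real (G \<inter> HSp) p"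
            using lim[of p] \<mu>(3) by (simp add: indicator_def)
        qed
      qed (use f01 in auto)
      then have "q < measure \<mu> (G \<inter> HSp) \<Longrightarrow> \<exists>j. q < (\<integral>p. f j p \<partial>\<mu>)"
        unfolding meas by (metis order_tendstoD(1) eventually_sequentially order_refl)
      then show ?thesis using True up by (auto intro: less_le_trans)
    qed auto
  qed
  moreover have "openin (Pb_top M) {\<mu>\<in>Pb M. (\<integral>p. f j p \<partial>\<mu>) \<in> {q<..}}" for j
    unfolding Pb_top_def
  proof (rule topology_generated_by_Basis, rule CollectI, intro exI conjI)
    show "bounded (f j ` HSp)" using f01 by (auto simp: bounded_iff intro!: exI[of _ 1])
  qed (use cont in auto)
  ultimately show ?thesis by auto
qed

section \<open>A countable family of test sets\<close>

definition basisX :: "'x set set" where "basisX = (SOME B. countable B \<and> topological_basis B)"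
definition basisH :: "('y \<times> real) set set" where "basisH = (SOME B. countable B \<and> topological_basis B)"
definition basisR :: "real set set" where "basisR = (SOME B. countable B \<and> topological_basis B)"

lemma basisX: "countable basisX" "topological_basis basisX"
  and basisH: "countable basisH" "topological_basis basisH"
  and basisR: "countable basisR" "topological_basis basisR"
  using someI_ex[of "\<lambda>B. countable B \<and> topological_basis (B :: 'x set set)"]
    someI_ex[of "\<lambda>B. countable B \<and> topological_basis (B :: ('y \<times> real) set set)"]
    someI_ex[of "\<lambda>B. countable B \<and> topological_basis (B :: real set set)"] ex_countable_basis
  unfolding basisX_def basisH_def basisR_def by metis+

text \<open>Finite unions of basic sets: they exhaust an open set increasingly, so that their masses
  approximate its mass from below, which single basic sets do not achieve.\<close>

definition opensH where "opensH = Union ` {F. finite F \<and> F \<subseteq> basisH}"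

lemma opensH: "countable opensH" "G \<in> opensH \<Longrightarrow> open G"
proof -
  show "countable opensH"
    unfolding opensH_def using countable_Collect_finite_subset[OF basisH(1)] by simp
  show "G \<in> opensH \<Longrightarrow> open G"
    using topological_basis_open[OF basisH(2)] unfolding opensH_def by blast
qed

lemma opensH_exhaust:
  assumes "open G" "\<mu> \<in> space SP"
  shows "emeasure \<mu> (G \<inter> HSp) = (SUP C\<in>{C\<in>opensH. C \<subseteq> G}. emeasure \<mu> (C \<inter> HSp))" (is "_ = ?S")
proof (rule antisym)
  note \<mu> = SP_D[OF assms(2)]
  have m: "open C \<Longrightarrow> C \<inter> HSp \<in> sets \<mu>" for C using HS_open \<mu> by simp
  show "?S \<le> emeasure \<mu> (G \<inter> HSp)"
    using m[OF assms(1)] by (intro SUP_least emeasure_mono) auto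
  define B where "B = {b\<in>basisH. b \<subseteq> G}"
  have "countable B" using basisH(1) by (auto simp: B_def)
  have G: "\<Union>B = G"
    using topological_basisE[OF basisH(2) assms(1)] unfolding B_def by blast
  show "emeasure \<mu> (G \<inter> HSp) \<le> ?S"
  proof (cases "B = {}")
    case True
    then show ?thesis using G by auto
  next
    case False
    define C where "C k = (\<Union>i\<le>k. from_nat_into B i)" for k :: nat
    have CB: "C k \<in> {C\<in>opensH. C \<subseteq> G}" for k
    proof -
      have "from_nat_into B ` {..k} \<subseteq> B" using from_nat_into[OF False] by auto
      then have "finite (from_nat_into B ` {..k})" "from_nat_into B ` {..k} \<subseteq> basisH" by (auto simp: B_def)
      then show ?thesis using G \<open>from_nat_into B ` {..k} \<subseteq> B\<close> unfolding C_def opensH_def by blast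
    qed
    have "(\<Union>k. C k) = G"
      using G range_from_nat_into[OF False \<open>countable B\<close>] unfolding C_def by blast
    then have "emeasure \<mu> (G \<inter> HSp) = emeasure \<mu> (\<Union>k. C k \<inter> HSp)" by (simp only: UN_simps)
    also have "\<dots> = (SUP k. emeasure \<mu> (C k \<inter> HSp))"
    proof (rule SUP_emeasure_incseq[symmetric])
      show "range (\<lambda>k. C k \<inter> HSp) \<subseteq> sets \<mu>" using CB opensH(2) m by blast
      show "incseq (\<lambda>k. C k \<inter> HSp)"
        unfolding incseq_def C_def by (intro allI impI Int_mono UN_mono) auto
    qed
    also have "\<dots> \<le> ?S" using CB by (intro SUP_least SUP_upper)
    finally show ?thesis .
  qed
qed

text \<open>The mass of an open set is approximated from inside by members of \<open>opensH\<close>,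
  and a rational fits between any level and the mass; hence countably many conditions decide weak
  convergence.\<close>

lemma wconvI:
  assumes \<mu>s: "\<And>n. \<mu>s n \<in> Pb M" "\<mu> \<in> Pb M"
    and ev: "\<And>G q::rat. G \<in> opensH \<Longrightarrow> of_rat q < measure \<mu> (G \<inter> HSp) \<Longrightarrow>
       eventually (\<lambda>n. of_rat q < measure (\<mu>s n) (G \<inter> HSp)) sequentially"
  shows "wconv \<mu>s \<mu>"
  unfolding wconv_def
proof (intro allI impI)
  have em: "emeasure \<nu> A = ennreal (measure \<nu> A)" if "\<nu> \<in> Pb M" for \<nu> A
  proof -
    interpret prob_space \<nu> by (rule Pb_D(1)[OF that])
    show ?thesis by (rule emeasure_eq_measure)
  qed
  fix G :: "('y \<times> real) set" assume G: "open G"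
  show "emeasure \<mu> (G \<inter> HSp) \<le> liminf (\<lambda>n. emeasure (\<mu>s n) (G \<inter> HSp))"
    unfolding le_Liminf_iff
  proof (intro allI impI)
    fix t assume "t < emeasure \<mu> (G \<inter> HSp)"
    then obtain C where C: "C \<in> opensH" "C \<subseteq> G" "t < emeasure \<mu> (C \<inter> HSp)"
      unfolding opensH_exhaust[OF G Pb_D(4)[OF \<mu>s(2)]] less_SUP_iff by auto
    then have "t < ennreal (measure \<mu> (C \<inter> HSp))" using em[OF \<mu>s(2)] by simp
    then obtain s where s: "t = ennreal s" "0 \<le> s" "s < measure \<mu> (C \<inter> HSp)"
      by (cases t) (auto simp: ennreal_less_iff top_unique)
    then obtain q where q: "s < of_rat q" "of_rat q < measure \<mu> (C \<inter> HSp)" using of_rat_dense by blast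
    from ev[OF C(1) q(2)]
    show "eventually (\<lambda>n. t < emeasure (\<mu>s n) (G \<inter> HSp)) sequentially"
    proof eventually_elim
      case (elim n)
      have "t < ennreal (measure (\<mu>s n) (C \<inter> HSp))"
        using s q elim by (auto simp: ennreal_less_iff)
      also have "\<dots> \<le> emeasure (\<mu>s n) (G \<inter> HSp)"
        unfolding em[OF \<mu>s(1), symmetric]
        using C(2) HS_open[OF G] Pb_D(2)[OF \<mu>s(1)] by (intro emeasure_mono) auto
      finally show ?case .
    qed
  qed
qed

section \<open>The topology of the extended state space through sequences\<close>

definition econv where
  "econv es e \<longleftrightarrow> (\<lambda>n::nat. fst (es n)) \<longlonglongrightarrow> fst e \<and> wconv (\<lambda>n. fst (snd (es n))) (fst (snd e)) \<and>
     (\<lambda>n. snd (snd (es n))) \<longlonglongrightarrow> (snd (snd e) :: real)"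

definition seq_open where
  "seq_open W \<longleftrightarrow> W \<subseteq> E_set M \<and> (\<forall>es e. (\<forall>n. es n \<in> E_set M - W) \<longrightarrow> e \<in> E_set M \<longrightarrow> econv es e \<longrightarrow> e \<notin> W)"

text \<open>Beliefs are constrained only by lower bounds on masses of open sets, in accordance with
  \<open>wconv\<close>; rational levels keep the family countable.\<close>

definition box where
  "box A G q I = (A \<inter> XX) \<times> {\<mu>\<in>Pb M. real_of_rat q < measure \<mu> (G \<inter> HSp)} \<times> (I \<inter> {0<..1})"

definition boxes where
  "boxes = {box A G q I | A G q I. A \<in> basisX \<and> G \<in> opensH \<and> I \<in> basisR}"

definition fboxes where
  "fboxes = (\<lambda>F. E_set M \<inter> \<Inter>F) ` {F. finite F \<and> F \<subseteq> boxes}"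

lemma countable_boxes: "countable boxes"
proof -
  have "boxes = (\<lambda>(A, G, q, I). box A G q I) ` (basisX \<times> opensH \<times> UNIV \<times> basisR)"
    unfolding boxes_def by force
  then show ?thesis using basisX basisR opensH by simp
qed

lemma countable_fboxes: "countable fboxes"
  unfolding fboxes_def using countable_Collect_finite_subset[OF countable_boxes] by simp

text \<open>The countably many boxes containing a point give a decreasing sequence of
  neighbourhoods. If none lay inside \<open>W\<close>, points chosen outside \<open>W\<close> would
  satisfy every box condition eventually, hence converge to the point, against sequential
  openness.\<close>

lemma seq_open_fboxes:
  assumes "seq_open W"
  shows "W = \<Union>{V\<in>fboxes. V \<subseteq> W}"
proof (intro antisym subsetI)
  fix e assume e: "e \<in> W"
  then have eE: "e \<in> E_set M" using assms by (auto simp: seq_open_def)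
  obtain x \<mu> z where exz: "e = (x, \<mu>, z)" by (cases e)
  have xz: "x \<in> XX" "\<mu> \<in> Pb M" "0 < z" "z \<le> 1" using eE exz by (auto simp: E_set_def)
  define K where "K = {b\<in>boxes. e \<in> b}"
  have boxI: "box A G q I \<in> K" if "A \<in> basisX" "G \<in> opensH" "I \<in> basisR" "x \<in> A" "real_of_rat q < measure \<mu> (G \<inter> HSp)" "z \<in> I" for A G q I
    using that xz exz by (auto simp: K_def boxes_def box_def)
  have "countable K" using countable_boxes by (auto simp: K_def)
  obtain A0 where A0: "A0 \<in> basisX" "x \<in> A0" using topological_basisE[OF basisX(2) open_UNIV] by auto
  obtain I0 where I0: "I0 \<in> basisR" "z \<in> I0" using topological_basisE[OF basisR(2) open_UNIV] by auto
  have G0: "{} \<in> opensH" unfolding opensH_def by (rule image_eqI[of _ _ "{}"]) auto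
  \<comment> \<open>The empty open set with level -1 puts no condition on the belief; such boxes
    test the other two components alone.\<close>
  have "box A0 {} (- 1) I0 \<in> K" by (rule boxI) (use A0 I0 G0 in auto)
  then have "K \<noteq> {}" by auto
  define N where "N k = E_set M \<inter> (\<Inter>i\<le>k. from_nat_into K i)" for k :: nat
  have NK: "from_nat_into K i \<in> K" for i using from_nat_into[OF \<open>K \<noteq> {}\<close>] .
  have Nf: "N k \<in> fboxes" for k
    unfolding N_def fboxes_def using NK by (intro image_eqI[of _ _ "from_nat_into K ` {..k}"]) (auto simp: K_def)
  have eN: "e \<in> N k" for k using NK eE by (auto simp: N_def K_def)
  have "\<exists>k. N k \<subseteq> W"
  proof (rule ccontr)
    assume "\<nexists>k. N k \<subseteq> W"
    then have "\<forall>k. \<exists>e'. e' \<in> N k \<and> e' \<notin> W" by blast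
    then obtain es where es: "\<And>k. es k \<in> N k" "\<And>k. es k \<notin> W" by metis
    have esE: "es k \<in> E_set M" for k using es(1)[of k] by (auto simp: N_def)
    have ev: "eventually (\<lambda>k. es k \<in> b) sequentially" if b: "b \<in> K" for b
    proof -
      obtain i where "from_nat_into K i = b" using b \<open>countable K\<close> from_nat_into_surj by metis
      then have "es k \<in> b" if "k \<ge> i" for k using es(1)[of k] that by (auto simp: N_def)
      then show ?thesis by (auto simp: eventually_sequentially)
    qed
    have "econv es e"
      unfolding econv_def
    proof (intro conjI)
      show "(\<lambda>n. fst (es n)) \<longlonglongrightarrow> fst e"
      proof (rule topological_tendstoI)
        fix S assume "open S" "fst e \<in> S"
        then obtain A where A: "A \<in> basisX" "x \<in> A" "A \<subseteq> S" using topological_basisE[OF basisX(2)] exz by (metis fst_conv)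
        have "box A {} (-1) I0 \<in> K" by (rule boxI) (use A I0 G0 in auto)
        from ev[OF this] show "eventually (\<lambda>n. fst (es n) \<in> S) sequentially"
          by eventually_elim (use A in \<open>auto simp: box_def\<close>)
      qed
      show "(\<lambda>n. snd (snd (es n))) \<longlonglongrightarrow> snd (snd e)"
      proof (rule topological_tendstoI)
        fix S assume "open S" "snd (snd e) \<in> S"
        then obtain I where I: "I \<in> basisR" "z \<in> I" "I \<subseteq> S" using topological_basisE[OF basisR(2)] exz by (metis snd_conv)
        have "box A0 {} (-1) I \<in> K" by (rule boxI) (use A0 I G0 in auto)
        from ev[OF this] show "eventually (\<lambda>n. snd (snd (es n)) \<in> S) sequentially"
          by eventually_elim (use I in \<open>auto simp: box_def\<close>)
      qed
      show "wconv (\<lambda>n. fst (snd (es n))) (fst (snd e))"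
      proof (rule wconvI)
        show "fst (snd (es n)) \<in> Pb M" for n using esE[of n] by (auto simp: E_set_def)
        show "fst (snd e) \<in> Pb M" using xz exz by simp
        fix G q assume "G \<in> opensH" "real_of_rat q < measure (fst (snd e)) (G \<inter> HSp)"
        then have "box A0 G q I0 \<in> K" using A0 I0 exz by (intro boxI) auto
        from ev[OF this] show "eventually (\<lambda>n. of_rat q < measure (fst (snd (es n))) (G \<inter> HSp)) sequentially"
          by eventually_elim (auto simp: box_def)
      qed
    qed
    with assms eE esE es(2) have "e \<notin> W" unfolding seq_open_def by blast
    with e show False by simp
  qed
  then show "e \<in> \<Union>{V\<in>fboxes. V \<subseteq> W}" using Nf eN by blast
qed auto

lemma openin_box: "A \<in> basisX \<Longrightarrow> G \<in> opensH \<Longrightarrow> I \<in> basisR \<Longrightarrow> openin (E_top M) (box A G q I)"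
  unfolding box_def E_top_def
  by (intro openin_prod_Times_iff[THEN iffD2] disjI2 conjI openin_Pb_top_gt opensH)
     (auto simp: openin_open Int_commute intro: topological_basis_open[OF basisX(2)] topological_basis_open[OF basisR(2)])

lemma openin_fbox:
  assumes "V \<in> fboxes" shows "openin (E_top M) V"
proof -
  obtain F where F: "V = E_set M \<inter> \<Inter>F" "finite F" "F \<subseteq> boxes" using assms by (auto simp: fboxes_def)
  have b: "openin (E_top M) b" if "b \<in> boxes" for b using that openin_box by (auto simp: boxes_def)
  have "V = topspace (E_top M) \<inter> \<Inter>F" using F by simp
  also have "openin (E_top M) \<dots>"
  proof (cases "F = {}")
    case False
    have "openin (E_top M) (\<Inter>F)" using F b False by (intro openin_Inter) auto
    then show ?thesis by (rule openin_Int[OF openin_topspace])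
  next
    case True then show ?thesis by (simp del: topspace_E_top)
  qed
  finally show ?thesis .
qed

lemma openin_E_topD:
  assumes W: "openin (E_top M) W" "e \<in> W" "\<And>n. es n \<in> E_set M" "econv es e"
  shows "eventually (\<lambda>n. es n \<in> W) sequentially"
proof -
  obtain x \<mu> z where exz: "e = (x, \<mu>, z)" by (cases e)
  obtain A B where AB: "openin (top_of_set XX) A" "openin (prod_topology (Pb_top M) (top_of_set {0<..1})) B"
    "x \<in> A" "(\<mu>, z) \<in> B" "A \<times> B \<subseteq> W"
    using openin_prod_topology_alt[THEN iffD1, rule_format, OF W(1)[unfolded E_top_def] W(2)[unfolded exz]]
    by (elim exE conjE)
  obtain P I where PI: "openin (Pb_top M) P" "openin (top_of_set {0<..1}) I" "\<mu> \<in> P" "z \<in> I" "P \<times> I \<subseteq> B"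
    using openin_prod_topology_alt[THEN iffD1, rule_format, OF AB(2,4)] by (elim exE conjE)
  obtain A' where A': "open A'" "A = XX \<inter> A'" using AB(1) by (auto simp: openin_open)
  obtain I' where I': "open I'" "I = {0<..1} \<inter> I'" using PI(2) by (auto simp: openin_open)
  have E: "fst (es n) \<in> XX" "fst (snd (es n)) \<in> Pb M" "snd (snd (es n)) \<in> {0<..1}" for n
    using W(3)[of n] by (auto simp: E_set_def)
  have "eventually (\<lambda>n. fst (es n) \<in> A') sequentially"
    using W(4) A' AB(3) exz by (auto simp: econv_def intro: topological_tendstoD)
  moreover have "eventually (\<lambda>n. snd (snd (es n)) \<in> I') sequentially"
    using W(4) I' PI(4) exz by (auto simp: econv_def intro: topological_tendstoD)
  moreover have "eventually (\<lambda>n. fst (snd (es n)) \<in> P) sequentially"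
    using W(4) PI(3) exz E by (intro Pb_top_openD[OF PI(1)]) (auto simp: econv_def)
  ultimately show ?thesis
  proof eventually_elim
    case (elim n)
    then have "(fst (es n), fst (snd (es n)), snd (snd (es n))) \<in> A \<times> P \<times> I" using A' I' E by blast
    moreover have "A \<times> P \<times> I \<subseteq> W" using AB(5) PI(5) by blast
    ultimately have "(fst (es n), fst (snd (es n)), snd (snd (es n))) \<in> W" by blast
    then show ?case by simp
  qed
qed

text \<open>The boxes take the place of a metric on beliefs: with a countable base of finite box
  intersections, open sets are exactly the sequentially open ones, and all topological questions
  below become questions about sequences.\<close>

lemma openin_E_top_iff: "openin (E_top M) W \<longleftrightarrow> seq_open W"
proof
  assume W: "openin (E_top M) W"
  show "seq_open W"
    unfolding seq_open_def
  proof (intro conjI allI impI notI)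
    show "W \<subseteq> E_set M" using openin_subset[OF W] by simp
    fix es e assume "\<forall>n. es n \<in> E_set M - W" "econv es e" "e \<in> W"
    then show False using openin_E_topD[OF W, of e es] by (auto simp: eventually_sequentially)
  qed
next
  assume "seq_open W"
  then have "W = \<Union>{V\<in>fboxes. V \<subseteq> W}" by (rule seq_open_fboxes)
  also have "openin (E_top M) \<dots>" using openin_fbox by (intro openin_Union) auto
  finally show "openin (E_top M) W" .
qed

section \<open>Borel sets and semicontinuity on the extended state space\<close>

lemma E_borel_space[simp]: "space (E_borel M) = E_set M"
  unfolding E_borel_def using openin_subset[of "E_top M"] by (intro space_measure_of) auto

lemma E_borel_sets: "sets (E_borel M) = sigma_sets (E_set M) {G. openin (E_top M) G}"
  unfolding E_borel_def using openin_subset[of "E_top M"] by (intro sets_measure_of) auto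

lemma seq_open_E_borel: "seq_open W \<Longrightarrow> W \<in> sets (E_borel M)"
  unfolding E_borel_sets openin_E_top_iff[symmetric] by auto

text \<open>Connects the evaluation sigma-algebra of \<open>SP\<close> with the Borel sets of the
  weak topology. Every open set is a countable union of finite box intersections, and membership in
  a box only involves the mass of one open set.\<close>

lemma measurable_E_borel:
  assumes x[measurable]: "f1 \<in> N \<rightarrow>\<^sub>M obs_borel M" and \<mu>[measurable]: "f2 \<in> N \<rightarrow>\<^sub>M SP" and z[measurable]: "f3 \<in> N \<rightarrow>\<^sub>M borel"
    and sp: "\<And>w. w \<in> space N \<Longrightarrow> (f1 w, f2 w, f3 w) \<in> E_set M"
  shows "(\<lambda>w. (f1 w, f2 w, f3 w)) \<in> N \<rightarrow>\<^sub>M E_borel M"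
  unfolding E_borel_def
proof (rule measurable_measure_of)
  show "{G. openin (E_top M) G} \<subseteq> Pow (E_set M)" using openin_subset[of "E_top M"] by auto
  show "(\<lambda>w. (f1 w, f2 w, f3 w)) \<in> space N \<rightarrow> E_set M" using sp by auto
  have x'[measurable]: "f1 \<in> N \<rightarrow>\<^sub>M borel" by (rule obs_borelD[OF x])
  have box: "{w\<in>space N. (f1 w, f2 w, f3 w) \<in> b} \<in> sets N" if bb: "b \<in> boxes" for b
  proof -
    obtain A G q I where b: "b = box A G q I" "A \<in> basisX" "G \<in> opensH" "I \<in> basisR"
      using bb unfolding boxes_def by blast
    have [measurable]: "A \<in> sets borel" "I \<in> sets borel"
      using b topological_basis_open[OF basisX(2)] topological_basis_open[OF basisR(2)] by auto
    have [measurable]: "(\<lambda>w. measure (f2 w) (G \<inter> HSp)) \<in> borel_measurable N"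
      using measurable_compose[OF \<mu>[unfolded SP_def] measurable_measure_subprob_algebra[OF HS_open[OF opensH(2)[OF b(3)]]]] .
    have "{w\<in>space N. (f1 w, f2 w, f3 w) \<in> b} = {w\<in>space N. f1 w \<in> A \<and> real_of_rat q < measure (f2 w) (G \<inter> HSp) \<and> f3 w \<in> I}"
      using sp by (auto simp: b box_def E_set_def)
    also have "\<dots> \<in> sets N" by measurable
    finally show ?thesis .
  qed
  have fb: "{w\<in>space N. (f1 w, f2 w, f3 w) \<in> V} \<in> sets N" if V: "V \<in> fboxes" for V
  proof -
    obtain F where F: "V = E_set M \<inter> \<Inter>F" "finite F" "F \<subseteq> boxes" using V by (auto simp: fboxes_def)
    have "{w\<in>space N. (f1 w, f2 w, f3 w) \<in> V} = {w\<in>space N. \<forall>b\<in>F. (f1 w, f2 w, f3 w) \<in> b}"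
      using sp F by auto
    also have "\<dots> \<in> sets N" using F box by (intro sets.sets_Collect_finite_All) auto
    finally show ?thesis .
  qed
  fix W assume "W \<in> {G. openin (E_top M) G}"
  then have "W = \<Union>{V\<in>fboxes. V \<subseteq> W}" by (intro seq_open_fboxes) (simp add: openin_E_top_iff)
  then have "(\<lambda>w. (f1 w, f2 w, f3 w)) -` W \<inter> space N = (\<Union>V\<in>{V\<in>fboxes. V \<subseteq> W}. {w\<in>space N. (f1 w, f2 w, f3 w) \<in> V})"
    by blast
  also have "\<dots> \<in> sets N"
    using countable_fboxes fb by (intro sets.countable_UN') auto
  finally show "(\<lambda>w. (f1 w, f2 w, f3 w)) -` W \<inter> space N \<in> sets N" .
qed

text \<open>Sequential closedness of sublevel sets. Keeping the level \<open>r\<close> fixed along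
  the sequence spares the later proofs limits inferior of real sequences.\<close>

lemma lower_semicont_iff:
  "lower_semicont (E_top M) v \<longleftrightarrow>
    (\<forall>es e r. (\<forall>n. es n \<in> E_set M) \<longrightarrow> e \<in> E_set M \<longrightarrow> econv es e \<longrightarrow> (\<forall>n. v (es n) \<le> r) \<longrightarrow> v e \<le> r)"
  unfolding lower_semicont_def openin_E_top_iff seq_open_def topspace_E_top
  by (auto simp: not_less) (meson not_less)+

lemma lower_semicont_ev:
  assumes "lower_semicont (E_top M) v" "\<And>n. es n \<in> E_set M" "e \<in> E_set M" "econv es e" "r < v e"
  shows "eventually (\<lambda>n. r < v (es n)) sequentially"
  using openin_E_topD[of "{e\<in>E_set M. r < v e}" e es] assms unfolding lower_semicont_def by auto

lemma lower_semicont_measurable: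
  assumes "lower_semicont (E_top M) v"
  shows "v \<in> borel_measurable (E_borel M)"
proof (rule borel_measurable_iff_greater[THEN iffD2], rule allI)
  fix r
  show "{w\<in>space (E_borel M). r < v w} \<in> sets (E_borel M)"
    using assms unfolding lower_semicont_def E_borel_sets by auto
qed

end

section \<open>Continuity of the update\<close>

text \<open>A positive finite limit \<open>a\<close> permits dividing a level by \<open>a\<close>,
  so the argument never meets the product of 0 and \<infinity>.\<close>

lemma liminf_mult_ennreal:
  fixes a w :: ennreal
  assumes a: "as \<longlonglongrightarrow> a" "0 < a" "a < \<infinity>" and w: "w \<le> liminf bs"
  shows "a * w \<le> liminf (\<lambda>n. as n * bs n)"
  unfolding le_Liminf_iff
proof (intro allI impI)
  fix t assume "t < a * w"
  then have "t / a < w" using a by (subst divide_less_ennreal) (auto simp: mult.commute)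
  then obtain s where s: "t / a < s" "s < w" using dense by blast
  then have ts: "t < a * s" using a by (subst (asm) divide_less_ennreal) (auto simp: mult.commute)
  have "s < \<infinity>" using s by (auto simp: less_top[symmetric])
  then have "(\<lambda>n. as n * s) \<longlonglongrightarrow> a * s"
    using a by (intro tendsto_mult_ennreal) auto
  then have "eventually (\<lambda>n. t < as n * s) sequentially" using ts by (rule order_tendstoD)
  moreover have "eventually (\<lambda>n. s < bs n) sequentially"
    using s w by (intro less_LiminfD) (rule less_le_trans)
  ultimately show "eventually (\<lambda>n. t < as n * bs n) sequentially"
  proof eventually_elim
    case (elim n)
    then show ?case by (meson less_imp_le less_le_trans mult_left_mono zero_le)
  qed
qed

text \<open>A Fatou-type bound together with conservation of mass forces \<open>L\<^sup>1\<close>-convergence.\<close>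

lemma AE_convergent_subseq_of_liminf:
  fixes f :: "'b \<Rightarrow> ennreal"
  assumes [measurable]: "f \<in> borel_measurable N" "\<And>n. fs n \<in> borel_measurable N"
    and one: "(\<integral>\<^sup>+x. f x \<partial>N) = 1" "\<And>n. (\<integral>\<^sup>+x. fs n x \<partial>N) = 1"
    and le: "\<And>x. x \<in> space N \<Longrightarrow> f x \<le> liminf (\<lambda>n. fs n x)"
  shows "\<exists>r::nat\<Rightarrow>nat. strict_mono r \<and> (AE x in N. (\<lambda>n. fs (r n) x) \<longlonglongrightarrow> f x)"
proof -
  define F where "F x = enn2real (f x)" for x
  define Fs where "Fs n x = enn2real (fs n x)" for n x
  have [measurable]: "F \<in> borel_measurable N" "\<And>n. Fs n \<in> borel_measurable N"
    unfolding F_def[abs_def] Fs_def[abs_def] by measurable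
  have fin: "AE x in N. f x = ennreal (F x)"
  proof -
    have "AE x in N. f x \<noteq> \<infinity>" by (rule nn_integral_PInf_AE) (auto simp: one)
    then show ?thesis by eventually_elim (auto simp: F_def less_top)
  qed
  have fins: "AE x in N. \<forall>n. fs n x = ennreal (Fs n x)"
  proof -
    have "AE x in N. \<forall>n. fs n x \<noteq> \<infinity>" unfolding AE_all_countable
      by (intro allI nn_integral_PInf_AE) (auto simp: one)
    then show ?thesis by eventually_elim (auto simp: Fs_def less_top)
  qed
  have pos: "0 \<le> F x" "0 \<le> Fs n x" for n x by (auto simp: F_def Fs_def)
  have nF: "(\<integral>\<^sup>+x. ennreal (F x) \<partial>N) = 1" using nn_integral_cong_AE[OF fin] one by simp
  have nFs: "(\<integral>\<^sup>+x. ennreal (Fs n x) \<partial>N) = 1" for n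
  proof -
    have "AE x in N. fs n x = ennreal (Fs n x)" using fins by eventually_elim simp
    from nn_integral_cong_AE[OF this] one show ?thesis by simp
  qed
  have iF: "integrable N F" and iFs: "integrable N (Fs n)" for n
    using nF nFs pos by (auto intro!: integrableI_nonneg)
  have IF: "(\<integral>x. F x \<partial>N) = 1" and IFs: "(\<integral>x. Fs n x \<partial>N) = 1" for n
    using nF nFs pos by (simp_all add: integral_eq_nn_integral)
  \<comment> \<open>Scheffe's argument. The minimum is dominated by \<open>F\<close> and converges
    to it, so its integral tends to 1; since \<open>\<bar>u - v\<bar> = u + v - 2 * min u v\<close>
    and all masses are 1, the distance in mean tends to 0.\<close>
  have minlim: "AE x in N. (\<lambda>n. min (Fs n x) (F x)) \<longlonglongrightarrow> F x"
    using fin fins AE_space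
  proof eventually_elim
    case (elim x)
    show ?case
    proof (rule order_tendstoI)
      fix t assume t: "t < F x"
      show "eventually (\<lambda>n. t < min (Fs n x) (F x)) sequentially"
      proof (cases "t < 0")
        case True
        then show ?thesis using t pos by (intro always_eventually) (auto intro: less_le_trans)
      next
        case False
        then have "ennreal t < f x" using t elim by (simp add: ennreal_less_iff)
        then have "eventually (\<lambda>n. ennreal t < fs n x) sequentially"
          using le[of x] elim by (intro less_LiminfD) (auto intro: less_le_trans)
        then show ?thesis
          by eventually_elim (use elim False t in \<open>auto simp: ennreal_less_iff\<close>)
      qed
    next
      fix t assume "F x < t"
      then show "eventually (\<lambda>n. min (Fs n x) (F x) < t) sequentially"
        by (intro always_eventually) (auto simp: min_less_iff_disj)
    qed
  qed
  have imin: "integrable N (\<lambda>x. min (Fs n x) (F x))" for n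
    using iF by (rule Bochner_Integration.integrable_bound) (auto simp: pos)
  have "(\<lambda>n. \<integral>x. min (Fs n x) (F x) \<partial>N) \<longlonglongrightarrow> (\<integral>x. F x \<partial>N)"
    by (rule integral_dominated_convergence[where w=F]) (use iF minlim pos in auto)
  then have lim: "(\<lambda>n. 2 - 2 * (\<integral>x. min (Fs n x) (F x) \<partial>N)) \<longlonglongrightarrow> 2 - 2 * 1"
    unfolding IF by (intro tendsto_intros)
  have "(\<integral>x. norm (Fs n x - F x) \<partial>N) = 2 - 2 * (\<integral>x. min (Fs n x) (F x) \<partial>N)" for n
  proof -
    have "(\<integral>x. norm (Fs n x - F x) \<partial>N) = (\<integral>x. Fs n x + F x - 2 * min (Fs n x) (F x) \<partial>N)"
      by (intro Bochner_Integration.integral_cong) (auto simp: min_def)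
    also have "\<dots> = 2 - 2 * (\<integral>x. min (Fs n x) (F x) \<partial>N)"
      using iF iFs imin by (simp add: IF IFs)
    finally show ?thesis .
  qed
  with lim have "(\<lambda>n. \<integral>x. norm (Fs n x - F x) \<partial>N) \<longlonglongrightarrow> 0" by simp
  then obtain r :: "nat \<Rightarrow> nat" where r: "strict_mono r" "AE x in N. (\<lambda>n. Fs (r n) x - F x) \<longlonglongrightarrow> 0"
    using tendsto_L1_AE_subseq[of N "\<lambda>n x. Fs n x - F x"] iF iFs by auto
  have "AE x in N. (\<lambda>n. fs (r n) x) \<longlonglongrightarrow> f x"
    using r(2) fin fins
  proof eventually_elim
    case (elim x)
    then have "(\<lambda>n. Fs (r n) x) \<longlonglongrightarrow> F x" by (simp add: LIM_zero_iff)
    then have "(\<lambda>n. ennreal (Fs (r n) x)) \<longlonglongrightarrow> ennreal (F x)" by (rule tendsto_ennrealI)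
    then show ?case using elim by simp
  qed
  with r(1) show ?thesis by blast
qed

context pomdp_standing
begin

section \<open>Agreement of \<open>upd\<close> with the operator of the model\<close>

lemma acts_iff: "a \<in> acts M x \<longleftrightarrow> (x, a) \<in> adm M" by (simp add: acts_def)

lemma mixX_eq:
  assumes adm: "(x, a) \<in> adm M" and x': "x' \<in> XX" and \<mu>: "\<mu> \<in> space SP"
  shows "mixX M x' x (margY M \<mu>) a = mx x a x' \<mu>"
proof -
  have [measurable]: "(\<lambda>y. \<integral>\<^sup>+y'. ennreal (qe x' y' x y a) \<partial>nu) \<in> borel_measurable (hid_borel M)"
    by measurable
  have [measurable]: "fst \<in> \<mu> \<rightarrow>\<^sub>M hid_borel M"
    using Rplus_fst_snd(3) measurable_cong_sets[OF SP_D(2)[OF \<mu>] refl] by blast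
  have "densX M x' x y a = (\<integral>\<^sup>+y'. ennreal (qe x' y' x y a) \<partial>nu)" if "y \<in> YY" for y
    unfolding densX_def using that adm x' by (intro nn_integral_cong) (simp add: qe_dens)
  then have "mixX M x' x (margY M \<mu>) a = (\<integral>\<^sup>+y. (\<integral>\<^sup>+y'. ennreal (qe x' y' x y a) \<partial>nu) \<partial>distr \<mu> (hid_borel M) fst)"
    unfolding mixX_def margY_def by (intro nn_integral_cong) simp
  also have "\<dots> = mx x a x' \<mu>" unfolding mx_def by (rule nn_integral_distr) measurable
  finally show ?thesis .
qed

text \<open>\<open>Psi\<close> is \<open>measure_of\<close> applied to a formula, which defines
  masses of sets only once the formula is known to be a measure; recognising it as the mass under
  \<open>upd\<close> settles this. On the points considered the extended density and cost agree with
  the given ones.\<close>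

lemma Psi_eq:
  assumes adm: "(x, a) \<in> adm M" and x': "x' \<in> XX" and \<mu>: "\<mu> \<in> space SP" and z: "0 \<le> z"
  shows "Psi M x a x' \<mu> z = upd x a x' \<mu> z"
proof -
  have "Psi M x a x' \<mu> z = measure_of (space HS) (sets HS) (emeasure (upd x a x' \<mu> z))"
    unfolding Psi_def
  proof (rule measure_of_eq)
    show "sets HS \<subseteq> Pow (space HS)" by (rule sets.space_closed)
    fix B assume "B \<in> sigma_sets (space HS) (sets HS)"
    then have B[measurable]: "B \<in> sets HS" by (simp only: sets.sigma_sets_eq)
    have inner: "(\<integral>\<^sup>+(y', s'). ennreal (dens M x' y' x (fst p) a) * indicator B (y', s')
        \<partial>(nu \<Otimes>\<^sub>M return Rplus (snd p + z * cost M x (fst p) a))) =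
      (\<integral>\<^sup>+y'. ennreal (qe x' y' x (fst p) a) * indicator B (y', snd p + z * ce x (fst p) a) \<partial>nu)"
      if p: "p \<in> HSp" for p
    proof -
      have c: "cost M x (fst p) a = ce x (fst p) a" using p adm by (auto simp: ce_def cost_dom_def)
      let ?t = "snd p + z * ce x (fst p) a"
      have t: "?t \<in> space Rplus" using p z ce_bounds(3)[THEN less_imp_le] by auto
      interpret R: prob_space "return Rplus ?t" by (rule prob_space_return[OF t])
      have m[measurable]: "(\<lambda>w. ennreal (qe x' (fst w) x (fst p) a) * indicator B w) \<in> borel_measurable (nu \<Otimes>\<^sub>M return Rplus ?t)"
      proof -
        have [measurable]: "fst \<in> nu \<Otimes>\<^sub>M return Rplus ?t \<rightarrow>\<^sub>M borel" by (rule hid_proj) measurable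
        have "B \<in> sets (nu \<Otimes>\<^sub>M return Rplus ?t)"
          using B sets_pair_measure_cong[OF sets_nu sets_return[of Rplus ?t]] by (simp add: hs_borel_def)
        then show ?thesis by measurable
      qed
      have "(\<integral>\<^sup>+(y', s'). ennreal (dens M x' y' x (fst p) a) * indicator B (y', s') \<partial>(nu \<Otimes>\<^sub>M return Rplus ?t))
        = (\<integral>\<^sup>+w. ennreal (qe x' (fst w) x (fst p) a) * indicator B w \<partial>(nu \<Otimes>\<^sub>M return Rplus ?t))"
        using p adm x' by (intro nn_integral_cong) (auto simp: space_pair_measure qe_dens)
      also have "\<dots> = (\<integral>\<^sup>+y'. (\<integral>\<^sup>+s'. ennreal (qe x' y' x (fst p) a) * indicator B (y', s') \<partial>return Rplus ?t) \<partial>nu)"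
        using R.nn_integral_fst[OF m] by simp
      also have "\<dots> = (\<integral>\<^sup>+y'. ennreal (qe x' y' x (fst p) a) * indicator B (y', ?t) \<partial>nu)"
      proof (rule nn_integral_cong)
        fix y' assume "y' \<in> space nu"
        have "(\<lambda>s'. ennreal (qe x' y' x (fst p) a) * indicator B (y', s')) \<in> borel_measurable Rplus"
          using measurable_Pair2[OF m, of y'] \<open>y' \<in> space nu\<close> by simp
        from nn_integral_return[OF t this]
        show "(\<integral>\<^sup>+s'. ennreal (qe x' y' x (fst p) a) * indicator B (y', s') \<partial>return Rplus ?t) =
          ennreal (qe x' y' x (fst p) a) * indicator B (y', ?t)" .
      qed
      finally show ?thesis by (simp add: c)
    qed
    have "(\<integral>\<^sup>+(y, s). (\<integral>\<^sup>+(y', s'). ennreal (dens M x' y' x y a) * indicator B (y', s')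
        \<partial>(nu \<Otimes>\<^sub>M return Rplus (s + z * cost M x y a))) \<partial>\<mu>) =
      (\<integral>\<^sup>+p. (\<integral>\<^sup>+y'. ennreal (qe x' y' x (fst p) a) * indicator B (y', snd p + z * ce x (fst p) a) \<partial>nu) \<partial>\<mu>)"
      using inner SP_D(3)[OF \<mu>] by (intro nn_integral_cong) (simp add: case_prod_beta)
    then show "(\<integral>\<^sup>+(y, s). (\<integral>\<^sup>+(y', s'). ennreal (dens M x' y' x y a) * indicator B (y', s')
        \<partial>(nu \<Otimes>\<^sub>M return Rplus (s + z * cost M x y a))) \<partial>\<mu>) / mixX M x' x (margY M \<mu>) a
        = emeasure (upd x a x' \<mu> z) B"
      using nn_integral_upd[OF \<mu> z, of "indicator B" x a x'] by (simp add: mixX_eq[OF adm x' \<mu>])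
  qed
  also have "\<dots> = upd x a x' \<mu> z"
    using measure_of_of_measure[of "upd x a x' \<mu> z"] by simp
  finally show ?thesis .
qed

text \<open>Admissibility of the action is implicit: by \<open>mx_inadm\<close> an inadmissible
  action has denominator 0.\<close>

definition update_ok where "update_ok x a x' \<mu> \<longleftrightarrow> 0 < mx x a x' \<mu> \<and> mx x a x' \<mu> < \<infinity>"

lemma mx_inadm: "(x, a) \<notin> adm M \<Longrightarrow> mx x a x' \<mu> = 0"
  by (simp add: mx_def qe_inadm)

lemma Psi_ok_iff:
  assumes "x' \<in> XX" "\<mu> \<in> space SP"
  shows "Psi_ok M x a x' \<mu> \<longleftrightarrow> update_ok x a x' \<mu>"
  using mixX_eq[where x=x and a=a, OF _ assms] mx_inadm[of x a x' \<mu>]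
  by (cases "(x, a) \<in> adm M") (auto simp: Psi_ok_def update_ok_def acts_iff)

lemma upd_prob:
  assumes "\<mu> \<in> space SP" "0 \<le> z"
  shows "prob_space (upd x a x' \<mu> z) \<longleftrightarrow> update_ok x a x' \<mu>"
  using emeasure_upd_space[OF assms, of x a x'] prob_space.emeasure_space_1[of "upd x a x' \<mu> z"]
  by (auto simp: update_ok_def intro!: prob_spaceI split: if_splits)

text \<open>One stage adds at most \<open>z * cu\<close> to the accumulated cost, so bounded support
  survives the update and the belief stays in \<open>Pb M\<close>. The bound does not depend on the
  observation.\<close>

lemma upd_support:
  assumes \<mu>: "\<mu> \<in> space SP" and K: "AE p in \<mu>. snd p \<le> K" and z: "0 \<le> z"
  shows "AE p in upd x a x' \<mu> z. snd p \<le> K + z * cu"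
proof -
  define S where "S = {p\<in>space HS. K + z * cu < snd p}"
  have S[measurable]: "S \<in> sets HS" unfolding S_def using Rplus_fst_snd by measurable
  have "(\<integral>\<^sup>+p. indicator S p \<partial>upd x a x' \<mu> z) = 
    (\<integral>\<^sup>+p. (\<integral>\<^sup>+y'. ennreal (qe x' y' x (fst p) a) *
       indicator S (y', snd p + z * ce x (fst p) a) \<partial>nu) \<partial>\<mu>) / mx x a x' \<mu>"
    by (rule nn_integral_upd[OF \<mu> z]) measurable
  also have "(\<integral>\<^sup>+p. (\<integral>\<^sup>+y'. ennreal (qe x' y' x (fst p) a) *
       indicator S (y', snd p + z * ce x (fst p) a) \<partial>nu) \<partial>\<mu>) = (\<integral>\<^sup>+p. 0 \<partial>\<mu>)"
  proof (rule nn_integral_cong_AE)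
    show "AE p in \<mu>. (\<integral>\<^sup>+y'. ennreal (qe x' y' x (fst p) a) *
       indicator S (y', snd p + z * ce x (fst p) a) \<partial>nu) = 0"
      using K
    proof eventually_elim
      case (elim p)
      have "snd p + z * ce x (fst p) a \<le> K + z * cu"
        using elim z ce_bounds(2)[of x "fst p" a] by (intro add_mono mult_left_mono)
      then show ?case by (auto simp: indicator_def S_def)
    qed
  qed
  finally have "emeasure (upd x a x' \<mu> z) S = 0"
    using nn_integral_indicator[of S "upd x a x' \<mu> z"] S by simp
  then show ?thesis
  proof (rule AE_I[rotated])
    show "S \<in> sets (upd x a x' \<mu> z)" using S by simp
  qed (auto simp: not_le S_def)
qed

lemma upd_Pb:
  assumes \<mu>: "\<mu> \<in> Pb M" and z: "0 \<le> z" and ok: "update_ok x a x' \<mu>"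
  shows "upd x a x' \<mu> z \<in> Pb M"
proof -
  obtain K where K: "K > 0" "AE p in \<mu>. snd p \<le> K" using \<mu> unfolding Pb_iff by blast
  have "0 < K + z * cu" using K z cost_bounds by (intro add_pos_nonneg mult_nonneg_nonneg) auto
  then show ?thesis unfolding Pb_iff
    using upd_prob[OF Pb_D(4)[OF \<mu>] z] ok upd_support[OF Pb_D(4)[OF \<mu>] K(2) z] by auto
qed

lemma update_ok_AE:
  assumes "\<mu> \<in> space SP" "(x, a) \<in> adm M"
  shows "AE x' in lam. update_ok x a x' \<mu> \<or> mx x a x' \<mu> = 0"
  using mx_finite_AE[OF assms] by eventually_elim (auto simp: update_ok_def zero_less_iff_neq_zero)

section \<open>Dependence of the update on its parameters\<close>

lemma qe_tendsto:
  assumes "(x, a) \<in> adm M" "\<And>n. (xs n, as n) \<in> adm M" "xs \<longlonglongrightarrow> x" "as \<longlonglongrightarrow> a"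
    "y \<in> YY" "\<And>n. ys n \<in> YY" "ys \<longlonglongrightarrow> y" "x' \<in> XX" "y' \<in> YY"
  shows "(\<lambda>n. qe x' y' (xs n) (ys n) (as n)) \<longlonglongrightarrow> qe x' y' x y a"
proof -
  have lim: "(\<lambda>n. (xs n, ys n, x', y', as n)) \<longlonglongrightarrow> (x, y, x', y', a)"
    using assms by (intro tendsto_intros)
  have mem: "(x, y, x', y', a) \<in> dens_dom M" "(xs n, ys n, x', y', as n) \<in> dens_dom M" for n
    using assms by (auto simp: dens_dom_def)
  have "(\<lambda>n. (\<lambda>(x, y, x', y', a). dens M x' y' x y a) (xs n, ys n, x', y', as n)) \<longlonglongrightarrow>
     (\<lambda>(x, y, x', y', a). dens M x' y' x y a) (x, y, x', y', a)"
    by (rule continuous_on_tendsto_compose[OF dens_continuous lim mem(1)]) (use mem in auto)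
  then show ?thesis using mem by (simp add: qe_def)
qed

lemma ce_tendsto:
  assumes "(x, a) \<in> adm M" "\<And>n. (xs n, as n) \<in> adm M" "xs \<longlonglongrightarrow> x" "as \<longlonglongrightarrow> a"
    "y \<in> YY" "\<And>n. ys n \<in> YY" "ys \<longlonglongrightarrow> y"
  shows "(\<lambda>n. ce (xs n) (ys n) (as n)) \<longlonglongrightarrow> ce x y a"
proof -
  have lim: "(\<lambda>n. (xs n, ys n, as n)) \<longlonglongrightarrow> (x, y, a)"
    using assms by (intro tendsto_intros)
  have mem: "(x, y, a) \<in> cost_dom M" "(xs n, ys n, as n) \<in> cost_dom M" for n
    using assms by (auto simp: cost_dom_def)
  have "(\<lambda>n. (\<lambda>(x, y, a). cost M x y a) (xs n, ys n, as n)) \<longlonglongrightarrow> (\<lambda>(x, y, a). cost M x y a) (x, y, a)"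
    by (rule continuous_on_tendsto_compose[OF cost_continuous lim mem(1)]) (use mem in auto)
  then show ?thesis using mem by (simp add: ce_def)
qed

text \<open>The numerator of \<open>upd\<close> on an open set. It is kept apart from the
  denominator because only a lower bound on its limit inferior is available, whereas the denominator
  has to converge.\<close>

definition updN where
  "updN x a x' \<mu> z G = (\<integral>\<^sup>+p. (\<integral>\<^sup>+y'. ennreal (qe x' y' x (fst p) a) *
     indicator (G \<inter> HSp) (y', snd p + z * ce x (fst p) a) \<partial>nu) \<partial>\<mu>)"

lemma emeasure_upd_open:
  assumes "\<mu> \<in> space SP" "0 \<le> z" "open G"
  shows "emeasure (upd x a x' \<mu> z) (G \<inter> HSp) = updN x a x' \<mu> z G / mx x a x' \<mu>"
proof -
  have "G \<inter> HSp \<in> sets HS" by (rule HS_open[OF assms(3)])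
  then show ?thesis
    using nn_integral_upd[OF assms(1,2), of "indicator (G \<inter> HSp)" x a x'] by (simp add: updN_def)
qed

lemma updN_inner_measurable:
  assumes z: "0 \<le> z" and G: "open G"
  shows "(\<lambda>p. \<integral>\<^sup>+y'. ennreal (qe x' y' x (fst p) a) *
     indicator (G \<inter> HSp) (y', snd p + z * ce x (fst p) a) \<partial>nu) \<in> borel_measurable HS"
proof -
  note [measurable] = HS_open[OF G] shift_measurable[OF z]
  have "(\<lambda>w. ennreal (qe x' (snd w) x (fst (fst w)) a) * indicator (G \<inter> HSp) (shift x a z w)) \<in> borel_measurable (HS \<Otimes>\<^sub>M nu)"
    by measurable
  then show ?thesis
    by (intro nu.borel_measurable_nn_integral) (simp add: shift_def case_prod_beta)
qed

lemma updN_UNIV: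
  assumes "\<mu> \<in> space SP" "0 \<le> z"
  shows "updN x a x' \<mu> z UNIV = mx x a x' \<mu>"
  unfolding updN_def mx_def
  using SP_D(3)[OF assms(1)] assms(2) ce_bounds(3)[THEN less_imp_le]
  by (intro nn_integral_cong) (auto simp: indicator_def)

context
  fixes x \<mu> and z :: real and a and xs :: "nat \<Rightarrow> 'x" and \<mu>s :: "nat \<Rightarrow> ('y \<times> real) measure" and zs :: "nat \<Rightarrow> real" and as :: "nat \<Rightarrow> 'a"
  assumes adm: "(x, a) \<in> adm M" "\<And>n. (xs n, as n) \<in> adm M"
    and Pb: "\<mu> \<in> Pb M" "\<And>n. \<mu>s n \<in> Pb M" and z: "0 \<le> z" "\<And>n. 0 \<le> zs n"
    and conv: "xs \<longlonglongrightarrow> x" "wconv \<mu>s \<mu>" "zs \<longlonglongrightarrow> z" "as \<longlonglongrightarrow> a"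
begin

text \<open>Fatou in two layers: over y' for the fixed measure \<open>nu\<close>, and over the old
  pair for the converging beliefs. The indicator causes no loss, since a point that lies in the open
  set in the limit lies there eventually.\<close>

lemma updN_liminf:
  assumes x': "x' \<in> XX" and G: "open G"
  shows "updN x a x' \<mu> z G \<le> liminf (\<lambda>n. updN (xs n) (as n) x' (\<mu>s n) (zs n) G)"
  unfolding updN_def
proof (rule weak_Fatou_HS[OF _ _ conv(2)])
  show "\<mu> \<in> space SP" "\<mu>s n \<in> space SP" for n using Pb Pb_D by auto
  show "(\<lambda>p. \<integral>\<^sup>+y'. ennreal (qe x' y' x (fst p) a) *
     indicator (G \<inter> HSp) (y', snd p + z * ce x (fst p) a) \<partial>nu) \<in> borel_measurable HS"
    "(\<lambda>p. \<integral>\<^sup>+y'. ennreal (qe x' y' (xs n) (fst p) (as n)) *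
     indicator (G \<inter> HSp) (y', snd p + zs n * ce (xs n) (fst p) (as n)) \<partial>nu) \<in> borel_measurable HS" for n
    using updN_inner_measurable[OF _ G] z by auto
  fix p and ps :: "nat \<Rightarrow> 'y \<times> real" assume p: "p \<in> HSp" "\<And>n. ps n \<in> HSp" "ps \<longlonglongrightarrow> p"
  have lims: "(\<lambda>n. fst (ps n)) \<longlonglongrightarrow> fst p" "(\<lambda>n. snd (ps n)) \<longlonglongrightarrow> snd p"
    using p(3) by (auto intro: tendsto_fst tendsto_snd)
  have Y: "fst p \<in> YY" "fst (ps n) \<in> YY" "0 \<le> snd p" "0 \<le> snd (ps n)" for n using p(1) p(2)[of n] by auto
  have c: "(\<lambda>n. snd (ps n) + zs n * ce (xs n) (fst (ps n)) (as n)) \<longlonglongrightarrow> snd p + z * ce x (fst p) a"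
    by (intro tendsto_intros lims conv ce_tendsto adm Y)
  let ?f = "\<lambda>y'. ennreal (qe x' y' x (fst p) a) * indicator (G \<inter> HSp) (y', snd p + z * ce x (fst p) a)"
  let ?fs = "\<lambda>n y'. ennreal (qe x' y' (xs n) (fst (ps n)) (as n)) *
      indicator (G \<inter> HSp) (y', snd (ps n) + zs n * ce (xs n) (fst (ps n)) (as n))"
  have m: "?fs n \<in> borel_measurable nu" for n
  proof -
    note [measurable] = HS_open[OF G]
    have "(\<lambda>y'. y') \<in> nu \<rightarrow>\<^sub>M hid_borel M" by measurable
    moreover have "snd (ps n) + zs n * ce (xs n) (fst (ps n)) (as n) \<in> space Rplus"
      using Y z ce_bounds(3)[THEN less_imp_le] by simp
    ultimately have [measurable]: "(\<lambda>y'. (y', snd (ps n) + zs n * ce (xs n) (fst (ps n)) (as n))) \<in> nu \<rightarrow>\<^sub>M HS"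
      unfolding hs_borel_def by (intro measurable_Pair measurable_const)
    show ?thesis by measurable
  qed
  have "(\<integral>\<^sup>+y'. ?f y' \<partial>nu) \<le> (\<integral>\<^sup>+y'. liminf (\<lambda>n. ?fs n y') \<partial>nu)"
  proof (rule nn_integral_mono)
    fix y' assume "y' \<in> space nu"
    then have y': "y' \<in> YY" by simp
    have q: "(\<lambda>n. ennreal (qe x' y' (xs n) (fst (ps n)) (as n))) \<longlonglongrightarrow> ennreal (qe x' y' x (fst p) a)"
      by (intro tendsto_ennrealI qe_tendsto adm conv Y lims x' y')
    show "?f y' \<le> liminf (\<lambda>n. ?fs n y')"
    proof (cases "(y', snd p + z * ce x (fst p) a) \<in> G")
      case True
      have "(\<lambda>n. (y', snd (ps n) + zs n * ce (xs n) (fst (ps n)) (as n))) \<longlonglongrightarrow> (y', snd p + z * ce x (fst p) a)"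
        by (intro tendsto_intros c)
      then have "eventually (\<lambda>n. (y', snd (ps n) + zs n * ce (xs n) (fst (ps n)) (as n)) \<in> G) sequentially"
        using G True by (auto dest: topological_tendstoD)
      then have "eventually (\<lambda>n. ennreal (qe x' y' (xs n) (fst (ps n)) (as n)) = ?fs n y') sequentially"
        by eventually_elim (use y' Y z ce_bounds(3)[THEN less_imp_le] in \<open>auto simp: indicator_def\<close>)
      then have "(\<lambda>n. ?fs n y') \<longlonglongrightarrow> ennreal (qe x' y' x (fst p) a)"
        by (rule Lim_transform_eventually[OF q])
      then have "liminf (\<lambda>n. ?fs n y') = ennreal (qe x' y' x (fst p) a)"
        by (rule lim_imp_Liminf[rotated]) simp
      then show ?thesis by (auto simp: indicator_def)
    qed auto
  qed
  also have "\<dots> \<le> liminf (\<lambda>n. \<integral>\<^sup>+y'. ?fs n y' \<partial>nu)"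
    by (rule nn_integral_liminf[OF m])
  finally show "(\<integral>\<^sup>+y'. ?f y' \<partial>nu) \<le> liminf (\<lambda>n. \<integral>\<^sup>+y'. ?fs n y' \<partial>nu)" .
qed

lemma mx_liminf:
  assumes x': "x' \<in> XX"
  shows "mx x a x' \<mu> \<le> liminf (\<lambda>n. mx (xs n) (as n) x' (\<mu>s n))"
  using updN_liminf[OF x' open_UNIV] updN_UNIV Pb Pb_D(4) z by simp

text \<open>The predictive densities all have total mass 1 by \<open>mx_total\<close> and satisfy
  the Fatou bound \<open>mx_liminf\<close>, so they converge in mean, and almost everywhere along a
  subsequence.\<close>

lemma mx_subseq:
  "\<exists>r::nat\<Rightarrow>nat. strict_mono r \<and> (AE x' in lam. (\<lambda>n. mx (xs (r n)) (as (r n)) x' (\<mu>s (r n))) \<longlonglongrightarrow> mx x a x' \<mu>)"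
proof (rule AE_convergent_subseq_of_liminf[where fs="\<lambda>n x'. mx (xs n) (as n) x' (\<mu>s n)"])
  have "(\<lambda>x'. x') \<in> lam \<rightarrow>\<^sub>M borel" by (rule obs_proj) simp
  then show "(\<lambda>x'. mx x a x' \<mu>) \<in> borel_measurable lam"
    "(\<lambda>x'. mx (xs n) (as n) x' (\<mu>s n)) \<in> borel_measurable lam" for n
    using Pb Pb_D(4) by (auto intro!: mx_measurable)
  have "emeasure \<mu> (space \<mu>) = 1" "emeasure (\<mu>s n) (space (\<mu>s n)) = 1" for n
    using Pb Pb_D(1) by (auto intro: prob_space.emeasure_space_1)
  then show "(\<integral>\<^sup>+x'. mx x a x' \<mu> \<partial>lam) = 1" "(\<integral>\<^sup>+x'. mx (xs n) (as n) x' (\<mu>s n) \<partial>lam) = 1" for n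
    using Pb Pb_D(4) adm by (simp_all add: mx_total)
qed (use mx_liminf in simp)

text \<open>At a fixed observation the numerator obeys a liminf bound and the denominator converges
  to a positive finite limit; the quotient then obeys the portmanteau inequality.\<close>

lemma upd_wconv:
  assumes x': "x' \<in> XX" and ok: "update_ok x a x' \<mu>"
    and lim: "(\<lambda>n. mx (xs n) (as n) x' (\<mu>s n)) \<longlonglongrightarrow> mx x a x' \<mu>"
  shows "wconv (\<lambda>n. upd (xs n) (as n) x' (\<mu>s n) (zs n)) (upd x a x' \<mu> z)"
  unfolding wconv_def
proof (intro allI impI)
  fix G :: "('y \<times> real) set" assume G: "open G"
  let ?N = "\<lambda>n. updN (xs n) (as n) x' (\<mu>s n) (zs n) G" and ?m = "\<lambda>n. mx (xs n) (as n) x' (\<mu>s n)"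
  have "(\<lambda>n. inverse (?m n)) \<longlonglongrightarrow> inverse (mx x a x' \<mu>)"
    by (rule continuous_on_tendsto_compose[of UNIV inverse, OF _ lim]) (auto intro!: continuous_intros)
  moreover have "0 < inverse (mx x a x' \<mu>)" "inverse (mx x a x' \<mu>) < \<infinity>"
    using ok by (auto simp: update_ok_def ennreal_inverse_positive less_top[symmetric])
  ultimately have "inverse (mx x a x' \<mu>) * updN x a x' \<mu> z G \<le> liminf (\<lambda>n. inverse (?m n) * ?N n)"
    by (rule liminf_mult_ennreal) (rule updN_liminf[OF x' G])
  then show "emeasure (upd x a x' \<mu> z) (G \<inter> HSp) \<le> liminf (\<lambda>n. emeasure (upd (xs n) (as n) x' (\<mu>s n) (zs n)) (G \<inter> HSp))"
    using emeasure_upd_open[OF Pb_D(4) _ G] Pb z by (simp add: divide_ennreal_def mult.commute)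
qed

end

end

section \<open>The Bellman operator on lower semicontinuous functions\<close>

locale pomdp_problem = pomdp_standing M U cl cu
  for M :: "('x::polish_space, 'y::polish_space, 'a::polish_space) pomdp" and U cl cu +
  fixes \<beta> :: real
  assumes beta: "0 < \<beta>" "\<beta> < 1" and concave: "concave_on {0..} U"
begin

lemma SP_measurable: "\<mu> \<in> space SP \<Longrightarrow> f \<in> HS \<rightarrow>\<^sub>M L \<Longrightarrow> f \<in> \<mu> \<rightarrow>\<^sub>M L"
  by (subst measurable_cong_sets[OF SP_D(2) refl])

lemma Pb_snd_nonneg: "\<mu> \<in> Pb M \<Longrightarrow> p \<in> space \<mu> \<Longrightarrow> 0 \<le> snd p"
  using Pb_D(3)[of \<mu>] by force

lemma U_mono: "0 \<le> s \<Longrightarrow> s \<le> t \<Longrightarrow> U s \<le> U t"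
  using U_strict_mono by (auto simp: strict_mono_on_def le_less)

text \<open>Both \<open>s\<close> and \<open>t\<close> are convex combinations of 0 and
  \<open>s + t\<close>, with exchanged weights; the two concavity inequalities add up to the
  claim.\<close>

lemma U_subadditive:
  assumes "0 \<le> s" "0 \<le> t"
  shows "U (s + t) \<le> U s + (U t - U 0)"
proof (cases "s + t = 0")
  case True
  then have "s = 0" "t = 0" using assms by linarith+
  then show ?thesis by simp
next
  case False
  define l where "l = s / (s + t)"
  have pos: "s + t > 0" using assms False by simp
  have l: "0 \<le> l" "l \<le> 1" using assms pos by (auto simp: l_def divide_simps)
  have ls: "l * (s + t) = s" "(1 - l) * (s + t) = t"
    using pos by (auto simp: l_def field_simps)
  have c: "convex_on {0..} (\<lambda>x. - U x)" using concave by (simp add: concave_on_def)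
  have "- U ((1 - l) * 0 + l * (s + t)) \<le> (1 - l) * (- U 0) + l * (- U (s + t))"
    using convex_onD[OF c l, of 0 "s + t"] assms by simp
  moreover have "- U (l * 0 + (1 - l) * (s + t)) \<le> l * (- U 0) + (1 - l) * (- U (s + t))"
    using convex_onD[OF c, of "1 - l" 0 "s + t"] l assms by simp
  ultimately show ?thesis using ls by (simp add: algebra_simps)
qed

text \<open>Utility counted from \<open>U 0\<close>: nonnegative for nonnegative arguments, so its
  expectations live in \<open>ennreal\<close> and need no integrability.\<close>

definition util0 where "util0 t = ennreal (U t - U 0)"

lemma U_measurable[measurable]: "U \<in> borel_measurable Rplus"
  unfolding Rplus_def by (rule borel_measurable_continuous_on_restrict[OF U_continuous])

lemma util0_measurable[measurable]: "util0 \<in> borel_measurable Rplus"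
  unfolding util0_def[abs_def] by measurable

lemma util0_mono: "0 \<le> s \<Longrightarrow> s \<le> t \<Longrightarrow> util0 s \<le> util0 t"
  unfolding util0_def by (intro ennreal_leI) (simp add: U_mono)

lemma util0_tendsto:
  assumes "0 \<le> t" "\<And>n. 0 \<le> ts n" "ts \<longlonglongrightarrow> t"
  shows "(\<lambda>n. util0 (ts n)) \<longlonglongrightarrow> util0 t"
  unfolding util0_def
  by (intro tendsto_intros continuous_on_tendsto_compose[OF U_continuous assms(3)]) (use assms in auto)

lemma add_Rplus_measurable[measurable (raw)]:
  assumes "f \<in> N \<rightarrow>\<^sub>M Rplus" "0 \<le> c" shows "(\<lambda>w. f w + c) \<in> N \<rightarrow>\<^sub>M Rplus"
proof -
  have "(\<lambda>w. f w + c) \<in> N \<rightarrow>\<^sub>M borel" using Rplus_borelD[OF assms(1)] by measurable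
  moreover have "(\<lambda>w. f w + c) \<in> space N \<rightarrow> {0..}" using measurable_space[OF assms(1)] assms(2) by fastforce
  ultimately show ?thesis unfolding Rplus_def by (intro measurable_restrict_space2)
qed

lemma util0_HS_measurable: "0 \<le> c \<Longrightarrow> (\<lambda>p. util0 (snd p + c)) \<in> borel_measurable HS"
  and U_HS_measurable: "0 \<le> c \<Longrightarrow> (\<lambda>p. U (snd p + c)) \<in> borel_measurable HS"
  using measurable_compose[OF add_Rplus_measurable[OF Rplus_fst_snd(4)] util0_measurable]
    measurable_compose[OF add_Rplus_measurable[OF Rplus_fst_snd(4)] U_measurable] by auto

section \<open>Expected utility of a belief with additional cost\<close>

definition exp_util where "exp_util \<mu> c = (\<integral>p. U (snd p + c) \<partial>\<mu>)"

lemma exp_util_props: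
  assumes \<mu>: "\<mu> \<in> Pb M" and c: "0 \<le> c"
  shows "integrable \<mu> (\<lambda>p. U (snd p + c))" "U 0 \<le> exp_util \<mu> c"
    "ennreal (exp_util \<mu> c - U 0) = (\<integral>\<^sup>+p. util0 (snd p + c) \<partial>\<mu>)"
    "AE p in \<mu>. snd p \<le> K \<Longrightarrow> exp_util \<mu> c \<le> U (K + c)"
proof -
  note P = Pb_D[OF \<mu>]
  interpret prob_space \<mu> by (rule P)
  have [measurable]: "(\<lambda>p. U (snd p + c)) \<in> borel_measurable \<mu>"
    by (rule SP_measurable[OF P(4) U_HS_measurable[OF c]])
  have nn: "AE p in \<mu>. 0 \<le> snd p" by (rule AE_I2) (rule Pb_snd_nonneg[OF \<mu>])
  have ge: "AE p in \<mu>. U 0 \<le> U (snd p + c)" using nn by eventually_elim (rule U_mono, use c in auto)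
  have le: "AE p in \<mu>. U (snd p + c) \<le> U (K + c)" if "AE p in \<mu>. snd p \<le> K" for K
    using that nn by eventually_elim (rule U_mono, use c in auto)
  obtain K' where K': "AE p in \<mu>. snd p \<le> K'" using \<mu> unfolding Pb_iff by blast
  show int: "integrable \<mu> (\<lambda>p. U (snd p + c))"
  proof (rule integrable_const_bound[where B="max \<bar>U 0\<bar> \<bar>U (K' + c)\<bar>"])
    show "AE p in \<mu>. norm (U (snd p + c)) \<le> max \<bar>U 0\<bar> \<bar>U (K' + c)\<bar>"
      using ge le[OF K'] by eventually_elim auto
  qed measurable
  show "U 0 \<le> exp_util \<mu> c" unfolding exp_util_def using int ge by (intro integral_ge_const)
  show "AE p in \<mu>. snd p \<le> K \<Longrightarrow> exp_util \<mu> c \<le> U (K + c)" unfolding exp_util_def using int le by (intro integral_le_const)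
  have "(\<integral>\<^sup>+p. util0 (snd p + c) \<partial>\<mu>) = ennreal (\<integral>p. U (snd p + c) - U 0 \<partial>\<mu>)"
    unfolding util0_def using int ge by (intro nn_integral_eq_integral) auto
  also have "(\<integral>p. U (snd p + c) - U 0 \<partial>\<mu>) = exp_util \<mu> c - U 0"
    unfolding exp_util_def using int by (simp add: prob_space)
  finally show "ennreal (exp_util \<mu> c - U 0) = (\<integral>\<^sup>+p. util0 (snd p + c) \<partial>\<mu>)" by simp
qed

lemma exp_util_mono:
  assumes "\<mu> \<in> Pb M" "0 \<le> c" "c \<le> d" shows "exp_util \<mu> c \<le> exp_util \<mu> d"
proof -
  have "AE p in \<mu>. U (snd p + c) \<le> U (snd p + d)"
    by (rule AE_I2, rule U_mono) (use Pb_snd_nonneg[OF assms(1)] assms in auto)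
  then show ?thesis unfolding exp_util_def using exp_util_props(1)[OF assms(1)] assms by (intro integral_mono_AE) auto
qed

lemma exp_util_shift:
  assumes "\<mu> \<in> Pb M" "0 \<le> c" shows "exp_util \<mu> c \<le> exp_util \<mu> 0 + (U c - U 0)"
proof -
  interpret prob_space \<mu> by (rule Pb_D(1)[OF assms(1)])
  have i: "integrable \<mu> (\<lambda>p. U (snd p))" "integrable \<mu> (\<lambda>p. U (snd p + c))"
    using exp_util_props(1)[OF assms(1), of 0] exp_util_props(1)[OF assms(1), of c] assms by auto
  have "AE p in \<mu>. U (snd p + c) \<le> U (snd p) + (U c - U 0)"
    by (rule AE_I2, rule U_subadditive) (use Pb_snd_nonneg[OF assms(1)] assms in auto)
  then have "exp_util \<mu> c \<le> (\<integral>p. U (snd p) + (U c - U 0) \<partial>\<mu>)"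
    unfolding exp_util_def using i by (intro integral_mono_AE) auto
  also have "\<dots> = exp_util \<mu> 0 + (U c - U 0)" using i by (simp add: exp_util_def prob_space)
  finally show ?thesis .
qed

text \<open>\<open>U\<close> may be unbounded and hence no test function for weak convergence; the
  Fatou lemma for the nonnegative function \<open>util0\<close> still gives closed sublevel sets,
  even with a varying additional cost.\<close>

lemma exp_util_lsc:
  assumes \<mu>: "\<mu> \<in> Pb M" "\<And>n. \<mu>s n \<in> Pb M" and w: "wconv \<mu>s \<mu>"
    and c: "0 \<le> c" "\<And>n. 0 \<le> cs n" "cs \<longlonglongrightarrow> c" and le: "\<And>n. exp_util (\<mu>s n) (cs n) \<le> r"
  shows "exp_util \<mu> c \<le> r"
proof -
  have r: "U 0 \<le> r" using exp_util_props(2)[OF \<mu>(2) c(2)] le by (rule order_trans)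
  have "(\<integral>\<^sup>+p. util0 (snd p + c) \<partial>\<mu>) \<le> liminf (\<lambda>n. \<integral>\<^sup>+p. util0 (snd p + cs n) \<partial>\<mu>s n)"
  proof (rule weak_Fatou_HS[OF _ _ w])
    show "\<mu>s n \<in> space SP" "\<mu> \<in> space SP" for n using \<mu> Pb_D(4) by auto
    fix p and ps :: "nat \<Rightarrow> 'y \<times> real" assume p: "p \<in> HSp" "\<And>n. ps n \<in> HSp" "ps \<longlonglongrightarrow> p"
    have nn: "0 \<le> snd p" "0 \<le> snd (ps n)" for n using p(1) p(2)[of n] by auto
    have "(\<lambda>n. util0 (snd (ps n) + cs n)) \<longlonglongrightarrow> util0 (snd p + c)"
      using nn c by (intro util0_tendsto tendsto_intros p(3)) auto
    then show "util0 (snd p + c) \<le> liminf (\<lambda>n. util0 (snd (ps n) + cs n))" by (simp add: lim_imp_Liminf)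
  qed (use util0_HS_measurable c in auto)
  also have "\<dots> = liminf (\<lambda>n. ennreal (exp_util (\<mu>s n) (cs n) - U 0))"
    using exp_util_props(3)[OF \<mu>(2) c(2)] by simp
  also have "\<dots> \<le> liminf (\<lambda>n::nat. ennreal (r - U 0))"
    by (intro Liminf_mono always_eventually allI ennreal_leI) (simp add: le)
  finally have "ennreal (exp_util \<mu> c - U 0) \<le> ennreal (r - U 0)"
    using exp_util_props(3)[OF \<mu>(1) c(1)] by (simp add: Liminf_const)
  then show ?thesis using r by (simp add: ennreal_le_iff)
qed

lemma E_setD: "(x, \<mu>, z) \<in> E_set M \<Longrightarrow> x \<in> XX \<and> \<mu> \<in> Pb M \<and> 0 < z \<and> z \<le> 1"
  by (auto simp: E_set_def)

lemma V_zero_exp_util: "V_zero U (x, \<mu>, z) = exp_util \<mu> 0"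
  by (simp add: V_zero_def exp_util_def case_prod_unfold)

lemma b_exp_util_aux:
  assumes "\<mu> \<in> Pb M" "0 \<le> c"
  shows "(\<integral>s. U (s + c) \<partial>margS \<mu>) = exp_util \<mu> c"
proof -
  have "snd \<in> \<mu> \<rightarrow>\<^sub>M Rplus"
    by (rule SP_measurable[OF Pb_D(4)[OF assms(1)] Rplus_fst_snd(4)])
  moreover have "(\<lambda>s. U (s + c)) \<in> borel_measurable Rplus"
    using measurable_compose[OF add_Rplus_measurable[OF measurable_ident assms(2)] U_measurable] by simp
  ultimately show ?thesis unfolding margS_def exp_util_def by (rule integral_distr)
qed

lemma disc_nonneg: "0 \<le> z \<Longrightarrow> 0 \<le> z * cu / (1 - \<beta>)" "0 \<le> z \<Longrightarrow> 0 \<le> z * cl / (1 - \<beta>)"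
  and disc_le: "0 \<le> z \<Longrightarrow> z * cl / (1 - \<beta>) \<le> z * cu / (1 - \<beta>)"
  using beta cost_bounds by (auto intro!: divide_nonneg_pos divide_right_mono mult_left_mono)

lemma b_upper_exp_util: "(x, \<mu>, z) \<in> E_set M \<Longrightarrow> b_upper U \<beta> cu (x, \<mu>, z) = exp_util \<mu> (z * cu / (1 - \<beta>))"
  and b_lower_exp_util: "(x, \<mu>, z) \<in> E_set M \<Longrightarrow> b_lower U \<beta> cl (x, \<mu>, z) = exp_util \<mu> (z * cl / (1 - \<beta>))"
  using b_exp_util_aux disc_nonneg by (auto simp: b_upper_def b_lower_def dest!: E_setD)

text \<open>\<open>C_E\<close> cut off by \<open>b_upper\<close>. The upper bound yields
  integrability inside \<open>L_op\<close>, and in contrast to the interval between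
  \<open>b_lower\<close> and \<open>b_upper\<close> the class also contains \<open>V_zero\<close>,
  so all three sequences of iterates stay in it.\<close>

definition bellman_class where
  "bellman_class = {v. lower_semicont (E_top M) v \<and> (\<forall>e\<in>E_set M. V_zero U e \<le> v e \<and> v e \<le> b_upper U \<beta> cu e)}"

lemma lower_semicont_exp_util:
  assumes "\<And>x \<mu> z. (x, \<mu>, z) \<in> E_set M \<Longrightarrow> v (x, \<mu>, z) = exp_util \<mu> (z * c)" "0 \<le> c"
  shows "lower_semicont (E_top M) v"
  unfolding lower_semicont_iff
proof (intro allI impI)
  fix es e r assume *: "\<forall>n. es n \<in> E_set M" "e \<in> E_set M" "econv es e" "\<forall>n. v (es n) \<le> r"
  have es: "v (es n) = exp_util (fst (snd (es n))) (snd (snd (es n)) * c)" "fst (snd (es n)) \<in> Pb M" "0 \<le> snd (snd (es n)) * c" for n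
    using *(1)[rule_format, of n] assms(1)[of "fst (es n)" "fst (snd (es n))" "snd (snd (es n))"] assms(2) by (auto simp: E_set_def)
  have e: "v e = exp_util (fst (snd e)) (snd (snd e) * c)" "fst (snd e) \<in> Pb M" "0 \<le> snd (snd e) * c"
    using *(2) assms(1)[of "fst e" "fst (snd e)" "snd (snd e)"] assms(2) by (auto simp: E_set_def)
  show "v e \<le> r" unfolding e(1)
  proof (rule exp_util_lsc[OF e(2) es(2) _ e(3) es(3)])
    show "wconv (\<lambda>n. fst (snd (es n))) (fst (snd e))" using *(3) by (simp add: econv_def)
    show "(\<lambda>n. snd (snd (es n)) * c) \<longlonglongrightarrow> snd (snd e) * c" using *(3) by (auto simp: econv_def intro: tendsto_intros)
    show "exp_util (fst (snd (es n))) (snd (snd (es n)) * c) \<le> r" for n using *(4) es(1) by metis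
  qed
qed

lemma bounds_in_class: "V_zero U \<in> bellman_class" "b_lower U \<beta> cl \<in> bellman_class" "b_upper U \<beta> cu \<in> bellman_class"
proof -
  have 1: "lower_semicont (E_top M) (V_zero U)"
    by (rule lower_semicont_exp_util[where c=0]) (simp_all add: V_zero_exp_util)
  have 2: "lower_semicont (E_top M) (b_lower U \<beta> cl)"
    by (rule lower_semicont_exp_util[where c="cl / (1 - \<beta>)"]) (use disc_nonneg[of 1] in \<open>simp_all add: b_lower_exp_util\<close>)
  have 3: "lower_semicont (E_top M) (b_upper U \<beta> cu)"
    by (rule lower_semicont_exp_util[where c="cu / (1 - \<beta>)"]) (use disc_nonneg[of 1] in \<open>simp_all add: b_upper_exp_util\<close>)
  have 4: "V_zero U e \<le> b_lower U \<beta> cl e" "b_lower U \<beta> cl e \<le> b_upper U \<beta> cu e" if e: "e \<in> E_set M" for e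
  proof -
    obtain x \<mu> z where exz: "e = (x, \<mu>, z)" by (cases e)
    note E = E_setD[OF e[unfolded exz]]
    show "V_zero U e \<le> b_lower U \<beta> cl e" "b_lower U \<beta> cl e \<le> b_upper U \<beta> cu e"
      using e E disc_nonneg[of z] disc_le[of z]
      by (auto simp: exz b_upper_exp_util b_lower_exp_util V_zero_exp_util intro!: exp_util_mono)
  qed
  show "V_zero U \<in> bellman_class" "b_lower U \<beta> cl \<in> bellman_class" "b_upper U \<beta> cu \<in> bellman_class"
    using 1 2 3 4 order_trans[OF 4] by (auto simp: bellman_class_def)
qed

section \<open>The Bellman integrand in extended nonnegative form\<close>

definition excess where "excess v e = ennreal (v e - U 0)"

text \<open>Counterpart of \<open>L_op\<close> with the predictive law written as a density with
  respect to \<open>lam\<close>. The reference measure no longer depends on state, belief or action,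
  so that Fatou over the next observation applies when these vary.\<close>

definition L_nn where
  "L_nn w = (\<lambda>(x, \<mu>, z) a. \<integral>\<^sup>+x'. mx x a x' \<mu> * (if update_ok x a x' \<mu> then w (x', upd x a x' \<mu> z, \<beta> * z) else 0) \<partial>lam)"

lemma class_ge_U0: "v \<in> bellman_class \<Longrightarrow> e \<in> E_set M \<Longrightarrow> U 0 \<le> v e"
  using exp_util_props(2)[of "fst (snd e)" 0] V_zero_exp_util[of "fst e" "fst (snd e)" "snd (snd e)"]
  by (force simp: bellman_class_def E_set_def)

lemma update_ok_measurable[measurable (raw)]:
  assumes [measurable]: "f \<in> N \<rightarrow>\<^sub>M borel" "g \<in> N \<rightarrow>\<^sub>M borel" "h \<in> N \<rightarrow>\<^sub>M borel" "m \<in> N \<rightarrow>\<^sub>M SP"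
  shows "Measurable.pred N (\<lambda>w. update_ok (f w) (g w) (h w) (m w))"
  unfolding update_ok_def by measurable

lemma lam_id[measurable]: "(\<lambda>x'. x') \<in> lam \<rightarrow>\<^sub>M borel" "(\<lambda>x'. x') \<in> lam \<rightarrow>\<^sub>M obs_borel M"
  by (auto intro: obs_proj)

text \<open>Where the update degenerates the old belief is substituted, because measurability into
  \<open>E_borel M\<close> requires values in \<open>E_set M\<close> everywhere.\<close>

lemma next_state_measurable:
  assumes \<mu>: "\<mu> \<in> Pb M" and z: "0 < z" "z \<le> 1"
  shows "(\<lambda>x'. (x', if update_ok x a x' \<mu> then upd x a x' \<mu> z else \<mu>, \<beta> * z)) \<in> lam \<rightarrow>\<^sub>M E_borel M"
proof (rule measurable_E_borel)
  have [measurable]: "(\<lambda>_. \<mu>) \<in> lam \<rightarrow>\<^sub>M SP" using Pb_D(4)[OF \<mu>] by simp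
  show "(\<lambda>x'. if update_ok x a x' \<mu> then upd x a x' \<mu> z else \<mu>) \<in> lam \<rightarrow>\<^sub>M SP"
    using z by (intro measurable_If upd_measurable) measurable
  show "(x', if update_ok x a x' \<mu> then upd x a x' \<mu> z else \<mu>, \<beta> * z) \<in> E_set M" if "x' \<in> space lam" for x'
    using that z beta \<mu> upd_Pb[OF \<mu>, of z x a x'] by (auto simp: E_set_def mult_le_one)
qed measurable

lemma next_in_E:
  assumes "\<mu> \<in> Pb M" "0 < z" "z \<le> 1" "x' \<in> XX" "update_ok x a x' \<mu>"
  shows "(x', upd x a x' \<mu> z, \<beta> * z) \<in> E_set M"
  using assms beta upd_Pb[of \<mu> z x a x'] by (auto simp: E_set_def mult_le_one)

lemma L_nn_integrand_measurable:
  assumes "v \<in> borel_measurable (E_borel M)" "\<mu> \<in> Pb M" "0 < z" "z \<le> 1"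
  shows "(\<lambda>x'. mx x a x' \<mu> * (if update_ok x a x' \<mu> then v (x', upd x a x' \<mu> z, \<beta> * z) else 0)) \<in> borel_measurable lam"
proof -
  have [measurable]: "(\<lambda>_. \<mu>) \<in> lam \<rightarrow>\<^sub>M SP" using Pb_D(4)[OF assms(2)] by simp
  have [measurable]: "(\<lambda>x'. v (x', if update_ok x a x' \<mu> then upd x a x' \<mu> z else \<mu>, \<beta> * z)) \<in> borel_measurable lam"
    by (rule measurable_compose[OF next_state_measurable[OF assms(2-4)] assms(1)])
  have "(\<lambda>x'. mx x a x' \<mu> * (if update_ok x a x' \<mu> then v (x', if update_ok x a x' \<mu> then upd x a x' \<mu> z else \<mu>, \<beta> * z) else 0)) \<in> borel_measurable lam"
    by measurable
  then show ?thesis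
    by (rule measurable_cong[THEN iffD1, rotated]) simp
qed

text \<open>The bridge between the real operator and \<open>L_nn\<close>. Under the predictive law
  the update is defined almost surely, and the integrand lies between \<open>U 0\<close> and a
  constant coming from the bounded support of the belief.\<close>

lemma L_excess:
  assumes v: "v \<in> bellman_class" and e: "(x, \<mu>, z) \<in> E_set M" and a: "a \<in> acts M x"
  shows "U 0 \<le> L_op M \<beta> v (x, \<mu>, z) a" "ennreal (L_op M \<beta> v (x, \<mu>, z) a - U 0) = L_nn (excess v) (x, \<mu>, z) a"
proof -
  note E = E_setD[OF e]
  have adm: "(x, a) \<in> adm M" using a by (simp add: acts_iff)
  have z: "0 \<le> z" and SP: "\<mu> \<in> space SP" using E Pb_D(4) by auto
  have [measurable]: "(\<lambda>_. \<mu>) \<in> lam \<rightarrow>\<^sub>M SP" using SP by simp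
  have [measurable]: "v \<in> borel_measurable (E_borel M)" using v by (auto simp: bellman_class_def intro: lower_semicont_measurable)
  have [measurable]: "(\<lambda>x'. v (x', if update_ok x a x' \<mu> then upd x a x' \<mu> z else \<mu>, \<beta> * z)) \<in> borel_measurable lam"
    using E by (intro measurable_compose[OF next_state_measurable]) auto
  define KX where "KX = density lam (\<lambda>x'. mx x a x' \<mu>)"
  \<comment> \<open>The default is \<open>U 0\<close> and not 0, so that the excess vanishes at
    degenerate observations, in agreement with \<open>L_nn\<close>.\<close>
  define h where "h x' = (if update_ok x a x' \<mu> then v (x', if update_ok x a x' \<mu> then upd x a x' \<mu> z else \<mu>, \<beta> * z) else U 0)" for x'
  have h[measurable]: "h \<in> borel_measurable lam" unfolding h_def[abs_def] by measurable
  have h'[measurable]: "h \<in> borel_measurable KX" unfolding KX_def by simp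
  have K: "kernelX M x (margY M \<mu>) a = KX"
    unfolding kernelX_def KX_def
  proof (rule density_cong)
    show "AE x' in lam. mixX M x' x (margY M \<mu>) a = mx x a x' \<mu>"
      using mixX_eq[OF adm _ SP] by (intro AE_I2) simp
    show "(\<lambda>x'. mx x a x' \<mu>) \<in> borel_measurable lam" by measurable
    then show "(\<lambda>x'. mixX M x' x (margY M \<mu>) a) \<in> borel_measurable lam"
      by (rule measurable_cong[THEN iffD1, rotated]) (simp add: mixX_eq[OF adm _ SP])
  qed
  interpret mu: prob_space \<mu> using E Pb_D by auto
  have "emeasure KX (space KX) = (\<integral>\<^sup>+x'. mx x a x' \<mu> \<partial>lam)"
    unfolding KX_def using sets.top[of lam]
    by (subst emeasure_density) (auto intro!: nn_integral_cong simp: indicator_def)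
  also have "\<dots> = 1" using mx_total[OF SP adm] mu.emeasure_space_1 by simp
  finally interpret K: prob_space KX by (rule prob_spaceI)
  have okAE: "AE x' in KX. update_ok x a x' \<mu>"
    unfolding KX_def using update_ok_AE[OF SP adm] by (subst AE_density) auto
  have spK: "space KX = XX" by (simp add: KX_def)
  have L: "L_op M \<beta> v (x, \<mu>, z) a = (\<integral>x'. h x' \<partial>KX)"
    unfolding L_op_def prod.case K
  proof (rule integral_cong_AE)
    let ?h0 = "\<lambda>x'. if update_ok x a x' \<mu> then v (x', if update_ok x a x' \<mu> then upd x a x' \<mu> z else \<mu>, \<beta> * z) else 0"
    have eq: "(if Psi_ok M x a x' \<mu> then v (x', Psi M x a x' \<mu> z, \<beta> * z) else 0) = ?h0 x'" if "x' \<in> space KX" for x'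
      using that by (simp add: spK Psi_ok_iff[OF _ SP] Psi_eq[OF adm _ SP z])
    have "?h0 \<in> borel_measurable lam" by measurable
    then have "?h0 \<in> borel_measurable KX" unfolding KX_def by simp
    then show "(\<lambda>x'. if Psi_ok M x a x' \<mu> then v (x', Psi M x a x' \<mu> z, \<beta> * z) else 0) \<in> borel_measurable KX"
      by (rule measurable_cong[THEN iffD1, rotated]) (simp only: eq)
    show "AE x' in KX. (if Psi_ok M x a x' \<mu> then v (x', Psi M x a x' \<mu> z, \<beta> * z) else 0) = h x'"
      using okAE AE_space by eventually_elim (simp only: eq h_def if_True)
  qed (rule h')
  obtain Kb where Kb: "AE p in \<mu>. snd p \<le> Kb" using E unfolding Pb_iff by blast
  have ge: "AE x' in KX. U 0 \<le> h x'"
    using okAE AE_space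
  proof eventually_elim
    case (elim x')
    then show ?case using next_in_E[of \<mu> z x' x a] E class_ge_U0[OF v] by (simp add: h_def spK)
  qed
  \<comment> \<open>The accumulated cost after one more stage is at most \<open>Kb + z * cu\<close>;
    the last summand is the largest discounted cost still to come at scale
    \<open>\<beta> * z\<close>.\<close>
  define Bd where "Bd = U (Kb + z * cu + \<beta> * z * cu / (1 - \<beta>))"
  have le: "AE x' in KX. h x' \<le> Bd"
    using okAE AE_space
  proof eventually_elim
    case (elim x')
    let ?\<mu>' = "upd x a x' \<mu> z"
    have e': "(x', ?\<mu>', \<beta> * z) \<in> E_set M" using elim E by (intro next_in_E) (auto simp: spK)
    have "h x' \<le> b_upper U \<beta> cu (x', ?\<mu>', \<beta> * z)" using elim v e' by (simp add: h_def bellman_class_def)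
    also have "\<dots> = exp_util ?\<mu>' (\<beta> * z * cu / (1 - \<beta>))" by (rule b_upper_exp_util[OF e'])
    also have "\<dots> \<le> Bd" unfolding Bd_def
      using E_setD[OF e'] disc_nonneg(1)[of "\<beta> * z"] upd_support[OF SP Kb z]
      by (intro exp_util_props(4)) auto
    finally show ?case .
  qed
  have int: "integrable KX h"
  proof (rule K.integrable_const_bound[where B="max \<bar>U 0\<bar> \<bar>Bd\<bar>"])
    show "AE x' in KX. norm (h x') \<le> max \<bar>U 0\<bar> \<bar>Bd\<bar>" using ge le by eventually_elim auto
  qed (rule h')
  show "U 0 \<le> L_op M \<beta> v (x, \<mu>, z) a" unfolding L using int ge by (intro K.integral_ge_const)
  have "ennreal (L_op M \<beta> v (x, \<mu>, z) a - U 0) = ennreal (\<integral>x'. h x' - U 0 \<partial>KX)"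
    unfolding L using int by (simp add: K.prob_space)
  also have "\<dots> = (\<integral>\<^sup>+x'. ennreal (h x' - U 0) \<partial>KX)"
    using int ge by (intro nn_integral_eq_integral[symmetric]) auto
  also have "\<dots> = (\<integral>\<^sup>+x'. mx x a x' \<mu> * ennreal (h x' - U 0) \<partial>lam)"
    unfolding KX_def by (rule nn_integral_density) measurable
  also have "\<dots> = L_nn (excess v) (x, \<mu>, z) a"
    unfolding L_nn_def prod.case
  proof (rule nn_integral_cong_AE)
    show "AE x' in lam. mx x a x' \<mu> * ennreal (h x' - U 0) =
        mx x a x' \<mu> * (if update_ok x a x' \<mu> then excess v (x', upd x a x' \<mu> z, \<beta> * z) else 0)"
      by (intro AE_I2) (simp add: h_def excess_def)
  qed
  finally show "ennreal (L_op M \<beta> v (x, \<mu>, z) a - U 0) = L_nn (excess v) (x, \<mu>, z) a" .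
qed

text \<open>A constant passes through unchanged because the predictive density has mass 1. The
  comparison is assumed at scale \<open>\<beta> * z\<close> only: the constants to which it is
  applied depend on the scale.\<close>

lemma L_shift:
  assumes v: "v \<in> bellman_class" "v' \<in> bellman_class" and e: "(x, \<mu>, z) \<in> E_set M" and a: "a \<in> acts M x" and k: "0 \<le> k"
    and le: "\<And>x' \<nu>. (x', \<nu>, \<beta> * z) \<in> E_set M \<Longrightarrow> v (x', \<nu>, \<beta> * z) \<le> v' (x', \<nu>, \<beta> * z) + k"
  shows "L_op M \<beta> v (x, \<mu>, z) a \<le> L_op M \<beta> v' (x, \<mu>, z) a + k"
proof -
  note E = E_setD[OF e]
  have adm: "(x, a) \<in> adm M" using a by (simp add: acts_iff)
  have SP: "\<mu> \<in> space SP" using E Pb_D(4) by auto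
  interpret mu: prob_space \<mu> using E Pb_D by auto
  have [measurable]: "(\<lambda>_. \<mu>) \<in> lam \<rightarrow>\<^sub>M SP" using SP by simp
  have "v' \<in> borel_measurable (E_borel M)" using v by (auto simp: bellman_class_def intro: lower_semicont_measurable)
  then have "excess v' \<in> borel_measurable (E_borel M)" unfolding excess_def[abs_def] by measurable
  note m = L_nn_integrand_measurable[OF this, of \<mu> z x a]
  have "ennreal (L_op M \<beta> v (x, \<mu>, z) a - U 0) = L_nn (excess v) (x, \<mu>, z) a"
    by (rule L_excess[OF v(1) e a])
  also have "\<dots> \<le> (\<integral>\<^sup>+x'. mx x a x' \<mu> * (if update_ok x a x' \<mu> then excess v' (x', upd x a x' \<mu> z, \<beta> * z) else 0) + ennreal k * mx x a x' \<mu> \<partial>lam)"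
    unfolding L_nn_def prod.case
  proof (rule nn_integral_mono)
    fix x' assume "x' \<in> space lam"
    show "mx x a x' \<mu> * (if update_ok x a x' \<mu> then excess v (x', upd x a x' \<mu> z, \<beta> * z) else 0)
      \<le> mx x a x' \<mu> * (if update_ok x a x' \<mu> then excess v' (x', upd x a x' \<mu> z, \<beta> * z) else 0) + ennreal k * mx x a x' \<mu>"
    proof (cases "update_ok x a x' \<mu>")
      case True
      let ?e = "(x', upd x a x' \<mu> z, \<beta> * z)"
      have e': "?e \<in> E_set M" using True E \<open>x' \<in> space lam\<close> by (intro next_in_E) auto
      have "excess v ?e \<le> ennreal (v' ?e - U 0 + k)" unfolding excess_def using le[OF e'] by (intro ennreal_leI) simp
      also have "\<dots> = excess v' ?e + ennreal k" unfolding excess_def using class_ge_U0[OF v(2) e'] k by (intro ennreal_plus) auto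
      finally have "mx x a x' \<mu> * excess v ?e \<le> mx x a x' \<mu> * (excess v' ?e + ennreal k)" by (rule mult_left_mono) simp
      then show ?thesis using True by (simp add: distrib_left mult.commute)
    qed simp
  qed
  also have "\<dots> = L_nn (excess v') (x, \<mu>, z) a + ennreal k * (\<integral>\<^sup>+x'. mx x a x' \<mu> \<partial>lam)"
  proof -
    have m2: "(\<lambda>x'. mx x a x' \<mu>) \<in> borel_measurable lam" by measurable
    then have m3: "(\<lambda>x'. ennreal k * mx x a x' \<mu>) \<in> borel_measurable lam" by measurable
    show ?thesis unfolding L_nn_def prod.case nn_integral_cmult[OF m2, symmetric]
      by (rule nn_integral_add[OF m m3]) (use E in auto)
  qed
  also have "\<dots> = ennreal (L_op M \<beta> v' (x, \<mu>, z) a - U 0) + ennreal k"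
    using L_excess(2)[OF v(2) e a] mx_total[OF SP adm] mu.emeasure_space_1 by simp
  also have "\<dots> = ennreal (L_op M \<beta> v' (x, \<mu>, z) a - U 0 + k)"
    using L_excess(1)[OF v(2) e a] k by (intro ennreal_plus[symmetric]) auto
  finally have "L_op M \<beta> v (x, \<mu>, z) a - U 0 \<le> L_op M \<beta> v' (x, \<mu>, z) a - U 0 + k"
    using L_excess(1)[OF v(2) e a] k by (subst (asm) ennreal_le_iff) auto
  then show ?thesis by simp
qed

text \<open>For payoffs that see only the accumulated cost, disintegration removes the update and
  \<open>qe_total\<close> integrates out the next state; what remains is the one-stage cost added to
  the old pair.\<close>

lemma L_nn_util0:
  assumes e: "(x, \<mu>, z) \<in> E_set M" and a: "(x, a) \<in> adm M" and c: "0 \<le> c"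
    and w: "\<And>x' \<nu>. (x', \<nu>, \<beta> * z) \<in> E_set M \<Longrightarrow> w (x', \<nu>, \<beta> * z) = (\<integral>\<^sup>+p. util0 (snd p + c) \<partial>\<nu>)"
  shows "L_nn w (x, \<mu>, z) a = (\<integral>\<^sup>+p. util0 (snd p + z * ce x (fst p) a + c) \<partial>\<mu>)"
proof -
  note E = E_setD[OF e]
  have SP: "\<mu> \<in> space SP" using E Pb_D(4) by auto
  have m: "(\<lambda>(x', p). util0 (snd p + c)) \<in> borel_measurable (obs_borel M \<Otimes>\<^sub>M HS)"
    using measurable_compose[OF measurable_snd util0_HS_measurable[OF c]] by (simp add: case_prod_unfold)
  have "L_nn w (x, \<mu>, z) a = (\<integral>\<^sup>+x'. mx x a x' \<mu> * (\<integral>\<^sup>+p. util0 (snd p + c) \<partial>upd x a x' \<mu> z) \<partial>lam)"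
    unfolding L_nn_def prod.case
  proof (rule nn_integral_cong_AE)
    show "AE x' in lam. mx x a x' \<mu> * (if update_ok x a x' \<mu> then w (x', upd x a x' \<mu> z, \<beta> * z) else 0) =
       mx x a x' \<mu> * (\<integral>\<^sup>+p. util0 (snd p + c) \<partial>upd x a x' \<mu> z)"
      using update_ok_AE[OF SP a] AE_space
    proof eventually_elim
      case (elim x')
      then show ?case using w next_in_E[of \<mu> z x' x a] E by auto
    qed
  qed
  also have "\<dots> = (\<integral>\<^sup>+p. (\<integral>\<^sup>+x'. (\<integral>\<^sup>+y'. ennreal (qe x' y' x (fst p) a) * util0 (snd p + z * ce x (fst p) a + c) \<partial>nu) \<partial>lam) \<partial>\<mu>)"
    using one_step_disintegration[OF SP a _ m, of z] E by simp
  also have "\<dots> = (\<integral>\<^sup>+p. util0 (snd p + z * ce x (fst p) a + c) \<partial>\<mu>)"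
  proof (rule nn_integral_cong)
    fix p assume "p \<in> space \<mu>"
    then have y: "fst p \<in> YY" using SP_D(3)[OF SP] by auto
    have m: "(\<lambda>x'. \<integral>\<^sup>+y'. ennreal (qe x' y' x (fst p) a) \<partial>nu) \<in> borel_measurable lam"
      by measurable
    show "(\<integral>\<^sup>+x'. (\<integral>\<^sup>+y'. ennreal (qe x' y' x (fst p) a) * util0 (snd p + z * ce x (fst p) a + c) \<partial>nu) \<partial>lam)
      = util0 (snd p + z * ce x (fst p) a + c)"
      using qe_total[OF a y] m by (simp add: nn_integral_multc)
  qed
  finally show ?thesis .
qed

lemma disc_split: "z * c + (\<beta> * z) * c / (1 - \<beta>) = z * c / (1 - \<beta>)"
  using beta by (simp add: field_simps)

text \<open>The one-stage cost lies between \<open>cl\<close> and \<open>cu\<close>, and by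
  \<open>disc_split\<close> a first stage followed by the geometric tail from scale
  \<open>\<beta> * z\<close> is the geometric tail from scale \<open>z\<close>. These inequalities
  make the three sequences of iterates monotone.\<close>

lemma L_basic:
  assumes e: "(x, \<mu>, z) \<in> E_set M" and a: "a \<in> acts M x"
  shows "V_zero U (x, \<mu>, z) \<le> L_op M \<beta> (V_zero U) (x, \<mu>, z) a"
    "b_lower U \<beta> cl (x, \<mu>, z) \<le> L_op M \<beta> (b_lower U \<beta> cl) (x, \<mu>, z) a"
    "L_op M \<beta> (b_upper U \<beta> cu) (x, \<mu>, z) a \<le> b_upper U \<beta> cu (x, \<mu>, z)"
proof -
  note E = E_setD[OF e]
  have adm: "(x, a) \<in> adm M" using a by (simp add: acts_iff)
  have bz: "0 \<le> \<beta> * z" using E beta by simp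
  have nn: "0 \<le> snd p" if "p \<in> space \<mu>" for p using that E Pb_snd_nonneg by blast
  have zc: "z * cl \<le> z * ce x y a" "z * ce x y a \<le> z * cu" "0 \<le> z * ce x y a" "0 \<le> z * cl" for y
    using E ce_bounds[where x=x and y=y and a=a] cost_bounds by (auto intro!: mult_left_mono mult_nonneg_nonneg)
  have 1: "ennreal (L_op M \<beta> (V_zero U) (x, \<mu>, z) a - U 0) = (\<integral>\<^sup>+p. util0 (snd p + z * ce x (fst p) a + 0) \<partial>\<mu>)"
    unfolding L_excess(2)[OF bounds_in_class(1) e a]
    by (rule L_nn_util0[OF e adm]) (use exp_util_props(3) in \<open>auto simp: excess_def V_zero_exp_util dest!: E_setD\<close>)
  have 2: "ennreal (L_op M \<beta> (b_lower U \<beta> cl) (x, \<mu>, z) a - U 0) = (\<integral>\<^sup>+p. util0 (snd p + z * ce x (fst p) a + \<beta> * z * cl / (1 - \<beta>)) \<partial>\<mu>)"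
    unfolding L_excess(2)[OF bounds_in_class(2) e a]
    by (rule L_nn_util0[OF e adm disc_nonneg(2)[OF bz]]) (use exp_util_props(3) disc_nonneg(2)[OF bz] in \<open>auto simp: excess_def b_lower_exp_util dest!: E_setD\<close>)
  have 3: "ennreal (L_op M \<beta> (b_upper U \<beta> cu) (x, \<mu>, z) a - U 0) = (\<integral>\<^sup>+p. util0 (snd p + z * ce x (fst p) a + \<beta> * z * cu / (1 - \<beta>)) \<partial>\<mu>)"
    unfolding L_excess(2)[OF bounds_in_class(3) e a]
    by (rule L_nn_util0[OF e adm disc_nonneg(1)[OF bz]]) (use exp_util_props(3) disc_nonneg(1)[OF bz] in \<open>auto simp: excess_def b_upper_exp_util dest!: E_setD\<close>)
  have "ennreal (V_zero U (x, \<mu>, z) - U 0) = (\<integral>\<^sup>+p. util0 (snd p + 0) \<partial>\<mu>)"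
    unfolding V_zero_exp_util using E by (intro exp_util_props(3)) auto
  also have "\<dots> \<le> ennreal (L_op M \<beta> (V_zero U) (x, \<mu>, z) a - U 0)"
    unfolding 1 using nn zc by (intro nn_integral_mono util0_mono) auto
  finally show "V_zero U (x, \<mu>, z) \<le> L_op M \<beta> (V_zero U) (x, \<mu>, z) a"
    using L_excess(1)[OF bounds_in_class(1) e a] by (simp add: ennreal_le_iff)
  have "ennreal (b_lower U \<beta> cl (x, \<mu>, z) - U 0) = (\<integral>\<^sup>+p. util0 (snd p + z * cl / (1 - \<beta>)) \<partial>\<mu>)"
    unfolding b_lower_exp_util[OF e] using E disc_nonneg by (intro exp_util_props(3)) auto
  also have "\<dots> \<le> ennreal (L_op M \<beta> (b_lower U \<beta> cl) (x, \<mu>, z) a - U 0)"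
    unfolding 2 disc_split[of z cl, symmetric] using nn zc disc_nonneg(2)[OF bz] by (intro nn_integral_mono util0_mono) (auto simp: algebra_simps)
  finally show "b_lower U \<beta> cl (x, \<mu>, z) \<le> L_op M \<beta> (b_lower U \<beta> cl) (x, \<mu>, z) a"
    using L_excess(1)[OF bounds_in_class(2) e a] by (simp add: ennreal_le_iff)
  have "ennreal (L_op M \<beta> (b_upper U \<beta> cu) (x, \<mu>, z) a - U 0) \<le> (\<integral>\<^sup>+p. util0 (snd p + z * cu / (1 - \<beta>)) \<partial>\<mu>)"
    unfolding 3 disc_split[of z cu, symmetric] using nn zc disc_nonneg(1)[OF bz] by (intro nn_integral_mono util0_mono) (auto simp: algebra_simps)
  also have "\<dots> = ennreal (b_upper U \<beta> cu (x, \<mu>, z) - U 0)"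
    unfolding b_upper_exp_util[OF e] using E disc_nonneg by (intro exp_util_props(3)[symmetric]) auto
  finally show "L_op M \<beta> (b_upper U \<beta> cu) (x, \<mu>, z) a \<le> b_upper U \<beta> cu (x, \<mu>, z)"
    using class_ge_U0[OF bounds_in_class(3) e] by (simp add: ennreal_le_iff)
qed

section \<open>Fixed point and minimizers\<close>

lemma class_lsc: "v \<in> bellman_class \<Longrightarrow> lower_semicont (E_top M) v"
  and class_measurable: "v \<in> bellman_class \<Longrightarrow> v \<in> borel_measurable (E_borel M)"
  by (auto simp: bellman_class_def intro: lower_semicont_measurable)

lemma excess_measurable: "v \<in> bellman_class \<Longrightarrow> excess v \<in> borel_measurable (E_borel M)"
  using class_measurable[of v] unfolding excess_def[abs_def] by measurable

lemma wconv_eventually_eq: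
  assumes "wconv \<mu>s \<mu>" "eventually (\<lambda>n. \<mu>s n = \<nu>s n) sequentially"
  shows "wconv \<nu>s \<mu>"
  unfolding wconv_def
proof (intro allI impI)
  fix G :: "('y \<times> real) set" assume "open G"
  have "eventually (\<lambda>n. emeasure (\<mu>s n) (G \<inter> HSp) = emeasure (\<nu>s n) (G \<inter> HSp)) sequentially"
    using assms(2) by eventually_elim simp
  note eq = Liminf_eq[OF this]
  have "emeasure \<mu> (G \<inter> HSp) \<le> liminf (\<lambda>n. emeasure (\<mu>s n) (G \<inter> HSp))"
    using assms(1) \<open>open G\<close> unfolding wconv_def by blast
  then show "emeasure \<mu> (G \<inter> HSp) \<le> liminf (\<lambda>n. emeasure (\<nu>s n) (G \<inter> HSp))"
    unfolding eq .
qed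

lemma wconv_subseq:
  assumes "wconv \<mu>s \<mu>" "strict_mono r"
  shows "wconv (\<lambda>n. \<mu>s (r n)) \<mu>"
  unfolding wconv_def
proof (intro allI impI)
  fix G :: "('y \<times> real) set" assume "open G"
  then have "emeasure \<mu> (G \<inter> HSp) \<le> liminf (\<lambda>n. emeasure (\<mu>s n) (G \<inter> HSp))" using assms by (simp add: wconv_def)
  also have "\<dots> \<le> liminf ((\<lambda>n. emeasure (\<mu>s n) (G \<inter> HSp)) \<circ> r)" by (rule liminf_subseq_mono[OF assms(2)])
  finally show "emeasure \<mu> (G \<inter> HSp) \<le> liminf (\<lambda>n. emeasure (\<mu>s (r n)) (G \<inter> HSp))" by (simp add: o_def)
qed

lemma econv_subseq: "econv es e \<Longrightarrow> strict_mono r \<Longrightarrow> econv (\<lambda>n. es (r n)) e"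
  unfolding econv_def
  using wconv_subseq[of "\<lambda>n. fst (snd (es n))" _ r]
    LIMSEQ_subseq_LIMSEQ[of "\<lambda>n. fst (es n)" _ r] LIMSEQ_subseq_LIMSEQ[of "\<lambda>n. snd (snd (es n))" _ r]
  by (auto simp: o_def)

lemma econv_const: "econv (\<lambda>_. e) e"
  by (simp add: econv_def wconv_def Liminf_const)

text \<open>Along a subsequence the predictive densities converge for almost every next observation.
  There the updates are eventually defined and converge weakly, so semicontinuity of
  \<open>v\<close> bounds the integrand, and Fatou over the observation finishes. The subsequence is
  harmless because the bounds \<rho> have the limit R along it as well.\<close>

lemma L_joint_lsc:
  assumes v: "v \<in> bellman_class" and e: "(x, \<mu>, z) \<in> E_set M" and es: "\<And>n. (xs n, \<mu>s n, zs n) \<in> E_set M"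
    and conv: "xs \<longlonglongrightarrow> x" "wconv \<mu>s \<mu>" "zs \<longlonglongrightarrow> z" "as \<longlonglongrightarrow> a"
    and a: "a \<in> acts M x" "\<And>n. as n \<in> acts M (xs n)"
    and le: "\<And>n. L_op M \<beta> v (xs n, \<mu>s n, zs n) (as n) \<le> \<rho> n" "\<rho> \<longlonglongrightarrow> R"
  shows "L_op M \<beta> v (x, \<mu>, z) a \<le> R"
proof -
  note E = E_setD[OF e] and Es = E_setD[OF es]
  have adm: "(x, a) \<in> adm M" "\<And>n. (xs n, as n) \<in> adm M" using a by (auto simp: acts_iff)
  have Pb: "\<mu> \<in> Pb M" "\<And>n. \<mu>s n \<in> Pb M" and z: "0 \<le> z" "\<And>n. 0 \<le> zs n"
    using E Es by (auto simp: less_imp_le)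
  obtain r :: "nat \<Rightarrow> nat" where r: "strict_mono r"
    "AE x' in lam. (\<lambda>n. mx (xs (r n)) (as (r n)) x' (\<mu>s (r n))) \<longlonglongrightarrow> mx x a x' \<mu>"
    using mx_subseq[OF adm Pb z conv] by blast
  have conv': "(\<lambda>n. xs (r n)) \<longlonglongrightarrow> x" "wconv (\<lambda>n. \<mu>s (r n)) \<mu>" "(\<lambda>n. zs (r n)) \<longlonglongrightarrow> z" "(\<lambda>n. as (r n)) \<longlonglongrightarrow> a"
    using conv r(1) wconv_subseq LIMSEQ_subseq_LIMSEQ[OF _ r(1)] by (auto simp: o_def)
  have upd_w: "wconv (\<lambda>n. upd (xs (r n)) (as (r n)) x' (\<mu>s (r n)) (zs (r n))) (upd x a x' \<mu> z)"
    if "x' \<in> XX" "update_ok x a x' \<mu>" "(\<lambda>n. mx (xs (r n)) (as (r n)) x' (\<mu>s (r n))) \<longlonglongrightarrow> mx x a x' \<mu>" for x'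
    by (rule upd_wconv[OF adm(1) adm(2) Pb(1) Pb(2) z(1) z(2) conv' that])
  let ?w = "\<lambda>n x'. if update_ok (xs (r n)) (as (r n)) x' (\<mu>s (r n))
    then excess v (x', upd (xs (r n)) (as (r n)) x' (\<mu>s (r n)) (zs (r n)), \<beta> * zs (r n)) else 0"
  let ?F = "\<lambda>n x'. mx (xs (r n)) (as (r n)) x' (\<mu>s (r n)) * ?w n x'"
  have "L_nn (excess v) (x, \<mu>, z) a \<le> (\<integral>\<^sup>+x'. liminf (\<lambda>n. ?F n x') \<partial>lam)"
    unfolding L_nn_def prod.case
  proof (rule nn_integral_mono_AE)
    show "AE x' in lam. mx x a x' \<mu> * (if update_ok x a x' \<mu> then excess v (x', upd x a x' \<mu> z, \<beta> * z) else 0) \<le> liminf (\<lambda>n. ?F n x')"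
      using r(2) AE_space
    proof eventually_elim
      case (elim x')
      show ?case
      proof (cases "update_ok x a x' \<mu>")
        case True
        have x': "x' \<in> XX" using elim by simp
        let ?e = "(x', upd x a x' \<mu> z, \<beta> * z)"
        let ?es = "\<lambda>n. (x', upd (xs (r n)) (as (r n)) x' (\<mu>s (r n)) (zs (r n)), \<beta> * zs (r n))"
        \<comment> \<open>At the finitely many indices where the update is undefined the limiting
          belief is inserted, so that the whole sequence stays in \<open>E_set M\<close> as
          semicontinuity requires.\<close>
        define es' where "es' n = (if update_ok (xs (r n)) (as (r n)) x' (\<mu>s (r n)) then ?es n else (x', upd x a x' \<mu> z, \<beta> * zs (r n)))" for n
        have eE: "?e \<in> E_set M" using E x' True by (intro next_in_E) auto
        have esE: "es' n \<in> E_set M" for n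
        proof (cases "update_ok (xs (r n)) (as (r n)) x' (\<mu>s (r n))")
          case True
          then show ?thesis using Es x' by (auto simp: es'_def intro!: next_in_E)
        next
          case False
          then show ?thesis using E_setD[OF eE] Es[of "r n"] beta x' by (auto simp: es'_def E_set_def mult_le_one)
        qed
        have m: "0 < mx x a x' \<mu>" "mx x a x' \<mu> < \<infinity>" using True by (auto simp: update_ok_def)
        have ok: "eventually (\<lambda>n. update_ok (xs (r n)) (as (r n)) x' (\<mu>s (r n))) sequentially"
          using order_tendstoD(1)[OF elim(1) m(1)] order_tendstoD(2)[OF elim(1) m(2)]
          by eventually_elim (simp add: update_ok_def)
        have "econv es' ?e" unfolding econv_def
        proof (intro conjI)
          have "fst (es' n) = x'" for n by (simp add: es'_def)
          then show "(\<lambda>n. fst (es' n)) \<longlonglongrightarrow> fst ?e" by simp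
          have "snd (snd (es' n)) = \<beta> * zs (r n)" for n by (simp add: es'_def)
          then show "(\<lambda>n. snd (snd (es' n))) \<longlonglongrightarrow> snd (snd ?e)" using conv'(3) by (auto intro: tendsto_intros)
          have "wconv (\<lambda>n. upd (xs (r n)) (as (r n)) x' (\<mu>s (r n)) (zs (r n))) (upd x a x' \<mu> z)"
            by (rule upd_w[OF x' True elim(1)])
          moreover have "eventually (\<lambda>n. upd (xs (r n)) (as (r n)) x' (\<mu>s (r n)) (zs (r n)) = fst (snd (es' n))) sequentially"
            using ok by eventually_elim (simp add: es'_def)
          ultimately show "wconv (\<lambda>n. fst (snd (es' n))) (fst (snd ?e))"
            by (simp add: wconv_eventually_eq)
        qed
        have "excess v ?e \<le> liminf (\<lambda>n. ?w n x')"
          unfolding le_Liminf_iff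
        proof (intro allI impI)
          fix t assume "t < excess v ?e"
          then obtain s where s: "t = ennreal s" "0 \<le> s" "s < v ?e - U 0"
            unfolding excess_def by (cases t) (auto simp: ennreal_less_iff top_unique)
          have "U 0 + s < v ?e" using s by simp
          from lower_semicont_ev[OF class_lsc[OF v] esE eE \<open>econv es' ?e\<close> this] ok
          show "eventually (\<lambda>n. t < ?w n x') sequentially"
            by eventually_elim (use s in \<open>auto simp: es'_def excess_def ennreal_less_iff\<close>)
        qed
        from liminf_mult_ennreal[OF elim(1) m this] True show ?thesis by simp
      qed simp
    qed
  qed
  also have "\<dots> \<le> liminf (\<lambda>n. \<integral>\<^sup>+x'. ?F n x' \<partial>lam)"
    by (rule nn_integral_liminf, rule L_nn_integrand_measurable[OF excess_measurable[OF v]]) (use Es in auto)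
  also have "\<dots> = liminf (\<lambda>n. L_nn (excess v) (xs (r n), \<mu>s (r n), zs (r n)) (as (r n)))"
    by (simp add: L_nn_def)
  also have "\<dots> = liminf (\<lambda>n. ennreal (L_op M \<beta> v (xs (r n), \<mu>s (r n), zs (r n)) (as (r n)) - U 0))"
    using L_excess(2)[OF v es a(2)] by simp
  also have "\<dots> \<le> liminf (\<lambda>n. ennreal (\<rho> (r n) - U 0))"
    by (intro Liminf_mono always_eventually allI ennreal_leI) (simp add: le)
  also have "\<dots> = ennreal (R - U 0)"
  proof (rule lim_imp_Liminf)
    have "(\<lambda>n. \<rho> (r n)) \<longlonglongrightarrow> R" using LIMSEQ_subseq_LIMSEQ[OF le(2) r(1)] by (simp add: o_def)
    then show "(\<lambda>n. ennreal (\<rho> (r n) - U 0)) \<longlonglongrightarrow> ennreal (R - U 0)" by (intro tendsto_intros)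
  qed simp
  finally have "ennreal (L_op M \<beta> v (x, \<mu>, z) a - U 0) \<le> ennreal (R - U 0)"
    using L_excess(2)[OF v e a(1)] by simp
  \<comment> \<open>Needed to return from \<open>ennreal\<close>, which would truncate a negative
    \<open>R - U 0\<close> to 0.\<close>
  moreover have "U 0 \<le> R"
  proof (rule LIMSEQ_le_const[OF le(2)], intro exI allI impI)
    show "U 0 \<le> \<rho> n" for n using L_excess(1)[OF v es a(2), of n] le(1)[of n] by linarith
  qed
  ultimately show ?thesis by (simp add: ennreal_le_iff)
qed

text \<open>Upper semicontinuity of the admissible sets supplies a limit action along a subsequence.
  Existence of minimising actions, semicontinuity of \<open>T_op\<close> and measurability of
  minimizers all rest on this.\<close>

lemma L_joint_usc:
  assumes v: "v \<in> bellman_class" and e: "e \<in> E_set M" and es: "\<And>n. es n \<in> E_set M" and conv: "econv es e"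
    and a: "\<And>n. as n \<in> acts M (fst (es n))"
    and le: "\<And>n. L_op M \<beta> v (es n) (as n) \<le> \<rho> n" "\<rho> \<longlonglongrightarrow> R"
  shows "\<exists>a\<in>acts M (fst e). \<exists>r::nat\<Rightarrow>nat. strict_mono r \<and> (as \<circ> r) \<longlonglongrightarrow> a \<and> L_op M \<beta> v e a \<le> R"
proof -
  have E: "fst e \<in> XX" "fst (es n) \<in> XX" for n using e es[of n] by (auto simp: E_set_def)
  obtain a r where r: "a \<in> acts M (fst e)" "strict_mono (r :: nat \<Rightarrow> nat)" "(as \<circ> r) \<longlonglongrightarrow> a"
    using acts_usc[of "fst e" "\<lambda>n. fst (es n)" as] E a conv unfolding econv_def by blast
  note c = econv_subseq[OF conv r(2), unfolded econv_def]
  have "L_op M \<beta> v (fst e, fst (snd e), snd (snd e)) a \<le> R"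
  proof (rule L_joint_lsc[OF v, where xs="\<lambda>n. fst (es (r n))" and \<mu>s="\<lambda>n. fst (snd (es (r n)))" and zs="\<lambda>n. snd (snd (es (r n)))"
       and as="\<lambda>n. as (r n)" and \<rho>="\<lambda>n. \<rho> (r n)"])
    show "(\<lambda>n. \<rho> (r n)) \<longlonglongrightarrow> R" using LIMSEQ_subseq_LIMSEQ[OF le(2) r(2)] by (simp add: o_def)
  qed (use e es c r a le(1) in \<open>auto simp: o_def\<close>)
  then show ?thesis using r by auto
qed

section \<open>Attainment, monotonicity and invariance of the class\<close>

lemma acts_nonempty: "x \<in> XX \<Longrightarrow> acts M x \<noteq> {}"
  using adm_graph unfolding acts_def by blast

lemma L_ge_U0: "v \<in> bellman_class \<Longrightarrow> e \<in> E_set M \<Longrightarrow> a \<in> acts M (fst e) \<Longrightarrow> U 0 \<le> L_op M \<beta> v e a"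
  using L_excess(1)[of v "fst e" "fst (snd e)" "snd (snd e)" a] by simp

lemma T_le: 
  assumes "v \<in> bellman_class" "e \<in> E_set M" "a \<in> acts M (fst e)" shows "T_op M \<beta> v e \<le> L_op M \<beta> v e a"
  unfolding T_op_def using assms(3) L_ge_U0[OF assms(1,2)] by (intro cINF_lower bdd_belowI[where m="U 0"]) auto

lemma T_ge:
  assumes "e \<in> E_set M" "\<And>a. a \<in> acts M (fst e) \<Longrightarrow> c \<le> L_op M \<beta> v e a" shows "c \<le> T_op M \<beta> v e"
  unfolding T_op_def using assms acts_nonempty[of "fst e"] by (intro cINF_greatest) (auto simp: E_set_def)

lemma T_attained:
  assumes v: "v \<in> bellman_class" and e: "e \<in> E_set M"
  shows "\<exists>a\<in>acts M (fst e). L_op M \<beta> v e a = T_op M \<beta> v e"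
proof -
  have "\<exists>a\<in>acts M (fst e). L_op M \<beta> v e a \<le> T_op M \<beta> v e + 1 / real (Suc n)" for n
  proof (rule ccontr)
    assume "\<not> ?thesis"
    then have "T_op M \<beta> v e + 1 / real (Suc n) \<le> T_op M \<beta> v e"
      by (intro T_ge[OF e]) (auto simp: not_le less_imp_le)
    then show False by simp
  qed
  then obtain as where as: "\<And>n. as n \<in> acts M (fst e)" "\<And>n. L_op M \<beta> v e (as n) \<le> T_op M \<beta> v e + 1 / real (Suc n)"
    by metis
  have "(\<lambda>n. T_op M \<beta> v e + 1 / real (Suc n)) \<longlonglongrightarrow> T_op M \<beta> v e + 0"
    using LIMSEQ_Suc[OF lim_1_over_n] by (intro tendsto_intros) simp
  then obtain a where "a \<in> acts M (fst e)" "L_op M \<beta> v e a \<le> T_op M \<beta> v e"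
    using L_joint_usc[OF v, where e=e and es="\<lambda>_. e" and as=as and \<rho>="\<lambda>n. T_op M \<beta> v e + 1 / real (Suc n)"
        and R="T_op M \<beta> v e"] e econv_const[of e] as by auto
  then show ?thesis using T_le[OF v e] by (auto intro: antisym)
qed

lemma T_shift:
  assumes v: "v \<in> bellman_class" "v' \<in> bellman_class" and e: "(x, \<mu>, z) \<in> E_set M" and k: "0 \<le> k"
    and le: "\<And>x' \<nu>. (x', \<nu>, \<beta> * z) \<in> E_set M \<Longrightarrow> v (x', \<nu>, \<beta> * z) \<le> v' (x', \<nu>, \<beta> * z) + k"
  shows "T_op M \<beta> v (x, \<mu>, z) \<le> T_op M \<beta> v' (x, \<mu>, z) + k"
proof -
  obtain a where a: "a \<in> acts M x" "L_op M \<beta> v' (x, \<mu>, z) a = T_op M \<beta> v' (x, \<mu>, z)"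
    using T_attained[OF v(2) e] by auto
  have "T_op M \<beta> v (x, \<mu>, z) \<le> L_op M \<beta> v (x, \<mu>, z) a" using a by (intro T_le[OF v(1) e]) simp
  also have "\<dots> \<le> L_op M \<beta> v' (x, \<mu>, z) a + k" by (rule L_shift[OF v e a(1) k le])
  finally show ?thesis using a by simp
qed

lemma T_mono:
  assumes v: "v \<in> bellman_class" "v' \<in> bellman_class" and le: "\<And>e. e \<in> E_set M \<Longrightarrow> v e \<le> v' e" and e: "e \<in> E_set M"
  shows "T_op M \<beta> v e \<le> T_op M \<beta> v' e"
  using T_shift[OF v, of "fst e" "fst (snd e)" "snd (snd e)" 0] le e by simp

lemma T_basic:
  assumes e: "e \<in> E_set M"
  shows "V_zero U e \<le> T_op M \<beta> (V_zero U) e" "b_lower U \<beta> cl e \<le> T_op M \<beta> (b_lower U \<beta> cl) e"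
    "T_op M \<beta> (b_upper U \<beta> cu) e \<le> b_upper U \<beta> cu e"
proof -
  have L: "V_zero U e \<le> L_op M \<beta> (V_zero U) e a" "b_lower U \<beta> cl e \<le> L_op M \<beta> (b_lower U \<beta> cl) e a"
    "L_op M \<beta> (b_upper U \<beta> cu) e a \<le> b_upper U \<beta> cu e" if "a \<in> acts M (fst e)" for a
    using L_basic[of "fst e" "fst (snd e)" "snd (snd e)" a] e that by auto
  show "V_zero U e \<le> T_op M \<beta> (V_zero U) e" "b_lower U \<beta> cl e \<le> T_op M \<beta> (b_lower U \<beta> cl) e"
    using L by (auto intro: T_ge[OF e])
  obtain a where "a \<in> acts M (fst e)" using T_attained[OF bounds_in_class(3) e] by blast
  then show "T_op M \<beta> (b_upper U \<beta> cu) e \<le> b_upper U \<beta> cu e"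
    using T_le[OF bounds_in_class(3) e] L(3) by (meson order_trans)
qed

text \<open>Minimising actions chosen along a converging sequence of states accumulate at an
  admissible action of the limit state, which is at least as good as the common level. The upper and
  lower bounds follow from monotonicity and \<open>T_basic\<close>.\<close>

lemma T_in_class:
  assumes v: "v \<in> bellman_class" shows "T_op M \<beta> v \<in> bellman_class"
  unfolding bellman_class_def
proof (intro CollectI conjI ballI)
  show "lower_semicont (E_top M) (T_op M \<beta> v)"
    unfolding lower_semicont_iff
  proof (intro allI impI)
    fix es e r assume *: "\<forall>n. es n \<in> E_set M" "e \<in> E_set M" "econv es e" "\<forall>n. T_op M \<beta> v (es n) \<le> r"
    have "\<exists>a\<in>acts M (fst (es n)). L_op M \<beta> v (es n) a = T_op M \<beta> v (es n)" for n
      using T_attained[OF v] * by blast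
    then obtain as where as: "\<And>n. as n \<in> acts M (fst (es n))" "\<And>n. L_op M \<beta> v (es n) (as n) = T_op M \<beta> v (es n)"
      by metis
    then obtain a where "a \<in> acts M (fst e)" "L_op M \<beta> v e a \<le> r"
      using L_joint_usc[OF v, of e es as "\<lambda>_. r" r] * by auto
    then show "T_op M \<beta> v e \<le> r" using T_le[OF v *(2)] by (meson order_trans)
  qed
  fix e assume e: "e \<in> E_set M"
  have "T_op M \<beta> (V_zero U) e \<le> T_op M \<beta> v e" "T_op M \<beta> v e \<le> T_op M \<beta> (b_upper U \<beta> cu) e"
    using v e by (auto intro!: T_mono bounds_in_class simp: bellman_class_def)
  then show "V_zero U e \<le> T_op M \<beta> v e" "T_op M \<beta> v e \<le> b_upper U \<beta> cu e"
    using T_basic[OF e] by auto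
qed

section \<open>Iterates and their common limit\<close>

abbreviation "Tn n v \<equiv> (T_op M \<beta> ^^ n) v"

lemma Tn_in_class: "v \<in> bellman_class \<Longrightarrow> Tn n v \<in> bellman_class"
  by (induction n) (auto intro: T_in_class)

lemma Tn_mono:
  assumes "v \<in> bellman_class" "v' \<in> bellman_class" "\<And>e. e \<in> E_set M \<Longrightarrow> v e \<le> v' e" "e \<in> E_set M"
  shows "Tn n v e \<le> Tn n v' e"
  using assms(4) by (induction n arbitrary: e) (auto intro!: T_mono Tn_in_class assms(1,2) assms(3))

lemma Tn_incseq:
  assumes "v \<in> bellman_class" "\<And>e. e \<in> E_set M \<Longrightarrow> v e \<le> T_op M \<beta> v e" "e \<in> E_set M"
  shows "incseq (\<lambda>n. Tn n v e)"
proof (rule incseq_SucI)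
  fix n show "Tn n v e \<le> Tn (Suc n) v e"
    using Tn_mono[OF assms(1) T_in_class[OF assms(1)] assms(2,3), of n] by (simp add: funpow_swap1)
qed

lemma Tn_decseq:
  assumes "v \<in> bellman_class" "\<And>e. e \<in> E_set M \<Longrightarrow> T_op M \<beta> v e \<le> v e" "e \<in> E_set M"
  shows "decseq (\<lambda>n. Tn n v e)"
proof (rule decseq_SucI)
  fix n show "Tn (Suc n) v e \<le> Tn n v e"
    using Tn_mono[OF T_in_class[OF assms(1)] assms(1) assms(2,3), of n] by (simp add: funpow_swap1)
qed

text \<open>What costs after stage \<open>n\<close> can add to utility when nothing has been
  accumulated. The identity \<open>gap n (\<beta> * z) = gap (Suc n) z\<close> drives the induction
  over iterates.\<close>

definition gap where "gap n z = U (\<beta> ^ n * z * cu / (1 - \<beta>)) - U 0"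

lemma gap_nonneg: "0 \<le> z \<Longrightarrow> 0 \<le> gap n z"
  using disc_nonneg(1)[of "\<beta> ^ n * z"] beta by (auto simp: gap_def intro!: U_mono)

lemma gap_lim:
  assumes "0 \<le> z" shows "(\<lambda>n. gap n z) \<longlonglongrightarrow> 0"
proof -
  have "(\<lambda>n. \<beta> ^ n * (z * cu / (1 - \<beta>))) \<longlonglongrightarrow> 0 * (z * cu / (1 - \<beta>))"
    using beta by (intro tendsto_intros LIMSEQ_realpow_zero) auto
  then have "(\<lambda>n. \<beta> ^ n * z * cu / (1 - \<beta>)) \<longlonglongrightarrow> 0" by (simp add: algebra_simps)
  moreover have "0 \<le> \<beta> ^ n * z * cu / (1 - \<beta>)" for n using disc_nonneg(1)[of "\<beta> ^ n * z"] beta assms by auto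
  ultimately have "(\<lambda>n. U (\<beta> ^ n * z * cu / (1 - \<beta>))) \<longlonglongrightarrow> U 0"
    by (intro continuous_on_tendsto_compose[OF U_continuous]) auto
  then show ?thesis unfolding gap_def using tendsto_diff[OF _ tendsto_const[of "U 0"]] by fastforce
qed

text \<open>Concavity enters here: it bounds the gap between the iterates uniformly in the belief.\<close>

lemma Tn_gap:
  assumes "(x, \<mu>, z) \<in> E_set M"
  shows "Tn n (b_upper U \<beta> cu) (x, \<mu>, z) \<le> Tn n (V_zero U) (x, \<mu>, z) + gap n z"
  using assms
proof (induction n arbitrary: x \<mu> z)
  case 0
  then show ?case
    using E_setD[OF 0] disc_nonneg(1)[of z] exp_util_shift[of \<mu> "z * cu / (1 - \<beta>)"] by (simp add: b_upper_exp_util V_zero_exp_util gap_def)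
next
  case (Suc n)
  have "T_op M \<beta> (Tn n (b_upper U \<beta> cu)) (x, \<mu>, z) \<le> T_op M \<beta> (Tn n (V_zero U)) (x, \<mu>, z) + gap (Suc n) z"
  proof (rule T_shift[OF Tn_in_class[OF bounds_in_class(3)] Tn_in_class[OF bounds_in_class(1)] Suc.prems])
    show "0 \<le> gap (Suc n) z" using E_setD[OF Suc.prems] by (intro gap_nonneg) auto
    fix x' \<nu> assume "(x', \<nu>, \<beta> * z) \<in> E_set M"
    from Suc.IH[OF this]
    show "Tn n (b_upper U \<beta> cu) (x', \<nu>, \<beta> * z) \<le> Tn n (V_zero U) (x', \<nu>, \<beta> * z) + gap (Suc n) z"
      by (simp add: gap_def mult_ac)
  qed
  then show ?case by simp
qed

text \<open>Taken along the decreasing iterates, which converge because they are bounded below by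
  \<open>U 0\<close>; the other sequences are compared with this one.\<close>

definition Vlim where "Vlim e = lim (\<lambda>n. Tn n (b_upper U \<beta> cu) e)"

lemma between_order:
  assumes "v \<in> bellman_class" "e \<in> E_set M"
  shows "Tn n (V_zero U) e \<le> Tn n v e" "Tn n v e \<le> Tn n (b_upper U \<beta> cu) e"
  using assms by (auto intro!: Tn_mono bounds_in_class simp: bellman_class_def)

lemma Vlim_upper_lim:
  assumes "e \<in> E_set M"
  shows "(\<lambda>n. Tn n (b_upper U \<beta> cu) e) \<longlonglongrightarrow> Vlim e"
proof -
  have "decseq (\<lambda>n. Tn n (b_upper U \<beta> cu) e)" by (rule Tn_decseq[OF bounds_in_class(3) T_basic(3) assms])
  then have "convergent (\<lambda>n. Tn n (b_upper U \<beta> cu) e)"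
    using class_ge_U0[OF Tn_in_class[OF bounds_in_class(3)] assms] decseq_convergent[of "\<lambda>n. Tn n (b_upper U \<beta> cu) e" "U 0"]
    unfolding convergent_def by metis
  then show ?thesis unfolding Vlim_def by (simp add: convergent_LIMSEQ_iff)
qed

text \<open>Any starting function in the class lies between \<open>V_zero\<close> and
  \<open>b_upper\<close>, and so do the iterates; stating this for all of them makes uniqueness of
  the fixed point a corollary.\<close>

lemma Vlim_lim:
  assumes v: "v \<in> bellman_class" and e: "e \<in> E_set M"
  shows "(\<lambda>n. Tn n v e) \<longlonglongrightarrow> Vlim e"
proof -
  have z: "(fst e, fst (snd e), snd (snd e)) \<in> E_set M" "0 \<le> snd (snd e)" using e by (auto simp: E_set_def)
  have lo: "(\<lambda>n. Tn n (b_upper U \<beta> cu) e - gap n (snd (snd e))) \<longlonglongrightarrow> Vlim e - 0"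
    by (intro tendsto_diff Vlim_upper_lim[OF e] gap_lim z)
  show ?thesis
  proof (rule tendsto_sandwich[OF _ _ lo[simplified] Vlim_upper_lim[OF e]])
    show "\<forall>\<^sub>F n in sequentially. Tn n (b_upper U \<beta> cu) e - gap n (snd (snd e)) \<le> Tn n v e"
      using Tn_gap[OF z(1)] between_order(1)[OF v e] by (intro always_eventually allI) (smt (verit) prod.collapse)
    show "\<forall>\<^sub>F n in sequentially. Tn n v e \<le> Tn n (b_upper U \<beta> cu) e"
      using between_order(2)[OF v e] by (intro always_eventually allI)
  qed
qed

lemma Tn_low_le_Vlim: "e \<in> E_set M \<Longrightarrow> Tn n (b_lower U \<beta> cl) e \<le> Vlim e"
  by (rule incseq_le[OF Tn_incseq[OF bounds_in_class(2) T_basic(2)] Vlim_lim[OF bounds_in_class(2)]])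

lemma Vlim_le_Tn_up: "e \<in> E_set M \<Longrightarrow> Vlim e \<le> Tn n (b_upper U \<beta> cu) e"
  by (rule decseq_ge[OF Tn_decseq[OF bounds_in_class(3) T_basic(3)] Vlim_lim[OF bounds_in_class(3)]])

lemma Vlim_bounds: "e \<in> E_set M \<Longrightarrow> b_lower U \<beta> cl e \<le> Vlim e" "e \<in> E_set M \<Longrightarrow> Vlim e \<le> b_upper U \<beta> cu e"
  using Tn_low_le_Vlim[of e 0] Vlim_le_Tn_up[of e 0] by auto

text \<open>Semicontinuity comes from below: \<open>Vlim\<close> is the increasing limit of the
  semicontinuous iterates of \<open>b_lower\<close>, so a level bounding \<open>Vlim\<close> along a
  sequence bounds each iterate there.\<close>

lemma Vlim_in_class: "Vlim \<in> bellman_class"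
  unfolding bellman_class_def
proof (intro CollectI conjI ballI)
  show "lower_semicont (E_top M) Vlim"
    unfolding lower_semicont_iff
  proof (intro allI impI)
    fix es e r assume *: "\<forall>n. es n \<in> E_set M" "e \<in> E_set M" "econv es e" "\<forall>n. Vlim (es n) \<le> r"
    show "Vlim e \<le> r"
    proof (rule LIMSEQ_le_const2[OF Vlim_lim[OF bounds_in_class(2) *(2)]], intro exI allI impI)
      fix k
      have "\<forall>n. Tn k (b_lower U \<beta> cl) (es n) \<le> r" using * Tn_low_le_Vlim by (meson order_trans)
      then show "Tn k (b_lower U \<beta> cl) e \<le> r"
        using class_lsc[OF Tn_in_class[OF bounds_in_class(2)], of k] * unfolding lower_semicont_iff by blast
    qed
  qed
  fix e assume e: "e \<in> E_set M"
  show "V_zero U e \<le> Vlim e" using Vlim_bounds(1)[OF e] bounds_in_class(2) e by (force simp: bellman_class_def)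
  show "Vlim e \<le> b_upper U \<beta> cu e" by (rule Vlim_bounds(2)[OF e])
qed

text \<open>Monotone approximation from both sides replaces an exchange of limit and infimum:
  \<open>Vlim\<close> lies below the decreasing and above the increasing iterates, and monotonicity
  of \<open>T_op\<close> gives one inequality from each.\<close>

lemma T_Vlim: "e \<in> E_set M \<Longrightarrow> T_op M \<beta> Vlim e = Vlim e"
proof (rule antisym)
  assume e: "e \<in> E_set M"
  show "T_op M \<beta> Vlim e \<le> Vlim e"
  proof (rule LIMSEQ_le_const[OF LIMSEQ_Suc[OF Vlim_upper_lim[OF e]]], intro exI allI impI)
    show "T_op M \<beta> Vlim e \<le> Tn (Suc n) (b_upper U \<beta> cu) e" for n
      using T_mono[OF Vlim_in_class Tn_in_class[OF bounds_in_class(3)] Vlim_le_Tn_up e] by simp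
  qed
  show "Vlim e \<le> T_op M \<beta> Vlim e"
  proof (rule LIMSEQ_le_const2[OF LIMSEQ_Suc[OF Vlim_lim[OF bounds_in_class(2) e]]], intro exI allI impI)
    show "Tn (Suc n) (b_lower U \<beta> cl) e \<le> T_op M \<beta> Vlim e" for n
      using T_mono[OF Tn_in_class[OF bounds_in_class(2)] Vlim_in_class Tn_low_le_Vlim e] by simp
  qed
qed

lemma Vlim_unique:
  assumes v: "v \<in> bellman_class" and fp: "\<And>e. e \<in> E_set M \<Longrightarrow> v e = T_op M \<beta> v e" and e: "e \<in> E_set M"
  shows "v e = Vlim e"
proof -
  have "Tn n v e = v e" if "e \<in> E_set M" for n e
    using that
  proof (induction n arbitrary: e)
    case (Suc n)
    have "T_op M \<beta> (Tn n v) e = T_op M \<beta> v e"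
      using Suc by (intro antisym T_mono Tn_in_class v) auto
    then show ?case using fp[OF Suc.prems] by simp
  qed simp
  then have "(\<lambda>n. Tn n v e) \<longlonglongrightarrow> v e" using e by simp
  then show ?thesis using Vlim_lim[OF v e] LIMSEQ_unique by blast
qed

text \<open>Functions such as \<open>V_inf\<close> and \<open>Vlim\<close> are compared on
  \<open>E_set M\<close> only, and the operator evaluates its argument there only.\<close>

lemma L_op_cong:
  assumes "\<And>e. e \<in> E_set M \<Longrightarrow> v e = v' e" and e: "e \<in> E_set M" and a: "a \<in> acts M (fst e)"
  shows "L_op M \<beta> v e a = L_op M \<beta> v' e a"
proof -
  obtain x \<mu> z where exz: "e = (x, \<mu>, z)" by (cases e)
  note E = E_setD[OF e[unfolded exz]]
  have adm: "(x, a) \<in> adm M" using a exz by (simp add: acts_iff)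
  show ?thesis unfolding exz L_op_def prod.case
  proof (rule Bochner_Integration.integral_cong[OF refl])
    fix x' assume "x' \<in> space (kernelX M x (margY M \<mu>) a)"
    then have x': "x' \<in> XX" by (simp add: kernelX_def)
    show "(if Psi_ok M x a x' \<mu> then v (x', Psi M x a x' \<mu> z, \<beta> * z) else 0) =
      (if Psi_ok M x a x' \<mu> then v' (x', Psi M x a x' \<mu> z, \<beta> * z) else 0)"
      using assms(1) next_in_E[of \<mu> z x' x a] E x' Pb_D(4)[of \<mu>]
      by (auto simp: Psi_ok_iff Psi_eq[OF adm])
  qed
qed

lemma T_op_cong:
  assumes "\<And>e. e \<in> E_set M \<Longrightarrow> v e = v' e" and e: "e \<in> E_set M"
  shows "T_op M \<beta> v e = T_op M \<beta> v' e"
  unfolding T_op_def using L_op_cong[OF assms] by (intro INF_cong) auto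

text \<open>The minimising actions form a compact set by semicontinuity in the action, so the
  selection theorem applies once the sets of states whose minimisers meet a closed set are
  Borel.\<close>

lemma minimizer_exists:
  assumes v: "v \<in> bellman_class" shows "\<exists>f. minimizer M \<beta> v f"
proof -
  define G where "G e = {a\<in>acts M (fst e). L_op M \<beta> v e a \<le> T_op M \<beta> v e}" for e
  have XX: "fst e \<in> XX" if "e \<in> E_set M" for e using that by (auto simp: E_set_def)
  have "\<exists>f\<in>E_borel M \<rightarrow>\<^sub>M borel. \<forall>e\<in>space (E_borel M). f e \<in> G e"
  proof (rule compact_valued_measurable_selection)
    fix e assume "e \<in> space (E_borel M)"
    then have e: "e \<in> E_set M" by simp
    show "G e \<noteq> {}" using T_attained[OF v e] by (auto simp: G_def)
    have c: "compact (acts M (fst e))" by (rule acts_compact[OF XX[OF e]])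
    have "closed (G e)" unfolding closed_sequential_limits
    proof (intro allI impI, elim conjE)
      fix as a assume as: "\<forall>n. as n \<in> G e" "as \<longlonglongrightarrow> a"
      have "a \<in> acts M (fst e)"
        using compact_imp_closed[OF c] as unfolding closed_sequential_limits G_def by blast
      moreover have "L_op M \<beta> v (fst e, fst (snd e), snd (snd e)) a \<le> T_op M \<beta> v e"
        by (rule L_joint_lsc[OF v, where xs="\<lambda>_. fst e" and \<mu>s="\<lambda>_. fst (snd e)" and zs="\<lambda>_. snd (snd e)" and as=as and \<rho>="\<lambda>_. T_op M \<beta> v e"])
          (use e as calculation econv_const[of e] in \<open>auto simp: G_def econv_def\<close>)
      ultimately show "a \<in> G e" by (simp add: G_def)
    qed
    moreover have "G e \<subseteq> acts M (fst e)" by (auto simp: G_def)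
    ultimately show "compact (G e)" using c compact_Int_closed[of "acts M (fst e)" "G e"] by (simp add: Int_absorb1)
  next
    fix C :: "'a set" assume C: "closed C"
    \<comment> \<open>States from which some action in \<open>C\<close> achieves the level
      \<open>q\<close>. By \<open>hit\<close> such a set is sequentially closed, hence Borel; the
      levels \<rho> in \<open>hit\<close> are allowed to vary because they also have to decrease to
      the minimal value.\<close>
    define A where "A q = {e\<in>E_set M. \<exists>a\<in>acts M (fst e) \<inter> C. L_op M \<beta> v e a \<le> q}" for q :: real
    have hit: "\<exists>a\<in>acts M (fst e) \<inter> C. L_op M \<beta> v e a \<le> R"
      if e: "e \<in> E_set M" and es: "\<And>n. es n \<in> A (\<rho> n)" and cv: "econv es e" and \<rho>: "\<rho> \<longlonglongrightarrow> R" for e es \<rho> R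
    proof -
      have "\<exists>a. a \<in> acts M (fst (es n)) \<and> a \<in> C \<and> L_op M \<beta> v (es n) a \<le> \<rho> n" for n using es[of n] by (auto simp: A_def)
      then obtain as where as: "\<And>n. as n \<in> acts M (fst (es n))" "\<And>n. as n \<in> C" "\<And>n. L_op M \<beta> v (es n) (as n) \<le> \<rho> n" by metis
      have esE: "es n \<in> E_set M" for n using es[of n] by (auto simp: A_def)
      obtain a r where a: "a \<in> acts M (fst e)" "strict_mono (r :: nat \<Rightarrow> nat)" "(as \<circ> r) \<longlonglongrightarrow> a" "L_op M \<beta> v e a \<le> R"
        using L_joint_usc[OF v e esE cv as(1) as(3) \<rho>] by blast
      have "a \<in> C" using C a(3) as(2) unfolding closed_sequential_limits by (metis comp_apply)
      then show ?thesis using a by blast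
    qed
    have Aset: "A q \<in> sets (E_borel M)" for q
    proof -
      have "seq_open (E_set M - A q)"
        unfolding seq_open_def
      proof (intro conjI allI impI)
        fix es e assume "\<forall>n. es n \<in> E_set M - (E_set M - A q)" "e \<in> E_set M" "econv es e"
        then show "e \<notin> E_set M - A q"
          using hit[of e es "\<lambda>_. q" q] by (auto simp: A_def)
      qed auto
      then have "space (E_borel M) - (E_set M - A q) \<in> sets (E_borel M)" by (intro sets.compl_sets seq_open_E_borel)
      also have "space (E_borel M) - (E_set M - A q) = A q" by (auto simp: A_def)
      finally show ?thesis .
    qed
    have [measurable]: "T_op M \<beta> v \<in> borel_measurable (E_borel M)" by (rule class_measurable[OF T_in_class[OF v]])
    \<comment> \<open>An action in \<open>C\<close> attains the minimum iff every rational level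
      above the minimum is reached in \<open>C\<close>; the nontrivial direction applies
      \<open>hit\<close> to the constant sequence of states and rational levels decreasing to the
      minimum.\<close>
    have "{e\<in>space (E_borel M). G e \<inter> C \<noteq> {}} = {e\<in>space (E_borel M). \<forall>q::rat. T_op M \<beta> v e < of_rat q \<longrightarrow> e \<in> A (of_rat q)}"
    proof (intro set_eqI iffI)
      fix e
      show "e \<in> {e\<in>space (E_borel M). G e \<inter> C \<noteq> {}} \<Longrightarrow> e \<in> {e\<in>space (E_borel M). \<forall>q::rat. T_op M \<beta> v e < of_rat q \<longrightarrow> e \<in> A (of_rat q)}"
      proof -
        assume "e \<in> {e\<in>space (E_borel M). G e \<inter> C \<noteq> {}}"
        then obtain a where "e \<in> E_set M" "a \<in> acts M (fst e) \<inter> C" "L_op M \<beta> v e a \<le> T_op M \<beta> v e"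
          by (auto simp: G_def)
        then show ?thesis unfolding A_def by (force intro: order_trans less_imp_le)
      qed
    next
      fix e assume *: "e \<in> {e\<in>space (E_borel M). \<forall>q::rat. T_op M \<beta> v e < of_rat q \<longrightarrow> e \<in> A (of_rat q)}"
      then have e: "e \<in> E_set M" by simp
      have "\<exists>q::rat. T_op M \<beta> v e < of_rat q \<and> of_rat q < T_op M \<beta> v e + 1 / real (Suc n)" for n
        using of_rat_dense[of "T_op M \<beta> v e" "T_op M \<beta> v e + 1 / real (Suc n)"] by simp
      then obtain q :: "nat \<Rightarrow> rat" where q: "\<And>n. T_op M \<beta> v e < of_rat (q n)" "\<And>n. of_rat (q n) < T_op M \<beta> v e + 1 / real (Suc n)"
        by metis
      have up: "(\<lambda>n. T_op M \<beta> v e + 1 / real (Suc n)) \<longlonglongrightarrow> T_op M \<beta> v e + 0"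
        using LIMSEQ_Suc[OF lim_1_over_n] by (intro tendsto_intros) simp
      have "(\<lambda>n. real_of_rat (q n)) \<longlonglongrightarrow> T_op M \<beta> v e"
        by (rule tendsto_sandwich[OF _ _ tendsto_const up[simplified]])
           (use q in \<open>auto intro!: always_eventually less_imp_le simp: less_imp_le\<close>)
      then have "\<exists>a\<in>acts M (fst e) \<inter> C. L_op M \<beta> v e a \<le> T_op M \<beta> v e"
        using q(1) * by (intro hit[OF e _ econv_const]) auto
      then show "e \<in> {e\<in>space (E_borel M). G e \<inter> C \<noteq> {}}" using e by (auto simp: G_def)
    qed
    also have "\<dots> \<in> sets (E_borel M)"
    proof (rule sets.sets_Collect_countable_All, rule sets.sets_Collect_imp)
      fix q :: rat
      show "{e\<in>space (E_borel M). e \<in> A (of_rat q)} \<in> sets (E_borel M)" using Aset by measurable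
      show "{e\<in>space (E_borel M). T_op M \<beta> v e < of_rat q} \<in> sets (E_borel M)" by measurable
    qed
    finally show "{e\<in>space (E_borel M). G e \<inter> C \<noteq> {}} \<in> sets (E_borel M)" .
  qed
  then obtain f where f: "f \<in> E_borel M \<rightarrow>\<^sub>M borel" "\<And>e. e \<in> E_set M \<Longrightarrow> f e \<in> G e" by auto
  have "f e \<in> act_space M" if "e \<in> E_set M" for e
    using f(2)[OF that] adm_subset by (auto simp: G_def acts_iff)
  then have "f \<in> E_borel M \<rightarrow>\<^sub>M act_borel M"
    unfolding act_borel_def using f(1) by (intro measurable_restrict_space2) auto
  moreover have "L_op M \<beta> v e (f e) = T_op M \<beta> v e" if "e \<in> E_set M" for e
    using f(2)[OF that] T_le[OF v that] by (auto simp: G_def intro: antisym)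
  ultimately have "minimizer M \<beta> v f" using f(2) by (auto simp: minimizer_def F_rules_def G_def)
  then show ?thesis by blast
qed

section \<open>Histories and the law of the process\<close>

abbreviation "SXY \<equiv> obs_borel M \<Otimes>\<^sub>M hid_borel M"
abbreviation "Om I \<equiv> PiM I (\<lambda>_::nat. SXY)"

lemma space_SXY[simp]: "space SXY = XX \<times> YY" by (simp add: space_pair_measure)

lemma kernel_subprob_measurable:
  assumes "f1 \<in> N \<rightarrow>\<^sub>M obs_borel M" "f2 \<in> N \<rightarrow>\<^sub>M hid_borel M" "f3 \<in> N \<rightarrow>\<^sub>M act_borel M"
    and "\<And>w. w \<in> space N \<Longrightarrow> (f1 w, f3 w) \<in> adm M"
  shows "(\<lambda>w. kernel M (f1 w) (f2 w) (f3 w)) \<in> N \<rightarrow>\<^sub>M subprob_algebra SXY"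
proof -
  note [measurable] = obs_borelD[OF assms(1)] hid_borelD[OF assms(2)] act_borelD[OF assms(3)]
  have "(\<lambda>w. (f1 w, f2 w, f3 w)) \<in> N \<rightarrow>\<^sub>M restrict_space borel (cost_dom M)"
  proof (rule measurable_restrict_space2)
    show "(\<lambda>w. (f1 w, f2 w, f3 w)) \<in> space N \<rightarrow> cost_dom M"
      using assms(4) measurable_space[OF assms(2)] by (auto simp: cost_dom_def)
    show "(\<lambda>w. (f1 w, f2 w, f3 w)) \<in> N \<rightarrow>\<^sub>M borel"
      by (intro borel_measurable_Pair obs_borelD[OF assms(1)] hid_borelD[OF assms(2)] act_borelD[OF assms(3)])
  qed
  from measurable_compose[OF this kernel]
  have "(\<lambda>w. kernel M (f1 w) (f2 w) (f3 w)) \<in> N \<rightarrow>\<^sub>M prob_algebra SXY" by simp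
  then show ?thesis by (rule measurable_prob_algebraD)
qed

section \<open>Actions along observed paths\<close>

lemma policyD:
  assumes "g \<in> policies M"
  shows "g n \<in> hist_space M n \<rightarrow>\<^sub>M act_borel M"
    "(xs, as) \<in> space (hist_space M n) \<Longrightarrow> g n (xs, as) \<in> acts M (xs n)"
  using assms by (auto simp: policies_def)

text \<open>Formulated for an arbitrary measurable family of observations, so that it serves paths
  of the full process and paths of observations alike.\<close>

lemma past_actions_measurable:
  assumes g: "g \<in> policies M"
  shows "(\<And>i. i < n \<Longrightarrow> (\<lambda>w. X w i) \<in> N \<rightarrow>\<^sub>M obs_borel M) \<Longrightarrow>
    (\<lambda>w. past_actions g (X w) n) \<in> N \<rightarrow>\<^sub>M PiM {..<n} (\<lambda>_. act_borel M)"
proof (induction n)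
  case 0
  have "(\<lambda>_. undefined) \<in> space (PiM {..<0::nat} (\<lambda>_. act_borel M))" by (simp add: space_PiM)
  then show ?case unfolding past_actions.simps by (rule measurable_const)
next
  case (Suc n)
  have [measurable]: "(\<lambda>w. past_actions g (X w) n) \<in> N \<rightarrow>\<^sub>M PiM {..<n} (\<lambda>_. act_borel M)"
    by (rule Suc.IH) (rule Suc.prems, simp)
  have [measurable]: "(\<lambda>w. restrict (X w) {..n}) \<in> N \<rightarrow>\<^sub>M PiM {..n} (\<lambda>_. obs_borel M)"
    by (rule measurable_restrict) (rule Suc.prems, simp)
  have "(\<lambda>w. (restrict (X w) {..n}, past_actions g (X w) n)) \<in> N \<rightarrow>\<^sub>M hist_space M n"
    unfolding hist_space_def by (rule measurable_Pair) fact+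
  from measurable_compose[OF this policyD(1)[OF g]]
  have "(\<lambda>w. (past_actions g (X w) n)(n := g n (restrict (X w) {..n}, past_actions g (X w) n)))
      \<in> N \<rightarrow>\<^sub>M PiM {..<Suc n} (\<lambda>_. act_borel M)"
    by (intro measurable_fun_upd[where J="{..<n}"]) (auto simp: lessThan_Suc)
  then show ?case unfolding past_actions.simps .
qed

lemma hist_measurable:
  assumes g: "g \<in> policies M" and X: "\<And>i. i \<le> n \<Longrightarrow> (\<lambda>w. X w i) \<in> N \<rightarrow>\<^sub>M obs_borel M"
  shows "(\<lambda>w. (restrict (X w) {..n}, past_actions g (X w) n)) \<in> N \<rightarrow>\<^sub>M hist_space M n"
proof -
  have [measurable]: "(\<lambda>w. past_actions g (X w) n) \<in> N \<rightarrow>\<^sub>M PiM {..<n} (\<lambda>_. act_borel M)"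
    by (rule past_actions_measurable[OF g]) (rule X, simp)
  have [measurable]: "(\<lambda>w. restrict (X w) {..n}) \<in> N \<rightarrow>\<^sub>M PiM {..n} (\<lambda>_. obs_borel M)"
    by (rule measurable_restrict) (rule X, simp)
  show ?thesis unfolding hist_space_def by (rule measurable_Pair) fact+
qed

lemma action_measurable:
  assumes g: "g \<in> policies M" and X: "\<And>i. i \<le> n \<Longrightarrow> (\<lambda>w. X w i) \<in> N \<rightarrow>\<^sub>M obs_borel M"
  shows "(\<lambda>w. action g (X w) n) \<in> N \<rightarrow>\<^sub>M act_borel M"
  unfolding action_def by (rule measurable_compose[OF hist_measurable[OF assms] policyD(1)[OF g]])

lemma hist_in_space:
  assumes g: "g \<in> policies M" and xs: "\<And>i. i \<le> n \<Longrightarrow> xs i \<in> XX"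
  shows "(restrict xs {..n}, past_actions g xs n) \<in> space (hist_space M n)"
proof -
  \<comment> \<open>Membership of a single history is read off from measurability over a one-point
    space.\<close>
  have "(\<lambda>w. (restrict ((\<lambda>_. xs) w) {..n}, past_actions g ((\<lambda>_. xs) w) n)) \<in> count_space {()} \<rightarrow>\<^sub>M hist_space M n"
    by (rule hist_measurable[OF g]) (use xs in auto)
  from measurable_space[OF this, of "()"] show ?thesis by simp
qed

lemma action_adm:
  assumes g: "g \<in> policies M" and xs: "\<And>i. i \<le> n \<Longrightarrow> xs i \<in> XX"
  shows "(xs n, action g xs n) \<in> adm M"
  using policyD(2)[OF g hist_in_space[OF assms]] by (simp add: action_def acts_iff)

lemma past_actions_cong: "(\<And>i. i < n \<Longrightarrow> xs i = ys i) \<Longrightarrow> past_actions g xs n = past_actions g ys n"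
proof (induction n)
  case (Suc n)
  then have "past_actions g xs n = past_actions g ys n" "restrict xs {..n} = restrict ys {..n}"
    by (auto simp: restrict_def)
  then show ?case by simp
qed simp

lemma action_cong:
  assumes "\<And>i. i \<le> n \<Longrightarrow> xs i = ys i" shows "action g xs n = action g ys n"
proof -
  have "past_actions g xs n = past_actions g ys n" "restrict xs {..n} = restrict ys {..n}"
    using assms past_actions_cong[of n xs ys g] by (auto simp: restrict_def)
  then show ?thesis by (simp add: action_def)
qed

lemma past_actions_action: "k < n \<Longrightarrow> past_actions g xs n k = action g xs k"
  by (induction n) (auto simp: action_def less_Suc_eq)

text \<open>The filter with \<open>upd\<close> for \<open>Psi\<close>, started at an arbitrary
  belief and scale: \<open>V_inf\<close> refers to all initial states, not only to the one of the
  original problem. Undefined updates appear as null measures instead of a separate definedness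
  predicate.\<close>

primrec hist_belief :: "('y \<times> real) measure \<Rightarrow> real \<Rightarrow> nat \<Rightarrow> ('x, 'a) hist \<Rightarrow> ('y \<times> real) measure" where
  "hist_belief \<mu> z 0 h = \<mu>"
| "hist_belief \<mu> z (Suc n) h = upd (fst h n) (snd h n) (fst h (Suc n)) (hist_belief \<mu> z n h) (\<beta> ^ n * z)"

lemma hist_belief_cong:
  "(\<And>i. i \<le> n \<Longrightarrow> fst h i = fst h' i) \<Longrightarrow> (\<And>i. i < n \<Longrightarrow> snd h i = snd h' i) \<Longrightarrow> hist_belief \<mu> z n h = hist_belief \<mu> z n h'"
  by (induction n) auto

lemma bz_nonneg: "0 \<le> z \<Longrightarrow> 0 \<le> \<beta> ^ n * z" using beta by simp

lemma hist_belief_measurable: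
  assumes \<mu>: "\<mu> \<in> space SP" and z: "0 \<le> z"
  shows "(\<And>i. i \<le> n \<Longrightarrow> (\<lambda>w. X w i) \<in> N \<rightarrow>\<^sub>M obs_borel M) \<Longrightarrow> (\<And>i. i < n \<Longrightarrow> (\<lambda>w. A w i) \<in> N \<rightarrow>\<^sub>M act_borel M) \<Longrightarrow>
    (\<lambda>w. hist_belief \<mu> z n (X w, A w)) \<in> N \<rightarrow>\<^sub>M SP"
proof (induction n)
  case 0 show ?case unfolding hist_belief.simps using \<mu> by (rule measurable_const)
next
  case (Suc n)
  have "(\<lambda>w. hist_belief \<mu> z n (X w, A w)) \<in> N \<rightarrow>\<^sub>M SP"
    by (rule Suc.IH) (rule Suc.prems, simp)+
  moreover have "(\<lambda>w. X w n) \<in> N \<rightarrow>\<^sub>M borel" "(\<lambda>w. X w (Suc n)) \<in> N \<rightarrow>\<^sub>M borel" "(\<lambda>w. A w n) \<in> N \<rightarrow>\<^sub>M borel"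
    by (rule obs_borelD act_borelD, rule Suc.prems, simp)+
  ultimately show ?case unfolding hist_belief.simps fst_conv snd_conv
    by (intro upd_measurable bz_nonneg z)
qed

lemma hist_belief_SP: "\<mu> \<in> space SP \<Longrightarrow> 0 \<le> z \<Longrightarrow> hist_belief \<mu> z n h \<in> space SP"
  by (induction n) (auto intro!: upd_SP bz_nonneg)

lemma mx_null:
  assumes "\<mu> \<in> space SP" "emeasure \<mu> HSp = 0" shows "mx x a x' \<mu> = 0"
proof -
  have "AE p in \<mu>. False"
    by (rule AE_I[of _ _ HSp]) (use assms SP_D(2,3)[OF assms(1)] sets.top[of \<mu>] in auto)
  then have "mx x a x' \<mu> = (\<integral>\<^sup>+p. 0 \<partial>\<mu>)" unfolding mx_def by (intro nn_integral_cong_AE) auto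
  then show ?thesis by simp
qed

text \<open>An update has mass 1 or 0, and mass 1 requires a genuine predecessor since a null belief
  has denominator 0. Membership in \<open>Pb M\<close> is thereby a condition on the total mass,
  which is visibly measurable.\<close>

lemma hist_belief_dichotomy:
  assumes \<mu>: "\<mu> \<in> Pb M" and z: "0 \<le> z"
  shows "hist_belief \<mu> z n h \<in> Pb M \<or> emeasure (hist_belief \<mu> z n h) HSp = 0"
proof (induction n)
  case 0 then show ?case using \<mu> by simp
next
  case (Suc n)
  note SPn = hist_belief_SP[OF Pb_D(4)[OF \<mu>] z, of n h]
  show ?case
  proof (cases "update_ok (fst h n) (snd h n) (fst h (Suc n)) (hist_belief \<mu> z n h)")
    case True
    then have "hist_belief \<mu> z n h \<in> Pb M" using Suc mx_null[OF SPn] by (auto simp: update_ok_def)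
    then show ?thesis using True upd_Pb[OF _ bz_nonneg[OF z]] by simp
  next
    case False
    then show ?thesis using emeasure_upd_space[OF SPn bz_nonneg[OF z]] by (auto simp: update_ok_def)
  qed
qed

lemma Pb_mass: "\<mu> \<in> Pb M \<Longrightarrow> emeasure \<mu> HSp = 1"
  using prob_space.emeasure_space_1[OF Pb_D(1)] Pb_D(3) by metis

lemma hist_belief_Pb_iff:
  assumes \<mu>: "\<mu> \<in> Pb M" and z: "0 \<le> z"
  shows "hist_belief \<mu> z n h \<in> Pb M \<longleftrightarrow> emeasure (hist_belief \<mu> z n h) HSp = 1"
  using hist_belief_dichotomy[OF assms, of n h] Pb_mass by auto

lemma hist_belief_Suc_Pb_iff:
  assumes \<mu>: "\<mu> \<in> Pb M" and z: "0 \<le> z"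
  shows "hist_belief \<mu> z (Suc n) h \<in> Pb M \<longleftrightarrow> hist_belief \<mu> z n h \<in> Pb M \<and> update_ok (fst h n) (snd h n) (fst h (Suc n)) (hist_belief \<mu> z n h)"
proof -
  note SPn = hist_belief_SP[OF Pb_D(4)[OF \<mu>] z, of n h]
  show ?thesis
    using emeasure_upd_space[OF SPn bz_nonneg[OF z]] hist_belief_Pb_iff[OF assms, of "Suc n" h] hist_belief_dichotomy[OF assms, of n h] mx_null[OF SPn]
    by (auto simp: update_ok_def split: if_splits)
qed

lemma hist_belief_Pb_measurable:
  assumes \<mu>: "\<mu> \<in> Pb M" and z: "0 \<le> z" and X: "(\<lambda>w. hist_belief \<mu> z n (H w)) \<in> N \<rightarrow>\<^sub>M SP"
  shows "Measurable.pred N (\<lambda>w. hist_belief \<mu> z n (H w) \<in> Pb M)"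
proof -
  have "HSp \<in> sets HS" using sets.top[of HS] by simp
  from measurable_compose[OF X[unfolded SP_def] measurable_emeasure_subprob_algebra[OF this]]
  have [measurable]: "(\<lambda>w. emeasure (hist_belief \<mu> z n (H w)) HSp) \<in> borel_measurable N" .
  show ?thesis unfolding hist_belief_Pb_iff[OF \<mu> z] by measurable
qed

section \<open>Finite-horizon laws\<close>

definition stepk where
  "stepk g n \<xi> = distr (kernel M (fst (\<xi> n)) (snd (\<xi> n)) (action g (fst \<circ> \<xi>) n)) (Om {0..<Suc (Suc n)}) (fun_upd \<xi> (Suc n))"

text \<open>The marginal of \<open>law\<close> on the times up to \<open>n\<close>, given by an
  explicit recursion so that integrals can be unfolded one stage at a time; \<open>law_props\<close>
  makes the identification.\<close>

primrec chain where
  "chain g x y 0 = return (Om {0..<Suc 0}) ((\<lambda>_. undefined)(0 := (x, y)))"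
| "chain g x y (Suc n) = bind (chain g x y n) (stepk g n)"

lemma Om_component:
  "i \<in> I \<Longrightarrow> (\<lambda>\<xi>. fst (\<xi> i)) \<in> Om I \<rightarrow>\<^sub>M obs_borel M" "i \<in> I \<Longrightarrow> (\<lambda>\<xi>. snd (\<xi> i)) \<in> Om I \<rightarrow>\<^sub>M hid_borel M"
  using measurable_compose[OF measurable_component_singleton[of i I "\<lambda>_. SXY"] measurable_fst]
    measurable_compose[OF measurable_component_singleton[of i I "\<lambda>_. SXY"] measurable_snd] by simp_all

lemma Om_space: "\<xi> \<in> space (Om I) \<Longrightarrow> i \<in> I \<Longrightarrow> fst (\<xi> i) \<in> XX \<and> snd (\<xi> i) \<in> YY"
  by (force simp: space_PiM)

context
  fixes g assumes g: "g \<in> policies M"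
begin

lemma action_Om_measurable: "{..n} \<subseteq> I \<Longrightarrow> (\<lambda>\<xi>. action g (fst \<circ> \<xi>) n) \<in> Om I \<rightarrow>\<^sub>M act_borel M"
  by (rule action_measurable[OF g]) (auto intro!: Om_component)

lemma action_Om_adm: "{..n} \<subseteq> I \<Longrightarrow> \<xi> \<in> space (Om I) \<Longrightarrow> (fst (\<xi> n), action g (fst \<circ> \<xi>) n) \<in> adm M"
  using action_adm[OF g, of n "fst \<circ> \<xi>"] Om_space[of \<xi> I] by auto

lemma step_measurable:
  "(\<lambda>\<xi>. kernel M (fst (\<xi> n)) (snd (\<xi> n)) (action g (fst \<circ> \<xi>) n)) \<in> Om {0..<Suc n} \<rightarrow>\<^sub>M subprob_algebra SXY"
  by (rule kernel_subprob_measurable[OF Om_component(1) Om_component(2) action_Om_measurable])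
     (auto intro!: action_Om_adm[of _ "{0..<Suc n}"])

lemma step_prob:
  assumes "\<xi> \<in> space (Om {0..<Suc n})"
  shows "prob_space (kernel M (fst (\<xi> n)) (snd (\<xi> n)) (action g (fst \<circ> \<xi>) n))"
    "sets (kernel M (fst (\<xi> n)) (snd (\<xi> n)) (action g (fst \<circ> \<xi>) n)) = sets SXY"
proof -
  have "(fst (\<xi> n), action g (fst \<circ> \<xi>) n) \<in> adm M" by (rule action_Om_adm[OF _ assms]) auto
  from kernel_prob[OF this, of "snd (\<xi> n)"] Om_space[OF assms, of n]
  show "prob_space (kernel M (fst (\<xi> n)) (snd (\<xi> n)) (action g (fst \<circ> \<xi>) n))"
    "sets (kernel M (fst (\<xi> n)) (snd (\<xi> n)) (action g (fst \<circ> \<xi>) n)) = sets SXY"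
    by (auto simp: space_prob_algebra)
qed

lemma IT:
  assumes "x \<in> XX" "y \<in> YY" shows "Ionescu_Tulcea (step_kernel M g x y) (\<lambda>_. SXY)"
proof (rule Ionescu_Tulcea.intro)
  fix i
  show "step_kernel M g x y i \<in> Om {0..<i} \<rightarrow>\<^sub>M subprob_algebra SXY"
  proof (cases i)
    case 0
    have "return SXY (x, y) \<in> space (subprob_algebra SXY)"
      using assms by (intro measurable_space[OF return_measurable]) simp
    then show ?thesis using 0 by (simp add: step_kernel_def[abs_def])
  next
    case (Suc n) then show ?thesis using step_measurable[of n] by (simp add: step_kernel_def[abs_def])
  qed
next
  fix i \<xi> assume "\<xi> \<in> space (Om {0..<i})"
  then show "prob_space (step_kernel M g x y i \<xi>)"
    using step_prob(1) assms by (cases i) (auto simp: step_kernel_def intro!: prob_space_return)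
qed

lemma fun_upd_Om_measurable: "\<xi> \<in> space (Om {0..<n}) \<Longrightarrow> fun_upd \<xi> n \<in> SXY \<rightarrow>\<^sub>M Om {0..<Suc n}"
  by (intro measurable_fun_upd[where J="{0..<n}"]) auto

lemma stepk_measurable: "stepk g n \<in> Om {0..<Suc n} \<rightarrow>\<^sub>M subprob_algebra (Om {0..<Suc (Suc n)})"
  unfolding stepk_def[abs_def]
proof (rule measurable_distr2[OF _ step_measurable])
  have "(\<lambda>p. (fst p)(Suc n := snd p)) \<in> Om {0..<Suc n} \<Otimes>\<^sub>M SXY \<rightarrow>\<^sub>M Om {0..<Suc (Suc n)}"
    by (intro measurable_fun_upd[where J="{0..<Suc n}"] measurable_fst measurable_snd) auto
  then show "(\<lambda>(\<xi>, w). \<xi>(Suc n := w)) \<in> Om {0..<Suc n} \<Otimes>\<^sub>M SXY \<rightarrow>\<^sub>M Om {0..<Suc (Suc n)}"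
    by (simp add: case_prod_unfold)
qed

lemma chain_measurable:
  assumes x: "x \<in> XX"
  shows "(\<lambda>y. chain g x y n) \<in> hid_borel M \<rightarrow>\<^sub>M subprob_algebra (Om {0..<Suc n})"
proof (induction n)
  case 0
  have "(\<lambda>y. (\<lambda>_. undefined)(0 := (x, y))) \<in> hid_borel M \<rightarrow>\<^sub>M Om {0..<Suc 0}"
    by (intro measurable_fun_upd[where J="{}"] measurable_Pair measurable_const measurable_ident_sets)
       (use x in \<open>auto simp: space_PiM\<close>)
  then show ?case by (simp add: measurable_compose[OF _ return_measurable])
next
  case (Suc n)
  then show ?case by (simp add: measurable_bind2[OF _ stepk_measurable])
qed

lemma chain_props:
  assumes xy: "x \<in> XX" "y \<in> YY"
  shows "subprob_space (chain g x y n)" "sets (chain g x y n) = sets (Om {0..<Suc n})" "space (chain g x y n) = space (Om {0..<Suc n})"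
  using measurable_space[OF chain_measurable[OF xy(1)], of y n] xy(2) sets_eq_imp_space_eq[of "chain g x y n" "Om {0..<Suc n}"]
  by (simp_all add: space_subprob_algebra)

lemma nn_integral_chain_0:
  assumes xy: "x \<in> XX" "y \<in> YY" and f: "f \<in> borel_measurable (Om {0..<Suc 0})"
  shows "(\<integral>\<^sup>+\<xi>. f \<xi> \<partial>chain g x y 0) = f ((\<lambda>_. undefined)(0 := (x, y)))"
proof -
  have "(\<lambda>_. undefined)(0 := (x, y)) \<in> space (Om {0..<Suc 0})" using xy by (auto simp: space_PiM PiE_def extensional_def)
  then show ?thesis using f by (simp add: nn_integral_return)
qed

text \<open>Unfolds the last stage down to the density, the form in which
  \<open>one_step_disintegration\<close> can be brought in.\<close>

lemma nn_integral_chain_Suc: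
  assumes xy: "x \<in> XX" "y \<in> YY" and f: "f \<in> borel_measurable (Om {0..<Suc (Suc n)})"
  shows "(\<integral>\<^sup>+\<xi>. f \<xi> \<partial>chain g x y (Suc n)) = (\<integral>\<^sup>+\<xi>. (\<integral>\<^sup>+x'. (\<integral>\<^sup>+y'.
     ennreal (qe x' y' (fst (\<xi> n)) (snd (\<xi> n)) (action g (fst \<circ> \<xi>) n)) * f (\<xi>(Suc n := (x', y'))) \<partial>nu) \<partial>lam) \<partial>chain g x y n)"
proof -
  note C = chain_props[OF xy, of n]
  have "stepk g n \<in> chain g x y n \<rightarrow>\<^sub>M subprob_algebra (Om {0..<Suc (Suc n)})"
    using stepk_measurable measurable_cong_sets[OF C(2) refl] by blast
  then have "(\<integral>\<^sup>+\<xi>. f \<xi> \<partial>chain g x y (Suc n)) = (\<integral>\<^sup>+\<xi>. (\<integral>\<^sup>+\<xi>'. f \<xi>' \<partial>stepk g n \<xi>) \<partial>chain g x y n)"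
    using nn_integral_bind[OF f] by simp
  also have "\<dots> = (\<integral>\<^sup>+\<xi>. (\<integral>\<^sup>+x'. (\<integral>\<^sup>+y'.
     ennreal (qe x' y' (fst (\<xi> n)) (snd (\<xi> n)) (action g (fst \<circ> \<xi>) n)) * f (\<xi>(Suc n := (x', y'))) \<partial>nu) \<partial>lam) \<partial>chain g x y n)"
  proof (rule nn_integral_cong)
    fix \<xi> assume "\<xi> \<in> space (chain g x y n)"
    then have \<xi>: "\<xi> \<in> space (Om {0..<Suc n})" using C by simp
    have adm: "(fst (\<xi> n), action g (fst \<circ> \<xi>) n) \<in> adm M" by (rule action_Om_adm[OF _ \<xi>]) auto
    have Y: "snd (\<xi> n) \<in> YY" using Om_space[OF \<xi>, of n] by simp
    have m: "fun_upd \<xi> (Suc n) \<in> SXY \<rightarrow>\<^sub>M Om {0..<Suc (Suc n)}" by (rule fun_upd_Om_measurable[OF \<xi>])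
    have m': "(\<lambda>w. f (\<xi>(Suc n := w))) \<in> borel_measurable SXY" by (rule measurable_compose[OF m f])
    have "(\<integral>\<^sup>+\<xi>'. f \<xi>' \<partial>stepk g n \<xi>) = (\<integral>\<^sup>+w. f (\<xi>(Suc n := w)) \<partial>kernel M (fst (\<xi> n)) (snd (\<xi> n)) (action g (fst \<circ> \<xi>) n))"
      unfolding stepk_def using m measurable_cong_sets[OF step_prob(2)[OF \<xi>] refl, of "Om {0..<Suc (Suc n)}"]
        f by (intro nn_integral_distr) simp_all
    also have "\<dots> = (\<integral>\<^sup>+x'. (\<integral>\<^sup>+y'.
     ennreal (qe x' y' (fst (\<xi> n)) (snd (\<xi> n)) (action g (fst \<circ> \<xi>) n)) * f (\<xi>(Suc n := (x', y'))) \<partial>nu) \<partial>lam)"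
      by (rule nn_integral_kernel[OF adm Y m'])
    finally show "(\<integral>\<^sup>+\<xi>'. f \<xi>' \<partial>stepk g n \<xi>) = (\<integral>\<^sup>+x'. (\<integral>\<^sup>+y'.
     ennreal (qe x' y' (fst (\<xi> n)) (snd (\<xi> n)) (action g (fst \<circ> \<xi>) n)) * f (\<xi>(Suc n := (x', y'))) \<partial>nu) \<partial>lam)" .
  qed
  finally show ?thesis .
qed

lemma law_props:
  assumes xy: "x \<in> XX" "y \<in> YY"
  shows "sets (law M g x y) = sets (Om UNIV)" "space (law M g x y) = space (Om UNIV)" "prob_space (law M g x y)"
    "f \<in> borel_measurable (Om {0..<Suc n}) \<Longrightarrow>
      (\<integral>\<^sup>+\<xi>. f (restrict \<xi> {0..<Suc n}) \<partial>law M g x y) = (\<integral>\<^sup>+\<xi>. f \<xi> \<partial>chain g x y n)"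
proof -
  interpret I: Ionescu_Tulcea "step_kernel M g x y" "\<lambda>_. SXY" by (rule IT[OF xy])
  have law: "law M g x y = I.PF.lim" by (simp add: law_def Let_def)
  show s: "sets (law M g x y) = sets (Om UNIV)" by (simp add: law)
  show "space (law M g x y) = space (Om UNIV)" by (simp add: law)
  \<comment> \<open>The Ionescu-Tulcea composition started at the empty path. Its length exceeds the
    argument of \<open>chain\<close> by one because \<open>chain\<close> at 0 already contains time
    0.\<close>
  have C: "I.C 0 (Suc n) (\<lambda>_. undefined) = chain g x y n" for n
  proof (induction n)
    case 0
    have u: "(\<lambda>_. undefined) \<in> space (Om {0..<0})" by (simp add: space_PiM)
    have "I.C 0 (Suc 0) (\<lambda>_. undefined) = I.eP 0 (\<lambda>_. undefined)"
      using u I.measurable_eP[of 0] by (simp add: bind_return)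
    also have "\<dots> = distr (return SXY (x, y)) (Om {0..<Suc 0}) (fun_upd (\<lambda>_. undefined) 0)"
      by (simp add: I.eP_def step_kernel_def)
    also have "\<dots> = return (Om {0..<Suc 0}) ((\<lambda>_. undefined)(0 := (x, y)))"
      using xy fun_upd_Om_measurable[OF u] by (intro distr_return) auto
    finally show ?case by simp
  next
    case (Suc n)
    have "I.eP (Suc n) = stepk g n"
      by (simp add: I.eP_def[abs_def] stepk_def[abs_def] step_kernel_def)
    then show ?case using Suc by simp
  qed
  have CI: "I.CI {0..<Suc n} = chain g x y n" for n
  proof (rule measure_eqI)
    show "sets (I.CI {0..<Suc n}) = sets (chain g x y n)"
      using chain_props(2)[OF xy, of n] by (simp add: I.CI_def)
    fix A assume "A \<in> sets (I.CI {0..<Suc n})"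
    then have A: "A \<in> sets (Om {0..<Suc n})" by (simp add: I.CI_def)
    have "emeasure (I.CI {0..<Suc n}) A = emeasure (I.C 0 (Suc n) (\<lambda>_. undefined)) (I.PF.emb {0..<Suc n} {0..<Suc n} A)"
      by (rule I.emeasure_CI[OF order_refl A])
    also have "I.PF.emb {0..<Suc n} {0..<Suc n} A = A"
      using sets.sets_into_space[OF A] by (intro prod_emb_id) (simp add: space_PiM)
    finally show "emeasure (I.CI {0..<Suc n}) A = emeasure (chain g x y n) A" unfolding C .
  qed
  have res: "(\<lambda>\<xi>. restrict \<xi> {0..<Suc n}) \<in> law M g x y \<rightarrow>\<^sub>M Om {0..<Suc n}" for n
    unfolding measurable_cong_sets[OF s refl] by (intro measurable_restrict_subset) auto
  have dl: "distr (law M g x y) (Om {0..<Suc n}) (\<lambda>\<xi>. restrict \<xi> {0..<Suc n}) = chain g x y n" for n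
    unfolding law CI[symmetric] by (rule I.distr_lim) simp
  show "f \<in> borel_measurable (Om {0..<Suc n}) \<Longrightarrow>
      (\<integral>\<^sup>+\<xi>. f (restrict \<xi> {0..<Suc n}) \<partial>law M g x y) = (\<integral>\<^sup>+\<xi>. f \<xi> \<partial>chain g x y n)" for f n
    unfolding dl[symmetric] by (rule nn_integral_distr[OF res, symmetric]) simp
  \<comment> \<open>Total mass of the limit law is read off from its marginal at time 0, a point
    mass.\<close>
  have "prob_space (chain g x y 0)"
    using xy by (auto intro!: prob_space_return simp: space_PiM PiE_def extensional_def)
  then show "prob_space (law M g x y)" unfolding dl[symmetric] by (rule prob_space_distrD[OF res])
qed

end

section \<open>The filter equation\<close>

abbreviation "PX n \<equiv> PiM {..n::nat} (\<lambda>_. obs_borel M)"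

definition obs_path :: "nat \<Rightarrow> (nat \<Rightarrow> 'x \<times> 'y) \<Rightarrow> nat \<Rightarrow> 'x" where
  "obs_path n \<xi> = restrict (fst \<circ> \<xi>) {..n}"

text \<open>Costs strictly before time \<open>n\<close>: together with the hidden state at time
  \<open>n\<close> this is the pair described by the belief after \<open>n\<close> updates.\<close>

definition partial_cost :: "(nat \<Rightarrow> ('x, 'a) hist \<Rightarrow> 'a) \<Rightarrow> nat \<Rightarrow> (nat \<Rightarrow> 'x \<times> 'y) \<Rightarrow> real" where
  "partial_cost g n \<xi> = (\<Sum>k<n. \<beta> ^ k * ce (fst (\<xi> k)) (snd (\<xi> k)) (action g (fst \<circ> \<xi>) k))"

lemma partial_cost_nonneg: "0 \<le> partial_cost g n \<xi>"
  unfolding partial_cost_def using beta ce_bounds(3) by (intro sum_nonneg mult_nonneg_nonneg) (auto simp: less_imp_le)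

lemma obs_path_measurable: "{..n} \<subseteq> I \<Longrightarrow> obs_path n \<in> Om I \<rightarrow>\<^sub>M PX n"
  unfolding obs_path_def[abs_def] by (rule measurable_restrict) (auto intro: Om_component)

lemma PX_component: "i \<le> n \<Longrightarrow> (\<lambda>xs. xs i) \<in> PX n \<rightarrow>\<^sub>M obs_borel M"
  by (rule measurable_component_singleton) simp

lemma PX_space: "xs \<in> space (PX n) \<Longrightarrow> i \<le> n \<Longrightarrow> xs i \<in> XX"
  by (force simp: space_PiM)

context
  fixes g x \<mu> z
  assumes g: "g \<in> policies M" and e: "(x, \<mu>, z) \<in> E_set M"
begin

lemma E: "x \<in> XX" "\<mu> \<in> Pb M" "0 < z" "z \<le> 1" "0 \<le> z" "\<mu> \<in> space SP"
  using E_setD[OF e] Pb_D(4) by auto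

definition path_belief where "path_belief n xs = hist_belief \<mu> z n (xs, \<lambda>k. action g xs k)"

lemma path_belief_0: "path_belief 0 xs = \<mu>" by (simp add: path_belief_def)

lemma path_belief_Suc: "path_belief (Suc n) xs = upd (xs n) (action g xs n) (xs (Suc n)) (path_belief n xs) (\<beta> ^ n * z)"
  by (simp add: path_belief_def)

lemma path_belief_cong: "(\<And>i. i \<le> n \<Longrightarrow> xs i = ys i) \<Longrightarrow> path_belief n xs = path_belief n ys"
  unfolding path_belief_def by (rule hist_belief_cong) (auto intro: action_cong)

lemma path_belief_SP: "path_belief n xs \<in> space SP" unfolding path_belief_def by (rule hist_belief_SP[OF E(6,5)])

lemma action_PX: "k \<le> n \<Longrightarrow> (\<lambda>xs. action g xs k) \<in> PX n \<rightarrow>\<^sub>M act_borel M"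
  by (rule action_measurable[OF g]) (rule PX_component, simp)

lemma path_belief_measurable: "path_belief n \<in> PX n \<rightarrow>\<^sub>M SP"
  unfolding path_belief_def[abs_def] by (rule hist_belief_measurable[OF E(6,5)]) (auto intro: PX_component action_PX)

lemma path_belief_Pb_measurable: "Measurable.pred (PX n) (\<lambda>xs. path_belief n xs \<in> Pb M)"
  unfolding path_belief_def by (rule hist_belief_Pb_measurable[OF E(2,5)]) (rule path_belief_measurable[unfolded path_belief_def[abs_def]])

lemma obs_path_Suc: "obs_path (Suc n) (\<xi>(Suc n := w)) = (obs_path n \<xi>)(Suc n := fst w)"
  by (auto simp: obs_path_def fun_eq_iff restrict_def)

lemma action_obs_path: "k \<le> n \<Longrightarrow> action g (obs_path n \<xi>) k = action g (fst \<circ> \<xi>) k"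
  by (rule action_cong) (simp add: obs_path_def)

lemma path_belief_upd: "path_belief n (xs(Suc n := w)) = path_belief n xs" by (rule path_belief_cong) simp

lemma action_upd: "action g (xs(Suc n := w)) n = action g xs n" by (rule action_cong) simp

lemma partial_cost_Suc_upd: "partial_cost g (Suc n) (\<xi>(Suc n := w)) = partial_cost g n \<xi> + \<beta> ^ n * ce (obs_path n \<xi> n) (snd (\<xi> n)) (action g (obs_path n \<xi>) n)"
proof -
  have "action g (fst \<circ> \<xi>(Suc n := w)) k = action g (fst \<circ> \<xi>) k" if "k \<le> n" for k
    using that by (intro action_cong) auto
  then have "partial_cost g (Suc n) (\<xi>(Suc n := w)) = partial_cost g (Suc n) \<xi>" unfolding partial_cost_def by (intro sum.cong) auto
  then show ?thesis by (simp add: partial_cost_def action_obs_path) (simp add: obs_path_def)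
qed

lemma partial_cost_measurable: "{..<n} \<subseteq> I \<Longrightarrow> partial_cost g n \<in> borel_measurable (Om I)"
  unfolding partial_cost_def[abs_def]
  by (intro borel_measurable_sum borel_measurable_times borel_measurable_const ce_measurable
      obs_borelD[OF Om_component(1)] hid_borelD[OF Om_component(2)] act_borelD[OF action_Om_measurable[OF g]]) auto

lemma state_HS_measurable:
  assumes s: "0 \<le> s" and I: "{..n} \<subseteq> I"
  shows "(\<lambda>\<xi>. (snd (\<xi> n), s + z * partial_cost g n \<xi>)) \<in> Om I \<rightarrow>\<^sub>M HS"
  unfolding hs_borel_def
proof (rule measurable_Pair)
  show "(\<lambda>\<xi>. snd (\<xi> n)) \<in> Om I \<rightarrow>\<^sub>M hid_borel M" using I by (intro Om_component) auto
  show "(\<lambda>\<xi>. s + z * partial_cost g n \<xi>) \<in> Om I \<rightarrow>\<^sub>M Rplus"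
    unfolding Rplus_def
  proof (rule measurable_restrict_space2)
    show "(\<lambda>\<xi>. s + z * partial_cost g n \<xi>) \<in> space (Om I) \<rightarrow> {0..}" using s E(5) partial_cost_nonneg by auto
    show "(\<lambda>\<xi>. s + z * partial_cost g n \<xi>) \<in> borel_measurable (Om I)"
      using I by (intro borel_measurable_add borel_measurable_times borel_measurable_const partial_cost_measurable) auto
  qed
qed

text \<open>Expectation over the initial pair drawn from \<mu> and the path up to time
  \<open>n\<close>. The initial cost level is a separate argument of \<open>F\<close> because the
  chain records states only.\<close>

definition expect where
  "expect n F = (\<integral>\<^sup>+p. (\<integral>\<^sup>+\<xi>. F (snd p) \<xi> \<partial>chain g x (fst p) n) \<partial>\<mu>)"

lemma p_space: "p \<in> space \<mu> \<Longrightarrow> fst p \<in> YY \<and> 0 \<le> snd p"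
  using Pb_D(3)[OF E(2)] by force

lemma expect_cong:
  assumes "\<And>s \<xi>. 0 \<le> s \<Longrightarrow> \<xi> \<in> space (Om {0..<Suc n}) \<Longrightarrow> F s \<xi> = G s \<xi>"
  shows "expect n F = expect n G"
  unfolding expect_def
proof (intro nn_integral_cong)
  fix p \<xi> assume p: "p \<in> space \<mu>" and "\<xi> \<in> space (chain g x (fst p) n)"
  then show "F (snd p) \<xi> = G (snd p) \<xi>"
    using p_space[OF p] chain_props(3)[OF g E(1), of "fst p" n] by (intro assms) auto
qed

lemma expect_mono:
  assumes "\<And>s \<xi>. 0 \<le> s \<Longrightarrow> \<xi> \<in> space (Om {0..<Suc n}) \<Longrightarrow> F s \<xi> \<le> G s \<xi>"
  shows "expect n F \<le> expect n G"
  unfolding expect_def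
proof (intro nn_integral_mono)
  fix p \<xi> assume p: "p \<in> space \<mu>" and "\<xi> \<in> space (chain g x (fst p) n)"
  then show "F (snd p) \<xi> \<le> G (snd p) \<xi>"
    using p_space[OF p] chain_props(3)[OF g E(1), of "fst p" n] by (intro assms) auto
qed

lemma chain_mass: "y \<in> YY \<Longrightarrow> (\<integral>\<^sup>+\<xi>. c \<partial>chain g x y n) = c"
  using law_props(4)[OF g E(1), of y "\<lambda>_. c" n] prob_space.emeasure_space_1[OF law_props(3)[OF g E(1), of y]] by simp

lemma expect_const: "expect n (\<lambda>_ _. c) = c"
proof -
  interpret prob_space \<mu> by (rule Pb_D(1)[OF E(2)])
  have "expect n (\<lambda>_ _. c) = (\<integral>\<^sup>+p. c \<partial>\<mu>)"
    unfolding expect_def using chain_mass p_space by (intro nn_integral_cong) auto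
  then show ?thesis by (simp add: emeasure_space_1)
qed

text \<open>The belief is the conditional law of hidden state and accumulated cost given the
  observed path. Equality of integrals over all nonnegative test functions expresses this without
  conditional expectations.\<close>

definition filter_eq where
  "filter_eq n \<longleftrightarrow> (\<forall>\<phi>. case_prod \<phi> \<in> borel_measurable (PX n \<Otimes>\<^sub>M HS) \<longrightarrow>
     expect n (\<lambda>s \<xi>. \<phi> (obs_path n \<xi>) (snd (\<xi> n), s + z * partial_cost g n \<xi>)) = expect n (\<lambda>s \<xi>. \<integral>\<^sup>+q. \<phi> (obs_path n \<xi>) q \<partial>path_belief n (obs_path n \<xi>)))"

lemma obs_path_in_PX: "\<xi> \<in> space (Om {0..<Suc n}) \<Longrightarrow> obs_path n \<xi> \<in> space (PX n)"
  by (rule measurable_space[OF obs_path_measurable]) auto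

lemma PX_adm: "xs \<in> space (PX n) \<Longrightarrow> (xs n, action g xs n) \<in> adm M"
  using PX_space by (intro action_adm[OF g]) auto

text \<open>Integrating out stage \<open>n + 1\<close> turns \<Phi> into a test function of the
  observed path and the hidden pair at time \<open>n\<close>. There the filter equation inserts the
  belief, and disintegration inside the belief produces predictive density and update.\<close>

lemma filter_step:
  assumes C: "filter_eq n" and \<Phi>: "case_prod \<Phi> \<in> borel_measurable (PX (Suc n) \<Otimes>\<^sub>M HS)"
  shows "expect (Suc n) (\<lambda>s \<xi>. \<Phi> (obs_path (Suc n) \<xi>) (snd (\<xi> (Suc n)), s + z * partial_cost g (Suc n) \<xi>)) =
    expect n (\<lambda>s \<xi>. (\<integral>\<^sup>+x'. mx (obs_path n \<xi> n) (action g (obs_path n \<xi>) n) x' (path_belief n (obs_path n \<xi>)) *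
      (\<integral>\<^sup>+q. \<Phi> ((obs_path n \<xi>)(Suc n := x')) q \<partial>upd (obs_path n \<xi> n) (action g (obs_path n \<xi>) n) x' (path_belief n (obs_path n \<xi>)) (\<beta> ^ n * z)) \<partial>lam))"
proof -
  \<comment> \<open>Conditional expectation of \<Phi> given observed path and hidden pair at time
    \<open>n\<close>.\<close>
  define \<phi> where "\<phi> xs q = (\<integral>\<^sup>+x'. (\<integral>\<^sup>+y'. ennreal (qe x' y' (xs n) (fst q) (action g xs n)) *
      \<Phi> (xs(Suc n := x')) (y', snd q + (\<beta> ^ n * z) * ce (xs n) (fst q) (action g xs n)) \<partial>nu) \<partial>lam)" for xs q
  let ?N = "((PX n \<Otimes>\<^sub>M HS) \<Otimes>\<^sub>M lam) \<Otimes>\<^sub>M nu"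
  have bz: "0 \<le> \<beta> ^ n * z" by (rule bz_nonneg[OF E(5)])
  have A: "(\<lambda>w. fst (fst (fst w))) \<in> ?N \<rightarrow>\<^sub>M PX n" "(\<lambda>w. snd (fst (fst w))) \<in> ?N \<rightarrow>\<^sub>M HS"
    "(\<lambda>w. snd (fst w)) \<in> ?N \<rightarrow>\<^sub>M lam" "snd \<in> ?N \<rightarrow>\<^sub>M nu"
    by (intro measurable_compose[OF measurable_fst] measurable_compose[OF measurable_fst measurable_snd] measurable_fst measurable_snd)+
  have A3: "(\<lambda>w. snd (fst w)) \<in> ?N \<rightarrow>\<^sub>M obs_borel M" using A(3) measurable_cong_sets[OF refl sets_lam] by blast
  have A4: "snd \<in> ?N \<rightarrow>\<^sub>M hid_borel M" using A(4) measurable_cong_sets[OF refl sets_nu] by blast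
  have B: "(\<lambda>w. fst (fst (fst w)) n) \<in> ?N \<rightarrow>\<^sub>M borel" "(\<lambda>w. action g (fst (fst (fst w))) n) \<in> ?N \<rightarrow>\<^sub>M borel"
    "(\<lambda>w. fst (snd (fst (fst w)))) \<in> ?N \<rightarrow>\<^sub>M borel" "(\<lambda>w. snd (snd (fst (fst w)))) \<in> ?N \<rightarrow>\<^sub>M borel"
    using measurable_compose[OF A(1) obs_borelD[OF PX_component[OF order_refl]]]
      measurable_compose[OF A(1) act_borelD[OF action_PX[OF order_refl]]]
      measurable_compose[OF A(2) Rplus_fst_snd(1)] measurable_compose[OF A(2) Rplus_fst_snd(2)] by simp_all
  have c: "(\<lambda>w. snd (snd (fst (fst w))) + (\<beta> ^ n * z) * ce (fst (fst (fst w)) n) (fst (snd (fst (fst w)))) (action g (fst (fst (fst w))) n)) \<in> ?N \<rightarrow>\<^sub>M Rplus"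
    unfolding Rplus_def
  proof (rule measurable_restrict_space2)
    show "(\<lambda>w. snd (snd (fst (fst w))) + (\<beta> ^ n * z) * ce (fst (fst (fst w)) n) (fst (snd (fst (fst w)))) (action g (fst (fst (fst w))) n)) \<in> borel_measurable ?N"
      by (intro borel_measurable_add borel_measurable_times borel_measurable_const ce_measurable B)
    show "(\<lambda>w. snd (snd (fst (fst w))) + (\<beta> ^ n * z) * ce (fst (fst (fst w)) n) (fst (snd (fst (fst w)))) (action g (fst (fst (fst w))) n)) \<in> space ?N \<rightarrow> {0..}"
      using bz ce_bounds(3)[THEN less_imp_le] by (auto simp: space_pair_measure intro!: add_nonneg_nonneg mult_nonneg_nonneg)
  qed
  have u: "(\<lambda>w. (fst (fst (fst w)))(Suc n := snd (fst w))) \<in> ?N \<rightarrow>\<^sub>M PX (Suc n)"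
    by (rule measurable_fun_upd[where J="{..n}", OF _ A(1) A3]) auto
  have "(\<lambda>w. ((fst (fst (fst w)))(Suc n := snd (fst w)), (snd w, snd (snd (fst (fst w))) + (\<beta> ^ n * z) * ce (fst (fst (fst w)) n) (fst (snd (fst (fst w)))) (action g (fst (fst (fst w))) n)))) \<in> ?N \<rightarrow>\<^sub>M PX (Suc n) \<Otimes>\<^sub>M HS"
    unfolding hs_borel_def by (intro measurable_Pair u A4 c[unfolded hs_borel_def]) 
      (use u A4 c in \<open>simp_all add: hs_borel_def\<close>)
  from measurable_compose[OF this \<Phi>]
  have "(\<lambda>w. ennreal (qe (snd (fst w)) (snd w) (fst (fst (fst w)) n) (fst (snd (fst (fst w)))) (action g (fst (fst (fst w))) n)) *
      \<Phi> ((fst (fst (fst w)))(Suc n := snd (fst w))) (snd w, snd (snd (fst (fst w))) + (\<beta> ^ n * z) * ce (fst (fst (fst w)) n) (fst (snd (fst (fst w)))) (action g (fst (fst (fst w))) n))) \<in> borel_measurable ?N"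
    by (intro borel_measurable_times_ennreal measurable_compose[OF _ measurable_ennreal] qe_measurable B obs_borelD[OF A3] hid_borelD[OF A4])
      simp
  then have "(\<lambda>v. \<integral>\<^sup>+y'. ennreal (qe (snd v) y' (fst (fst v) n) (fst (snd (fst v))) (action g (fst (fst v)) n)) *
      \<Phi> ((fst (fst v))(Suc n := snd v)) (y', snd (snd (fst v)) + (\<beta> ^ n * z) * ce (fst (fst v) n) (fst (snd (fst v))) (action g (fst (fst v)) n)) \<partial>nu)
      \<in> borel_measurable ((PX n \<Otimes>\<^sub>M HS) \<Otimes>\<^sub>M lam)"
    by (intro nu.borel_measurable_nn_integral) (simp add: case_prod_unfold)
  then have "(\<lambda>u. \<integral>\<^sup>+x'. (\<integral>\<^sup>+y'. ennreal (qe x' y' (fst u n) (fst (snd u)) (action g (fst u) n)) *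
      \<Phi> ((fst u)(Suc n := x')) (y', snd (snd u) + (\<beta> ^ n * z) * ce (fst u n) (fst (snd u)) (action g (fst u) n)) \<partial>nu) \<partial>lam)
      \<in> borel_measurable (PX n \<Otimes>\<^sub>M HS)"
    by (intro lam.borel_measurable_nn_integral) (simp add: case_prod_unfold)
  then have \<phi>m: "case_prod \<phi> \<in> borel_measurable (PX n \<Otimes>\<^sub>M HS)"
    by (simp add: \<phi>_def[abs_def] case_prod_unfold)
  have "expect (Suc n) (\<lambda>s \<xi>. \<Phi> (obs_path (Suc n) \<xi>) (snd (\<xi> (Suc n)), s + z * partial_cost g (Suc n) \<xi>)) =
     expect n (\<lambda>s \<xi>. \<phi> (obs_path n \<xi>) (snd (\<xi> n), s + z * partial_cost g n \<xi>))"
    unfolding expect_def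
  proof (rule nn_integral_cong)
    fix p assume "p \<in> space \<mu>"
    then have p: "fst p \<in> YY" "0 \<le> snd p" using p_space by auto
    have m: "(\<lambda>\<xi>. \<Phi> (obs_path (Suc n) \<xi>) (snd (\<xi> (Suc n)), snd p + z * partial_cost g (Suc n) \<xi>)) \<in> borel_measurable (Om {0..<Suc (Suc n)})"
    proof -
      have I: "{..Suc n} \<subseteq> {0..<Suc (Suc n)}" by auto
      show ?thesis
        using measurable_compose[OF measurable_Pair[OF obs_path_measurable[OF I] state_HS_measurable[OF p(2) I]] \<Phi>] by simp
    qed
    show "(\<integral>\<^sup>+\<xi>. \<Phi> (obs_path (Suc n) \<xi>) (snd (\<xi> (Suc n)), snd p + z * partial_cost g (Suc n) \<xi>) \<partial>chain g x (fst p) (Suc n)) =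
      (\<integral>\<^sup>+\<xi>. \<phi> (obs_path n \<xi>) (snd (\<xi> n), snd p + z * partial_cost g n \<xi>) \<partial>chain g x (fst p) n)"
      unfolding nn_integral_chain_Suc[OF g E(1) p(1) m]
    proof (rule nn_integral_cong)
      fix \<xi>
      have r: "obs_path n \<xi> n = fst (\<xi> n)" by (simp add: obs_path_def)
      show "(\<integral>\<^sup>+x'. (\<integral>\<^sup>+y'. ennreal (qe x' y' (fst (\<xi> n)) (snd (\<xi> n)) (action g (fst \<circ> \<xi>) n)) *
         \<Phi> (obs_path (Suc n) (\<xi>(Suc n := (x', y')))) (snd ((\<xi>(Suc n := (x', y'))) (Suc n)), snd p + z * partial_cost g (Suc n) (\<xi>(Suc n := (x', y')))) \<partial>nu) \<partial>lam)
         = \<phi> (obs_path n \<xi>) (snd (\<xi> n), snd p + z * partial_cost g n \<xi>)"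
        unfolding \<phi>_def partial_cost_Suc_upd obs_path_Suc by (simp add: r action_obs_path algebra_simps)
    qed
  qed
  also have "\<dots> = expect n (\<lambda>s \<xi>. \<integral>\<^sup>+q. \<phi> (obs_path n \<xi>) q \<partial>path_belief n (obs_path n \<xi>))"
    using C \<phi>m unfolding filter_eq_def by blast
  also have "\<dots> = expect n (\<lambda>s \<xi>. (\<integral>\<^sup>+x'. mx (obs_path n \<xi> n) (action g (obs_path n \<xi>) n) x' (path_belief n (obs_path n \<xi>)) *
      (\<integral>\<^sup>+q. \<Phi> ((obs_path n \<xi>)(Suc n := x')) q \<partial>upd (obs_path n \<xi> n) (action g (obs_path n \<xi>) n) x' (path_belief n (obs_path n \<xi>)) (\<beta> ^ n * z)) \<partial>lam))"
  proof (rule expect_cong)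
    fix s \<xi> assume "\<xi> \<in> space (Om {0..<Suc n})"
    then have xs: "obs_path n \<xi> \<in> space (PX n)" by (rule obs_path_in_PX)
    have u: "(\<lambda>w. (obs_path n \<xi>)(Suc n := fst w)) \<in> obs_borel M \<Otimes>\<^sub>M HS \<rightarrow>\<^sub>M PX (Suc n)"
      by (rule measurable_fun_upd[where J="{..n}", OF _ measurable_const[OF xs] measurable_fst]) auto
    have "(\<lambda>(x', p). \<Phi> ((obs_path n \<xi>)(Suc n := x')) p) \<in> borel_measurable (obs_borel M \<Otimes>\<^sub>M HS)"
      using measurable_compose[OF measurable_Pair[OF u measurable_snd] \<Phi>] by (simp add: case_prod_unfold)
    from one_step_disintegration[OF path_belief_SP PX_adm[OF xs] bz this]
    show "(\<integral>\<^sup>+q. \<phi> (obs_path n \<xi>) q \<partial>path_belief n (obs_path n \<xi>)) = (\<integral>\<^sup>+x'. mx (obs_path n \<xi> n) (action g (obs_path n \<xi>) n) x' (path_belief n (obs_path n \<xi>)) *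
      (\<integral>\<^sup>+q. \<Phi> ((obs_path n \<xi>)(Suc n := x')) q \<partial>upd (obs_path n \<xi> n) (action g (obs_path n \<xi>) n) x' (path_belief n (obs_path n \<xi>)) (\<beta> ^ n * z)) \<partial>lam)"
      by (simp add: \<phi>_def)
  qed
  finally show ?thesis .
qed

text \<open>Test functions that ignore the hidden pair: the update contributes mass 1 wherever it is
  defined, which shows \<open>mx\<close> to be the conditional density of the next
  observation.\<close>

lemma observed_step:
  assumes C: "filter_eq n" and \<psi>: "\<psi> \<in> borel_measurable (PX (Suc n))"
  shows "expect (Suc n) (\<lambda>s \<xi>. \<psi> (obs_path (Suc n) \<xi>)) =
    expect n (\<lambda>s \<xi>. (\<integral>\<^sup>+x'. mx (obs_path n \<xi> n) (action g (obs_path n \<xi>) n) x' (path_belief n (obs_path n \<xi>)) * \<psi> ((obs_path n \<xi>)(Suc n := x')) \<partial>lam))"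
proof -
  have "case_prod (\<lambda>xs q. \<psi> xs) \<in> borel_measurable (PX (Suc n) \<Otimes>\<^sub>M HS)"
    using measurable_compose[OF measurable_fst \<psi>] by (simp add: case_prod_unfold)
  from filter_step[OF C this]
  have "expect (Suc n) (\<lambda>s \<xi>. \<psi> (obs_path (Suc n) \<xi>)) =
    expect n (\<lambda>s \<xi>. (\<integral>\<^sup>+x'. mx (obs_path n \<xi> n) (action g (obs_path n \<xi>) n) x' (path_belief n (obs_path n \<xi>)) *
      (\<integral>\<^sup>+q. \<psi> ((obs_path n \<xi>)(Suc n := x')) \<partial>upd (obs_path n \<xi> n) (action g (obs_path n \<xi>) n) x' (path_belief n (obs_path n \<xi>)) (\<beta> ^ n * z)) \<partial>lam))" .
  also have "\<dots> = expect n (\<lambda>s \<xi>. (\<integral>\<^sup>+x'. mx (obs_path n \<xi> n) (action g (obs_path n \<xi>) n) x' (path_belief n (obs_path n \<xi>)) * \<psi> ((obs_path n \<xi>)(Suc n := x')) \<partial>lam))"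
  proof (rule expect_cong, rule nn_integral_cong_AE)
    fix s \<xi> assume "\<xi> \<in> space (Om {0..<Suc n})"
    then have xs: "obs_path n \<xi> \<in> space (PX n)" by (rule obs_path_in_PX)
    show "AE x' in lam. mx (obs_path n \<xi> n) (action g (obs_path n \<xi>) n) x' (path_belief n (obs_path n \<xi>)) *
      (\<integral>\<^sup>+q. \<psi> ((obs_path n \<xi>)(Suc n := x')) \<partial>upd (obs_path n \<xi> n) (action g (obs_path n \<xi>) n) x' (path_belief n (obs_path n \<xi>)) (\<beta> ^ n * z)) =
      mx (obs_path n \<xi> n) (action g (obs_path n \<xi>) n) x' (path_belief n (obs_path n \<xi>)) * \<psi> ((obs_path n \<xi>)(Suc n := x'))"
      using update_ok_AE[OF path_belief_SP PX_adm[OF xs], of n "obs_path n \<xi>"]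
    proof eventually_elim
      case (elim x')
      then show ?case
        using emeasure_upd_space[OF path_belief_SP bz_nonneg[OF E(5)], of "obs_path n \<xi> n" "action g (obs_path n \<xi>) n" x' n "obs_path n \<xi>" n]
        by (auto simp: update_ok_def)
    qed
  qed
  finally show ?thesis .
qed

lemma path_belief_integral_measurable:
  assumes \<phi>: "case_prod \<phi> \<in> borel_measurable (PX n \<Otimes>\<^sub>M HS)"
  shows "(\<lambda>xs. \<integral>\<^sup>+q. \<phi> xs q \<partial>path_belief n xs) \<in> borel_measurable (PX n)"
  by (rule nn_integral_measurable_subprob_algebra2[OF \<phi> path_belief_measurable[unfolded SP_def]])

text \<open>In the induction step both sides become the same expression: \<open>filter_step\<close>
  for the test function itself, and \<open>observed_step\<close> for its integral against the
  updated belief.\<close>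

lemma filter_eq_holds: "filter_eq n"
proof (induction n)
  case 0
  interpret prob_space \<mu> by (rule Pb_D(1)[OF E(2)])
  show ?case unfolding filter_eq_def
  proof (intro allI impI)
    fix \<phi> :: "(nat \<Rightarrow> 'x) \<Rightarrow> 'y \<times> real \<Rightarrow> ennreal" assume \<phi>: "case_prod \<phi> \<in> borel_measurable (PX 0 \<Otimes>\<^sub>M HS)"
    define xs where "xs = restrict (\<lambda>_. x) {..0::nat}"
    have rs0: "obs_path 0 ((\<lambda>_. undefined)(0 := (x, y))) = xs" for y by (auto simp: obs_path_def xs_def restrict_def)
    have I: "{..0} \<subseteq> {0..<Suc 0}" by auto
    have "expect 0 (\<lambda>s \<xi>. \<phi> (obs_path 0 \<xi>) (snd (\<xi> 0), s + z * partial_cost g 0 \<xi>)) = (\<integral>\<^sup>+p. \<phi> xs p \<partial>\<mu>)"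
      unfolding expect_def
    proof (rule nn_integral_cong)
      fix p assume "p \<in> space \<mu>"
      then have p: "fst p \<in> YY" "0 \<le> snd p" using p_space by auto
      have m: "(\<lambda>\<xi>. \<phi> (obs_path 0 \<xi>) (snd (\<xi> 0), snd p + z * partial_cost g 0 \<xi>)) \<in> borel_measurable (Om {0..<Suc 0})"
        using measurable_compose[OF measurable_Pair[OF obs_path_measurable[OF I] state_HS_measurable[OF p(2) I]] \<phi>] by simp
      show "(\<integral>\<^sup>+\<xi>. \<phi> (obs_path 0 \<xi>) (snd (\<xi> 0), snd p + z * partial_cost g 0 \<xi>) \<partial>chain g x (fst p) 0) = \<phi> xs p"
        unfolding nn_integral_chain_0[OF g E(1) p(1) m] rs0 by (simp add: partial_cost_def)
    qed
    also have "\<dots> = expect 0 (\<lambda>s \<xi>. \<integral>\<^sup>+q. \<phi> (obs_path 0 \<xi>) q \<partial>path_belief 0 (obs_path 0 \<xi>))"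
    proof -
      have "(\<integral>\<^sup>+\<xi>. (\<integral>\<^sup>+q. \<phi> (obs_path 0 \<xi>) q \<partial>path_belief 0 (obs_path 0 \<xi>)) \<partial>chain g x (fst p) 0) = (\<integral>\<^sup>+q. \<phi> xs q \<partial>\<mu>)" if "p \<in> space \<mu>" for p
      proof -
        have p: "fst p \<in> YY" using p_space that by auto
        have m: "(\<lambda>\<xi>. \<integral>\<^sup>+q. \<phi> (obs_path 0 \<xi>) q \<partial>path_belief 0 (obs_path 0 \<xi>)) \<in> borel_measurable (Om {0..<Suc 0})"
          by (rule measurable_compose[OF obs_path_measurable[OF I] path_belief_integral_measurable[OF \<phi>]])
        show ?thesis unfolding nn_integral_chain_0[OF g E(1) p m] rs0 by (simp add: path_belief_0)
      qed
      then have "expect 0 (\<lambda>s \<xi>. \<integral>\<^sup>+q. \<phi> (obs_path 0 \<xi>) q \<partial>path_belief 0 (obs_path 0 \<xi>)) = (\<integral>\<^sup>+p. (\<integral>\<^sup>+q. \<phi> xs q \<partial>\<mu>) \<partial>\<mu>)"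
        unfolding expect_def by (intro nn_integral_cong)
      then show ?thesis by (simp add: emeasure_space_1)
    qed
    finally show "expect 0 (\<lambda>s \<xi>. \<phi> (obs_path 0 \<xi>) (snd (\<xi> 0), s + z * partial_cost g 0 \<xi>)) = expect 0 (\<lambda>s \<xi>. \<integral>\<^sup>+q. \<phi> (obs_path 0 \<xi>) q \<partial>path_belief 0 (obs_path 0 \<xi>))" .
  qed
next
  case (Suc n)
  show ?case unfolding filter_eq_def
  proof (intro allI impI)
    fix \<phi> :: "(nat \<Rightarrow> 'x) \<Rightarrow> 'y \<times> real \<Rightarrow> ennreal" assume \<phi>: "case_prod \<phi> \<in> borel_measurable (PX (Suc n) \<Otimes>\<^sub>M HS)"
    show "expect (Suc n) (\<lambda>s \<xi>. \<phi> (obs_path (Suc n) \<xi>) (snd (\<xi> (Suc n)), s + z * partial_cost g (Suc n) \<xi>)) =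
      expect (Suc n) (\<lambda>s \<xi>. \<integral>\<^sup>+q. \<phi> (obs_path (Suc n) \<xi>) q \<partial>path_belief (Suc n) (obs_path (Suc n) \<xi>))"
      unfolding filter_step[OF Suc \<phi>] observed_step[OF Suc path_belief_integral_measurable[OF \<phi>]]
      by (simp add: path_belief_Suc path_belief_upd action_upd)
  qed
qed

text \<open>The value 0 at null beliefs is consistent with integration against them, so these paths
  require no separate probability estimate.\<close>

definition belief_value where
  "belief_value n w xs = (if path_belief n xs \<in> Pb M then w (xs n, path_belief n xs, \<beta> ^ n * z) else 0 :: ennreal)"

lemma bz_pos: "0 < \<beta> ^ n * z" "\<beta> ^ n * z \<le> 1"
  using beta E by (auto intro!: mult_le_one power_le_one)

lemma state_in_E: "path_belief n xs \<in> Pb M \<Longrightarrow> xs n \<in> XX \<Longrightarrow> (xs n, path_belief n xs, \<beta> ^ n * z) \<in> E_set M"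
  using bz_pos by (auto simp: E_set_def)

lemma belief_value_measurable:
  assumes w: "w \<in> borel_measurable (E_borel M)"
  shows "belief_value n w \<in> borel_measurable (PX n)"
proof -
  have "(\<lambda>xs. (xs n, if path_belief n xs \<in> Pb M then path_belief n xs else \<mu>, \<beta> ^ n * z)) \<in> PX n \<rightarrow>\<^sub>M E_borel M"
  proof (rule measurable_E_borel)
    show "(\<lambda>xs. xs n) \<in> PX n \<rightarrow>\<^sub>M obs_borel M" by (rule PX_component) simp
    show "(\<lambda>xs. if path_belief n xs \<in> Pb M then path_belief n xs else \<mu>) \<in> PX n \<rightarrow>\<^sub>M SP"
      by (rule measurable_If[OF path_belief_measurable measurable_const[OF E(6)] path_belief_Pb_measurable[unfolded pred_def]])
    show "(\<lambda>xs. \<beta> ^ n * z) \<in> borel_measurable (PX n)" by (rule borel_measurable_const)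
    show "(xs n, if path_belief n xs \<in> Pb M then path_belief n xs else \<mu>, \<beta> ^ n * z) \<in> E_set M" if "xs \<in> space (PX n)" for xs
      using PX_space[OF that order_refl] bz_pos E by (auto simp: E_set_def)
  qed
  from measurable_compose[OF this w]
  have "(\<lambda>xs. if path_belief n xs \<in> Pb M then w (xs n, if path_belief n xs \<in> Pb M then path_belief n xs else \<mu>, \<beta> ^ n * z) else 0) \<in> borel_measurable (PX n)"
    by (intro measurable_If path_belief_Pb_measurable[unfolded pred_def]) auto
  then show ?thesis
    by (rule measurable_cong[THEN iffD1, rotated]) (simp add: belief_value_def)
qed

text \<open>Observed state and belief together move by one application of \<open>L_nn\<close> with
  the action of the policy: the next observation has density \<open>mx\<close>, and the next belief
  is the update.\<close>

lemma belief_value_step: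
  assumes v: "v \<in> bellman_class"
  shows "expect (Suc n) (\<lambda>s \<xi>. belief_value (Suc n) (excess v) (obs_path (Suc n) \<xi>)) =
    expect n (\<lambda>s \<xi>. belief_value n (\<lambda>e. excess (\<lambda>e. L_op M \<beta> v e (action g (obs_path n \<xi>) n)) e) (obs_path n \<xi>))"
  unfolding observed_step[OF filter_eq_holds belief_value_measurable[OF excess_measurable[OF v]]]
proof (rule expect_cong)
  fix s \<xi> assume "\<xi> \<in> space (Om {0..<Suc n})"
  then have xs: "obs_path n \<xi> \<in> space (PX n)" by (rule obs_path_in_PX)
  let ?xs = "obs_path n \<xi>"
  let ?a = "action g ?xs n"
  have x: "?xs n \<in> XX" using PX_space[OF xs] by simp
  have a: "?a \<in> acts M (?xs n)" using PX_adm[OF xs] by (simp add: acts_iff)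
  show "(\<integral>\<^sup>+x'. mx (?xs n) ?a x' (path_belief n ?xs) * belief_value (Suc n) (excess v) (?xs(Suc n := x')) \<partial>lam) =
    belief_value n (\<lambda>e. excess (\<lambda>e. L_op M \<beta> v e ?a) e) ?xs"
  proof (cases "path_belief n ?xs \<in> Pb M")
    case True
    have "(\<integral>\<^sup>+x'. mx (?xs n) ?a x' (path_belief n ?xs) * belief_value (Suc n) (excess v) (?xs(Suc n := x')) \<partial>lam) = L_nn (excess v) (?xs n, path_belief n ?xs, \<beta> ^ n * z) ?a"
      unfolding L_nn_def prod.case
    proof (rule nn_integral_cong)
      fix x'
      have "path_belief (Suc n) (?xs(Suc n := x')) \<in> Pb M \<longleftrightarrow> update_ok (?xs n) ?a x' (path_belief n ?xs)"
        using hist_belief_Suc_Pb_iff[OF E(2,5), of n "(?xs(Suc n := x'), \<lambda>k. action g (?xs(Suc n := x')) k)"] True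
          path_belief_upd[of n ?xs x'] action_upd[of ?xs n x'] by (simp add: path_belief_def)
      then show "mx (?xs n) ?a x' (path_belief n ?xs) * belief_value (Suc n) (excess v) (?xs(Suc n := x')) =
        mx (?xs n) ?a x' (path_belief n ?xs) * (if update_ok (?xs n) ?a x' (path_belief n ?xs) then excess v (x', upd (?xs n) ?a x' (path_belief n ?xs) (\<beta> ^ n * z), \<beta> * (\<beta> ^ n * z)) else 0)"
        unfolding belief_value_def by (simp add: path_belief_Suc path_belief_upd action_upd mult_ac)
    qed
    also have "\<dots> = belief_value n (\<lambda>e. excess (\<lambda>e. L_op M \<beta> v e ?a) e) ?xs"
      using True L_excess(2)[OF v state_in_E[OF True x] a] by (simp add: belief_value_def excess_def)
    finally show ?thesis .
  next
    \<comment> \<open>A null belief has predictive density 0, in agreement with the default of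
      \<open>belief_value\<close>.\<close>
    case False
    then have "emeasure (path_belief n ?xs) HSp = 0" using hist_belief_dichotomy[OF E(2,5)] unfolding path_belief_def by blast
    from mx_null[OF path_belief_SP this] False show ?thesis by (simp add: belief_value_def)
  qed
qed

lemma belief_value_mono:
  assumes "\<And>e. e \<in> E_set M \<Longrightarrow> fst e = xs n \<Longrightarrow> w e \<le> w' e" "xs \<in> space (PX n)"
  shows "belief_value n w xs \<le> belief_value n w' xs"
  using assms(1)[of "(xs n, path_belief n xs, \<beta> ^ n * z)"] state_in_E[of n xs] PX_space[OF assms(2), of n] by (simp add: belief_value_def)

lemma excess_mono: "v e \<le> v' e \<Longrightarrow> excess v e \<le> excess v' e"
  unfolding excess_def by (intro ennreal_leI) simp

lemma belief_value_0: "expect 0 (\<lambda>s \<xi>. belief_value 0 w (obs_path 0 \<xi>)) = w (x, \<mu>, z)"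
proof -
  have "expect 0 (\<lambda>s \<xi>. belief_value 0 w (obs_path 0 \<xi>)) = expect 0 (\<lambda>_ _. w (x, \<mu>, z))"
    unfolding expect_def
  proof (rule nn_integral_cong)
    fix p assume "p \<in> space \<mu>"
    then have p: "fst p \<in> YY" using p_space by auto
    have u: "(\<lambda>_. undefined)(0 := (x, fst p)) \<in> space (Om {0..<Suc 0})"
      using p E(1) by (auto simp: space_PiM PiE_def extensional_def)
    have "AE \<xi> in chain g x (fst p) 0. fst (\<xi> 0) = x"
    proof -
      have pm: "Measurable.pred (Om {0..<Suc 0}) (\<lambda>\<xi>. fst (\<xi> 0) = x)"
        using obs_borelD[OF Om_component(1)[of 0 "{0..<Suc 0}"]] by measurable
      show ?thesis unfolding chain.simps AE_return[OF u pm] by simp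
    qed
    then have "AE \<xi> in chain g x (fst p) 0. belief_value 0 w (obs_path 0 \<xi>) = w (x, \<mu>, z)"
      by eventually_elim (simp add: belief_value_def path_belief_0 E(2) obs_path_def)
    then show "(\<integral>\<^sup>+\<xi>. belief_value 0 w (obs_path 0 \<xi>) \<partial>chain g x (fst p) 0) = (\<integral>\<^sup>+\<xi>. w (x, \<mu>, z) \<partial>chain g x (fst p) 0)"
      by (rule nn_integral_cong_AE)
  qed
  then show ?thesis by (simp add: expect_const)
qed

text \<open>Generalised over \<open>v\<close>, so that the innermost application of
  \<open>T_op\<close> can be split off. It is at most \<open>L_op\<close> at the action of the
  policy, and \<open>belief_value_step\<close> trades that for one more stage of the
  process.\<close>

lemma iterate_le:
  assumes v: "v \<in> bellman_class" shows "excess (Tn n v) (x, \<mu>, z) \<le> expect n (\<lambda>s \<xi>. belief_value n (excess v) (obs_path n \<xi>))"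
  using v
proof (induction n arbitrary: v)
  case 0 then show ?case by (simp add: belief_value_0)
next
  case (Suc n)
  have "excess (Tn (Suc n) v) (x, \<mu>, z) = excess (Tn n (T_op M \<beta> v)) (x, \<mu>, z)" by (simp add: funpow_swap1)
  also have "\<dots> \<le> expect n (\<lambda>s \<xi>. belief_value n (excess (T_op M \<beta> v)) (obs_path n \<xi>))" by (rule Suc.IH[OF T_in_class[OF Suc.prems]])
  also have "\<dots> \<le> expect (Suc n) (\<lambda>s \<xi>. belief_value (Suc n) (excess v) (obs_path (Suc n) \<xi>))"
    unfolding belief_value_step[OF Suc.prems]
  proof (rule expect_mono, rule belief_value_mono[OF _ obs_path_in_PX])
    fix s \<xi> e assume *: "\<xi> \<in> space (Om {0..<Suc n})" "e \<in> E_set M" "fst e = obs_path n \<xi> n"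
    have "action g (obs_path n \<xi>) n \<in> acts M (fst e)" using PX_adm[OF obs_path_in_PX[OF *(1)]] *(3) by (simp add: acts_iff)
    then show "excess (T_op M \<beta> v) e \<le> excess (\<lambda>e. L_op M \<beta> v e (action g (obs_path n \<xi>) n)) e"
      by (intro excess_mono T_le[OF Suc.prems *(2)])
  qed
  finally show ?case .
qed

text \<open>A martingale property: if the actions realise the fixed-point equation, one further
  stage leaves the expected excess of \<open>Vlim\<close> along the beliefs unchanged.\<close>

lemma iterate_optimal:
  assumes opt: "\<And>n xs. xs \<in> space (PX n) \<Longrightarrow> path_belief n xs \<in> Pb M \<Longrightarrow>
      L_op M \<beta> Vlim (xs n, path_belief n xs, \<beta> ^ n * z) (action g xs n) = Vlim (xs n, path_belief n xs, \<beta> ^ n * z)"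
  shows "expect n (\<lambda>s \<xi>. belief_value n (excess Vlim) (obs_path n \<xi>)) = excess Vlim (x, \<mu>, z)"
proof (induction n)
  case 0 then show ?case by (simp add: belief_value_0)
next
  case (Suc n)
  have "expect (Suc n) (\<lambda>s \<xi>. belief_value (Suc n) (excess Vlim) (obs_path (Suc n) \<xi>)) = expect n (\<lambda>s \<xi>. belief_value n (excess Vlim) (obs_path n \<xi>))"
    unfolding belief_value_step[OF Vlim_in_class]
    by (rule expect_cong) (simp add: belief_value_def excess_def opt obs_path_in_PX)
  with Suc show ?case by simp
qed

text \<open>The filter equation for a test function of the accumulated cost alone. In applications
  \<open>c\<close> is the least or greatest discounted cost still to come, and \<open>w\<close> the
  excess of \<open>b_lower\<close> or \<open>b_upper\<close>.\<close>

lemma expect_cost: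
  assumes c: "0 \<le> c"
    and w: "\<And>x' \<nu>. (x', \<nu>, \<beta> ^ n * z) \<in> E_set M \<Longrightarrow> w (x', \<nu>, \<beta> ^ n * z) = (\<integral>\<^sup>+p. util0 (snd p + c) \<partial>\<nu>)"
  shows "expect n (\<lambda>s \<xi>. util0 (s + z * partial_cost g n \<xi> + c)) = expect n (\<lambda>s \<xi>. belief_value n w (obs_path n \<xi>))"
proof -
  have "case_prod (\<lambda>xs q. util0 (snd q + c)) \<in> borel_measurable (PX n \<Otimes>\<^sub>M HS)"
    using measurable_compose[OF measurable_snd util0_HS_measurable[OF c]] by (simp add: case_prod_unfold)
  then have "expect n (\<lambda>s \<xi>. util0 (s + z * partial_cost g n \<xi> + c)) = expect n (\<lambda>s \<xi>. \<integral>\<^sup>+q. util0 (snd q + c) \<partial>path_belief n (obs_path n \<xi>))"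
    using filter_eq_holds[of n] unfolding filter_eq_def by fastforce
  also have "\<dots> = expect n (\<lambda>s \<xi>. belief_value n w (obs_path n \<xi>))"
  proof (rule expect_cong)
    fix s \<xi> assume "\<xi> \<in> space (Om {0..<Suc n})"
    then have x: "obs_path n \<xi> n \<in> XX" using PX_space[OF obs_path_in_PX] by simp
    show "(\<integral>\<^sup>+q. util0 (snd q + c) \<partial>path_belief n (obs_path n \<xi>)) = belief_value n w (obs_path n \<xi>)"
    proof (cases "path_belief n (obs_path n \<xi>) \<in> Pb M")
      case True
      then show ?thesis using w state_in_E[OF True x] by (simp add: belief_value_def)
    next
      case False
      then have em: "emeasure (path_belief n (obs_path n \<xi>)) HSp = 0" using hist_belief_dichotomy[OF E(2,5)] unfolding path_belief_def by blast
      have "AE q in path_belief n (obs_path n \<xi>). False"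
        by (rule AE_I[of _ _ HSp]) (use em SP_D(2,3)[OF path_belief_SP] sets.top[of "path_belief n (obs_path n \<xi>)"] in auto)
      then have "(\<integral>\<^sup>+q. util0 (snd q + c) \<partial>path_belief n (obs_path n \<xi>)) = (\<integral>\<^sup>+q. 0 \<partial>path_belief n (obs_path n \<xi>))"
        by (intro nn_integral_cong_AE) auto
      then show ?thesis using False by (simp add: belief_value_def)
    qed
  qed
  finally show ?thesis .
qed

end

section \<open>The value of a policy\<close>

lemma disc_cost_sums:
  assumes g: "g \<in> policies M" and \<xi>: "\<xi> \<in> space (Om UNIV)"
  shows "(\<lambda>k. \<beta> ^ k * ce (fst (\<xi> k)) (snd (\<xi> k)) (action g (fst \<circ> \<xi>) k)) sums disc_cost M \<beta> g \<xi>"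
proof -
  have "cost M (fst (\<xi> k)) (snd (\<xi> k)) (action g (fst \<circ> \<xi>) k) = ce (fst (\<xi> k)) (snd (\<xi> k)) (action g (fst \<circ> \<xi>) k)" for k
    using action_Om_adm[OF g _ \<xi>, of k] Om_space[OF \<xi>, of k] by (simp add: ce_def cost_dom_def)
  then have "disc_cost M \<beta> g \<xi> = (\<Sum>k. \<beta> ^ k * ce (fst (\<xi> k)) (snd (\<xi> k)) (action g (fst \<circ> \<xi>) k))"
    by (simp add: disc_cost_def)
  moreover have "summable (\<lambda>k. \<beta> ^ k * ce (fst (\<xi> k)) (snd (\<xi> k)) (action g (fst \<circ> \<xi>) k))"
  proof (rule summable_comparison_test'[where g="\<lambda>k. \<beta> ^ k * cu" and N=0])
    show "summable (\<lambda>k. \<beta> ^ k * cu)" using beta by (intro summable_mult2 summable_geometric) auto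
    show "norm (\<beta> ^ k * ce (fst (\<xi> k)) (snd (\<xi> k)) (action g (fst \<circ> \<xi>) k)) \<le> \<beta> ^ k * cu" for k
      using beta ce_bounds(2)[of "fst (\<xi> k)" "snd (\<xi> k)" "action g (fst \<circ> \<xi>) k"]
        ce_bounds(3)[of "fst (\<xi> k)" "snd (\<xi> k)" "action g (fst \<circ> \<xi>) k"] by (simp add: abs_mult)
  qed
  ultimately show ?thesis by (simp add: summable_sums)
qed

text \<open>Splitting the series after \<open>n\<close> terms leaves a tail between two geometric
  series. The constants \<open>cl / (1 - \<beta>)\<close> and \<open>cu / (1 - \<beta>)\<close> in
  \<open>b_lower\<close> and \<open>b_upper\<close> have this origin.\<close>

lemma disc_cost_bounds:
  assumes g: "g \<in> policies M" and \<xi>: "\<xi> \<in> space (Om UNIV)"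
  shows "partial_cost g n \<xi> + \<beta> ^ n * cl / (1 - \<beta>) \<le> disc_cost M \<beta> g \<xi>" "disc_cost M \<beta> g \<xi> \<le> partial_cost g n \<xi> + \<beta> ^ n * cu / (1 - \<beta>)"
    "partial_cost g n \<xi> \<le> disc_cost M \<beta> g \<xi>"
proof -
  let ?c = "\<lambda>k. \<beta> ^ k * ce (fst (\<xi> k)) (snd (\<xi> k)) (action g (fst \<circ> \<xi>) k)"
  note s = disc_cost_sums[OF assms]
  have tail: "(\<lambda>k. ?c (k + n)) sums (disc_cost M \<beta> g \<xi> - partial_cost g n \<xi>)"
    using s unfolding partial_cost_def by (rule sums_split_initial_segment)
  have geo: "(\<lambda>k. \<beta> ^ (k + n) * c) sums (\<beta> ^ n * c / (1 - \<beta>))" for c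
  proof -
    have "(\<lambda>k. \<beta> ^ k) sums (1 / (1 - \<beta>))" using beta by (intro geometric_sums) auto
    from sums_mult[OF this, of "\<beta> ^ n * c"] show ?thesis by (simp add: power_add mult_ac)
  qed
  have "\<beta> ^ n * cl / (1 - \<beta>) \<le> disc_cost M \<beta> g \<xi> - partial_cost g n \<xi>"
    by (rule sums_le[OF _ geo tail]) (use beta ce_bounds in \<open>auto intro!: mult_left_mono\<close>)
  moreover have "disc_cost M \<beta> g \<xi> - partial_cost g n \<xi> \<le> \<beta> ^ n * cu / (1 - \<beta>)"
    by (rule sums_le[OF _ tail geo]) (use beta ce_bounds in \<open>auto intro!: mult_left_mono\<close>)
  moreover have "0 \<le> \<beta> ^ n * cl / (1 - \<beta>)" using disc_nonneg(2)[of "\<beta> ^ n"] beta by simp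
  ultimately show "partial_cost g n \<xi> + \<beta> ^ n * cl / (1 - \<beta>) \<le> disc_cost M \<beta> g \<xi>" "disc_cost M \<beta> g \<xi> \<le> partial_cost g n \<xi> + \<beta> ^ n * cu / (1 - \<beta>)"
    "partial_cost g n \<xi> \<le> disc_cost M \<beta> g \<xi>" by auto
qed

lemma disc_cost_nonneg: "g \<in> policies M \<Longrightarrow> \<xi> \<in> space (Om UNIV) \<Longrightarrow> 0 \<le> disc_cost M \<beta> g \<xi>"
  using disc_cost_bounds(3)[of g \<xi> 0] by (simp add: partial_cost_def)

lemma partial_cost_lim: "g \<in> policies M \<Longrightarrow> \<xi> \<in> space (Om UNIV) \<Longrightarrow> (\<lambda>n. partial_cost g n \<xi>) \<longlonglongrightarrow> disc_cost M \<beta> g \<xi>"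
  using disc_cost_sums[of g \<xi>] unfolding sums_def partial_cost_def .

context
  fixes g x \<mu> z
  assumes g: "g \<in> policies M" and e: "(x, \<mu>, z) \<in> E_set M"
begin

lemmas init_state = E[OF g e]

section \<open>Expected utility of the discounted cost\<close>

lemma disc_cost_measurable: "disc_cost M \<beta> g \<in> borel_measurable (Om UNIV)"
  by (rule borel_measurable_LIMSEQ_real[of _ "\<lambda>n. partial_cost g n"]) (use partial_cost_lim[OF g] partial_cost_measurable[OF g e] in auto)

lemma total_cost_measurable: "0 \<le> s \<Longrightarrow> (\<lambda>\<xi>. s + z * disc_cost M \<beta> g \<xi>) \<in> Om UNIV \<rightarrow>\<^sub>M Rplus"
  unfolding Rplus_def using disc_cost_nonneg[OF g] init_state(5)
  by (intro measurable_restrict_space2 borel_measurable_add borel_measurable_times borel_measurable_const disc_cost_measurable) auto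

lemma partial_cost_util0_measurable:
  assumes "0 \<le> s" "0 \<le> c" "{..<n} \<subseteq> I"
  shows "(\<lambda>\<xi>. util0 (s + z * partial_cost g n \<xi> + c)) \<in> borel_measurable (Om I)"
proof (rule measurable_compose[OF _ util0_measurable])
  show "(\<lambda>\<xi>. s + z * partial_cost g n \<xi> + c) \<in> Om I \<rightarrow>\<^sub>M Rplus"
    unfolding Rplus_def using assms init_state(5) partial_cost_nonneg
    by (intro measurable_restrict_space2 borel_measurable_add borel_measurable_times borel_measurable_const partial_cost_measurable[OF g e]) auto
qed

lemma law_partial_cost:
  assumes y: "y \<in> YY" and s: "0 \<le> s" "0 \<le> c"
  shows "(\<integral>\<^sup>+\<xi>. util0 (s + z * partial_cost g n \<xi> + c) \<partial>law M g x y) = (\<integral>\<^sup>+\<xi>. util0 (s + z * partial_cost g n \<xi> + c) \<partial>chain g x y n)"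
proof -
  have "partial_cost g n (restrict \<xi> {0..<Suc n}) = partial_cost g n \<xi>" for \<xi> :: "nat \<Rightarrow> 'x \<times> 'y"
  proof -
    have "action g (fst \<circ> restrict \<xi> {0..<Suc n}) k = action g (fst \<circ> \<xi>) k" if "k < n" for k
      using that by (intro action_cong) auto
    then show ?thesis unfolding partial_cost_def by (intro sum.cong) auto
  qed
  moreover have "{..<n} \<subseteq> {0..<Suc n}" by auto
  ultimately show ?thesis
    using law_props(4)[OF g init_state(1) y partial_cost_util0_measurable[OF s, of n "{0..<Suc n}"]] by simp
qed

definition path_excess where "path_excess p = (\<integral>\<^sup>+\<xi>. util0 (snd p + z * disc_cost M \<beta> g \<xi>) \<partial>law M g x (fst p))"

lemma path_excess_bounds:
  assumes p: "p \<in> HSp"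
  shows "(\<integral>\<^sup>+\<xi>. util0 (snd p + z * partial_cost g n \<xi> + \<beta> ^ n * z * cl / (1 - \<beta>)) \<partial>chain g x (fst p) n) \<le> path_excess p"
    "path_excess p \<le> (\<integral>\<^sup>+\<xi>. util0 (snd p + z * partial_cost g n \<xi> + \<beta> ^ n * z * cu / (1 - \<beta>)) \<partial>chain g x (fst p) n)"
proof -
  have y: "fst p \<in> YY" "0 \<le> snd p" using p by auto
  have bz: "0 \<le> \<beta> ^ n * z" by (rule bz_nonneg[OF init_state(5)])
  note c = disc_nonneg[OF bz]
  have sp: "space (law M g x (fst p)) = space (Om UNIV)" by (rule law_props(2)[OF g init_state(1) y(1)])
  have zm: "z * partial_cost g n \<xi> + \<beta> ^ n * z * cl / (1 - \<beta>) \<le> z * disc_cost M \<beta> g \<xi>"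
    "z * disc_cost M \<beta> g \<xi> \<le> z * partial_cost g n \<xi> + \<beta> ^ n * z * cu / (1 - \<beta>)" if "\<xi> \<in> space (Om UNIV)" for \<xi>
    using mult_left_mono[OF disc_cost_bounds(1)[OF g that, of n] init_state(5)] mult_left_mono[OF disc_cost_bounds(2)[OF g that, of n] init_state(5)]
    by (auto simp: algebra_simps)
  have zd: "0 \<le> z * partial_cost g n \<xi>" for \<xi> using init_state(5) partial_cost_nonneg by simp
  show "(\<integral>\<^sup>+\<xi>. util0 (snd p + z * partial_cost g n \<xi> + \<beta> ^ n * z * cl / (1 - \<beta>)) \<partial>chain g x (fst p) n) \<le> path_excess p"
    unfolding path_excess_def law_partial_cost[OF y c(2), symmetric]
  proof (rule nn_integral_mono, rule util0_mono)
    fix \<xi> assume "\<xi> \<in> space (law M g x (fst p))"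
    then show "snd p + z * partial_cost g n \<xi> + \<beta> ^ n * z * cl / (1 - \<beta>) \<le> snd p + z * disc_cost M \<beta> g \<xi>"
      using zm(1)[of \<xi>] sp by simp
  qed (use y c zd in auto)
  show "path_excess p \<le> (\<integral>\<^sup>+\<xi>. util0 (snd p + z * partial_cost g n \<xi> + \<beta> ^ n * z * cu / (1 - \<beta>)) \<partial>chain g x (fst p) n)"
    unfolding path_excess_def law_partial_cost[OF y c(1), symmetric]
  proof (rule nn_integral_mono, rule util0_mono)
    fix \<xi> assume "\<xi> \<in> space (law M g x (fst p))"
    then show "snd p + z * disc_cost M \<beta> g \<xi> \<le> snd p + z * partial_cost g n \<xi> + \<beta> ^ n * z * cu / (1 - \<beta>)" "0 \<le> snd p + z * disc_cost M \<beta> g \<xi>"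
      using zm(2)[of \<xi>] sp y init_state(5) disc_cost_nonneg[OF g, of \<xi>] by auto
  qed
qed

lemma partial_cost_mono: "m \<le> n \<Longrightarrow> partial_cost g m \<xi> \<le> partial_cost g n \<xi>"
  unfolding partial_cost_def using beta ce_bounds(3)
  by (intro sum_mono2) (auto intro!: mult_nonneg_nonneg simp: less_imp_le)

text \<open>Monotone convergence expresses the infinite-horizon integral through finite chains.
  Measurability in the initial hidden pair then follows from \<open>chain_measurable\<close>,
  without studying how \<open>law\<close> depends on its starting point.\<close>

lemma path_excess_SUP:
  assumes p: "p \<in> HSp"
  shows "path_excess p = (SUP n. \<integral>\<^sup>+\<xi>. util0 (snd p + z * partial_cost g n \<xi>) \<partial>chain g x (fst p) n)"
proof -
  have y: "fst p \<in> YY" "0 \<le> snd p" using p by auto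
  have sp: "space (law M g x (fst p)) = space (Om UNIV)" by (rule law_props(2)[OF g init_state(1) y(1)])
  have sets: "sets (law M g x (fst p)) = sets (Om UNIV)" by (rule law_props(1)[OF g init_state(1) y(1)])
  have inc: "incseq (\<lambda>n \<xi>. util0 (snd p + z * partial_cost g n \<xi>))"
    unfolding incseq_def le_fun_def using y(2) init_state(5) partial_cost_nonneg partial_cost_mono
    by (auto intro!: util0_mono add_nonneg_nonneg mult_nonneg_nonneg mult_left_mono)
  have "path_excess p = (\<integral>\<^sup>+\<xi>. (SUP n. util0 (snd p + z * partial_cost g n \<xi>)) \<partial>law M g x (fst p))"
    unfolding path_excess_def
  proof (rule nn_integral_cong)
    fix \<xi> assume "\<xi> \<in> space (law M g x (fst p))"
    then have \<xi>: "\<xi> \<in> space (Om UNIV)" using sp by simp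
    have "(\<lambda>n. util0 (snd p + z * partial_cost g n \<xi>)) \<longlonglongrightarrow> util0 (snd p + z * disc_cost M \<beta> g \<xi>)"
      using y(2) init_state(5) partial_cost_nonneg disc_cost_nonneg[OF g \<xi>]
      by (intro util0_tendsto tendsto_intros partial_cost_lim[OF g \<xi>]) auto
    moreover have "(\<lambda>n. util0 (snd p + z * partial_cost g n \<xi>)) \<longlonglongrightarrow> (SUP n. util0 (snd p + z * partial_cost g n \<xi>))"
      using inc by (intro LIMSEQ_SUP) (auto simp: incseq_def le_fun_def)
    ultimately show "util0 (snd p + z * disc_cost M \<beta> g \<xi>) = (SUP n. util0 (snd p + z * partial_cost g n \<xi>))"
      by (rule LIMSEQ_unique)
  qed
  also have "\<dots> = (SUP n. \<integral>\<^sup>+\<xi>. util0 (snd p + z * partial_cost g n \<xi>) \<partial>law M g x (fst p))"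
  proof (rule nn_integral_monotone_convergence_SUP[OF inc])
    fix n
    have "(\<lambda>\<xi>. util0 (snd p + z * partial_cost g n \<xi> + 0)) \<in> borel_measurable (Om UNIV)"
      by (rule partial_cost_util0_measurable[OF y(2)]) auto
    then show "(\<lambda>\<xi>. util0 (snd p + z * partial_cost g n \<xi>)) \<in> borel_measurable (law M g x (fst p))"
      unfolding measurable_cong_sets[OF sets refl] by simp
  qed
  also have "\<dots> = (SUP n. \<integral>\<^sup>+\<xi>. util0 (snd p + z * partial_cost g n \<xi>) \<partial>chain g x (fst p) n)"
    using law_partial_cost[OF y, of 0] by simp
  finally show ?thesis .
qed

lemma chain_HS_measurable: "(\<lambda>p. chain g x (fst p) n) \<in> HS \<rightarrow>\<^sub>M subprob_algebra (Om {0..<Suc n})"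
  by (rule measurable_compose[OF Rplus_fst_snd(3) chain_measurable[OF g init_state(1)]])

lemma path_excess_measurable: "path_excess \<in> borel_measurable HS"
proof -
  have "(\<lambda>p. \<integral>\<^sup>+\<xi>. util0 (snd p + z * partial_cost g n \<xi>) \<partial>chain g x (fst p) n) \<in> borel_measurable HS" for n
  proof (rule nn_integral_measurable_subprob_algebra2[OF _ chain_HS_measurable])
    have "(\<lambda>w. snd (fst w) + z * partial_cost g n (snd w)) \<in> HS \<Otimes>\<^sub>M Om {0..<Suc n} \<rightarrow>\<^sub>M Rplus"
      unfolding Rplus_def
    proof (rule measurable_restrict_space2)
      show "(\<lambda>w. snd (fst w) + z * partial_cost g n (snd w)) \<in> borel_measurable (HS \<Otimes>\<^sub>M Om {0..<Suc n})"
        by (intro borel_measurable_add borel_measurable_times borel_measurable_const measurable_compose[OF measurable_fst Rplus_fst_snd(2)]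
            measurable_compose[OF measurable_snd partial_cost_measurable[OF g e]]) auto
      show "(\<lambda>w. snd (fst w) + z * partial_cost g n (snd w)) \<in> space (HS \<Otimes>\<^sub>M Om {0..<Suc n}) \<rightarrow> {0..}"
        using init_state(5) partial_cost_nonneg by (auto simp: space_pair_measure)
    qed
    from measurable_compose[OF this util0_measurable]
    show "(\<lambda>(p, \<xi>). util0 (snd p + z * partial_cost g n \<xi>)) \<in> borel_measurable (HS \<Otimes>\<^sub>M Om {0..<Suc n})"
      by (simp add: case_prod_unfold)
  qed
  then have "(\<lambda>p. SUP n. \<integral>\<^sup>+\<xi>. util0 (snd p + z * partial_cost g n \<xi>) \<partial>chain g x (fst p) n) \<in> borel_measurable HS"
    by (intro borel_measurable_SUP) auto
  then show ?thesis
    by (rule measurable_cong[THEN iffD1, rotated]) (simp add: path_excess_SUP)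
qed

definition path_utility where "path_utility p = (\<integral>\<xi>. U (snd p + z * disc_cost M \<beta> g \<xi>) \<partial>law M g x (fst p))"

lemma path_utility_props:
  assumes p: "p \<in> HSp"
  shows "U 0 \<le> path_utility p" "path_utility p \<le> U (snd p + z * cu / (1 - \<beta>))" "ennreal (path_utility p - U 0) = path_excess p"
proof -
  have y: "fst p \<in> YY" "0 \<le> snd p" using p by auto
  interpret L: prob_space "law M g x (fst p)" by (rule law_props(3)[OF g init_state(1) y(1)])
  have sp: "space (law M g x (fst p)) = space (Om UNIV)" by (rule law_props(2)[OF g init_state(1) y(1)])
  have m: "(\<lambda>\<xi>. U (snd p + z * disc_cost M \<beta> g \<xi>)) \<in> borel_measurable (law M g x (fst p))"
    unfolding measurable_cong_sets[OF law_props(1)[OF g init_state(1) y(1)] refl]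
    by (rule measurable_compose[OF total_cost_measurable[OF y(2)] U_measurable])
  have ge: "AE \<xi> in law M g x (fst p). U 0 \<le> U (snd p + z * disc_cost M \<beta> g \<xi>)"
    by (rule AE_I2, rule U_mono) (use y init_state(5) disc_cost_nonneg[OF g] sp in auto)
  have le: "AE \<xi> in law M g x (fst p). U (snd p + z * disc_cost M \<beta> g \<xi>) \<le> U (snd p + z * cu / (1 - \<beta>))"
  proof (rule AE_I2, rule U_mono)
    fix \<xi> assume "\<xi> \<in> space (law M g x (fst p))"
    then have \<xi>: "\<xi> \<in> space (Om UNIV)" using sp by simp
    show "0 \<le> snd p + z * disc_cost M \<beta> g \<xi>" using y init_state(5) disc_cost_nonneg[OF g \<xi>] by simp
    show "snd p + z * disc_cost M \<beta> g \<xi> \<le> snd p + z * cu / (1 - \<beta>)"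
      using mult_left_mono[OF disc_cost_bounds(2)[OF g \<xi>, of 0] init_state(5)] by (simp add: partial_cost_def)
  qed
  have int: "integrable (law M g x (fst p)) (\<lambda>\<xi>. U (snd p + z * disc_cost M \<beta> g \<xi>))"
  proof (rule L.integrable_const_bound[OF _ m])
    show "AE \<xi> in law M g x (fst p). norm (U (snd p + z * disc_cost M \<beta> g \<xi>)) \<le> max \<bar>U 0\<bar> \<bar>U (snd p + z * cu / (1 - \<beta>))\<bar>"
      using ge le by eventually_elim auto
  qed
  show "U 0 \<le> path_utility p" unfolding path_utility_def using int ge by (intro L.integral_ge_const)
  show "path_utility p \<le> U (snd p + z * cu / (1 - \<beta>))" unfolding path_utility_def using int le by (intro L.integral_le_const)
  have "path_excess p = ennreal (\<integral>\<xi>. U (snd p + z * disc_cost M \<beta> g \<xi>) - U 0 \<partial>law M g x (fst p))"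
    unfolding path_excess_def util0_def using int ge by (intro nn_integral_eq_integral) auto
  also have "\<dots> = ennreal (path_utility p - U 0)" unfolding path_utility_def using int by (simp add: L.prob_space)
  finally show "ennreal (path_utility p - U 0) = path_excess p" by simp
qed

lemma path_utility_measurable: "path_utility \<in> borel_measurable HS"
proof -
  have "(\<lambda>p. U 0 + enn2real (path_excess p)) \<in> borel_measurable HS" using path_excess_measurable by measurable
  then show ?thesis
  proof (rule measurable_cong[THEN iffD1, rotated])
    fix p assume "p \<in> space HS"
    then have "p \<in> HSp" by simp
    from path_utility_props[OF this] show "U 0 + enn2real (path_excess p) = path_utility p"
      by (metis add.commute diff_add_cancel diff_ge_0_iff_ge enn2real_ennreal)
  qed
qed

definition policy_value where "policy_value = (\<integral>p. path_utility p \<partial>\<mu>)"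

lemma policy_value_props: "U 0 \<le> policy_value" "ennreal (policy_value - U 0) = (\<integral>\<^sup>+p. path_excess p \<partial>\<mu>)"
proof -
  interpret prob_space \<mu> by (rule Pb_D(1)[OF init_state(2)])
  have sp: "space \<mu> = HSp" by (rule Pb_D(3)[OF init_state(2)])
  have m: "path_utility \<in> borel_measurable \<mu>" by (rule SP_measurable[OF init_state(6) path_utility_measurable])
  obtain K where K: "AE p in \<mu>. snd p \<le> K" using init_state(2) unfolding Pb_iff by blast
  have ge: "AE p in \<mu>. U 0 \<le> path_utility p" by (rule AE_I2) (simp add: path_utility_props(1) sp)
  have le: "AE p in \<mu>. path_utility p \<le> U (K + z * cu / (1 - \<beta>))"
    using K AE_space
  proof eventually_elim
    case (elim p)
    then have p: "p \<in> HSp" using sp by simp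
    have "path_utility p \<le> U (snd p + z * cu / (1 - \<beta>))" by (rule path_utility_props(2)[OF p])
    also have "\<dots> \<le> U (K + z * cu / (1 - \<beta>))"
      using elim p disc_nonneg(1)[OF init_state(5)] by (intro U_mono) auto
    finally show ?case .
  qed
  have int: "integrable \<mu> path_utility"
  proof (rule integrable_const_bound[OF _ m])
    show "AE p in \<mu>. norm (path_utility p) \<le> max \<bar>U 0\<bar> \<bar>U (K + z * cu / (1 - \<beta>))\<bar>"
      using ge le by eventually_elim auto
  qed
  show "U 0 \<le> policy_value" unfolding policy_value_def using int ge by (intro integral_ge_const)
  have "ennreal (policy_value - U 0) = ennreal (\<integral>p. path_utility p - U 0 \<partial>\<mu>)" unfolding policy_value_def using int by (simp add: prob_space)
  also have "\<dots> = (\<integral>\<^sup>+p. ennreal (path_utility p - U 0) \<partial>\<mu>)"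
    using int ge by (intro nn_integral_eq_integral[symmetric]) auto
  also have "\<dots> = (\<integral>\<^sup>+p. path_excess p \<partial>\<mu>)" using path_utility_props(3) sp by (intro nn_integral_cong) simp
  finally show "ennreal (policy_value - U 0) = (\<integral>\<^sup>+p. path_excess p \<partial>\<mu>)" .
qed

section \<open>Comparison of a policy with the fixed point\<close>

lemma sp_mu: "p \<in> space \<mu> \<Longrightarrow> p \<in> HSp" using Pb_D(3)[OF init_state(2)] by simp

lemma excess_b_util0:
  assumes "(x', \<nu>, z') \<in> E_set M"
  shows "excess (b_lower U \<beta> cl) (x', \<nu>, z') = (\<integral>\<^sup>+p. util0 (snd p + z' * cl / (1 - \<beta>)) \<partial>\<nu>)"
    "excess (b_upper U \<beta> cu) (x', \<nu>, z') = (\<integral>\<^sup>+p. util0 (snd p + z' * cu / (1 - \<beta>)) \<partial>\<nu>)"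
  using E_setD[OF assms] disc_nonneg[of z'] by (auto simp: excess_def b_lower_exp_util[OF assms] b_upper_exp_util[OF assms] intro!: exp_util_props(3))

text \<open>By \<open>iterate_le\<close> and \<open>expect_cost\<close> the \<open>n\<close>-th
  iterate of \<open>b_lower\<close> is at most the expected utility of the cost up to
  \<open>n\<close> plus the smallest possible tail, which the true cost dominates; \<open>n\<close>
  then tends to infinity.\<close>

lemma Vlim_le_policy_value: "Vlim (x, \<mu>, z) \<le> policy_value"
proof (rule LIMSEQ_le_const2[OF Vlim_lim[OF bounds_in_class(2) e]], intro exI allI impI)
  fix n
  have bz: "0 \<le> \<beta> ^ n * z" by (rule bz_nonneg[OF init_state(5)])
  have "excess (Tn n (b_lower U \<beta> cl)) (x, \<mu>, z) \<le> expect g x \<mu> n (\<lambda>s \<xi>. belief_value g \<mu> z n (excess (b_lower U \<beta> cl)) (obs_path n \<xi>))"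
    by (rule iterate_le[OF g e bounds_in_class(2)])
  also have "\<dots> = expect g x \<mu> n (\<lambda>s \<xi>. util0 (s + z * partial_cost g n \<xi> + \<beta> ^ n * z * cl / (1 - \<beta>)))"
    by (rule expect_cost[OF g e disc_nonneg(2)[OF bz], symmetric]) (rule excess_b_util0)
  also have "\<dots> \<le> (\<integral>\<^sup>+p. path_excess p \<partial>\<mu>)"
    unfolding expect_def[OF g e] by (intro nn_integral_mono path_excess_bounds(1) sp_mu)
  also have "\<dots> = ennreal (policy_value - U 0)" using policy_value_props by simp
  finally show "Tn n (b_lower U \<beta> cl) (x, \<mu>, z) \<le> policy_value"
    using policy_value_props(1) by (simp add: excess_def ennreal_le_iff)
qed

text \<open>The largest possible tail replaces the true one, which gives \<open>b_upper\<close>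
  evaluated at the belief of time \<open>n\<close>. It exceeds \<open>Vlim\<close> there by at most
  \<open>gap n z\<close>, the expectation of \<open>Vlim\<close> is the initial value by
  \<open>iterate_optimal\<close>, and the gap tends to 0.\<close>

lemma policy_value_le_Vlim:
  assumes opt: "\<And>n xs. xs \<in> space (PX n) \<Longrightarrow> path_belief g \<mu> z n xs \<in> Pb M \<Longrightarrow>
      L_op M \<beta> Vlim (xs n, path_belief g \<mu> z n xs, \<beta> ^ n * z) (action g xs n) = Vlim (xs n, path_belief g \<mu> z n xs, \<beta> ^ n * z)"
  shows "policy_value \<le> Vlim (x, \<mu>, z)"
proof -
  have "policy_value \<le> Vlim (x, \<mu>, z) + gap n z" for n
  proof -
    have bz: "0 \<le> \<beta> ^ n * z" by (rule bz_nonneg[OF init_state(5)])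
    interpret prob_space \<mu> by (rule Pb_D(1)[OF init_state(2)])
    let ?st = "\<lambda>\<xi>. belief_value g \<mu> z n (excess Vlim) (obs_path n \<xi>)"
    have m: "?st \<in> borel_measurable (Om {0..<Suc n})"
      by (rule measurable_compose[OF obs_path_measurable belief_value_measurable[OF g e excess_measurable[OF Vlim_in_class]]]) auto
    have m2: "(\<lambda>p. \<integral>\<^sup>+\<xi>. ?st \<xi> \<partial>chain g x (fst p) n) \<in> borel_measurable \<mu>"
      by (rule SP_measurable[OF init_state(6)], rule measurable_compose[OF chain_HS_measurable nn_integral_measurable_subprob_algebra[OF m]])
    have "ennreal (policy_value - U 0) = (\<integral>\<^sup>+p. path_excess p \<partial>\<mu>)" by (rule policy_value_props)
    also have "\<dots> \<le> expect g x \<mu> n (\<lambda>s \<xi>. util0 (s + z * partial_cost g n \<xi> + \<beta> ^ n * z * cu / (1 - \<beta>)))"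
      unfolding expect_def[OF g e] by (intro nn_integral_mono path_excess_bounds(2) sp_mu)
    also have "\<dots> = expect g x \<mu> n (\<lambda>s \<xi>. belief_value g \<mu> z n (excess (b_upper U \<beta> cu)) (obs_path n \<xi>))"
      by (rule expect_cost[OF g e disc_nonneg(1)[OF bz]]) (rule excess_b_util0)
    also have "\<dots> \<le> expect g x \<mu> n (\<lambda>s \<xi>. ?st \<xi> + ennreal (gap n z))"
    proof (rule expect_mono[OF g e])
      fix s \<xi> assume "\<xi> \<in> space (Om {0..<Suc n})"
      then have xs: "obs_path n \<xi> \<in> space (PX n)" by (rule obs_path_in_PX[OF g e])
      show "belief_value g \<mu> z n (excess (b_upper U \<beta> cu)) (obs_path n \<xi>) \<le> ?st \<xi> + ennreal (gap n z)"
      proof (cases "path_belief g \<mu> z n (obs_path n \<xi>) \<in> Pb M")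
        case True
        let ?e = "(obs_path n \<xi> n, path_belief g \<mu> z n (obs_path n \<xi>), \<beta> ^ n * z)"
        have e': "?e \<in> E_set M" using PX_space[OF xs] True by (intro state_in_E[OF g e]) auto
        \<comment> \<open>The gap estimate for zero iterations at scale
          \<open>\<beta> ^ n * z\<close>, where \<open>gap 0\<close> is
          \<open>gap n z\<close>.\<close>
        have "b_upper U \<beta> cu ?e \<le> V_zero U ?e + gap n z" using Tn_gap[OF e', of 0] by (simp add: gap_def)
        also have "\<dots> \<le> Vlim ?e + gap n z" using Vlim_in_class e' by (simp add: bellman_class_def)
        finally have "excess (b_upper U \<beta> cu) ?e \<le> ennreal ((Vlim ?e - U 0) + gap n z)" unfolding excess_def by (intro ennreal_leI) simp
        also have "\<dots> = excess Vlim ?e + ennreal (gap n z)"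
          unfolding excess_def using class_ge_U0[OF Vlim_in_class e'] gap_nonneg[OF init_state(5)] by (intro ennreal_plus) auto
        finally show ?thesis using True by (simp add: belief_value_def[OF g e])
      qed (simp add: belief_value_def[OF g e])
    qed
    also have "\<dots> = (\<integral>\<^sup>+p. (\<integral>\<^sup>+\<xi>. ?st \<xi> \<partial>chain g x (fst p) n) + ennreal (gap n z) \<partial>\<mu>)"
      unfolding expect_def[OF g e]
    proof (rule nn_integral_cong)
      fix p assume "p \<in> space \<mu>"
      from sp_mu[OF this] have y: "fst p \<in> YY" by (simp add: mem_Times_iff)
      have m': "?st \<in> borel_measurable (chain g x (fst p) n)"
        unfolding measurable_cong_sets[OF chain_props(2)[OF g init_state(1) y] refl] by (rule m)
      show "(\<integral>\<^sup>+\<xi>. ?st \<xi> + ennreal (gap n z) \<partial>chain g x (fst p) n) = (\<integral>\<^sup>+\<xi>. ?st \<xi> \<partial>chain g x (fst p) n) + ennreal (gap n z)"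
        by (subst nn_integral_add[OF m' borel_measurable_const]) (simp only: chain_mass[OF g e y])
    qed
    also have "\<dots> = expect g x \<mu> n (\<lambda>s \<xi>. ?st \<xi>) + ennreal (gap n z)"
      unfolding expect_def[OF g e] by (subst nn_integral_add[OF m2 borel_measurable_const]) (simp add: emeasure_space_1)
    also have "\<dots> = excess Vlim (x, \<mu>, z) + ennreal (gap n z)"
      using iterate_optimal[OF g e opt] by simp
    also have "\<dots> = ennreal ((Vlim (x, \<mu>, z) - U 0) + gap n z)"
      unfolding excess_def using class_ge_U0[OF Vlim_in_class e] gap_nonneg[OF init_state(5)] by (intro ennreal_plus[symmetric]) auto
    finally show ?thesis
      using class_ge_U0[OF Vlim_in_class e] gap_nonneg[OF init_state(5), of n] by (subst (asm) ennreal_le_iff) auto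
  qed
  moreover have "(\<lambda>n. Vlim (x, \<mu>, z) + gap n z) \<longlonglongrightarrow> Vlim (x, \<mu>, z) + 0"
    by (intro tendsto_intros gap_lim init_state)
  ultimately show ?thesis using LIMSEQ_le_const by fastforce
qed

end

section \<open>Optimality of the filter policy\<close>

lemma minimizer_Vlim:
  assumes "minimizer M \<beta> Vlim f" "e \<in> E_set M"
  shows "f e \<in> acts M (fst e)" "L_op M \<beta> Vlim e (f e) = Vlim e"
  using assms T_Vlim by (auto simp: minimizer_def F_rules_def)

lemma hist_component:
  "i \<le> n \<Longrightarrow> (\<lambda>h. fst h i) \<in> hist_space M n \<rightarrow>\<^sub>M obs_borel M"
  "i < n \<Longrightarrow> (\<lambda>h. snd h i) \<in> hist_space M n \<rightarrow>\<^sub>M act_borel M"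
  unfolding hist_space_def
  by (auto intro!: measurable_compose[OF measurable_fst measurable_component_singleton] measurable_compose[OF measurable_snd measurable_component_singleton])

text \<open>Off the beliefs that are probability measures the policy falls back on the measurable
  selector of the graph assumption.\<close>

lemma filter_policy_exists:
  assumes f: "f \<in> F_rules M" and \<mu>: "\<mu> \<in> Pb M" and z: "0 < z" "z \<le> 1"
  shows "\<exists>g\<in>policies M. \<forall>n. \<forall>h\<in>space (hist_space M n). hist_belief \<mu> z n h \<in> Pb M \<longrightarrow> g n h = f (fst h n, hist_belief \<mu> z n h, \<beta> ^ n * z)"
proof -
  obtain \<phi> where \<phi>: "\<phi> \<in> obs_borel M \<rightarrow>\<^sub>M act_borel M" "\<And>x. x \<in> XX \<Longrightarrow> (x, \<phi> x) \<in> adm M"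
    using adm_graph by blast
  have z0: "0 \<le> z" using z by simp
  have bz: "0 < \<beta> ^ n * z" "\<beta> ^ n * z \<le> 1" for n using beta z by (auto intro!: mult_le_one power_le_one)
  \<comment> \<open>The inner conditional looks redundant but keeps the argument of \<open>f\<close>
    inside \<open>E_set M\<close> at every history, as measurability into \<open>E_borel M\<close>
    requires.\<close>
  define g where "g n h = (if hist_belief \<mu> z n h \<in> Pb M then f (fst h n, if hist_belief \<mu> z n h \<in> Pb M then hist_belief \<mu> z n h else \<mu>, \<beta> ^ n * z) else \<phi> (fst h n))" for n h
  have fm: "f \<in> E_borel M \<rightarrow>\<^sub>M act_borel M" "\<And>e. e \<in> E_set M \<Longrightarrow> f e \<in> acts M (fst e)"
    using f by (auto simp: F_rules_def)
  have XXh: "fst h n \<in> XX" if "h \<in> space (hist_space M n)" for h n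
    using measurable_space[OF hist_component(1)[OF order_refl] that] by simp
  have "g \<in> policies M"
    unfolding policies_def
  proof (intro CollectI allI conjI ballI)
    fix n
    have gbm: "(\<lambda>h. hist_belief \<mu> z n h) \<in> hist_space M n \<rightarrow>\<^sub>M SP"
      using hist_belief_measurable[OF Pb_D(4)[OF \<mu>] z0, of n "\<lambda>h. fst h" "hist_space M n" "\<lambda>h. snd h"] hist_component by simp
    have pm: "{h \<in> space (hist_space M n). hist_belief \<mu> z n h \<in> Pb M} \<in> sets (hist_space M n)"
      using hist_belief_Pb_measurable[OF \<mu> z0 gbm] by (simp add: pred_def)
    have "(\<lambda>h. (fst h n, if hist_belief \<mu> z n h \<in> Pb M then hist_belief \<mu> z n h else \<mu>, \<beta> ^ n * z)) \<in> hist_space M n \<rightarrow>\<^sub>M E_borel M"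
    proof (rule measurable_E_borel)
      show "(\<lambda>h. fst h n) \<in> hist_space M n \<rightarrow>\<^sub>M obs_borel M" by (rule hist_component(1)) simp
      show "(\<lambda>h. if hist_belief \<mu> z n h \<in> Pb M then hist_belief \<mu> z n h else \<mu>) \<in> hist_space M n \<rightarrow>\<^sub>M SP"
        by (rule measurable_If[OF gbm measurable_const[OF Pb_D(4)[OF \<mu>]] pm])
      show "(\<lambda>h. \<beta> ^ n * z) \<in> borel_measurable (hist_space M n)" by (rule borel_measurable_const)
      show "(fst h n, if hist_belief \<mu> z n h \<in> Pb M then hist_belief \<mu> z n h else \<mu>, \<beta> ^ n * z) \<in> E_set M" if "h \<in> space (hist_space M n)" for h
        using XXh[OF that] bz \<mu> by (auto simp: E_set_def)
    qed
    from measurable_If[OF measurable_compose[OF this fm(1)] measurable_compose[OF hist_component(1)[OF order_refl] \<phi>(1)] pm]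
    show "g n \<in> hist_space M n \<rightarrow>\<^sub>M act_borel M" unfolding g_def[abs_def] .
    fix h assume h: "h \<in> space (hist_space M n)"
    have "g n h \<in> acts M (fst h n)"
    proof (cases "hist_belief \<mu> z n h \<in> Pb M")
      case True
      then have "(fst h n, hist_belief \<mu> z n h, \<beta> ^ n * z) \<in> E_set M" using XXh[OF h] bz by (auto simp: E_set_def)
      from fm(2)[OF this] True show ?thesis by (simp add: g_def)
    next
      case False
      then show ?thesis using \<phi>(2)[OF XXh[OF h]] by (simp add: g_def acts_iff)
    qed
    then show "case h of (xs, as) \<Rightarrow> g n (xs, as) \<in> acts M (xs n)" by (simp add: case_prod_unfold)
  qed
  then show ?thesis by (intro bexI[of _ g]) (simp_all add: g_def)
qed

text \<open>The actions recorded in a history generated by \<open>g\<close> are those of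
  \<open>g\<close> along the observed path, so the belief of the history is the belief of the path
  and the minimizer yields the fixed-point equation at every genuine belief.\<close>

lemma filter_policy_value:
  assumes f: "minimizer M \<beta> Vlim f" and e: "(x, \<mu>, z) \<in> E_set M" and g: "g \<in> policies M"
    and gen: "\<And>n h. h \<in> space (hist_space M n) \<Longrightarrow> hist_belief \<mu> z n h \<in> Pb M \<Longrightarrow> g n h = f (fst h n, hist_belief \<mu> z n h, \<beta> ^ n * z)"
  shows "policy_value g x \<mu> z = Vlim (x, \<mu>, z)"
proof (rule antisym)
  show "Vlim (x, \<mu>, z) \<le> policy_value g x \<mu> z" by (rule Vlim_le_policy_value[OF g e])
  show "policy_value g x \<mu> z \<le> Vlim (x, \<mu>, z)"
  proof (rule policy_value_le_Vlim[OF g e])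
    fix n xs assume xs: "xs \<in> space (PX n)" and b: "path_belief g \<mu> z n xs \<in> Pb M"
    let ?h = "(restrict xs {..n}, past_actions g xs n)"
    have h: "?h \<in> space (hist_space M n)" using PX_space[OF xs] by (intro hist_in_space[OF g])
    have hist_belief: "hist_belief \<mu> z n ?h = path_belief g \<mu> z n xs"
      unfolding path_belief_def[OF g e] by (rule hist_belief_cong) (auto simp: past_actions_action)
    have "action g xs n = f (xs n, path_belief g \<mu> z n xs, \<beta> ^ n * z)"
      using gen[OF h] hist_belief b by (simp add: action_def)
    moreover have "(xs n, path_belief g \<mu> z n xs, \<beta> ^ n * z) \<in> E_set M"
      using PX_space[OF xs] b by (intro state_in_E[OF g e]) auto
    ultimately show "L_op M \<beta> Vlim (xs n, path_belief g \<mu> z n xs, \<beta> ^ n * z) (action g xs n) = Vlim (xs n, path_belief g \<mu> z n xs, \<beta> ^ n * z)"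
      using minimizer_Vlim(2)[OF f] by simp
  qed
qed

lemma V_inf_policy_value: 
  assumes "(x, \<mu>, z) \<in> E_set M"
  shows "V_inf M U \<beta> (x, \<mu>, z) = (INF g\<in>policies M. policy_value g x \<mu> z)"
  unfolding V_inf_def prod.case
proof (rule INF_cong[OF refl])
  fix g assume g: "g \<in> policies M"
  show "(\<integral>(y, s). (\<integral>\<xi>. U (s + z * disc_cost M \<beta> g \<xi>) \<partial>law M g x y) \<partial>\<mu>) = policy_value g x \<mu> z"
    unfolding policy_value_def[OF g assms] path_utility_def[OF g assms, abs_def] by (simp add: case_prod_unfold)
qed

text \<open>The attaining policy is rebuilt for each initial belief and scale, with a filter started
  there; the lower bound holds for all policies.\<close>

lemma V_inf_Vlim:
  assumes e: "e \<in> E_set M" shows "V_inf M U \<beta> e = Vlim e"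
proof -
  obtain x \<mu> z where exz: "e = (x, \<mu>, z)" by (cases e)
  note e' = e[unfolded exz]
  obtain f where f: "minimizer M \<beta> Vlim f" using minimizer_exists[OF Vlim_in_class] by blast
  then have "f \<in> F_rules M" by (simp add: minimizer_def)
  from filter_policy_exists[OF this] E_setD[OF e']
  obtain g where g: "g \<in> policies M" "\<forall>n. \<forall>h\<in>space (hist_space M n). hist_belief \<mu> z n h \<in> Pb M \<longrightarrow> g n h = f (fst h n, hist_belief \<mu> z n h, \<beta> ^ n * z)"
    by blast
  have eq: "policy_value g x \<mu> z = Vlim (x, \<mu>, z)" by (rule filter_policy_value[OF f e' g(1)]) (use g(2) in blast)
  have "(INF g\<in>policies M. policy_value g x \<mu> z) = Vlim (x, \<mu>, z)"
  proof (rule antisym)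
    have "(INF g\<in>policies M. policy_value g x \<mu> z) \<le> policy_value g x \<mu> z"
      by (rule cINF_lower[OF bdd_belowI2 g(1)]) (rule Vlim_le_policy_value[OF _ e'])
    then show "(INF g\<in>policies M. policy_value g x \<mu> z) \<le> Vlim (x, \<mu>, z)" using eq by simp
    show "Vlim (x, \<mu>, z) \<le> (INF g\<in>policies M. policy_value g x \<mu> z)"
      using g(1) Vlim_le_policy_value[OF _ e'] by (intro cINF_greatest) auto
  qed
  then show ?thesis using V_inf_policy_value[OF e'] exz by simp
qed

section \<open>The original problem as a particular initial state\<close>

lemma init_hid_props: "prob_space (init_hid M)" "sets (init_hid M) = sets (hid_borel M)" "space (init_hid M) = YY"
  using init_hid sets_eq_imp_space_eq[of "init_hid M" "hid_borel M"] by (auto simp: space_prob_algebra)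

lemma pair0_measurable: "(\<lambda>y. (y, 0)) \<in> init_hid M \<rightarrow>\<^sub>M HS"
  unfolding hs_borel_def using init_hid_props(2)
  by (intro measurable_Pair measurable_ident_sets measurable_const) auto

text \<open>As the image of the initial law under \<open>\<lambda>y. (y, 0)\<close>, the belief lets
  integrals over pairs reduce to integrals over the hidden state by change of variables.\<close>

lemma init_belief_distr: "init_belief M = distr (init_hid M) HS (\<lambda>y. (y, 0))"
proof (rule measure_eqI)
  have z: "0 \<in> space Rplus" by simp
  interpret R: prob_space "return Rplus (0::real)" by (rule prob_space_return[OF z])
  have s: "sets (init_belief M) = sets HS"
    unfolding init_belief_def hs_borel_def using init_hid_props(2) by (intro sets_pair_measure_cong) auto
  then show "sets (init_belief M) = sets (distr (init_hid M) HS (\<lambda>y. (y, 0)))" by simp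
  fix A assume A: "A \<in> sets (init_belief M)"
  then have A': "A \<in> sets HS" using s by simp
  have "emeasure (init_belief M) A = (\<integral>\<^sup>+y. (\<integral>\<^sup>+s. indicator A (y, s) \<partial>return Rplus 0) \<partial>init_hid M)"
    using A unfolding init_belief_def by (rule R.emeasure_pair_measure)
  also have "\<dots> = (\<integral>\<^sup>+y. indicator A (y, 0) \<partial>init_hid M)"
  proof (rule nn_integral_cong)
    fix y assume y: "y \<in> space (init_hid M)"
    have "(\<lambda>s. indicator A (y, s) :: ennreal) \<in> borel_measurable Rplus"
      using measurable_Pair2[of "indicator A :: _ \<Rightarrow> ennreal" "hid_borel M" Rplus borel y] A' y init_hid_props(3)
      by (simp add: hs_borel_def)
    from nn_integral_return[OF z this]
    show "(\<integral>\<^sup>+s. indicator A (y, s) \<partial>return Rplus 0) = (indicator A (y, 0) :: ennreal)" .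
  qed
  also have "\<dots> = (\<integral>\<^sup>+p. indicator A p \<partial>distr (init_hid M) HS (\<lambda>y. (y, 0)))"
    using A' by (intro nn_integral_distr[symmetric] pair0_measurable) simp
  also have "\<dots> = emeasure (distr (init_hid M) HS (\<lambda>y. (y, 0))) A" using A' by simp
  finally show "emeasure (init_belief M) A = emeasure (distr (init_hid M) HS (\<lambda>y. (y, 0))) A" .
qed

lemma init_belief_Pb: "init_belief M \<in> Pb M"
  unfolding Pb_iff init_belief_distr
proof (intro conjI exI[of _ "1::real"])
  show "prob_space (distr (init_hid M) HS (\<lambda>y. (y, 0)))"
    by (rule prob_space.prob_space_distr[OF init_hid_props(1) pair0_measurable])
  have "{p\<in>space HS. snd p \<le> 1} \<in> sets HS" using Rplus_fst_snd(2) by measurable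
  then show "AE p in distr (init_hid M) HS (\<lambda>y. (y, 0)). snd p \<le> 1"
    by (subst AE_distr_iff[OF pair0_measurable]) auto
qed auto

lemma init_in_E: "x \<in> XX \<Longrightarrow> (x, init_belief M, 1) \<in> E_set M"
  using init_belief_Pb by (simp add: E_set_def)

lemma policy_cost_policy_value:
  assumes g: "g \<in> policies M" and x: "x \<in> XX"
  shows "policy_cost M U \<beta> g x = policy_value g x (init_belief M) 1"
proof -
  note e = init_in_E[OF x]
  have "policy_value g x (init_belief M) 1 = (\<integral>p. path_utility g x 1 p \<partial>init_belief M)" by (rule policy_value_def[OF g e])
  also have "\<dots> = (\<integral>y. path_utility g x 1 (y, 0) \<partial>init_hid M)"
    unfolding init_belief_distr by (rule integral_distr[OF pair0_measurable path_utility_measurable[OF g e]])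
  also have "\<dots> = policy_cost M U \<beta> g x"
    unfolding policy_cost_def path_utility_def[OF g e] by simp
  finally show ?thesis by simp
qed

lemma J_inf_V_inf: "x \<in> XX \<Longrightarrow> J_inf M U \<beta> x = V_inf M U \<beta> (x, init_belief M, 1)"
  unfolding J_inf_def V_inf_policy_value[OF init_in_E] by (intro INF_cong refl policy_cost_policy_value)

text \<open>Definedness and equality are proved together because the next update is defined or not
  according to the current belief. The null beliefs of \<open>hist_belief\<close> correspond to
  histories that fail \<open>belief_ok\<close>.\<close>

lemma belief_hist_belief:
  assumes "\<And>k. k \<le> n \<Longrightarrow> fst h k \<in> XX"
  shows "(belief_ok M \<beta> n h \<longleftrightarrow> hist_belief (init_belief M) 1 n h \<in> Pb M) \<and> (belief_ok M \<beta> n h \<longrightarrow> belief M \<beta> n h = hist_belief (init_belief M) 1 n h)"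
  using assms
proof (induction n)
  case 0 then show ?case using init_belief_Pb by (simp add: belief_ok_def)
next
  case (Suc n)
  note IH = Suc.IH[OF Suc.prems[OF le_SucI]]
  have bs: "belief_ok M \<beta> (Suc n) h \<longleftrightarrow> belief_ok M \<beta> n h \<and> Psi_ok M (fst h n) (snd h n) (fst h (Suc n)) (belief M \<beta> n h)"
    by (auto simp: belief_ok_def less_Suc_eq)
  show ?case
  proof (cases "belief_ok M \<beta> n h")
    case True
    then have b: "belief M \<beta> n h = hist_belief (init_belief M) 1 n h" "hist_belief (init_belief M) 1 n h \<in> Pb M" using IH by auto
    have x: "fst h (Suc n) \<in> XX" by (rule Suc.prems) simp
    have ok: "Psi_ok M (fst h n) (snd h n) (fst h (Suc n)) (belief M \<beta> n h) \<longleftrightarrow> update_ok (fst h n) (snd h n) (fst h (Suc n)) (hist_belief (init_belief M) 1 n h)"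
      unfolding b(1) by (rule Psi_ok_iff[OF x Pb_D(4)[OF b(2)]])
    have adm: "(fst h n, snd h n) \<in> adm M" if "update_ok (fst h n) (snd h n) (fst h (Suc n)) (hist_belief (init_belief M) 1 n h)"
    proof (rule ccontr)
      assume "(fst h n, snd h n) \<notin> adm M"
      from mx_inadm[OF this, of "fst h (Suc n)" "hist_belief (init_belief M) 1 n h"] that show False by (simp add: update_ok_def)
    qed
    show ?thesis
      using bs True ok hist_belief_Suc_Pb_iff[OF init_belief_Pb, of 1 n h] b Psi_eq[OF adm x Pb_D(4)[OF b(2)], of "\<beta> ^ n"] beta
      by auto
  next
    case False
    then show ?thesis using bs hist_belief_Suc_Pb_iff[OF init_belief_Pb, of 1 n h] IH by auto
  qed
qed

text \<open>The factor 1 is the initial scale, left in place so that the right-hand side is an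
  instance of \<open>filter_policy_exists\<close> and of the premise of
  \<open>filter_policy_value\<close>.\<close>

lemma generated_by_iff:
  "generated_by M \<beta> f g \<longleftrightarrow> (\<forall>n. \<forall>h\<in>space (hist_space M n).
     hist_belief (init_belief M) 1 n h \<in> Pb M \<longrightarrow> g n h = f (fst h n, hist_belief (init_belief M) 1 n h, \<beta> ^ n * 1))"
proof -
  have "belief_ok M \<beta> n h \<longleftrightarrow> hist_belief (init_belief M) 1 n h \<in> Pb M" "belief_ok M \<beta> n h \<Longrightarrow> belief M \<beta> n h = hist_belief (init_belief M) 1 n h"
    if "h \<in> space (hist_space M n)" for n h
    using belief_hist_belief[of n h] measurable_space[OF hist_component(1) that] by auto
  then show ?thesis unfolding generated_by_def by auto
qed

lemma V_inf_minimizer_iff: "minimizer M \<beta> (V_inf M U \<beta>) f \<longleftrightarrow> minimizer M \<beta> Vlim f"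
proof -
  have "L_op M \<beta> (V_inf M U \<beta>) e (f e) = L_op M \<beta> Vlim e (f e)" "T_op M \<beta> (V_inf M U \<beta>) e = T_op M \<beta> Vlim e"
    if "f \<in> F_rules M" "e \<in> E_set M" for e
    using that by (auto intro!: L_op_cong T_op_cong V_inf_Vlim simp: F_rules_def)
  then show ?thesis unfolding minimizer_def by (intro conj_cong ball_cong refl) simp
qed

lemma generated_optimal:
  assumes f: "minimizer M \<beta> Vlim f" and g: "g \<in> policies M" "generated_by M \<beta> f g"
  shows "optimal M U \<beta> g"
  unfolding optimal_def
proof (intro conjI ballI)
  fix x assume x: "x \<in> XX"
  have "policy_cost M U \<beta> g x = Vlim (x, init_belief M, 1)"
    unfolding policy_cost_policy_value[OF g(1) x]
    by (rule filter_policy_value[OF f init_in_E[OF x] g(1)]) (use g(2) generated_by_iff in blast)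
  then show "policy_cost M U \<beta> g x = J_inf M U \<beta> x" using J_inf_V_inf[OF x] V_inf_Vlim[OF init_in_E[OF x]] by simp
qed (rule g)

end

theorem theorem6p1:
  fixes M :: "('x::polish_space, 'y::polish_space, 'a::polish_space) pomdp"
    and U :: "real \<Rightarrow> real" and cl cu \<beta> :: real
  assumes standing: "pomdp_standing M U cl cu"
    and beta: "0 < \<beta>" "\<beta> < 1"
    and concave: "concave_on {0..} U"
  shows
    "(V_inf M U \<beta> \<in> C_E M U \<and>
      (\<forall>e\<in>E_set M. b_lower U \<beta> cl e \<le> V_inf M U \<beta> e \<and> V_inf M U \<beta> e \<le> b_upper U \<beta> cu e) \<and>
      (\<forall>e\<in>E_set M. V_inf M U \<beta> e = T_op M \<beta> (V_inf M U \<beta>) e) \<and>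
      (\<forall>v\<in>C_E M U.
        (\<forall>e\<in>E_set M. b_lower U \<beta> cl e \<le> v e \<and> v e \<le> b_upper U \<beta> cu e) \<and>
        (\<forall>e\<in>E_set M. v e = T_op M \<beta> v e) \<longrightarrow>
        (\<forall>e\<in>E_set M. v e = V_inf M U \<beta> e)) \<and>
      (\<forall>e\<in>E_set M.
        incseq (\<lambda>n. (T_op M \<beta> ^^ n) (V_zero U) e) \<and>
        (\<lambda>n. (T_op M \<beta> ^^ n) (V_zero U) e) \<longlonglongrightarrow> V_inf M U \<beta> e \<and>
        incseq (\<lambda>n. (T_op M \<beta> ^^ n) (b_lower U \<beta> cl) e) \<and>
        (\<lambda>n. (T_op M \<beta> ^^ n) (b_lower U \<beta> cl) e) \<longlonglongrightarrow> V_inf M U \<beta> e \<and>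
        decseq (\<lambda>n. (T_op M \<beta> ^^ n) (b_upper U \<beta> cu) e) \<and>
        (\<lambda>n. (T_op M \<beta> ^^ n) (b_upper U \<beta> cu) e) \<longlonglongrightarrow> V_inf M U \<beta> e) \<and>
      (\<forall>x\<in>obs_states M. J_inf M U \<beta> x = V_inf M U \<beta> (x, init_belief M, 1)))
     \<and>
     (\<exists>f. minimizer M \<beta> (V_inf M U \<beta>) f \<and>
        (\<exists>g\<in>policies M. generated_by M \<beta> f g) \<and>
        (\<forall>g\<in>policies M. generated_by M \<beta> f g \<longrightarrow> optimal M U \<beta> g))"
proof -
  interpret pomdp_problem M U cl cu \<beta>
    by (rule pomdp_problem.intro[OF standing]) (unfold_locales, fact+)
  have eq: "\<And>e. e \<in> E_set M \<Longrightarrow> V_inf M U \<beta> e = Vlim e" by (rule V_inf_Vlim)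
  \<comment> \<open>Semicontinuity refers to superlevel sets inside the topological space only, so
    agreement on \<open>E_set M\<close> transfers it from \<open>Vlim\<close>.\<close>
  have "{e\<in>E_set M. r < V_inf M U \<beta> e} = {e\<in>E_set M. r < Vlim e}" for r using eq by auto
  then have C: "V_inf M U \<beta> \<in> C_E M U"
    using Vlim_in_class eq by (auto simp: C_E_def bellman_class_def lower_semicont_def)
  have fp: "V_inf M U \<beta> e = T_op M \<beta> (V_inf M U \<beta>) e" if "e \<in> E_set M" for e
    using T_op_cong[of "V_inf M U \<beta>" Vlim e] eq T_Vlim[OF that] that by simp
  have uniq: "v e = V_inf M U \<beta> e" if "v \<in> C_E M U" "\<forall>e\<in>E_set M. b_lower U \<beta> cl e \<le> v e \<and> v e \<le> b_upper U \<beta> cu e"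
    "\<forall>e\<in>E_set M. v e = T_op M \<beta> v e" "e \<in> E_set M" for v e
  proof -
    \<comment> \<open>The upper bound \<open>b_upper\<close> places the competing solution in the
      class in which the fixed point is unique.\<close>
    have "v \<in> bellman_class" using that by (auto simp: C_E_def bellman_class_def)
    from Vlim_unique[OF this _ that(4)] that(3) eq[OF that(4)] show ?thesis by simp
  qed
  obtain f where f: "minimizer M \<beta> Vlim f" using minimizer_exists[OF Vlim_in_class] by blast
  have "\<exists>g\<in>policies M. generated_by M \<beta> f g"
    unfolding generated_by_iff using f by (intro filter_policy_exists init_belief_Pb) (auto simp: minimizer_def)
  then have b: "\<exists>f. minimizer M \<beta> (V_inf M U \<beta>) f \<and> (\<exists>g\<in>policies M. generated_by M \<beta> f g) \<and>
      (\<forall>g\<in>policies M. generated_by M \<beta> f g \<longrightarrow> optimal M U \<beta> g)"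
    using f generated_optimal[OF f] V_inf_minimizer_iff by blast
  have lim: "(\<lambda>n. (T_op M \<beta> ^^ n) v e) \<longlonglongrightarrow> V_inf M U \<beta> e" if "v \<in> bellman_class" "e \<in> E_set M" for v e
    using Vlim_lim[OF that] eq[OF that(2)] by simp
  have inc: "incseq (\<lambda>n. (T_op M \<beta> ^^ n) (V_zero U) e)" "incseq (\<lambda>n. (T_op M \<beta> ^^ n) (b_lower U \<beta> cl) e)"
    "decseq (\<lambda>n. (T_op M \<beta> ^^ n) (b_upper U \<beta> cu) e)" if "e \<in> E_set M" for e
    using that by (intro Tn_incseq Tn_decseq bounds_in_class T_basic; simp)+
  show ?thesis
    by (intro conjI ballI impI C fp b inc lim bounds_in_class J_inf_V_inf uniq) (auto simp: eq Vlim_bounds)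
qed

end
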